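(* Suppose that $(G,X)$ is a second-countable transformation group with $G$ abelian. Let $z\in X$ and let $(x_n)_{n\geq 1}$ be a sequence in $X$ such that $S_{x_n}\to S_z$ in $\Sigma$. Assume that $G\cdot z$ is locally closed in $X$ and that $S_z$ is compact. Let $M\in\mathbb{R}$ with $M\geq 1$, and suppose that there exists an open neighbourhood $V$ of $z$ in $X$ such that $\phi_z^{-1}(V)$ is relatively compact and \[\nu_{x_n}(q_{x_n}(\phi_{x_n}^{-1}(V)))\leq M\,\nu_z(q_z(\phi_z^{-1}(V)))\] frequently (that is, for infinitely many $n$). Then $M_L(\operatorname{Ind}(z,\tau),(\operatorname{Ind}(x_n,\tau_n)))\leq\lfloor M\rfloor$ for any $\tau,\tau_n\in\hat G$.
   Context: Transformation group: a second-countable transformation group $(G,X)$ is a second-countable locally compact Hausdorff group $G$ with a (jointly) continuous action $(s,x)\mapsto s\cdot x$ on a second-countable locally compact Hausdorff space $X$. A subset is locally closed if it is relatively open in its closure; relatively compact means having compact closure. Stability subgroups and maps: for $x\in X$, $S_x=\{s\in G: s\cdot x=x\}$; $q_x:G\to G/S_x$ is the quotient map, $\dot s=sS_x$; $\phi_x:G\to X$ is $\phi_x(s)=s\cdot x$. Fell topology: $\Sigma$ is the set of closed subgroups of $G$ with the topology having as a basis the sets $U(C,F)=\{H\in\Sigma: C\cap H=\emptyset,\ H\cap A\neq\emptyset \text{ for each } A\in F\}$, $C\subset G$ compact and $F$ a finite family of non-empty open subsets of $G$. Measures: $\mu$ is a fixed Haar measure on $G$. Fix $f_0\in C_c(G)$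 with $f_0(e)=1$, $0\leq f_0\leq 1$; for $H\in\Sigma$, $\alpha_H$ is the Haar measure on $H$ with $\int_H f_0\,d\alpha_H=1$. $\nu_H$ is the unique Haar measure on $G/H$ with $\int_G f(s)\,d\mu(s)=\int_{G/H}\int_H f(st)\,d\alpha_H(t)\,d\nu_H(\dot s)$ for all $f\in C_c(G)$. Write $\nu_x=\nu_{S_x}$. Induced representations: $\hat G$ is the character group of $G$. $C_0(X)\rtimes G$ is the crossed product for the action $(s\cdot f)(x)=f(s^{-1}\cdot x)$. For $x\in X$, $\tau\in\hat G$, $\operatorname{Ind}(x,\tau)=M_x\rtimes V_\tau$ is the irreducible representation of $C_0(X)\rtimes G$ on $L^2(G/S_x,\nu_x)$ that is the integrated form of the covariant pair $(M_x(f)\xi)(\dot s)=f(s\cdot x)\xi(\dot s)$, $(V_\tau(t)\xi)(\dot s)=\tau(t)\xi(t^{-1}\cdot\dot s)$; the same symbol denotes its class in the spectrum of $C_0(X)\rtimes G$. Relative lower multiplicity: let $A$ be a $C^*$-algebra, $\pi\in\hat A$, and $\varphi$ a pure state of $A$ associated with $\pi$. Let $\mathcal N$ be the base of weak$^*$-neighbourhoods of $0$ in $A^*$ consisting of the sets $N=\{\psi\in A^*:|\psi(a_i)|<\epsilon,\ 1\leq i\leq m\}$ ($\epsilon>0$, $a_1,\dots,a_m\in A$). For $\sigma\in\hat A$ and $N\in\mathcal N$ let $d(\sigma,\varphi,N)\in\{0,1,2,\dots,\infty\}$ be the supremum of the cardinalities of finite orthonormal subsets of $\{\eta\in H_\sigma:\|\eta\|=1,\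 \langle\sigma(\cdot)\eta,\eta\rangle\in\varphi+N\}$ (it is $0$ if this set is empty). For a net $\Omega=(\pi_\lambda)$ in $\hat A$, $M_L(\pi,\Omega)=\inf_{N\in\mathcal N}\liminf_\lambda d(\pi_\lambda,\varphi,N)$; this does not depend on the choice of $\varphi$. *)

theory Defs
  imports "HOL-Analysis.Analysis"
begin

(* Groups are types and are written additively: s + t is the product st, 0 is the unit e and
   -s is the inverse of s.  Hausdorff and second countable are type classes; local compactness
   is part of the following locale. *)

locale transformation_group =
  fixes act :: "'g::{topological_group_add, t2_space, second_countable_topology} \<Rightarrow>
      'x::{t2_space, second_countable_topology} \<Rightarrow> 'x"
  assumes locally_compact_group: "locally_compact_space (euclidean :: 'g topology)"
    and locally_compact_space: "locally_compact_space (euclidean :: 'x topology)"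
    and act_continuous: "continuous_on UNIV (\<lambda>(s, x). act s x)"
    and act_zero: "act 0 x = x"
    and act_add: "act (s + t) x = act s (act t x)"

definition stabilizer :: "('g \<Rightarrow> 'x \<Rightarrow> 'x) \<Rightarrow> 'x \<Rightarrow> 'g set" where
  "stabilizer act x = {s. act s x = x}"

definition orbit :: "('g \<Rightarrow> 'x \<Rightarrow> 'x) \<Rightarrow> 'x \<Rightarrow> 'x set" where
  "orbit act x = range (\<lambda>s. act s x)"

definition locally_closed :: "'a::topological_space set \<Rightarrow> bool" where
  "locally_closed S \<longleftrightarrow> openin (top_of_set (closure S)) S"

definition relatively_compact :: "'a::topological_space set \<Rightarrow> bool" where
  "relatively_compact S \<longleftrightarrow> compact (closure S)"

definition closed_subgroups :: "'g::{topological_space, group_add} set set" where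
  "closed_subgroups = {H. closed H \<and> 0 \<in> H \<and> (\<forall>s\<in>H. \<forall>t\<in>H. s + t \<in> H) \<and> (\<forall>s\<in>H. - s \<in> H)}"

(* These sets are closed under finite intersections, so they are a base of the topology they
   generate; its underlying set is closed_subgroups, the set obtained from C = {} and F = {}. *)
definition fell_topology :: "'g::{topological_space, group_add} set topology" where
  "fell_topology = topology_generated_by
     {{H \<in> closed_subgroups. C \<inter> H = {} \<and> (\<forall>A\<in>F. H \<inter> A \<noteq> {})} | C F.
        compact C \<and> finite F \<and> (\<forall>A\<in>F. open A \<and> A \<noteq> {})}"

definition Cc :: "('a::topological_space \<Rightarrow> 'b::real_normed_vector) set" where
  "Cc = {f. continuous_on UNIV f \<and> compact (closure {x. f x \<noteq> 0})}"

(* C_0(X) *)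
definition C0 :: "('a::topological_space \<Rightarrow> complex) set" where
  "C0 = {f. continuous_on UNIV f \<and> (\<forall>e>0. compact {x. e \<le> cmod (f x)})}"

definition characters :: "('g::{topological_space, group_add} \<Rightarrow> complex) set" where
  "characters = {\<tau>. continuous_on UNIV \<tau> \<and> (\<forall>s. cmod (\<tau> s) = 1) \<and> (\<forall>s t. \<tau> (s + t) = \<tau> s * \<tau> t)}"


section \<open>Cosets and Haar measures\<close>

(* The quotient map q_H; points of G/H are cosets, i.e. subsets of G. *)
definition coset :: "'g::group_add set \<Rightarrow> 'g \<Rightarrow> 'g set" where
  "coset H s = (+) s ` H"

definition coset_topology :: "'g::{topological_space, group_add} set \<Rightarrow> 'g set topology" where
  "coset_topology H = topology (\<lambda>U. U \<subseteq> range (coset H) \<and> open (coset H -` U))"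

lemma openin_coset_topology:
  "openin (coset_topology H) U \<longleftrightarrow> U \<subseteq> range (coset H) \<and> open (coset H -` U)"
proof -
  have "istopology (\<lambda>U. U \<subseteq> range (coset H) \<and> open (coset H -` U))"
    unfolding istopology_def by (auto simp: vimage_Union)
  then show ?thesis
    unfolding coset_topology_def by (simp add: topology_inverse')
qed

definition borel_of_topology :: "'a topology \<Rightarrow> 'a measure" where
  "borel_of_topology T = sigma (topspace T) {U. openin T U}"

(* A nonzero Borel measure on T, finite on compact sets and invariant under the maps tr s, s in S.
   On second countable locally compact Hausdorff spaces, the only ones used below, a Borel
   measure that is finite on compact sets is automatically regular. *)
definition invariant_measure :: "'a topology \<Rightarrow> 's set \<Rightarrow> ('s \<Rightarrow> 'a \<Rightarrow> 'a) \<Rightarrow> 'a measure \<Rightarrow> bool" where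
  "invariant_measure T S tr m \<longleftrightarrow>
     sets m = sets (borel_of_topology T) \<and> emeasure m (topspace T) \<noteq> 0 \<and>
     (\<forall>K. compactin T K \<and> K \<in> sets m \<longrightarrow> emeasure m K < \<infinity>) \<and>
     (\<forall>s\<in>S. \<forall>B\<in>sets m. emeasure m (tr s ` B) = emeasure m B)"

definition haar_measure :: "'g::{topological_space, group_add} measure \<Rightarrow> bool" where
  "haar_measure \<mu> \<longleftrightarrow> invariant_measure euclidean UNIV (+) \<mu>"

definition haar_measure_on :: "'g::{topological_space, group_add} set \<Rightarrow> 'g measure \<Rightarrow> bool" where
  "haar_measure_on H \<alpha> \<longleftrightarrow> invariant_measure (top_of_set H) H (+) \<alpha>"

definition haar_measure_quotient :: "'g::{topological_space, group_add} set \<Rightarrow> 'g set measure \<Rightarrow> bool" where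
  "haar_measure_quotient H \<nu> \<longleftrightarrow>
     invariant_measure (coset_topology H) UNIV (\<lambda>s c. (+) s ` c) \<nu>"

definition coset_rep :: "'g set \<Rightarrow> 'g" where
  "coset_rep c = (SOME s. s \<in> c)"

(* alpha_H and nu_H are determined by mu and f0 (existence and uniqueness of Haar measure and
   Weil's formula), so a pair with this property is the pair of families attached to mu and f0.
   The inner integral does not depend on the representative of the coset. *)
definition haar_families ::
  "('g::{topological_space, group_add} \<Rightarrow> real) \<Rightarrow> 'g measure \<Rightarrow>
     ('g set \<Rightarrow> 'g measure) \<Rightarrow> ('g set \<Rightarrow> 'g set measure) \<Rightarrow> bool" where
  "haar_families f0 \<mu> \<alpha> \<nu> \<longleftrightarrow>
     (\<forall>H\<in>closed_subgroups.
        haar_measure_on H (\<alpha> H) \<and> (\<integral>t. f0 t \<partial>\<alpha> H) = 1 \<and>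
        haar_measure_quotient H (\<nu> H) \<and>
        (\<forall>f \<in> (Cc :: ('g \<Rightarrow> complex) set).
           (\<integral>s. f s \<partial>\<mu>) = (\<integral>c. (\<integral>t. f (coset_rep c + t) \<partial>\<alpha> H) \<partial>\<nu> H)))"


section \<open>Hilbert spaces and star-algebras\<close>

record 'v vspace =
  vecs :: "'v set"
  vadd :: "'v \<Rightarrow> 'v \<Rightarrow> 'v"
  vzero :: 'v
  vscale :: "complex \<Rightarrow> 'v \<Rightarrow> 'v"

record 'v hspace = "'v vspace" +
  inn :: "'v \<Rightarrow> 'v \<Rightarrow> complex"

record 'v star_alg = "'v vspace" +
  amult :: "'v \<Rightarrow> 'v \<Rightarrow> 'v"
  astar :: "'v \<Rightarrow> 'v"
  anorm :: "'v \<Rightarrow> real"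

definition vdiff :: "('v, 'm) vspace_scheme \<Rightarrow> 'v \<Rightarrow> 'v \<Rightarrow> 'v" where
  "vdiff V a b = vadd V a (vscale V (- 1) b)"

locale complex_vector_space =
  fixes V :: "('v, 'm) vspace_scheme"
  assumes vzero_in: "vzero V \<in> vecs V"
    and vadd_in: "a \<in> vecs V \<Longrightarrow> b \<in> vecs V \<Longrightarrow> vadd V a b \<in> vecs V"
    and vscale_in: "a \<in> vecs V \<Longrightarrow> vscale V c a \<in> vecs V"
    and vadd_assoc: "a \<in> vecs V \<Longrightarrow> b \<in> vecs V \<Longrightarrow> e \<in> vecs V \<Longrightarrow>
        vadd V (vadd V a b) e = vadd V a (vadd V b e)"
    and vadd_commute: "a \<in> vecs V \<Longrightarrow> b \<in> vecs V \<Longrightarrow> vadd V a b = vadd V b a"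
    and vadd_zero: "a \<in> vecs V \<Longrightarrow> vadd V a (vzero V) = a"
    and vadd_neg: "a \<in> vecs V \<Longrightarrow> vdiff V a a = vzero V"
    and vscale_add: "a \<in> vecs V \<Longrightarrow> b \<in> vecs V \<Longrightarrow>
        vscale V c (vadd V a b) = vadd V (vscale V c a) (vscale V c b)"
    and add_vscale: "a \<in> vecs V \<Longrightarrow> vscale V (c + d) a = vadd V (vscale V c a) (vscale V d a)"
    and vscale_vscale: "a \<in> vecs V \<Longrightarrow> vscale V c (vscale V d a) = vscale V (c * d) a"
    and vscale_one: "a \<in> vecs V \<Longrightarrow> vscale V 1 a = a"

definition hnorm :: "('v, 'm) hspace_scheme \<Rightarrow> 'v \<Rightarrow> real" where
  "hnorm H \<xi> = sqrt (Re (inn H \<xi> \<xi>))"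

definition hdist :: "('v, 'm) hspace_scheme \<Rightarrow> 'v \<Rightarrow> 'v \<Rightarrow> real" where
  "hdist H \<xi> \<eta> = hnorm H (vdiff H \<xi> \<eta>)"

locale hilbert_space = complex_vector_space H for H :: "('v, 'm) hspace_scheme" +
  assumes inn_add: "\<xi> \<in> vecs H \<Longrightarrow> \<eta> \<in> vecs H \<Longrightarrow> \<zeta> \<in> vecs H \<Longrightarrow>
        inn H (vadd H \<xi> \<eta>) \<zeta> = inn H \<xi> \<zeta> + inn H \<eta> \<zeta>"
    and inn_scale: "\<xi> \<in> vecs H \<Longrightarrow> \<eta> \<in> vecs H \<Longrightarrow> inn H (vscale H c \<xi>) \<eta> = c * inn H \<xi> \<eta>"
    and inn_cnj: "\<xi> \<in> vecs H \<Longrightarrow> \<eta> \<in> vecs H \<Longrightarrow> inn H \<eta> \<xi> = cnj (inn H \<xi> \<eta>)"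
    and inn_pos: "\<xi> \<in> vecs H \<Longrightarrow> 0 \<le> Re (inn H \<xi> \<xi>)"
    and inn_definite: "\<xi> \<in> vecs H \<Longrightarrow> inn H \<xi> \<xi> = 0 \<Longrightarrow> \<xi> = vzero H"
    and complete: "(\<And>n. F n \<in> vecs H) \<Longrightarrow>
        (\<And>e. e > 0 \<Longrightarrow> \<exists>N. \<forall>m\<ge>N. \<forall>n\<ge>N. hdist H (F m) (F n) < e) \<Longrightarrow>
        \<exists>\<xi>\<in>vecs H. (\<lambda>n. hdist H (F n) \<xi>) \<longlonglongrightarrow> 0"

definition bounded_operator :: "('v, 'm) hspace_scheme \<Rightarrow> ('v \<Rightarrow> 'v) \<Rightarrow> bool" where
  "bounded_operator H T \<longleftrightarrow>
     (\<forall>\<xi>\<in>vecs H. T \<xi> \<in> vecs H) \<and>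
     (\<forall>\<xi>\<in>vecs H. \<forall>\<eta>\<in>vecs H. T (vadd H \<xi> \<eta>) = vadd H (T \<xi>) (T \<eta>)) \<and>
     (\<forall>\<xi>\<in>vecs H. \<forall>c. T (vscale H c \<xi>) = vscale H c (T \<xi>)) \<and>
     (\<exists>C. \<forall>\<xi>\<in>vecs H. hnorm H (T \<xi>) \<le> C * hnorm H \<xi>)"

definition orthonormal :: "('v, 'm) hspace_scheme \<Rightarrow> 'v set \<Rightarrow> bool" where
  "orthonormal H S \<longleftrightarrow> S \<subseteq> vecs H \<and> (\<forall>\<xi>\<in>S. \<forall>\<eta>\<in>S. inn H \<xi> \<eta> = (if \<xi> = \<eta> then 1 else 0))"

(* L^2(m): square integrable functions modulo equality almost everywhere. *)

definition L2_functions :: "'a measure \<Rightarrow> ('a \<Rightarrow> complex) set" where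
  "L2_functions m = {f \<in> borel_measurable m. integrable m (\<lambda>x. (cmod (f x))\<^sup>2)}"

definition L2_rel :: "'a measure \<Rightarrow> (('a \<Rightarrow> complex) \<times> ('a \<Rightarrow> complex)) set" where
  "L2_rel m = {(f, g). f \<in> L2_functions m \<and> g \<in> L2_functions m \<and> (AE x in m. f x = g x)}"

definition L2_class :: "'a measure \<Rightarrow> ('a \<Rightarrow> complex) \<Rightarrow> ('a \<Rightarrow> complex) set" where
  "L2_class m f = L2_rel m `` {f}"

definition L2 :: "'a measure \<Rightarrow> ('a \<Rightarrow> complex) set hspace" where
  "L2 m = \<lparr>
     vecs = L2_functions m // L2_rel m,
     vadd = (\<lambda>a b. \<Union>f\<in>a. \<Union>g\<in>b. L2_class m (\<lambda>x. f x + g x)),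
     vzero = L2_class m (\<lambda>x. 0),
     vscale = (\<lambda>c a. \<Union>f\<in>a. L2_class m (\<lambda>x. c * f x)),
     inn = (\<lambda>a b. (\<integral>x. (SOME f. f \<in> a) x * cnj ((SOME g. g \<in> b) x) \<partial>m)) \<rparr>"

(* Completion of a normed star-algebra: Cauchy sequences modulo null sequences. *)

definition cauchy_sequences :: "'b star_alg \<Rightarrow> (nat \<Rightarrow> 'b) set" where
  "cauchy_sequences B = {F. (\<forall>n. F n \<in> vecs B) \<and>
     (\<forall>e>0. \<exists>N. \<forall>m\<ge>N. \<forall>n\<ge>N. anorm B (vdiff B (F m) (F n)) < e)}"

definition null_rel :: "'b star_alg \<Rightarrow> ((nat \<Rightarrow> 'b) \<times> (nat \<Rightarrow> 'b)) set" where
  "null_rel B = {(F, F'). F \<in> cauchy_sequences B \<and> F' \<in> cauchy_sequences B \<and>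
     (\<lambda>n. anorm B (vdiff B (F n) (F' n))) \<longlonglongrightarrow> 0}"

definition completion :: "'b star_alg \<Rightarrow> (nat \<Rightarrow> 'b) set star_alg" where
  "completion B = \<lparr>
     vecs = cauchy_sequences B // null_rel B,
     vadd = (\<lambda>a b. \<Union>F\<in>a. \<Union>F'\<in>b. null_rel B `` {\<lambda>n. vadd B (F n) (F' n)}),
     vzero = null_rel B `` {\<lambda>n. vzero B},
     vscale = (\<lambda>c a. \<Union>F\<in>a. null_rel B `` {\<lambda>n. vscale B c (F n)}),
     amult = (\<lambda>a b. \<Union>F\<in>a. \<Union>F'\<in>b. null_rel B `` {\<lambda>n. amult B (F n) (F' n)}),
     astar = (\<lambda>a. \<Union>F\<in>a. null_rel B `` {\<lambda>n. astar B (F n)}),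
     anorm = (\<lambda>a. lim (\<lambda>n. anorm B ((SOME F. F \<in> a) n))) \<rparr>"

(* Continuous extension to the completion of B of a family of operators indexed by B. *)
definition extend_to_completion ::
  "('h, 'm) hspace_scheme \<Rightarrow> ('b \<Rightarrow> 'h \<Rightarrow> 'h) \<Rightarrow> (nat \<Rightarrow> 'b) set \<Rightarrow> 'h \<Rightarrow> 'h" where
  "extend_to_completion H \<rho> a \<xi> =
     (THE \<eta>. \<eta> \<in> vecs H \<and> (\<forall>F\<in>a. (\<lambda>n. hdist H (\<rho> (F n) \<xi>) \<eta>) \<longlonglongrightarrow> 0))"


section \<open>The crossed product of $C_0(X)$ by an abelian group\<close>

(* A *-representation pi of C_0(X) and a strongly continuous unitary representation U of G with
   U(s) pi(f) = pi(s.f) U(s), where (s.f)(x) = f(-s . x). *)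
definition covariant_pair ::
  "('g::{topological_space, group_add} \<Rightarrow> 'x::topological_space \<Rightarrow> 'x) \<Rightarrow> 'h hspace \<Rightarrow>
     (('x \<Rightarrow> complex) \<Rightarrow> 'h \<Rightarrow> 'h) \<Rightarrow> ('g \<Rightarrow> 'h \<Rightarrow> 'h) \<Rightarrow> bool" where
  "covariant_pair act H \<pi> U \<longleftrightarrow>
     (\<forall>f\<in>C0. bounded_operator H (\<pi> f)) \<and>
     (\<forall>f\<in>C0. \<forall>g\<in>C0. \<forall>\<xi>\<in>vecs H. \<pi> (\<lambda>x. f x + g x) \<xi> = vadd H (\<pi> f \<xi>) (\<pi> g \<xi>)) \<and>
     (\<forall>f\<in>C0. \<forall>c. \<forall>\<xi>\<in>vecs H. \<pi> (\<lambda>x. c * f x) \<xi> = vscale H c (\<pi> f \<xi>)) \<and>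
     (\<forall>f\<in>C0. \<forall>g\<in>C0. \<forall>\<xi>\<in>vecs H. \<pi> (\<lambda>x. f x * g x) \<xi> = \<pi> f (\<pi> g \<xi>)) \<and>
     (\<forall>f\<in>C0. \<forall>\<xi>\<in>vecs H. \<forall>\<eta>\<in>vecs H. inn H (\<pi> (\<lambda>x. cnj (f x)) \<xi>) \<eta> = inn H \<xi> (\<pi> f \<eta>)) \<and>
     (\<forall>s. bounded_operator H (U s)) \<and>
     (\<forall>s. \<forall>\<xi>\<in>vecs H. \<forall>\<eta>\<in>vecs H. inn H (U s \<xi>) (U s \<eta>) = inn H \<xi> \<eta>) \<and>
     (\<forall>\<xi>\<in>vecs H. U 0 \<xi> = \<xi>) \<and>
     (\<forall>s t. \<forall>\<xi>\<in>vecs H. U (s + t) \<xi> = U s (U t \<xi>)) \<and>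
     (\<forall>\<xi>\<in>vecs H. \<forall>s. ((\<lambda>t. hdist H (U t \<xi>) (U s \<xi>)) \<longlongrightarrow> 0) (at s)) \<and>
     (\<forall>s. \<forall>f\<in>C0. \<forall>\<xi>\<in>vecs H. U s (\<pi> f \<xi>) = \<pi> (\<lambda>x. f (act (- s) x)) (U s \<xi>))"

(* The operator "integral of pi(f(s)) U(s) d mu(s)", as a weak integral. *)
definition integrated_form ::
  "'g measure \<Rightarrow> 'h hspace \<Rightarrow> (('x \<Rightarrow> complex) \<Rightarrow> 'h \<Rightarrow> 'h) \<Rightarrow> ('g \<Rightarrow> 'h \<Rightarrow> 'h) \<Rightarrow>
     ('g \<Rightarrow> 'x \<Rightarrow> complex) \<Rightarrow> 'h \<Rightarrow> 'h" where
  "integrated_form \<mu> H \<pi> U f \<xi> =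
     (THE \<zeta>. \<zeta> \<in> vecs H \<and> (\<forall>\<eta>\<in>vecs H. inn H \<zeta> \<eta> = (\<integral>s. inn H (\<pi> (f s) (U s \<xi>)) \<eta> \<partial>\<mu>)))"

(* C_c(G, C_0(X)), where C_0(X) carries the supremum norm. *)
definition CcC0 :: "('g::topological_space \<Rightarrow> 'x::topological_space \<Rightarrow> complex) set" where
  "CcC0 = {f. (\<forall>s. f s \<in> C0) \<and> (\<forall>s. uniform_limit UNIV f (f s) (at s)) \<and>
     compact (closure {s. f s \<noteq> (\<lambda>x. 0)})}"

(* The universal norm: the supremum of the norms of (pi \<rtimes> U)(f) over all covariant pairs on
   Hilbert spaces whose vectors are elements of a fixed type.  For (G, X) second countable that
   type is large enough: the norm is attained on cyclic representations, these act on separable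
   Hilbert spaces, and a separable Hilbert space has at most as many elements as the type complex,
   hence is isomorphic to one whose vectors are elements of ('g set \<Rightarrow> complex) set.  The latter
   type is chosen because it also contains the vectors of L^2(G/H). *)
definition universal_norm ::
  "('g::{topological_space, group_add} \<Rightarrow> 'x::topological_space \<Rightarrow> 'x) \<Rightarrow> 'g measure \<Rightarrow>
     ('g \<Rightarrow> 'x \<Rightarrow> complex) \<Rightarrow> real" where
  "universal_norm act \<mu> f =
     Sup {hnorm H (integrated_form \<mu> H \<pi> U f \<xi>) | (H :: ('g set \<Rightarrow> complex) set hspace) \<pi> U \<xi>.
            hilbert_space H \<and> covariant_pair act H \<pi> U \<and> \<xi> \<in> vecs H \<and> hnorm H \<xi> \<le> 1}"

(* The modular function does not appear in the involution because G is abelian. *)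
definition convolution_algebra ::
  "('g::{topological_space, ab_group_add} \<Rightarrow> 'x::topological_space \<Rightarrow> 'x) \<Rightarrow> 'g measure \<Rightarrow>
     ('g \<Rightarrow> 'x \<Rightarrow> complex) star_alg" where
  "convolution_algebra act \<mu> = \<lparr>
     vecs = CcC0,
     vadd = (\<lambda>f g s x. f s x + g s x),
     vzero = (\<lambda>s x. 0),
     vscale = (\<lambda>c f s x. c * f s x),
     amult = (\<lambda>f g s x. (\<integral>r. f r x * g (- r + s) (act (- r) x) \<partial>\<mu>)),
     astar = (\<lambda>f s x. cnj (f (- s) (act (- s) x))),
     anorm = universal_norm act \<mu> \<rparr>"

definition crossed_product ::
  "('g::{topological_space, ab_group_add} \<Rightarrow> 'x::topological_space \<Rightarrow> 'x) \<Rightarrow> 'g measure \<Rightarrow>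
     (nat \<Rightarrow> 'g \<Rightarrow> 'x \<Rightarrow> complex) set star_alg" where
  "crossed_product act \<mu> = completion (convolution_algebra act \<mu>)"


section \<open>The representations $\mathrm{Ind}(x,\tau)$\<close>

record ('a, 'h) rep =
  rspace :: "'h hspace"
  rop :: "'a \<Rightarrow> 'h \<Rightarrow> 'h"

definition mult_op ::
  "('g \<Rightarrow> 'x \<Rightarrow> 'x) \<Rightarrow> 'g set measure \<Rightarrow> 'x \<Rightarrow> ('x \<Rightarrow> complex) \<Rightarrow>
     ('g set \<Rightarrow> complex) set \<Rightarrow> ('g set \<Rightarrow> complex) set" where
  "mult_op act m x f a = (\<Union>\<xi>\<in>a. L2_class m (\<lambda>c. f (act (coset_rep c) x) * \<xi> c))"

definition translation_op ::
  "'g::group_add set measure \<Rightarrow> ('g \<Rightarrow> complex) \<Rightarrow> 'g \<Rightarrow>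
     ('g set \<Rightarrow> complex) set \<Rightarrow> ('g set \<Rightarrow> complex) set" where
  "translation_op m \<tau> t a = (\<Union>\<xi>\<in>a. L2_class m (\<lambda>c. \<tau> t * \<xi> ((+) (- t) ` c)))"

definition Ind ::
  "('g::{topological_space, group_add} \<Rightarrow> 'x::topological_space \<Rightarrow> 'x) \<Rightarrow> 'g measure \<Rightarrow>
     ('g set \<Rightarrow> 'g set measure) \<Rightarrow> 'x \<Rightarrow> ('g \<Rightarrow> complex) \<Rightarrow>
     ((nat \<Rightarrow> 'g \<Rightarrow> 'x \<Rightarrow> complex) set, ('g set \<Rightarrow> complex) set) rep" where
  "Ind act \<mu> \<nu> x \<tau> =
     (let m = \<nu> (stabilizer act x); H = L2 m in
      \<lparr> rspace = H,
        rop = extend_to_completion H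
          (integrated_form \<mu> H (mult_op act m x) (translation_op m \<tau>)) \<rparr>)"


section \<open>Relative lower multiplicity\<close>

definition linear_functional :: "'a star_alg \<Rightarrow> ('a \<Rightarrow> complex) \<Rightarrow> bool" where
  "linear_functional A \<psi> \<longleftrightarrow>
     (\<forall>a\<in>vecs A. \<forall>b\<in>vecs A. \<psi> (vadd A a b) = \<psi> a + \<psi> b) \<and>
     (\<forall>a\<in>vecs A. \<forall>c. \<psi> (vscale A c a) = c * \<psi> a)"

(* Only the values of a functional on vecs A matter. *)
definition dual :: "'a star_alg \<Rightarrow> ('a \<Rightarrow> complex) set" where
  "dual A = {\<psi>. linear_functional A \<psi> \<and> (\<exists>C. \<forall>a\<in>vecs A. cmod (\<psi> a) \<le> C * anorm A a)}"

definition dual_norm :: "'a star_alg \<Rightarrow> ('a \<Rightarrow> complex) \<Rightarrow> real" where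
  "dual_norm A \<psi> = Sup {cmod (\<psi> a) | a. a \<in> vecs A \<and> anorm A a \<le> 1}"

definition state :: "'a star_alg \<Rightarrow> ('a \<Rightarrow> complex) \<Rightarrow> bool" where
  "state A \<phi> \<longleftrightarrow> \<phi> \<in> dual A \<and> dual_norm A \<phi> = 1 \<and>
     (\<forall>a\<in>vecs A. Im (\<phi> (amult A (astar A a) a)) = 0 \<and> 0 \<le> Re (\<phi> (amult A (astar A a) a)))"

definition pure_state :: "'a star_alg \<Rightarrow> ('a \<Rightarrow> complex) \<Rightarrow> bool" where
  "pure_state A \<phi> \<longleftrightarrow> state A \<phi> \<and>
     (\<forall>\<psi>1 \<psi>2 t. state A \<psi>1 \<and> state A \<psi>2 \<and> 0 < t \<and> t < 1 \<and>
        (\<forall>a\<in>vecs A. \<phi> a = complex_of_real t * \<psi>1 a + complex_of_real (1 - t) * \<psi>2 a) \<longrightarrow>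
        (\<forall>a\<in>vecs A. \<psi>1 a = \<phi> a \<and> \<psi>2 a = \<phi> a))"

definition vector_functional :: "('a, 'h) rep \<Rightarrow> 'h \<Rightarrow> 'a \<Rightarrow> complex" where
  "vector_functional \<sigma> \<eta> a = inn (rspace \<sigma>) (rop \<sigma> a \<eta>) \<eta>"

(* For irreducible \<sigma>: the GNS representation of the pure state \<phi> is equivalent to \<sigma>. *)
definition pure_state_of :: "'a star_alg \<Rightarrow> ('a, 'h) rep \<Rightarrow> ('a \<Rightarrow> complex) \<Rightarrow> bool" where
  "pure_state_of A \<sigma> \<phi> \<longleftrightarrow> pure_state A \<phi> \<and>
     (\<exists>\<xi>\<in>vecs (rspace \<sigma>). hnorm (rspace \<sigma>) \<xi> = 1 \<and> (\<forall>a\<in>vecs A. \<phi> a = vector_functional \<sigma> \<xi> a))"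

definition weak_star_base :: "'a star_alg \<Rightarrow> ('a \<Rightarrow> complex) set set" where
  "weak_star_base A =
     {{\<psi> \<in> dual A. \<forall>a\<in>E. cmod (\<psi> a) < e} | E e. finite E \<and> E \<subseteq> vecs A \<and> e > 0}"

(* d(sigma, phi, N); it depends only on the unitary equivalence class of sigma, so points of the
   spectrum are given by representatives. *)
definition orthonormal_count ::
  "('a, 'h) rep \<Rightarrow> ('a \<Rightarrow> complex) \<Rightarrow> ('a \<Rightarrow> complex) set \<Rightarrow> enat" where
  "orthonormal_count \<sigma> \<phi> N =
     (SUP S \<in> {S. finite S \<and> orthonormal (rspace \<sigma>) S \<and>
                 S \<subseteq> {\<eta> \<in> vecs (rspace \<sigma>). hnorm (rspace \<sigma>) \<eta> = 1 \<and>
                       (\<lambda>a. vector_functional \<sigma> \<eta> a - \<phi> a) \<in> N}}.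
        enat (card S))"

(* M_L(pi, Omega) computed with a pure state phi associated with pi, for the net
   Omega = (\<sigma> l), l tending along the filter \<F>. *)
definition lower_multiplicity ::
  "'a star_alg \<Rightarrow> ('a \<Rightarrow> complex) \<Rightarrow> ('l \<Rightarrow> ('a, 'h) rep) \<Rightarrow> 'l filter \<Rightarrow> enat" where
  "lower_multiplicity A \<phi> \<sigma> \<F> =
     (INF N \<in> weak_star_base A. Liminf \<F> (\<lambda>l. orthonormal_count (\<sigma> l) \<phi> N))"

end

theory Submission
  imports Defs
begin

text \<open>The multiplicity is bounded by testing the pure state at a single element of the crossed product,
  \<open>D(t, y) = a\<^sup>-\<^sup>1 k(t) cnj(\<tau>(t)) E(y) cnj(E(-t \<cdot> y))\<close> with \<open>a = \<alpha>\<^sub>H(H)\<close> for the stabilizer \<open>H\<close> of \<open>z\<close>.  Here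
  \<open>E \<in> C\<^sub>c(X)\<close> restricts on the orbit of \<open>z\<close> to an approximation of the unit vector \<open>\<xi>\<close> defining \<open>\<phi>\<close>, and
  \<open>k \<in> C\<^sub>c(G)\<close> is \<open>1\<close> on all differences of points at which \<open>E\<close> does not vanish, so that \<open>Ind(z, \<tau>)(D)\<close> is
  the rank one operator given by \<open>E\<close> and \<open>\<phi>(D)\<close> is close to \<open>1\<close>.

  If \<open>K\<close> orthonormal vectors of \<open>L\<^sup>2(G/S\<^sub>x)\<close>, \<open>x = x\<^sub>n\<close>, have vector functionals close to \<open>\<phi>\<close> at \<open>D\<close>, then \<open>K\<close> is
  almost bounded by the sum of their values, which a Hilbert--Schmidt estimate bounds by
  \<open>(A N + b K) / 2\<close>.  Here \<open>N\<close> is the square norm of \<open>E\<close> on the orbit of \<open>x\<close>, \<open>A\<close> bounds the averages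
  \<open>a\<^sup>-\<^sup>1 \<integral> k(t) \<bar>E(t \<cdot> y)\<bar>\<^sup>2 dt\<close>, and \<open>b\<close> is close to \<open>1\<close> because \<open>H \<mapsto> \<alpha>\<^sub>H(H \<inter> C)\<close> is upper semicontinuous
  at compact \<open>H\<close>.  By shrinking the support of \<open>E\<close> to a neighbourhood of a compact piece of the orbit of
  \<open>z\<close>, all these averages become close to their values on that orbit.  Pairing \<open>\<bar>E\<bar>\<^sup>2\<close> with a function
  supported in \<open>V\<close> whose integral over the orbit of \<open>z\<close> almost exhausts \<open>V\<close>, the hypothesis gives that
  \<open>A N\<close> is at most \<open>M\<close> up to a small error.  Hence \<open>K\<close> is almost bounded by \<open>(M + K) / 2\<close>, so that \<open>K \<le> M\<close>.\<close>


section \<open>Hilbert spaces\<close>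

text \<open>The multiplicity is an infimum over neighbourhoods of a lower limit, so one
  neighbourhood that works for infinitely many \<open>n\<close> is enough, and infinitely many are
  all that the hypothesis supplies. The obstacle is that \<open>D\<close> gives a rank one operator
  only at \<open>z\<close>: at \<open>x n\<close> the cutoff \<open>k\<close> may truncate the
  kernel, and the operator need be neither positive nor of controlled trace norm. Pairing its kernel
  with a second kernel is still possible, because \<open>k\<close> confines both to pairs at bounded
  distance in \<open>G\<close>. Splitting |x y| into squares charges half of the bound to the
  operator and half to the K vectors; the latter half is harmless, since K / 2 can be moved to the
  other side. The constant \<open>a\<close> arises because \<open>D\<close> is integrated over
  \<open>G\<close>: for compact \<open>H\<close> the image of \<mu> on G/H is \<alpha>_H(H) times
  \<nu>_H. Nothing is known of \<open>x n\<close> beyond the convergence of the stabilizers and the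
  measure of its visits to \<open>V\<close>. Hence the estimates on \<open>E\<close>,
  \<open>F\<close> and \<open>k\<close> are arranged to hold at all points of \<open>X\<close> where
  \<open>E\<close> or \<open>F\<close> does not vanish, and not only along the orbit of
  \<open>z\<close>.\<close>

context complex_vector_space
begin

lemma vdiff_in: "a \<in> vecs V \<Longrightarrow> b \<in> vecs V \<Longrightarrow> vdiff V a b \<in> vecs V"
  unfolding vdiff_def by (intro vadd_in vscale_in)

lemma vadd_vdiff:
  assumes "a \<in> vecs V" "b \<in> vecs V"
  shows "vadd V (vdiff V a b) b = a"
proof -
  have "vadd V (vdiff V a b) b = vadd V a (vadd V (vscale V (- 1) b) b)"
    unfolding vdiff_def using assms by (intro vadd_assoc vscale_in)
  also have "vadd V (vscale V (- 1) b) b = vdiff V b b"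
    unfolding vdiff_def using assms by (intro vadd_commute vscale_in)
  finally show ?thesis using assms by (simp add: vadd_neg vadd_zero)
qed

lemma vdiff_eq_zero:
  assumes "a \<in> vecs V" "b \<in> vecs V" "vdiff V a b = vzero V"
  shows "a = b"
proof -
  have "a = vadd V (vzero V) b" using vadd_vdiff[OF assms(1,2)] assms(3) by simp
  also have "\<dots> = vadd V b (vzero V)" using assms by (intro vadd_commute vzero_in)
  finally show ?thesis using assms by (simp add: vadd_zero)
qed

end

context hilbert_space
begin

lemma inn_add_right:
  assumes "\<xi> \<in> vecs H" "\<eta> \<in> vecs H" "\<zeta> \<in> vecs H"
  shows "inn H \<zeta> (vadd H \<xi> \<eta>) = inn H \<zeta> \<xi> + inn H \<zeta> \<eta>"
  using assms by (metis inn_add inn_cnj vadd_in complex_cnj_add)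

lemma inn_scale_right:
  assumes "\<xi> \<in> vecs H" "\<eta> \<in> vecs H"
  shows "inn H \<xi> (vscale H c \<eta>) = cnj c * inn H \<xi> \<eta>"
  using assms by (metis inn_scale inn_cnj vscale_in complex_cnj_mult)

lemma inn_diff:
  assumes "\<xi> \<in> vecs H" "\<eta> \<in> vecs H" "\<zeta> \<in> vecs H"
  shows "inn H (vdiff H \<xi> \<eta>) \<zeta> = inn H \<xi> \<zeta> - inn H \<eta> \<zeta>"
    and "inn H \<zeta> (vdiff H \<xi> \<eta>) = inn H \<zeta> \<xi> - inn H \<zeta> \<eta>"
  using assms unfolding vdiff_def
  by (simp_all add: inn_add inn_add_right inn_scale inn_scale_right vscale_in)

lemma inn_self_Im: "\<xi> \<in> vecs H \<Longrightarrow> Im (inn H \<xi> \<xi>) = 0"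
  using inn_cnj[of \<xi> \<xi>] by (simp add: complex_eq_iff)

lemma hnorm_ge0: "\<xi> \<in> vecs H \<Longrightarrow> 0 \<le> hnorm H \<xi>"
  by (simp add: hnorm_def inn_pos)

lemma hnorm_sq: "\<xi> \<in> vecs H \<Longrightarrow> (hnorm H \<xi>)\<^sup>2 = Re (inn H \<xi> \<xi>)"
  by (simp add: hnorm_def inn_pos)

lemma inn_self: "\<xi> \<in> vecs H \<Longrightarrow> inn H \<xi> \<xi> = of_real ((hnorm H \<xi>)\<^sup>2)"
  by (simp add: hnorm_sq complex_eq_iff inn_self_Im)

lemma inn_vzero:
  assumes "\<xi> \<in> vecs H"
  shows "inn H \<xi> (vzero H) = 0" "inn H (vzero H) \<xi> = 0"
  using inn_diff[OF assms assms assms] vadd_neg[OF assms] by simp_all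

lemma hnorm_vzero: "hnorm H (vzero H) = 0"
  by (simp add: hnorm_def inn_vzero vzero_in)

lemma hnorm_eq0: "\<xi> \<in> vecs H \<Longrightarrow> hnorm H \<xi> = 0 \<Longrightarrow> \<xi> = vzero H"
  using inn_self[of \<xi>] inn_definite by simp

lemma hnorm_scale: "\<xi> \<in> vecs H \<Longrightarrow> hnorm H (vscale H c \<xi>) = cmod c * hnorm H \<xi>"
proof -
  assume x: "\<xi> \<in> vecs H"
  have "inn H (vscale H c \<xi>) (vscale H c \<xi>) = of_real ((cmod c)\<^sup>2 * (hnorm H \<xi>)\<^sup>2)"
    using x by (simp add: inn_scale inn_scale_right vscale_in inn_self[OF x])
       (metis complex_norm_square mult.commute of_real_power)
  then show ?thesis using hnorm_ge0[OF x]
    by (simp add: hnorm_def[of H "vscale H c \<xi>"] real_sqrt_mult)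
qed

text \<open>The vector \<open>w\<close> below is the component of \<open>\<xi>\<close> orthogonal to
  \<open>\<eta>\<close>, scaled by \<open>b\<close> so that no division occurs; its square norm is
  \<open>b\<close> times the defect in the squared inequality.\<close>

lemma Cauchy_Schwarz:
  assumes x: "\<xi> \<in> vecs H" and y: "\<eta> \<in> vecs H"
  shows "cmod (inn H \<xi> \<eta>) \<le> hnorm H \<xi> * hnorm H \<eta>"
proof (cases "hnorm H \<eta> = 0")
  case True
  then have "\<eta> = vzero H" using y hnorm_eq0 by blast
  then show ?thesis using x by (simp add: inn_vzero True[unfolded \<open>\<eta> = vzero H\<close>])
next
  case False
  define c where "c = inn H \<xi> \<eta>"
  define b where "b = (hnorm H \<eta>)\<^sup>2"
  define w where "w = vdiff H (vscale H (of_real b) \<xi>) (vscale H c \<eta>)"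
  have b: "b > 0" using False by (simp add: b_def)
  have yx: "inn H \<eta> \<xi> = cnj c" using inn_cnj[OF x y] by (simp add: c_def)
  have "inn H w w = of_real (b * (b * (hnorm H \<xi>)\<^sup>2 - (cmod c)\<^sup>2))"
    using x y unfolding w_def
    by (simp add: inn_diff inn_scale inn_scale_right vscale_in vdiff_in inn_self[OF x]
        inn_self[OF y, folded b_def] yx c_def[symmetric] complex_norm_square[symmetric]
        algebra_simps power2_eq_square complex_norm_square)
  moreover have "0 \<le> Re (inn H w w)"
    using x y unfolding w_def by (intro inn_pos vdiff_in vscale_in)
  ultimately have "0 \<le> b * (b * (hnorm H \<xi>)\<^sup>2 - (cmod c)\<^sup>2)" by simp
  then have "(cmod c)\<^sup>2 \<le> (hnorm H \<xi> * hnorm H \<eta>)\<^sup>2"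
    using b by (simp add: zero_le_mult_iff b_def power_mult_distrib mult.commute)
  then show ?thesis unfolding c_def
    using hnorm_ge0 x y by (meson mult_nonneg_nonneg power2_le_imp_le)
qed

lemma hnorm_sq_add:
  assumes "\<xi> \<in> vecs H" "\<eta> \<in> vecs H"
  shows "(hnorm H (vadd H \<xi> \<eta>))\<^sup>2 = (hnorm H \<xi>)\<^sup>2 + 2 * Re (inn H \<xi> \<eta>) + (hnorm H \<eta>)\<^sup>2"
proof -
  have "Re (inn H \<eta> \<xi>) = Re (inn H \<xi> \<eta>)" using inn_cnj[OF assms] by simp
  then show ?thesis
    using assms by (simp add: hnorm_sq inn_add inn_add_right vadd_in)
qed

lemma hnorm_sq_diff:
  assumes "\<xi> \<in> vecs H" "\<eta> \<in> vecs H"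
  shows "(hnorm H (vdiff H \<xi> \<eta>))\<^sup>2 = (hnorm H \<xi>)\<^sup>2 - 2 * Re (inn H \<xi> \<eta>) + (hnorm H \<eta>)\<^sup>2"
proof -
  have "Re (inn H \<eta> \<xi>) = Re (inn H \<xi> \<eta>)" using inn_cnj[OF assms] by simp
  then show ?thesis
    using assms by (simp add: hnorm_sq inn_diff vdiff_in)
qed

lemma hnorm_triangle:
  assumes "\<xi> \<in> vecs H" "\<eta> \<in> vecs H"
  shows "hnorm H (vadd H \<xi> \<eta>) \<le> hnorm H \<xi> + hnorm H \<eta>"
proof (rule power2_le_imp_le)
  have "Re (inn H \<xi> \<eta>) \<le> hnorm H \<xi> * hnorm H \<eta>"
    using Cauchy_Schwarz[OF assms] complex_Re_le_cmod order_trans by blast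
  then show "(hnorm H (vadd H \<xi> \<eta>))\<^sup>2 \<le> (hnorm H \<xi> + hnorm H \<eta>)\<^sup>2"
    by (simp add: hnorm_sq_add[OF assms] power2_sum)
  show "0 \<le> hnorm H \<xi> + hnorm H \<eta>" using assms by (simp add: hnorm_ge0)
qed

lemma hdist_ge0: "\<xi> \<in> vecs H \<Longrightarrow> \<eta> \<in> vecs H \<Longrightarrow> 0 \<le> hdist H \<xi> \<eta>"
  unfolding hdist_def by (intro hnorm_ge0 vdiff_in)

lemma hdist_commute: "\<xi> \<in> vecs H \<Longrightarrow> \<eta> \<in> vecs H \<Longrightarrow> hdist H \<xi> \<eta> = hdist H \<eta> \<xi>"
proof -
  assume a: "\<xi> \<in> vecs H" "\<eta> \<in> vecs H"
  have "Re (inn H \<eta> \<xi>) = Re (inn H \<xi> \<eta>)" using inn_cnj[OF a] by simp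
  then have "(hdist H \<xi> \<eta>)\<^sup>2 = (hdist H \<eta> \<xi>)\<^sup>2"
    using a by (simp add: hdist_def hnorm_sq_diff)
  then show ?thesis using a by (simp add: hdist_ge0)
qed

lemma hdist_triangle:
  assumes "\<xi> \<in> vecs H" "\<eta> \<in> vecs H" "\<zeta> \<in> vecs H"
  shows "hdist H \<xi> \<zeta> \<le> hdist H \<xi> \<eta> + hdist H \<eta> \<zeta>"
proof -
  let ?a = "vdiff H \<xi> \<eta>" and ?b = "vdiff H \<eta> \<zeta>" and ?c = "vdiff H \<xi> \<zeta>"
  let ?s = "vadd H ?a ?b"
  have in': "?a \<in> vecs H" "?b \<in> vecs H" "?c \<in> vecs H" "?s \<in> vecs H"
    using assms by (auto intro: vdiff_in vadd_in)
  \<comment> \<open>The two vectors are shown equal by testing against all vectors, which replaces a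
    rearrangement with the bare vector space axioms.\<close>
  have "inn H ?s v = inn H ?c v" if "v \<in> vecs H" for v
    using assms in' that by (simp add: inn_add inn_diff)
  then have "inn H (vdiff H ?s ?c) (vdiff H ?s ?c) = 0"
    using in' by (simp add: inn_diff(1) vdiff_in)
  then have "?s = ?c" using in' inn_definite vdiff_in vdiff_eq_zero by metis
  then show ?thesis unfolding hdist_def using hnorm_triangle[OF in'(1,2)] by simp
qed

lemma hdist_eq0: "\<xi> \<in> vecs H \<Longrightarrow> \<eta> \<in> vecs H \<Longrightarrow> hdist H \<xi> \<eta> = 0 \<Longrightarrow> \<xi> = \<eta>"
  unfolding hdist_def by (metis hnorm_eq0 vdiff_in vdiff_eq_zero)

lemma inn_ext:
  assumes "\<xi> \<in> vecs H" "\<zeta> \<in> vecs H" "\<And>\<eta>. \<eta> \<in> vecs H \<Longrightarrow> inn H \<xi> \<eta> = inn H \<zeta> \<eta>"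
  shows "\<xi> = \<zeta>"
proof -
  have "inn H (vdiff H \<xi> \<zeta>) (vdiff H \<xi> \<zeta>) = 0"
    using assms by (simp add: inn_diff(1) vdiff_in)
  then show ?thesis using assms inn_definite vdiff_in vdiff_eq_zero by metis
qed

lemma hdist_limit_unique:
  assumes "\<And>n. F n \<in> vecs H" "\<xi> \<in> vecs H" "\<eta> \<in> vecs H"
    and "(\<lambda>n. hdist H (F n) \<xi>) \<longlonglongrightarrow> 0" "(\<lambda>n. hdist H (F n) \<eta>) \<longlonglongrightarrow> 0"
  shows "\<xi> = \<eta>"
proof -
  have "(\<lambda>n. hdist H (F n) \<xi> + hdist H (F n) \<eta>) \<longlonglongrightarrow> 0"
    using tendsto_add[OF assms(4,5)] by simp
  moreover have "hdist H \<xi> \<eta> \<le> hdist H (F n) \<xi> + hdist H (F n) \<eta>" for n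
    using hdist_triangle[of \<xi> "F n" \<eta>] hdist_commute assms(1-3) by metis
  ultimately have "hdist H \<xi> \<eta> \<le> 0"
    by (meson LIMSEQ_le_const)
  then show ?thesis using hdist_ge0 hdist_eq0 assms by (meson order_antisym)
qed

lemma abs_hnorm_diff:
  assumes "\<xi> \<in> vecs H" "\<eta> \<in> vecs H"
  shows "\<bar>hnorm H \<xi> - hnorm H \<eta>\<bar> \<le> hdist H \<xi> \<eta>"
proof -
  have z: "hdist H v (vzero H) = hnorm H v" if "v \<in> vecs H" for v
    using hnorm_sq_diff[OF that vzero_in] that inn_vzero(1)[OF that]
    by (simp add: hdist_def hnorm_vzero hnorm_ge0 vdiff_in vzero_in power2_eq_iff_nonneg)
  show ?thesis
    using hdist_triangle[OF assms(1,2) vzero_in] hdist_triangle[OF assms(2,1) vzero_in]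
      hdist_commute[OF assms] by (simp add: z assms abs_le_iff)
qed

text \<open>The representing vector minimises \<open>\<parallel>\<zeta>\<parallel>\<^sup>2 - 2 Re (\<psi> \<zeta>)\<close>; by the parallelogram law a
  minimising sequence is Cauchy.\<close>

lemma Riesz_representation:
  assumes add: "\<And>a b. a \<in> vecs H \<Longrightarrow> b \<in> vecs H \<Longrightarrow> \<psi> (vadd H a b) = \<psi> a + \<psi> b"
    and scale: "\<And>a c. a \<in> vecs H \<Longrightarrow> \<psi> (vscale H c a) = cnj c * \<psi> a"
    and bound: "\<And>a. a \<in> vecs H \<Longrightarrow> cmod (\<psi> a) \<le> B * hnorm H a"
  obtains \<zeta> where "\<zeta> \<in> vecs H" "\<And>\<eta>. \<eta> \<in> vecs H \<Longrightarrow> inn H \<zeta> \<eta> = \<psi> \<eta>"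
proof -
  define J where "J = (\<lambda>v. (hnorm H v)\<^sup>2 - 2 * Re (\<psi> v))"
  define d where "d = Inf (J ` vecs H)"
  have lower: "- B\<^sup>2 \<le> J v" if v: "v \<in> vecs H" for v
  proof -
    have "Re (\<psi> v) \<le> B * hnorm H v"
      using bound[OF v] complex_Re_le_cmod order_trans by blast
    moreover have "0 \<le> (hnorm H v - B)\<^sup>2" by simp
    ultimately show ?thesis unfolding J_def power2_diff by (simp add: algebra_simps)
  qed
  have bdd: "bdd_below (J ` vecs H)" using lower by (auto intro!: bdd_belowI)
  have d_le: "d \<le> J v" if "v \<in> vecs H" for v
    unfolding d_def using bdd that by (simp add: cInf_lower)
  have "\<exists>v\<in>vecs H. J v < d + 1 / real (Suc n)" for n
  proof -
    have "d < d + 1 / real (Suc n)" by simp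
    then show ?thesis unfolding d_def using cInf_lessD[of "J ` vecs H"] vzero_in
      by (metis (no_types, lifting) empty_iff image_iff)
  qed
  then obtain F where F: "\<And>n. F n \<in> vecs H" "\<And>n. J (F n) < d + 1 / real (Suc n)" by metis
  have dist: "(hdist H (F m) (F n))\<^sup>2 \<le> 2 / real (Suc m) + 2 / real (Suc n)" for m n
  proof -
    let ?mid = "vscale H (1/2) (vadd H (F m) (F n))"
    have mid: "?mid \<in> vecs H" using F by (intro vscale_in vadd_in)
    have J1: "(hnorm H ?mid)\<^sup>2 = ((hnorm H (F m))\<^sup>2 + 2 * Re (inn H (F m) (F n)) + (hnorm H (F n))\<^sup>2) / 4"
      using F by (simp add: hnorm_scale vadd_in power_mult_distrib hnorm_sq_add power_divide)
    have J2: "Re (\<psi> ?mid) = (Re (\<psi> (F m)) + Re (\<psi> (F n))) / 2"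
      using F by (simp add: scale vadd_in add)
    \<comment> \<open>The parallelogram law for \<open>J\<close>: its linear part cancels, and
      \<open>J ?mid\<close> is at least \<open>d\<close>, so two nearly minimal values force their
      arguments together.\<close>
    have alg: "A - 2 * C + B = 2 * (A - 2 * P) + 2 * (B - 2 * Q)
        - 4 * ((A + 2 * C + B) / 4 - 2 * ((P + Q) / 2))" for A B C P Q :: real
      by (simp add: add_divide_distrib)
    have "(hdist H (F m) (F n))\<^sup>2 = 2 * J (F m) + 2 * J (F n) - 4 * J ?mid"
      unfolding J_def J1 J2 hdist_def hnorm_sq_diff[OF F(1) F(1)] by (rule alg)
    also have "\<dots> \<le> 2 / real (Suc m) + 2 / real (Suc n)"
      using F(2)[of m] F(2)[of n] d_le[OF mid] by (simp add: algebra_simps)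
    finally show ?thesis .
  qed
  have cauchy: "\<exists>N. \<forall>m\<ge>N. \<forall>n\<ge>N. hdist H (F m) (F n) < e" if e: "e > 0" for e
  proof -
    obtain N where N: "real N > 4 / e\<^sup>2" using reals_Archimedean2 by blast
    have "hdist H (F m) (F n) < e" if mn: "m \<ge> N" "n \<ge> N" for m n
    proof (rule power2_less_imp_less)
      have pos: "real (Suc N) > 4 / e\<^sup>2" using N by simp
      have "2 / real (Suc m) \<le> 2 / real (Suc N)" "2 / real (Suc n) \<le> 2 / real (Suc N)"
        using mn by (simp_all add: frac_le)
      then have "(hdist H (F m) (F n))\<^sup>2 \<le> 4 / real (Suc N)" using dist[of m n] by simp
      also have "\<dots> < e\<^sup>2" using pos e by (simp add: field_simps del: of_nat_Suc)
      finally show "(hdist H (F m) (F n))\<^sup>2 < e\<^sup>2" .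
    qed (use e in simp)
    then show ?thesis by blast
  qed
  obtain \<zeta> where \<zeta>: "\<zeta> \<in> vecs H" "(\<lambda>n. hdist H (F n) \<zeta>) \<longlonglongrightarrow> 0"
    using complete[of F] F(1) cauchy by blast
  have norm_lim: "(\<lambda>n. hnorm H (F n)) \<longlonglongrightarrow> hnorm H \<zeta>"
    using Lim_null_comparison[OF _ \<zeta>(2), of "\<lambda>n. hnorm H (F n) - hnorm H \<zeta>"]
      abs_hnorm_diff[OF F(1) \<zeta>(1)] by (simp add: LIM_zero_iff)
  have diff: "\<psi> (vdiff H a b) = \<psi> a - \<psi> b" if "a \<in> vecs H" "b \<in> vecs H" for a b
    using that by (simp add: vdiff_def add scale vscale_in)
  have psi_lim: "(\<lambda>n. \<psi> (F n)) \<longlonglongrightarrow> \<psi> \<zeta>"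
  proof -
    have le: "cmod (\<psi> (F n) - \<psi> \<zeta>) \<le> B * hdist H (F n) \<zeta>" for n
      using bound[OF vdiff_in[OF F(1) \<zeta>(1), of n]] diff[OF F(1) \<zeta>(1)] by (simp add: hdist_def)
    have lim: "(\<lambda>n. B * hdist H (F n) \<zeta>) \<longlonglongrightarrow> 0"
      using tendsto_mult_left[OF \<zeta>(2), of B] by simp
    have "(\<lambda>n. \<psi> (F n) - \<psi> \<zeta>) \<longlonglongrightarrow> 0"
      by (rule Lim_null_comparison[OF _ lim]) (use le in \<open>intro always_eventually allI\<close>)
    then show ?thesis by (simp add: LIM_zero_iff)
  qed
  have "(\<lambda>n. J (F n)) \<longlonglongrightarrow> J \<zeta>"
    unfolding J_def by (intro tendsto_intros norm_lim psi_lim)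
  moreover have "(\<lambda>n. d + 1 / real (Suc n)) \<longlonglongrightarrow> d + 0"
    by (intro tendsto_intros LIMSEQ_Suc[OF lim_1_over_n])
  ultimately have "J \<zeta> \<le> d + 0"
    using F(2) by (intro LIMSEQ_le[of "\<lambda>n. J (F n)" "J \<zeta>" "\<lambda>n. d + 1 / real (Suc n)"]) (auto intro: less_imp_le)
  then have min: "J \<zeta> \<le> J v" if "v \<in> vecs H" for v using d_le[OF that] by simp
  have "inn H \<zeta> \<eta> = \<psi> \<eta>" if \<eta>: "\<eta> \<in> vecs H" for \<eta>
  proof (rule ccontr)
    define w where "w = inn H \<zeta> \<eta> - \<psi> \<eta>"
    assume "inn H \<zeta> \<eta> \<noteq> \<psi> \<eta>"
    then have w: "(cmod w)\<^sup>2 > 0" by (simp add: w_def)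
    \<comment> \<open>Moving from the minimiser by - t w \<eta> changes \<open>J\<close> by t |w|^2
      (t |\<eta>|^2 - 2). This \<open>t\<close> keeps t |\<eta>|^2 at most 1, so the change is
      negative unless w = 0.\<close>
    define t where "t = 1 / (1 + (hnorm H \<eta>)\<^sup>2)"
    have t: "t > 0" by (auto simp: t_def intro!: divide_pos_pos add_pos_nonneg)
    define c where "c = - of_real t * w"
    have cin: "vscale H c \<eta> \<in> vecs H" using \<eta> by (intro vscale_in)
    have "J (vadd H \<zeta> (vscale H c \<eta>)) = J \<zeta> + 2 * Re (cnj c * w) + (cmod c)\<^sup>2 * (hnorm H \<eta>)\<^sup>2"
      unfolding J_def w_def using \<zeta>(1) \<eta> cin
      by (simp add: hnorm_sq_add add scale hnorm_scale inn_scale_right power_mult_distrib algebra_simps)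
    then have "0 \<le> 2 * Re (cnj c * w) + (cmod c)\<^sup>2 * (hnorm H \<eta>)\<^sup>2"
      using min[OF vadd_in[OF \<zeta>(1) cin]] by simp
    also have "Re (cnj c * w) = - t * (cmod w)\<^sup>2"
      by (simp add: c_def cmod_power2) (simp add: algebra_simps power2_eq_square)
    also have "(cmod c)\<^sup>2 = t\<^sup>2 * (cmod w)\<^sup>2" by (simp add: c_def norm_mult power_mult_distrib)
    finally have "0 \<le> (t * (cmod w)\<^sup>2) * (t * (hnorm H \<eta>)\<^sup>2 - 2)"
      by (simp add: power2_eq_square[of t] algebra_simps)
    moreover have "t * (cmod w)\<^sup>2 > 0" using t w by (rule mult_pos_pos)
    ultimately have "2 \<le> t * (hnorm H \<eta>)\<^sup>2" by (simp add: zero_le_mult_iff)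
    moreover have "t * (hnorm H \<eta>)\<^sup>2 \<le> 1"
    proof -
      have "1 + (hnorm H \<eta>)\<^sup>2 > 0" by (rule add_pos_nonneg) auto
      then show ?thesis unfolding t_def by (simp add: divide_le_eq)
    qed
    ultimately show False by simp
  qed
  then show ?thesis using that \<zeta>(1) by blast
qed

end

section \<open>Covariant pairs and the universal norm\<close>

lemma compact_closed_subset: "compact K \<Longrightarrow> closed A \<Longrightarrow> A \<subseteq> K \<Longrightarrow> compact A"
  by (metis compact_Int_closed inf.absorb2)

text \<open>Continuity of \<open>h\<close> at 0 places every level set of the composition inside a
  level set of \<open>f\<close>, which is compact. Besides scaling and conjugation this serves the
  square root in \<open>hnorm_rep_le\<close>.\<close>

lemma C0_comp:
  fixes f :: "'x::topological_space \<Rightarrow> complex"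
  assumes f: "f \<in> C0" and h: "continuous_on UNIV h" "h 0 = 0"
  shows "(\<lambda>x. h (f x)) \<in> (C0 :: ('x \<Rightarrow> complex) set)"
proof -
  have cf: "continuous_on UNIV f" using f by (simp add: C0_def)
  have chf: "continuous_on UNIV (\<lambda>x. h (f x))"
    using continuous_on_compose2[OF h(1) cf] by simp
  have "compact {x. e \<le> cmod (h (f x))}" if e: "e > 0" for e
  proof -
    obtain d where d: "d > 0" "\<And>w. dist w 0 < d \<Longrightarrow> dist (h w) (h 0) < e"
      using h(1) e by (metis UNIV_I continuous_on_iff)
    have "closed {x. e \<le> cmod (h (f x))}"
      by (intro closed_Collect_le continuous_on_const continuous_on_norm chf)
    moreover have "compact {x. d \<le> cmod (f x)}" using f d(1) by (simp add: C0_def)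
    moreover have "{x. e \<le> cmod (h (f x))} \<subseteq> {x. d \<le> cmod (f x)}"
    proof
      fix x assume "x \<in> {x. e \<le> cmod (h (f x))}"
      moreover have "cmod (f x) < d \<Longrightarrow> cmod (h (f x)) < e" using d(2)[of "f x"] h(2) by simp
      ultimately show "x \<in> {x. d \<le> cmod (f x)}" by (meson mem_Collect_eq not_le)
    qed
    ultimately show ?thesis using compact_closed_subset by blast
  qed
  then show ?thesis using chf by (simp add: C0_def)
qed

lemma C0_add:
  fixes f g :: "'x::topological_space \<Rightarrow> complex"
  assumes f: "f \<in> C0" and g: "g \<in> C0"
  shows "(\<lambda>x. f x + g x) \<in> C0"
proof -
  have cf: "continuous_on UNIV (\<lambda>x. f x + g x)"
    using f g by (auto simp: C0_def intro: continuous_intros)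
  have "compact {x. e \<le> cmod (f x + g x)}" if e: "e > 0" for e
  proof -
    have "closed {x. e \<le> cmod (f x + g x)}"
      by (intro closed_Collect_le continuous_on_const continuous_on_norm cf)
    moreover have "compact ({x. e/2 \<le> cmod (f x)} \<union> {x. e/2 \<le> cmod (g x)})"
      using f g half_gt_zero[OF e] unfolding C0_def by (intro compact_Un) blast+
    moreover have "e/2 \<le> cmod (f x) \<or> e/2 \<le> cmod (g x)" if "e \<le> cmod (f x + g x)" for x
      using norm_triangle_ineq[of "f x" "g x"] that by linarith
    then have "{x. e \<le> cmod (f x + g x)} \<subseteq> {x. e/2 \<le> cmod (f x)} \<union> {x. e/2 \<le> cmod (g x)}"
      by blast
    ultimately show ?thesis using compact_closed_subset by blast
  qed
  then show ?thesis using cf by (simp add: C0_def)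
qed

lemma C0_bounded:
  fixes f :: "'x::topological_space \<Rightarrow> complex"
  assumes f: "f \<in> C0"
  obtains B where "B \<ge> 0" "\<And>x. cmod (f x) \<le> B"
proof -
  have "compact {x. 1 \<le> cmod (f x)}" using f by (simp add: C0_def)
  moreover have "continuous_on {x. 1 \<le> cmod (f x)} f"
    using f by (auto simp: C0_def intro: continuous_on_subset)
  ultimately have "bounded (f ` {x. 1 \<le> cmod (f x)})"
    by (intro compact_imp_bounded compact_continuous_image)
  then obtain B where B: "\<And>x. 1 \<le> cmod (f x) \<Longrightarrow> cmod (f x) \<le> B"
    by (auto simp: bounded_iff)
  have "cmod (f x) \<le> max 1 B" for x using B[of x] by (cases "1 \<le> cmod (f x)") auto
  then show ?thesis using that[of "max 1 B"] by auto
qed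

lemma C0_scale: "f \<in> C0 \<Longrightarrow> (\<lambda>x. c * f x) \<in> C0" for f :: "'x::topological_space \<Rightarrow> complex"
  by (rule C0_comp) (auto intro!: continuous_intros)

lemma C0_cnj: "f \<in> C0 \<Longrightarrow> (\<lambda>x. cnj (f x)) \<in> C0" for f :: "'x::topological_space \<Rightarrow> complex"
  by (rule C0_comp) (auto intro!: continuous_intros)

text \<open>Uniform convergence at each \<open>s\<close> gives a bound on a neighbourhood of
  \<open>s\<close>, and finitely many such neighbourhoods cover the support.\<close>

lemma CcC0_bounded:
  fixes f :: "'g::topological_space \<Rightarrow> 'x::topological_space \<Rightarrow> complex"
  assumes f: "f \<in> CcC0"
  obtains B where "B \<ge> 0" "\<And>s x. cmod (f s x) \<le> B"
proof -
  let ?K = "closure {s. f s \<noteq> (\<lambda>x. 0)}"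
  have "\<exists>B T. open T \<and> s \<in> T \<and> (\<forall>t\<in>T. \<forall>x. cmod (f t x) \<le> B)" for s
  proof -
    have "f s \<in> C0" using f by (simp add: CcC0_def)
    then obtain B where B: "\<And>x. cmod (f s x) \<le> B" using C0_bounded by blast
    have "uniform_limit UNIV f (f s) (at s)" using f by (simp add: CcC0_def)
    then have "\<forall>\<^sub>F t in at s. \<forall>x\<in>UNIV. dist (f t x) (f s x) < 1"
      unfolding uniform_limit_iff by simp
    then obtain T where T: "open T" "s \<in> T"
        "\<And>t x. t \<in> T \<Longrightarrow> t \<noteq> s \<Longrightarrow> dist (f t x) (f s x) < 1"
      unfolding eventually_at_topological by auto
    have "cmod (f t x) \<le> B + 1" if "t \<in> T" for t x
    proof -
      have "dist (f t x) (f s x) < 1" using T(3)[OF that] by (cases "t = s") auto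
      then show ?thesis using B[of x] norm_triangle_sub[of "f t x" "f s x"]
        by (simp add: dist_norm)
    qed
    then show ?thesis using T by blast
  qed
  then obtain B T where T: "\<And>s. open (T s)" "\<And>s. s \<in> T s"
      "\<And>s t x. t \<in> T s \<Longrightarrow> cmod (f t x) \<le> B s" by metis
  have "compact ?K" using f by (simp add: CcC0_def)
  then obtain D where D: "finite D" "?K \<subseteq> (\<Union>s\<in>D. T s)"
    using T(1,2) by (elim compactE_image[of ?K ?K T]) auto
  have "cmod (f t x) \<le> (\<Sum>s\<in>D. \<bar>B s\<bar>)" for t x
  proof (cases "f t x = 0")
    case True then show ?thesis by (simp add: sum_nonneg)
  next
    case False
    then have "t \<in> ?K" using closure_subset by fastforce
    then obtain s where s: "s \<in> D" "t \<in> T s" using D by blast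
    have "cmod (f t x) \<le> \<bar>B s\<bar>" using T(3)[OF s(2), of x] by simp
    also have "\<dots> \<le> (\<Sum>s\<in>D. \<bar>B s\<bar>)" using s D by (intro member_le_sum) auto
    finally show ?thesis .
  qed
  then show ?thesis using that[of "\<Sum>s\<in>D. \<bar>B s\<bar>"] by (simp add: sum_nonneg)
qed

lemma CcC0_lincomb:
  fixes f g :: "'g::topological_space \<Rightarrow> 'x::topological_space \<Rightarrow> complex"
  assumes f: "f \<in> CcC0" and g: "g \<in> CcC0"
  shows "(\<lambda>s x. f s x + c * g s x) \<in> CcC0"
proof -
  have "uniform_limit UNIV (\<lambda>s x. f s x + c * g s x) (\<lambda>x. f s x + c * g s x) (at s)" for s
  proof -
    have "uniform_limit UNIV f (f s) (at s)" "uniform_limit UNIV g (g s) (at s)"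
      using f g by (simp_all add: CcC0_def)
    then show ?thesis
      by (intro uniform_limit_add bounded_linear.uniform_limit[OF bounded_linear_mult_right]) auto
  qed
  moreover have "compact (closure {s. (\<lambda>x. f s x + c * g s x) \<noteq> (\<lambda>x. 0)})"
  proof -
    let ?A = "{s. f s \<noteq> (\<lambda>x. 0)}" and ?B = "{s. g s \<noteq> (\<lambda>x. 0)}"
    have c: "compact (closure ?A \<union> closure ?B)"
      using f g by (intro compact_Un) (simp_all add: CcC0_def)
    have "{s. (\<lambda>x. f s x + c * g s x) \<noteq> (\<lambda>x. 0)} \<subseteq> ?A \<union> ?B"
      by (auto simp: fun_eq_iff)
    then have "closure {s. (\<lambda>x. f s x + c * g s x) \<noteq> (\<lambda>x. 0)} \<subseteq> closure ?A \<union> closure ?B"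
      unfolding closure_Un[symmetric] by (rule closure_mono)
    then show ?thesis using compact_closed_subset[OF c closed_closure] by blast
  qed
  moreover have "(\<lambda>x. f s x + c * g s x) \<in> C0" for s
    using f g by (intro C0_add C0_scale) (simp_all add: CcC0_def)
  ultimately show ?thesis unfolding CcC0_def by simp
qed

section \<open>Integrated forms of covariant representations\<close>

locale covariant_rep = hilbert_space H for H :: "'h hspace" +
  fixes act :: "'g::{t2_space, group_add} \<Rightarrow> 'x::topological_space \<Rightarrow> 'x"
    and \<pi> :: "('x \<Rightarrow> complex) \<Rightarrow> 'h \<Rightarrow> 'h" and U :: "'g \<Rightarrow> 'h \<Rightarrow> 'h" and \<mu> :: "'g measure"
  assumes cov: "covariant_pair act H \<pi> U"
    and sets_\<mu>: "sets \<mu> = sets borel"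
    and finite_\<mu>: "compact K \<Longrightarrow> emeasure \<mu> K < \<infinity>"
begin

lemmas rep_bdd = cov[unfolded covariant_pair_def, THEN conjunct1, rule_format]
lemmas rep_add = cov[unfolded covariant_pair_def, THEN conjunct2, THEN conjunct1, rule_format]
lemmas rep_scale = cov[unfolded covariant_pair_def, THEN conjunct2, THEN conjunct2, THEN conjunct1, rule_format]
lemmas rep_mult = cov[unfolded covariant_pair_def, THEN conjunct2, THEN conjunct2, THEN conjunct2, THEN conjunct1, rule_format]
lemmas rep_cnj = cov[unfolded covariant_pair_def, THEN conjunct2, THEN conjunct2, THEN conjunct2, THEN conjunct2, THEN conjunct1, rule_format]
lemmas U_bdd = cov[unfolded covariant_pair_def, THEN conjunct2, THEN conjunct2, THEN conjunct2, THEN conjunct2, THEN conjunct2, THEN conjunct1, rule_format]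
lemmas unitary = cov[unfolded covariant_pair_def, THEN conjunct2, THEN conjunct2, THEN conjunct2, THEN conjunct2, THEN conjunct2, THEN conjunct2, THEN conjunct1, rule_format]
lemmas strongly_continuous = cov[unfolded covariant_pair_def, THEN conjunct2, THEN conjunct2, THEN conjunct2, THEN conjunct2, THEN conjunct2, THEN conjunct2, THEN conjunct2, THEN conjunct2, THEN conjunct2, THEN conjunct1, rule_format]

lemma rep_in: "f \<in> C0 \<Longrightarrow> \<xi> \<in> vecs H \<Longrightarrow> \<pi> f \<xi> \<in> vecs H"
  and U_in: "\<xi> \<in> vecs H \<Longrightarrow> U s \<xi> \<in> vecs H"
  and rep_linear: "f \<in> C0 \<Longrightarrow> \<xi> \<in> vecs H \<Longrightarrow> \<eta> \<in> vecs H \<Longrightarrow> \<pi> f (vadd H \<xi> \<eta>) = vadd H (\<pi> f \<xi>) (\<pi> f \<eta>)"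
  and rep_vscale: "f \<in> C0 \<Longrightarrow> \<xi> \<in> vecs H \<Longrightarrow> \<pi> f (vscale H c \<xi>) = vscale H c (\<pi> f \<xi>)"
  and U_vscale: "\<xi> \<in> vecs H \<Longrightarrow> U s (vscale H c \<xi>) = vscale H c (U s \<xi>)"
  using rep_bdd U_bdd unfolding bounded_operator_def by blast+

lemma hnorm_U: "\<xi> \<in> vecs H \<Longrightarrow> hnorm H (U s \<xi>) = hnorm H \<xi>"
  by (simp add: hnorm_def unitary)

text \<open>Contractivity: \<open>g = c - sqrt (c\<^sup>2 - \<bar>f\<bar>\<^sup>2)\<close> again lies in \<open>C\<^sub>0(X)\<close>, and
  \<open>c\<^sup>2 \<parallel>\<xi>\<parallel>\<^sup>2 - \<parallel>\<pi>(f) \<xi>\<parallel>\<^sup>2 = \<parallel>c \<xi> - \<pi>(g) \<xi>\<parallel>\<^sup>2\<close>.\<close>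

lemma hnorm_rep_le:
  assumes f: "f \<in> C0" and le: "\<And>x. cmod (f x) \<le> c" and x: "\<xi> \<in> vecs H"
  shows "hnorm H (\<pi> f \<xi>) \<le> c * hnorm H \<xi>"
proof -
  have c0: "c \<ge> 0" using le[of undefined] norm_ge_zero order_trans by blast
  \<comment> \<open>C_0(X) may lack a unit, so the square root of c^2 - |f|^2 is replaced by its
    difference from \<open>c\<close>, which vanishes where \<open>f\<close> does; the identity |f|^2
    = 2 c g - g^2 then involves elements of C_0(X) only.\<close>
  define g where "g = (\<lambda>x. complex_of_real (c - sqrt (c\<^sup>2 - (cmod (f x))\<^sup>2)))"
  have g: "g \<in> C0" unfolding g_def
    by (rule C0_comp[OF f]) (use c0 in \<open>auto intro!: continuous_intros\<close>)
  have cg: "(\<lambda>x. cnj (g x)) = g" by (simp add: g_def)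
  have fg: "cnj (f x) * f x = 2 * of_real c * g x + (- 1) * (g x * g x)" for x
  proof -
    have "(sqrt (c\<^sup>2 - (cmod (f x))\<^sup>2))\<^sup>2 = c\<^sup>2 - (cmod (f x))\<^sup>2"
      using le[of x] by (intro real_sqrt_pow2) (simp add: power_mono)
    then have "(cmod (f x))\<^sup>2 = 2 * c * (c - sqrt (c\<^sup>2 - (cmod (f x))\<^sup>2)) - (c - sqrt (c\<^sup>2 - (cmod (f x))\<^sup>2))\<^sup>2"
      by (simp add: power2_diff) (simp add: power2_eq_square algebra_simps)
    then have "complex_of_real ((cmod (f x))\<^sup>2) =
        of_real (2 * c * (c - sqrt (c\<^sup>2 - (cmod (f x))\<^sup>2)) - (c - sqrt (c\<^sup>2 - (cmod (f x))\<^sup>2))\<^sup>2)"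
      by (rule arg_cong)
    also have "\<dots> = 2 * of_real c * g x + (- 1) * (g x * g x)"
      by (simp add: g_def power2_eq_square)
    finally show ?thesis by (simp only: complex_norm_square mult.commute)
  qed
  have gg: "(\<lambda>x. g x * g x) \<in> C0" by (rule C0_comp[OF g]) (auto intro!: continuous_intros)
  have pf: "\<pi> f \<xi> \<in> vecs H" "\<pi> g \<xi> \<in> vecs H" "\<pi> g (\<pi> g \<xi>) \<in> vecs H" using f g x rep_in by auto
  have "inn H (\<pi> f \<xi>) (\<pi> f \<xi>) = inn H (\<pi> (\<lambda>x. cnj (f x)) (\<pi> f \<xi>)) \<xi>"
    using rep_cnj[OF f pf(1) x] by simp
  also have "\<pi> (\<lambda>x. cnj (f x)) (\<pi> f \<xi>) = \<pi> (\<lambda>x. cnj (f x) * f x) \<xi>"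
    using rep_mult[OF C0_cnj[OF f] f x] by simp
  also have "\<dots> = vadd H (vscale H (2 * of_real c) (\<pi> g \<xi>)) (vscale H (-1) (\<pi> g (\<pi> g \<xi>)))"
    by (simp only: fg rep_add[OF C0_scale[OF g] C0_scale[OF gg] x] rep_scale[OF g x]
        rep_scale[OF gg x] rep_mult[OF g g x])
  also have "inn H \<dots> \<xi> = 2 * of_real c * inn H (\<pi> g \<xi>) \<xi> - inn H (\<pi> g (\<pi> g \<xi>)) \<xi>"
    using pf x by (simp add: inn_add inn_scale vscale_in)
  also have "inn H (\<pi> g (\<pi> g \<xi>)) \<xi> = inn H (\<pi> g \<xi>) (\<pi> g \<xi>)"
    using rep_cnj[OF g pf(2) x] cg by simp
  finally have "(hnorm H (\<pi> f \<xi>))\<^sup>2 = 2 * c * Re (inn H (\<pi> g \<xi>) \<xi>) - (hnorm H (\<pi> g \<xi>))\<^sup>2"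
    using pf by (simp add: hnorm_sq)
  moreover have "0 \<le> (hnorm H (vdiff H (\<pi> g \<xi>) (vscale H (of_real c) \<xi>)))\<^sup>2" by simp
  then have "0 \<le> (hnorm H (\<pi> g \<xi>))\<^sup>2 - 2 * c * Re (inn H (\<pi> g \<xi>) \<xi>) + c\<^sup>2 * (hnorm H \<xi>)\<^sup>2"
    using pf x c0 by (simp add: hnorm_sq_diff vscale_in inn_scale_right hnorm_scale power_mult_distrib)
  ultimately have "(hnorm H (\<pi> f \<xi>))\<^sup>2 \<le> (c * hnorm H \<xi>)\<^sup>2" by (simp add: power_mult_distrib)
  then show ?thesis using c0 x by (meson hnorm_ge0 mult_nonneg_nonneg power2_le_imp_le)
qed

lemma rep_diff:
  assumes "f \<in> C0" "g \<in> C0" "\<xi> \<in> vecs H"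
  shows "\<pi> (\<lambda>x. f x + (- 1) * g x) \<xi> = vdiff H (\<pi> f \<xi>) (\<pi> g \<xi>)"
  unfolding vdiff_def using assms rep_add[OF assms(1) C0_scale[OF assms(2)] assms(3), of "-1"]
    rep_scale[OF assms(2,3), of "-1"] by simp

lemma rep_vdiff:
  assumes "f \<in> C0" "\<xi> \<in> vecs H" "\<eta> \<in> vecs H"
  shows "\<pi> f (vdiff H \<xi> \<eta>) = vdiff H (\<pi> f \<xi>) (\<pi> f \<eta>)"
  unfolding vdiff_def using assms by (simp add: rep_linear rep_vscale vscale_in)

text \<open>The difference of the vectors at \<open>t\<close> and \<open>s\<close> splits into
  \<pi>(f t - f s) U_t \<xi>, small by contractivity and uniform convergence, and \<pi>(f s) (U_t
  \<xi> - U_s \<xi>), small by strong continuity.\<close>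

lemma continuous_integrand:
  assumes f: "f \<in> CcC0" and x: "\<xi> \<in> vecs H" and y: "\<eta> \<in> vecs H"
  shows "continuous_on UNIV (\<lambda>s. inn H (\<pi> (f s) (U s \<xi>)) \<eta>)"
proof -
  have fs: "f s \<in> C0" for s using f by (simp add: CcC0_def)
  obtain B where B: "B \<ge> 0" "\<And>s x. cmod (f s x) \<le> B" using CcC0_bounded[OF f] by blast
  have "((\<lambda>t. inn H (\<pi> (f t) (U t \<xi>)) \<eta>) \<longlongrightarrow> inn H (\<pi> (f s) (U s \<xi>)) \<eta>) (at s)" for s
  proof (rule tendstoI)
    fix e :: real assume e: "e > 0"
    \<comment> \<open>The summand 1 keeps both divisors positive when a vector or the bound
      \<open>B\<close> vanishes.\<close>
    define A where "A = hnorm H \<xi> * hnorm H \<eta> + 1"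
    define C where "C = B * hnorm H \<eta> + 1"
    have A: "A > 0" and C: "C > 0" using B(1) x y by (auto simp: A_def C_def intro!: add_nonneg_pos mult_nonneg_nonneg hnorm_ge0)
    have "uniform_limit UNIV f (f s) (at s)" using f by (simp add: CcC0_def)
    then have ev1: "\<forall>\<^sub>F t in at s. \<forall>x\<in>UNIV. dist (f t x) (f s x) < e / (2 * A)"
      using e A unfolding uniform_limit_iff by (meson divide_pos_pos mult_pos_pos zero_less_numeral)
    have ev2: "\<forall>\<^sub>F t in at s. dist (hdist H (U t \<xi>) (U s \<xi>)) 0 < e / (2 * C)"
      using tendstoD[OF strongly_continuous[OF x]] e C by simp
    show "\<forall>\<^sub>F t in at s. dist (inn H (\<pi> (f t) (U t \<xi>)) \<eta>) (inn H (\<pi> (f s) (U s \<xi>)) \<eta>) < e"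
      using ev1 ev2
    proof eventually_elim
      case (elim t)
      let ?a = "\<pi> (\<lambda>x. f t x + (-1) * f s x) (U t \<xi>)"
      let ?b = "\<pi> (f s) (vdiff H (U t \<xi>) (U s \<xi>))"
      have fd: "(\<lambda>x. f t x + (-1) * f s x) \<in> C0" by (intro C0_add C0_scale fs)
      have ab: "?a \<in> vecs H" "?b \<in> vecs H"
        by (rule rep_in[OF fd U_in[OF x]], rule rep_in[OF fs vdiff_in[OF U_in[OF x] U_in[OF x]]])
      have "inn H (\<pi> (f t) (U t \<xi>)) \<eta> - inn H (\<pi> (f s) (U s \<xi>)) \<eta> = inn H ?a \<eta> + inn H ?b \<eta>"
        using rep_diff[OF fs fs U_in[OF x], of t s t] rep_vdiff[OF fs U_in[OF x] U_in[OF x], of s t s] x y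
        by (simp add: inn_diff rep_in[OF fs] U_in)
      also have "cmod \<dots> \<le> hnorm H ?a * hnorm H \<eta> + hnorm H ?b * hnorm H \<eta>"
        using Cauchy_Schwarz[OF ab(1) y] Cauchy_Schwarz[OF ab(2) y] norm_triangle_ineq order_trans add_mono by meson
      also have "hnorm H ?a \<le> e / (2 * A) * hnorm H (U t \<xi>)"
        using elim(1) by (intro hnorm_rep_le fd U_in x) (auto simp: dist_norm less_imp_le)
      also have "hnorm H ?b \<le> B * hdist H (U t \<xi>) (U s \<xi>)"
        unfolding hdist_def using x by (intro hnorm_rep_le fs vdiff_in U_in B)
      also have "hdist H (U t \<xi>) (U s \<xi>) \<le> e / (2 * C)" using elim(2) by (simp add: dist_real_def)
      finally have "cmod (inn H (\<pi> (f t) (U t \<xi>)) \<eta> - inn H (\<pi> (f s) (U s \<xi>)) \<eta>)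
          \<le> e / (2 * A) * hnorm H \<xi> * hnorm H \<eta> + B * (e / (2 * C)) * hnorm H \<eta>"
        using y x B(1) by (simp add: hnorm_ge0 mult_right_mono mult_left_mono hnorm_U)
      also have "\<dots> = e / 2 * ((A - 1) / A) + e / 2 * ((C - 1) / C)"
        by (simp add: A_def C_def mult.assoc)
      also have "\<dots> < e / 2 * 1 + e / 2 * 1"
        using e A C by (intro add_strict_mono mult_strict_left_mono) (auto simp: divide_less_eq)
      finally show ?case by (simp add: dist_norm)
    qed
  qed
  then show ?thesis by (simp add: continuous_on_def)
qed

lemma integrable_integrand:
  assumes f: "f \<in> CcC0" and B: "\<And>s x. cmod (f s x) \<le> B" and x: "\<xi> \<in> vecs H" and y: "\<eta> \<in> vecs H"
  shows "integrable \<mu> (\<lambda>s. inn H (\<pi> (f s) (U s \<xi>)) \<eta>)"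
    and "cmod (\<integral>s. inn H (\<pi> (f s) (U s \<xi>)) \<eta> \<partial>\<mu>)
      \<le> measure \<mu> (closure {s. f s \<noteq> (\<lambda>x. 0)}) * B * hnorm H \<xi> * hnorm H \<eta>"
proof -
  let ?K = "closure {s. f s \<noteq> (\<lambda>x. 0)}" and ?I = "\<lambda>s. inn H (\<pi> (f s) (U s \<xi>)) \<eta>"
  have fs: "f s \<in> C0" for s using f by (simp add: CcC0_def)
  have K: "?K \<in> sets \<mu>" "emeasure \<mu> ?K < \<infinity>"
    using finite_\<mu>[of ?K] f by (simp_all add: sets_\<mu> CcC0_def)
  have le: "cmod (?I s) \<le> B * hnorm H \<xi> * hnorm H \<eta>" for s
  proof -
    have "cmod (?I s) \<le> hnorm H (\<pi> (f s) (U s \<xi>)) * hnorm H \<eta>"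
      using x y fs by (intro Cauchy_Schwarz rep_in U_in)
    also have "\<dots> \<le> B * hnorm H (U s \<xi>) * hnorm H \<eta>"
      using x y fs B by (intro mult_right_mono hnorm_rep_le U_in hnorm_ge0)
    finally show ?thesis using x by (simp add: hnorm_U)
  qed
  have zero: "?I s = 0" if "s \<notin> ?K" for s
  proof -
    have "s \<notin> {s. f s \<noteq> (\<lambda>x. 0)}" by (rule contra_subsetD[OF closure_subset that])
    then have fz: "cmod (f s x) \<le> 0" for x by simp
    have "hnorm H (\<pi> (f s) (U s \<xi>)) \<le> 0 * hnorm H (U s \<xi>)"
      by (rule hnorm_rep_le[OF fs fz U_in[OF x]])
    then have h0: "hnorm H (\<pi> (f s) (U s \<xi>)) = 0"
      using hnorm_ge0[OF rep_in[OF fs U_in[OF x]], of s s] by linarith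
    have "cmod (?I s) \<le> 0"
      using Cauchy_Schwarz[OF rep_in[OF fs U_in[OF x]] y, of s s] by (simp only: h0 mult_zero_left)
    then show ?thesis by simp
  qed
  have meas: "?I \<in> borel_measurable \<mu>"
    using borel_measurable_continuous_onI[OF continuous_integrand[OF f x y]] sets_\<mu>
    by (metis measurable_cong_sets)
  show int: "integrable \<mu> ?I"
    using K meas le zero by (intro integrableI_bounded_set[of ?K]) auto
  have "cmod (\<integral>s. ?I s \<partial>\<mu>) \<le> (\<integral>s. cmod (?I s) \<partial>\<mu>)"
    by (rule integral_norm_bound)
  also have "\<dots> \<le> (\<integral>s. indicator ?K s * (B * hnorm H \<xi> * hnorm H \<eta>) \<partial>\<mu>)"
  proof (rule integral_mono)
    show "integrable \<mu> (\<lambda>s. indicator ?K s * (B * hnorm H \<xi> * hnorm H \<eta>))"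
      using K by (intro integrable_mult_left integrable_real_indicator) auto
    show "cmod (?I s) \<le> indicator ?K s * (B * hnorm H \<xi> * hnorm H \<eta>)" for s
      using le[of s] zero[of s] by (cases "s \<in> ?K") auto
  qed (rule integrable_norm[OF int])
  also have "\<dots> = measure \<mu> ?K * B * hnorm H \<xi> * hnorm H \<eta>"
    using K by (simp add: mult.assoc)
  finally show "cmod (\<integral>s. ?I s \<partial>\<mu>) \<le> measure \<mu> ?K * B * hnorm H \<xi> * hnorm H \<eta>" .
qed

text \<open>Riesz representation supplies the vector, and a vector is determined by its inner
  products, so the description operator in \<open>integrated_form\<close> denotes what it
  should.\<close>

lemma integrated_form_weak:
  assumes f: "f \<in> CcC0" and x: "\<xi> \<in> vecs H"
  shows "integrated_form \<mu> H \<pi> U f \<xi> \<in> vecs H \<and> (\<forall>\<eta>\<in>vecs H.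
    inn H (integrated_form \<mu> H \<pi> U f \<xi>) \<eta> = (\<integral>s. inn H (\<pi> (f s) (U s \<xi>)) \<eta> \<partial>\<mu>))"
proof -
  obtain B where B: "B \<ge> 0" "\<And>s x. cmod (f s x) \<le> B" using CcC0_bounded[OF f] by blast
  note int = integrable_integrand(1)[OF f B(2) x]
  have in': "\<pi> (f s) (U s \<xi>) \<in> vecs H" for s using f x by (intro rep_in U_in) (simp_all add: CcC0_def)
  obtain \<zeta> where \<zeta>: "\<zeta> \<in> vecs H"
      "\<And>\<eta>. \<eta> \<in> vecs H \<Longrightarrow> inn H \<zeta> \<eta> = (\<integral>s. inn H (\<pi> (f s) (U s \<xi>)) \<eta> \<partial>\<mu>)"
  proof (rule Riesz_representation[of "\<lambda>\<eta>. (\<integral>s. inn H (\<pi> (f s) (U s \<xi>)) \<eta> \<partial>\<mu>)"])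
    show "(\<integral>s. inn H (\<pi> (f s) (U s \<xi>)) (vadd H a b) \<partial>\<mu>) =
        (\<integral>s. inn H (\<pi> (f s) (U s \<xi>)) a \<partial>\<mu>) + (\<integral>s. inn H (\<pi> (f s) (U s \<xi>)) b \<partial>\<mu>)"
      if "a \<in> vecs H" "b \<in> vecs H" for a b
      using that int in' by (simp add: inn_add_right)
    show "(\<integral>s. inn H (\<pi> (f s) (U s \<xi>)) (vscale H c a) \<partial>\<mu>) =
        cnj c * (\<integral>s. inn H (\<pi> (f s) (U s \<xi>)) a \<partial>\<mu>)" if "a \<in> vecs H" for a c
      using that int in' by (simp add: inn_scale_right)
  qed (use integrable_integrand(2)[OF f B(2) x] in auto)
  show ?thesis
    unfolding integrated_form_def by (rule theI2[of _ \<zeta>]) (use \<zeta> in \<open>auto intro: inn_ext\<close>)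
qed

lemmas integrated_form_in = integrated_form_weak[THEN conjunct1]
lemmas inn_integrated_form = integrated_form_weak[THEN conjunct2, rule_format]

lemma hnorm_integrated_form_le:
  assumes f: "f \<in> CcC0" and B: "\<And>s x. cmod (f s x) \<le> B" and x: "\<xi> \<in> vecs H"
  shows "hnorm H (integrated_form \<mu> H \<pi> U f \<xi>)
      \<le> measure \<mu> (closure {s. f s \<noteq> (\<lambda>x. 0)}) * B * hnorm H \<xi>"
proof -
  let ?z = "integrated_form \<mu> H \<pi> U f \<xi>" and ?m = "measure \<mu> (closure {s. f s \<noteq> (\<lambda>x. 0)})"
  have z: "?z \<in> vecs H" using f x by (rule integrated_form_in)
  have B0: "B \<ge> 0" using B[of undefined undefined] norm_ge_zero order_trans by blast
  have "cmod (inn H ?z ?z) \<le> ?m * B * hnorm H \<xi> * hnorm H ?z"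
    using inn_integrated_form[OF f x z] integrable_integrand(2)[OF f B x z] by simp
  then have "(hnorm H ?z)\<^sup>2 \<le> ?m * B * hnorm H \<xi> * hnorm H ?z"
    using inn_self[OF z] by (simp add: norm_power hnorm_ge0 z)
  then show ?thesis using hnorm_ge0[OF z] B0 hnorm_ge0[OF x]
    by (cases "hnorm H ?z = 0") (auto simp: power2_eq_square)
qed

lemma integrated_form_diff:
  assumes f: "f \<in> CcC0" and g: "g \<in> CcC0" and x: "\<xi> \<in> vecs H"
  shows "integrated_form \<mu> H \<pi> U (\<lambda>s x. f s x + (-1) * g s x) \<xi> =
    vdiff H (integrated_form \<mu> H \<pi> U f \<xi>) (integrated_form \<mu> H \<pi> U g \<xi>)" (is "?l = ?r")
proof (rule inn_ext)
  have fg: "(\<lambda>s x. f s x + (-1) * g s x) \<in> CcC0" by (rule CcC0_lincomb[OF f g, of "-1"])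
  show "?l \<in> vecs H" by (rule integrated_form_in[OF fg x])
  show "?r \<in> vecs H" using f g x by (intro vdiff_in integrated_form_in)
  fix \<eta> assume y: "\<eta> \<in> vecs H"
  obtain B C where BC: "\<And>s x. cmod (f s x) \<le> B" "\<And>s x. cmod (g s x) \<le> C"
    using CcC0_bounded f g by metis
  have C0: "f s \<in> C0" "g s \<in> C0" for s using f g by (simp_all add: CcC0_def)
  have "inn H ?l \<eta> = (\<integral>s. inn H (\<pi> (f s) (U s \<xi>)) \<eta> - inn H (\<pi> (g s) (U s \<xi>)) \<eta> \<partial>\<mu>)"
    by (simp only: inn_integrated_form[OF fg x y] rep_diff[OF C0 U_in[OF x]]
        inn_diff(1)[OF rep_in[OF C0(1) U_in[OF x]] rep_in[OF C0(2) U_in[OF x]] y])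
  also have "\<dots> = inn H ?r \<eta>"
    by (simp add: inn_diff(1)[OF integrated_form_in[OF f x] integrated_form_in[OF g x] y]
        inn_integrated_form[OF f x y] inn_integrated_form[OF g x y]
        integrable_integrand(1)[OF f BC(1) x y] integrable_integrand(1)[OF g BC(2) x y])
  finally show "inn H ?l \<eta> = inn H ?r \<eta>" .
qed

lemma integrated_form_vscale:
  assumes f: "f \<in> CcC0" and x: "\<xi> \<in> vecs H"
  shows "integrated_form \<mu> H \<pi> U f (vscale H c \<xi>) = vscale H c (integrated_form \<mu> H \<pi> U f \<xi>)"
    (is "?l = ?r")
proof (rule inn_ext)
  show "?l \<in> vecs H" "?r \<in> vecs H" using f x by (auto intro!: vscale_in integrated_form_in)
  fix \<eta> assume y: "\<eta> \<in> vecs H"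
  have C0: "f s \<in> C0" for s using f by (simp_all add: CcC0_def)
  show "inn H ?l \<eta> = inn H ?r \<eta>"
    using f x y by (simp add: inn_integrated_form vscale_in inn_scale integrated_form_in
        U_vscale rep_vscale U_in rep_in C0)
qed

end

section \<open>The universal norm\<close>

context
  fixes act :: "'g::{t2_space, group_add} \<Rightarrow> 'x::topological_space \<Rightarrow> 'x" and \<mu> :: "'g measure"
    and H :: "('g set \<Rightarrow> complex) set hspace" and \<pi> U
  assumes rep: "covariant_rep H act \<pi> U \<mu>"
begin

interpretation covariant_rep H act \<pi> U \<mu> by (rule rep)

text \<open>The measure of the support times the supremum of \<open>f\<close> bounds every
  integrated form, whatever the representation; without such a bound the \<open>Sup\<close> in
  \<open>universal_norm\<close> would carry no information.\<close>

lemma universal_norm_bdd: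
  fixes f :: "'g \<Rightarrow> 'x \<Rightarrow> complex"
  assumes f: "f \<in> CcC0"
  shows "bdd_above {hnorm H (integrated_form \<mu> H \<pi> U f \<xi>) | (H :: ('g set \<Rightarrow> complex) set hspace) \<pi> U \<xi>.
            hilbert_space H \<and> covariant_pair act H \<pi> U \<and> \<xi> \<in> vecs H \<and> hnorm H \<xi> \<le> 1}"
proof -
  obtain B where B: "B \<ge> 0" "\<And>s x. cmod (f s x) \<le> B" using CcC0_bounded[OF f] by blast
  let ?L = "measure \<mu> (closure {s. f s \<noteq> (\<lambda>x. 0)}) * B"
  have "hnorm H' (integrated_form \<mu> H' \<pi>' U' f \<xi>) \<le> ?L"
    if "hilbert_space H'" "covariant_pair act H' \<pi>' U'" "\<xi> \<in> vecs H'" "hnorm H' \<xi> \<le> 1"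
    for H' :: "('g set \<Rightarrow> complex) set hspace" and \<pi>' U' \<xi>
  proof -
    interpret c: covariant_rep H' act \<pi>' U' \<mu>
      using that sets_\<mu> finite_\<mu> by (simp add: covariant_rep_def covariant_rep_axioms_def)
    have "hnorm H' (integrated_form \<mu> H' \<pi>' U' f \<xi>) \<le> ?L * hnorm H' \<xi>"
      using c.hnorm_integrated_form_le[OF f B(2) that(3)] .
    also have "\<dots> \<le> ?L * 1" using that(4) B by (intro mult_left_mono) auto
    finally show ?thesis by simp
  qed
  then show ?thesis by (intro bdd_aboveI[of _ ?L]) blast
qed

text \<open>Rescaling to norm 1 brings a vector into the set under the supremum. Operators therefore
  depend continuously on \<open>f\<close> in the universal norm, as the extension to the completion
  requires.\<close>

lemma hnorm_integrated_form_universal: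
  assumes f: "f \<in> CcC0" and x: "\<xi> \<in> vecs H"
  shows "hnorm H (integrated_form \<mu> H \<pi> U f \<xi>) \<le> universal_norm act \<mu> f * hnorm H \<xi>"
proof (cases "hnorm H \<xi> = 0")
  case True
  obtain B where B: "B \<ge> 0" "\<And>s x. cmod (f s x) \<le> B" using CcC0_bounded[OF f] by blast
  show ?thesis using hnorm_integrated_form_le[OF f B(2) x] True by simp
next
  case False
  then have n: "hnorm H \<xi> > 0" using hnorm_ge0[OF x] by simp
  let ?c = "complex_of_real (1 / hnorm H \<xi>)"
  have y: "vscale H ?c \<xi> \<in> vecs H" using x by (rule vscale_in)
  have "hnorm H (vscale H ?c \<xi>) \<le> 1" using n x by (simp add: hnorm_scale norm_divide)
  then have "hnorm H (integrated_form \<mu> H \<pi> U f (vscale H ?c \<xi>)) \<le> universal_norm act \<mu> f"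
    unfolding universal_norm_def using hilbert_space_axioms cov y
    by (intro cSup_upper universal_norm_bdd f) blast
  then show ?thesis using n x f
    by (simp add: integrated_form_vscale integrated_form_in hnorm_scale norm_divide divide_le_eq)
qed

text \<open>The supremum of zeros is 0 only over a nonempty set, so the given representation serves
  as a witness.\<close>

lemma universal_norm_zero: "universal_norm act \<mu> (\<lambda>s x. 0) = 0"
proof -
  have z: "(\<lambda>s x. 0) \<in> (CcC0 :: ('g \<Rightarrow> 'x \<Rightarrow> complex) set)"
    by (auto simp: CcC0_def C0_def not_le[symmetric] uniform_limit_iff)
  have "hnorm H' (integrated_form \<mu> H' \<pi>' U' (\<lambda>s x. 0) \<xi>) = 0"
    if "hilbert_space H'" "covariant_pair act H' \<pi>' U'" "\<xi> \<in> vecs H'"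
    for H' :: "('g set \<Rightarrow> complex) set hspace" and \<pi>' U' \<xi>
  proof -
    interpret c: covariant_rep H' act \<pi>' U' \<mu>
      using that sets_\<mu> finite_\<mu> by (simp add: covariant_rep_def covariant_rep_axioms_def)
    show ?thesis using c.hnorm_integrated_form_le[OF z, of 0 \<xi>] that(3)
        c.hnorm_ge0[OF c.integrated_form_in[OF z that(3)]] by simp
  qed
  moreover have "hilbert_space H" "covariant_pair act H \<pi> U" "vzero H \<in> vecs H" "hnorm H (vzero H) \<le> 1"
    using hilbert_space_axioms cov vzero_in hnorm_vzero by auto
  ultimately have "{hnorm H (integrated_form \<mu> H \<pi> U (\<lambda>s x. 0) \<xi>) | (H :: ('g set \<Rightarrow> complex) set hspace) \<pi> U \<xi>.
            hilbert_space H \<and> covariant_pair act H \<pi> U \<and> \<xi> \<in> vecs H \<and> hnorm H \<xi> \<le> 1} = {0}"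
    by (intro subset_antisym subsetI) (auto, metis)
  then show ?thesis unfolding universal_norm_def by simp
qed

end

section \<open>Constant sequences as elements of the crossed product\<close>

context
  fixes act :: "'g::{t2_space, ab_group_add} \<Rightarrow> 'x::topological_space \<Rightarrow> 'x" and \<mu> :: "'g measure"
    and H :: "('g set \<Rightarrow> complex) set hspace" and \<pi> U
  assumes rep: "covariant_rep H act \<pi> U \<mu>"
begin

interpretation covariant_rep H act \<pi> U \<mu> by (rule rep)

lemma const_null_rel:
  assumes D: "D \<in> CcC0"
  shows "((\<lambda>n. D), (\<lambda>n. D)) \<in> null_rel (convolution_algebra act \<mu>)"
proof -
  have "vdiff (convolution_algebra act \<mu>) D D = (\<lambda>s x. 0)"
    by (simp add: vdiff_def convolution_algebra_def)
  then have "anorm (convolution_algebra act \<mu>) (vdiff (convolution_algebra act \<mu>) D D) = 0"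
    using universal_norm_zero[OF rep] by (simp add: convolution_algebra_def)
  then show ?thesis using D
    by (simp add: null_rel_def cauchy_sequences_def) (simp add: convolution_algebra_def)
qed

lemma const_in_crossed_product:
  assumes D: "D \<in> CcC0"
  shows "null_rel (convolution_algebra act \<mu>) `` {\<lambda>n. D} \<in> vecs (crossed_product act \<mu>)"
proof -
  have "(\<lambda>n. D) \<in> cauchy_sequences (convolution_algebra act \<mu>)"
    using const_null_rel[OF D] by (simp add: null_rel_def)
  then show ?thesis by (simp add: crossed_product_def completion_def quotientI)
qed

text \<open>Every sequence of the class approaches \<open>D\<close> in the universal norm, which
  dominates the operator norm, so all of them give the same limit; the constant sequence makes that
  limit unique.\<close>

lemma extend_to_completion_const:
  assumes D: "D \<in> CcC0" and x: "\<xi> \<in> vecs H"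
  shows "extend_to_completion H (integrated_form \<mu> H \<pi> U)
    (null_rel (convolution_algebra act \<mu>) `` {\<lambda>n. D}) \<xi> = integrated_form \<mu> H \<pi> U D \<xi>"
  unfolding extend_to_completion_def
proof (rule the_equality)
  let ?A = "convolution_algebra act \<mu>" and ?\<rho> = "integrated_form \<mu> H \<pi> U"
  have "(\<lambda>n. hdist H (?\<rho> (F n) \<xi>) (?\<rho> D \<xi>)) \<longlonglongrightarrow> 0" if "F \<in> null_rel ?A `` {\<lambda>n. D}" for F
  proof -
    have F: "\<And>n. F n \<in> CcC0" "(\<lambda>n. universal_norm act \<mu> (\<lambda>s x. D s x + (-1) * F n s x)) \<longlonglongrightarrow> 0"
      using that by (simp_all add: null_rel_def cauchy_sequences_def convolution_algebra_def vdiff_def)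
    have le: "hdist H (?\<rho> (F n) \<xi>) (?\<rho> D \<xi>) \<le>
        universal_norm act \<mu> (\<lambda>s x. D s x + (-1) * F n s x) * hnorm H \<xi>" for n
    proof -
      have "hdist H (?\<rho> (F n) \<xi>) (?\<rho> D \<xi>) = hnorm H (?\<rho> (\<lambda>s x. D s x + (-1) * F n s x) \<xi>)"
        unfolding integrated_form_diff[OF D F(1) x]
        using hdist_commute[OF integrated_form_in[OF F(1) x] integrated_form_in[OF D x]]
        by (simp add: hdist_def)
      then show ?thesis
        using hnorm_integrated_form_universal[OF rep CcC0_lincomb[OF D F(1), of "-1" n] x] by (simp only:)
    qed
    have lim: "(\<lambda>n. universal_norm act \<mu> (\<lambda>s x. D s x + (-1) * F n s x) * hnorm H \<xi>) \<longlonglongrightarrow> 0"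
      using tendsto_mult_right[OF F(2), of "hnorm H \<xi>"] by (simp only: mult_zero_left)
    have "norm (hdist H (?\<rho> (F n) \<xi>) (?\<rho> D \<xi>)) = hdist H (?\<rho> (F n) \<xi>) (?\<rho> D \<xi>)" for n
      using hdist_ge0[OF integrated_form_in[OF F(1) x] integrated_form_in[OF D x], of n]
      unfolding real_norm_def by (rule abs_of_nonneg)
    then show ?thesis
      by (intro Lim_null_comparison[OF _ lim] always_eventually allI) (simp only: le)
  qed
  then show *: "?\<rho> D \<xi> \<in> vecs H \<and>
      (\<forall>F\<in>null_rel ?A `` {\<lambda>n. D}. (\<lambda>n. hdist H (?\<rho> (F n) \<xi>) (?\<rho> D \<xi>)) \<longlonglongrightarrow> 0)"
    using integrated_form_in[OF D x] by blast
  show "\<eta> = ?\<rho> D \<xi>" if "\<eta> \<in> vecs H \<and>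
      (\<forall>F\<in>null_rel ?A `` {\<lambda>n. D}. (\<lambda>n. hdist H (?\<rho> (F n) \<xi>) \<eta>) \<longlonglongrightarrow> 0)" for \<eta>
    using that * const_null_rel[OF D] integrated_form_in[OF D x]
    by (intro hdist_limit_unique[of "\<lambda>n. ?\<rho> D \<xi>"]) auto
qed

end

section \<open>The Hilbert space of square integrable functions\<close>

lemma L2_functions_iff:
  "f \<in> L2_functions m \<longleftrightarrow> f \<in> borel_measurable m \<and> (\<integral>\<^sup>+x. ennreal ((cmod (f x))\<^sup>2) \<partial>m) < \<infinity>"
proof -
  have "integrable m (\<lambda>x. (cmod (f x))\<^sup>2) \<longleftrightarrow> (\<integral>\<^sup>+x. ennreal ((cmod (f x))\<^sup>2) \<partial>m) < \<infinity>"
    if [measurable]: "f \<in> borel_measurable m"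
    using that by (simp add: integrable_iff_bounded)
  then show ?thesis by (auto simp: L2_functions_def)
qed

lemma L2_measurable [measurable_dest]: "f \<in> L2_functions m \<Longrightarrow> f \<in> borel_measurable m"
  by (simp add: L2_functions_def)

lemma L2_integrable_square: "f \<in> L2_functions m \<Longrightarrow> integrable m (\<lambda>x. (cmod (f x))\<^sup>2)"
  by (simp add: L2_functions_def)

lemma L2_nn_integral:
  "f \<in> L2_functions m \<Longrightarrow> (\<integral>\<^sup>+x. ennreal ((cmod (f x))\<^sup>2) \<partial>m) = ennreal (\<integral>x. (cmod (f x))\<^sup>2 \<partial>m)"
  by (intro nn_integral_eq_integral L2_integrable_square) auto

lemma cmod_add_square_le: "(cmod (a + b))\<^sup>2 \<le> 2 * (cmod a)\<^sup>2 + 2 * (cmod b)\<^sup>2"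
proof -
  have "(cmod (a + b))\<^sup>2 \<le> (cmod a + cmod b)\<^sup>2" by (intro power_mono norm_triangle_ineq) auto
  also have "\<dots> \<le> 2 * (cmod a)\<^sup>2 + 2 * (cmod b)\<^sup>2"
    using zero_le_power2[of "cmod a - cmod b"] unfolding power2_sum power2_diff by linarith
  finally show ?thesis .
qed

lemma L2_bound:
  assumes f: "f \<in> borel_measurable m" and g: "integrable m g" and le: "\<And>x. (cmod (f x))\<^sup>2 \<le> g x"
  shows "f \<in> L2_functions m"
proof -
  have "integrable m (\<lambda>x. (cmod (f x))\<^sup>2)"
    by (rule Bochner_Integration.integrable_bound[OF g])
       (use f le in \<open>auto intro!: AE_I2 order_trans[OF le abs_ge_self]\<close>)
  then show ?thesis using f by (simp add: L2_functions_def)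
qed

lemma L2_add:
  assumes f: "f \<in> L2_functions m" and g: "g \<in> L2_functions m"
  shows "(\<lambda>x. f x + g x) \<in> L2_functions m"
proof (rule L2_bound)
  show "integrable m (\<lambda>x. 2 * (cmod (f x))\<^sup>2 + 2 * (cmod (g x))\<^sup>2)"
    using f g by (intro Bochner_Integration.integrable_add integrable_mult_right L2_integrable_square)
qed (use f g in \<open>auto intro: cmod_add_square_le L2_measurable\<close>)

lemma L2_scale:
  assumes f: "f \<in> L2_functions m"
  shows "(\<lambda>x. c * f x) \<in> L2_functions m"
proof (rule L2_bound)
  show "integrable m (\<lambda>x. (cmod c)\<^sup>2 * (cmod (f x))\<^sup>2)"
    using f by (intro integrable_mult_right L2_integrable_square)
qed (use f in \<open>auto simp: norm_mult power_mult_distrib intro: L2_measurable\<close>)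

lemma L2_diff:
  assumes f: "f \<in> L2_functions m" and g: "g \<in> L2_functions m"
  shows "(\<lambda>x. f x - g x) \<in> L2_functions m"
  using L2_add[OF f L2_scale[OF g, of "-1"]] by simp

lemma L2_zero: "(\<lambda>x. 0) \<in> L2_functions m"
  by (simp add: L2_functions_def)

lemma L2_mult_integrable:
  assumes f: "f \<in> L2_functions m" and g: "g \<in> L2_functions m"
  shows "integrable m (\<lambda>x. f x * cnj (g x))"
proof (rule Bochner_Integration.integrable_bound)
  show "integrable m (\<lambda>x. (cmod (f x))\<^sup>2 + (cmod (g x))\<^sup>2)"
    using f g by (intro Bochner_Integration.integrable_add L2_integrable_square)
  have "norm (f x * cnj (g x)) \<le> norm ((cmod (f x))\<^sup>2 + (cmod (g x))\<^sup>2)" for x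
  proof -
    have "0 \<le> (cmod (f x) - cmod (g x))\<^sup>2" "0 \<le> cmod (f x) * cmod (g x)" by simp_all
    then have "cmod (f x) * cmod (g x) \<le> (cmod (f x))\<^sup>2 + (cmod (g x))\<^sup>2"
      unfolding power2_diff by linarith
    then show ?thesis by (simp add: norm_mult)
  qed
  then show "AE x in m. norm (f x * cnj (g x)) \<le> norm ((cmod (f x))\<^sup>2 + (cmod (g x))\<^sup>2)" by simp
  note [measurable] = L2_measurable[OF f] L2_measurable[OF g]
  have "cnj \<in> borel_measurable borel" by (intro borel_measurable_continuous_onI continuous_intros)
  then show "(\<lambda>x. f x * cnj (g x)) \<in> borel_measurable m" by measurable
qed

text \<open>Along a subsequence with \<open>\<parallel>f\<^sub>r\<^sub>(\<^sub>k\<^sub>+\<^sub>1\<^sub>) - f\<^sub>r\<^sub>(\<^sub>k\<^sub>)\<parallel>\<^sup>2 < 8\<^sup>-\<^sup>k\<close> the weighted sum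
  \<open>\<Sum> 4\<^sup>k \<bar>f\<^sub>r\<^sub>(\<^sub>k\<^sub>+\<^sub>1\<^sub>) - f\<^sub>r\<^sub>(\<^sub>k\<^sub>)\<bar>\<^sup>2\<close> is integrable, hence the subsequence converges almost everywhere.\<close>

lemma Riesz_Fischer:
  assumes f: "\<And>n. f n \<in> L2_functions m"
    and cauchy: "\<And>e. e > 0 \<Longrightarrow> \<exists>N. \<forall>i\<ge>N. \<forall>j\<ge>N. (\<integral>x. (cmod (f i x - f j x))\<^sup>2 \<partial>m) < e"
  obtains g where "g \<in> L2_functions m" "(\<lambda>n. \<integral>x. (cmod (f n x - g x))\<^sup>2 \<partial>m) \<longlonglongrightarrow> 0"
proof -
  note [measurable] = L2_measurable[OF f]
  define d where "d = (\<lambda>i j. \<integral>\<^sup>+x. ennreal ((cmod (f i x - f j x))\<^sup>2) \<partial>m)"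
  have d: "d i j = ennreal (\<integral>x. (cmod (f i x - f j x))\<^sup>2 \<partial>m)" for i j
    unfolding d_def by (intro L2_nn_integral L2_diff f)
  have "\<exists>N. \<forall>i\<ge>N. \<forall>j\<ge>N. d i j \<le> ennreal ((1/8) ^ k)" for k
  proof -
    have "(0::real) < (1/8) ^ k" by simp
    from cauchy[OF this] show ?thesis unfolding d by (auto intro!: ennreal_leI less_imp_le)
  qed
  then obtain N where N: "\<And>k i j. i \<ge> N k \<Longrightarrow> j \<ge> N k \<Longrightarrow> d i j \<le> ennreal ((1/8) ^ k)" by metis
  \<comment> \<open>Partial sums make \<open>r\<close> monotone while keeping \<open>r k\<close> at
    least \<open>N k\<close>.\<close>
  define r where "r = (\<lambda>k. \<Sum>i\<le>k. N i)"
  have rN: "N k \<le> r k" "r k \<le> r (Suc k)" for k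
    unfolding r_def by (auto intro: member_le_sum)
  have dr: "d (r (Suc k)) (r k) \<le> ennreal ((1/8) ^ k)" for k
    using rN[of k] by (intro N) auto
  \<comment> \<open>The weight 4^k leaves integrals of at most 2^-k, which are summable, and
    boundedness of \<open>w k x\<close> in \<open>k\<close> still yields increments of order
    2^-k.\<close>
  define w where "w = (\<lambda>k x. 4 ^ k * (cmod (f (r (Suc k)) x - f (r k) x))\<^sup>2)"
  have [measurable]: "w k \<in> borel_measurable m" for k unfolding w_def by measurable
  have wpos: "0 \<le> w k x" for k x by (simp add: w_def)
  have int_w: "(\<integral>\<^sup>+x. ennreal (w k x) \<partial>m) \<le> ennreal ((1/2) ^ k)" for k
  proof -
    have "(\<integral>\<^sup>+x. ennreal (w k x) \<partial>m) = ennreal (4 ^ k) * d (r (Suc k)) (r k)"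
      unfolding d_def w_def by (simp add: ennreal_mult nn_integral_cmult)
    also have "\<dots> \<le> ennreal (4 ^ k) * ennreal ((1/8) ^ k)" by (intro mult_left_mono dr) auto
    also have "\<dots> = ennreal ((1/2) ^ k)"
      by (simp flip: ennreal_mult power_mult_distrib)
    finally show ?thesis .
  qed
  have "(\<integral>\<^sup>+x. (\<Sum>k. ennreal (w k x)) \<partial>m) = (\<Sum>k. \<integral>\<^sup>+x. ennreal (w k x) \<partial>m)"
    by (intro nn_integral_suminf) measurable
  also have "\<dots> \<le> (\<Sum>k. ennreal ((1/2) ^ k))" by (intro suminf_le int_w) auto
  also have "\<dots> = ennreal (\<Sum>k. (1/2) ^ k)"
    by (intro suminf_ennreal2) (auto intro: summable_geometric)
  also have "\<dots> < \<infinity>" by simp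
  finally have "AE x in m. (\<Sum>k. ennreal (w k x)) \<noteq> \<infinity>"
    by (intro nn_integral_noteq_infinite) auto
  then have conv: "AE x in m. convergent (\<lambda>k. f (r k) x)"
  proof eventually_elim
    case (elim x)
    have "summable (\<lambda>k. w k x)"
      using elim wpos by (intro summable_suminf_not_top) auto
    then have "(\<lambda>k. w k x) \<longlonglongrightarrow> 0" by (rule summable_LIMSEQ_zero)
    then have "Bseq (\<lambda>k. w k x)" using convergent_imp_Bseq convergentI by blast
    then obtain C where C: "C > 0" "\<And>k. norm (w k x) \<le> C" by (auto elim: BseqE)
    have le: "norm (f (r (Suc k)) x - f (r k) x) \<le> sqrt C * (1/2) ^ k" for k
    proof (rule power2_le_imp_le)
      have "4 ^ k * (cmod (f (r (Suc k)) x - f (r k) x))\<^sup>2 \<le> C" using C(2)[of k] by (simp add: w_def)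
      then have "(cmod (f (r (Suc k)) x - f (r k) x))\<^sup>2 \<le> C / 4 ^ k" by (simp add: field_simps)
      also have "\<dots> = (sqrt C * (1/2) ^ k)\<^sup>2" using C(1)
        by (simp add: power_mult_distrib power_divide power_mult[symmetric] mult.commute[of k]) (simp add: power_mult)
      finally show "(cmod (f (r (Suc k)) x - f (r k) x))\<^sup>2 \<le> (sqrt C * (1/2) ^ k)\<^sup>2" .
    qed (use C in simp)
    have "summable (\<lambda>k. f (r (Suc k)) x - f (r k) x)"
      using le by (rule summable_comparison_test'[rotated]) (intro summable_mult summable_geometric, simp)
    then have "convergent (\<lambda>n. f (r n) x - f (r 0) x)"
      unfolding summable_iff_convergent sum_lessThan_telescope[of "\<lambda>k. f (r k) x"] .
    from convergent_add[OF this convergent_const[of "f (r 0) x"]] show ?case by simp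
  qed
  define g where "g = (\<lambda>x. lim (\<lambda>k. f (r k) x))"
  have [measurable]: "g \<in> borel_measurable m" unfolding g_def by measurable
  have limg: "AE x in m. (\<lambda>k. f (r k) x) \<longlonglongrightarrow> g x"
    using conv unfolding g_def by eventually_elim (simp add: convergent_LIMSEQ_iff)
  have r_ge: "k \<le> i \<Longrightarrow> r k \<le> r i" for k i using rN(2) lift_Suc_mono_le by blast
  \<comment> \<open>Fatou's lemma along the subsequence bounds the distance of \<open>g\<close> from
    every \<open>f n\<close> with n >= N k, so the whole sequence converges and not merely the
    subsequence.\<close>
  have fatou: "(\<integral>\<^sup>+x. ennreal ((cmod (f n x - g x))\<^sup>2) \<partial>m) \<le> ennreal ((1/8) ^ k)" if n: "n \<ge> N k" for n k
  proof -
    have "(\<integral>\<^sup>+x. ennreal ((cmod (f n x - g x))\<^sup>2) \<partial>m) =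
        (\<integral>\<^sup>+x. liminf (\<lambda>i. ennreal ((cmod (f n x - f (r i) x))\<^sup>2)) \<partial>m)"
    proof (intro nn_integral_cong_AE, use limg in eventually_elim)
      case (elim x)
      then have "(\<lambda>i. ennreal ((cmod (f n x - f (r i) x))\<^sup>2)) \<longlonglongrightarrow> ennreal ((cmod (f n x - g x))\<^sup>2)"
        by (intro tendsto_intros)
      then show ?case by (intro lim_imp_Liminf[symmetric]) auto
    qed
    also have "\<dots> \<le> liminf (\<lambda>i. d n (r i))"
      unfolding d_def by (intro nn_integral_liminf) measurable
    also have "\<dots> \<le> ennreal ((1/8) ^ k)"
    proof -
      have "\<forall>\<^sub>F i in sequentially. d n (r i) \<le> ennreal ((1/8) ^ k)"
        using eventually_ge_at_top[of k]
        by eventually_elim (intro N n order_trans[OF rN(1) r_ge])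
      then show ?thesis by (intro Liminf_le) auto
    qed
    finally show ?thesis .
  qed
  have diff: "(\<lambda>x. f (N 0) x - g x) \<in> L2_functions m"
    unfolding L2_functions_iff using fatou[of 0 "N 0"] by (auto intro: le_less_trans)
  have g: "g \<in> L2_functions m" using L2_diff[OF f[of "N 0"] diff] by simp
  have "(\<lambda>n. \<integral>x. (cmod (f n x - g x))\<^sup>2 \<partial>m) \<longlonglongrightarrow> 0"
  proof (rule LIMSEQ_I)
    fix e :: real assume "e > 0"
    then obtain k where k: "(1/8::real) ^ k < e" using real_arch_pow_inv[of e "1/8"] by auto
    have "norm ((\<integral>x. (cmod (f n x - g x))\<^sup>2 \<partial>m) - 0) < e" if "n \<ge> N k" for n
    proof -
      have "ennreal (\<integral>x. (cmod (f n x - g x))\<^sup>2 \<partial>m) \<le> ennreal ((1/8) ^ k)"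
        using fatou[OF that] L2_nn_integral[OF L2_diff[OF f g]] by simp
      then show ?thesis using k by simp
    qed
    then show "\<exists>no. \<forall>n\<ge>no. norm ((\<integral>x. (cmod (f n x - g x))\<^sup>2 \<partial>m) - 0) < e" by blast
  qed
  then show ?thesis using that g by blast
qed

section \<open>Classes of functions modulo equality almost everywhere\<close>

lemma equiv_L2_rel: "equiv (L2_functions m) (L2_rel m)"
  by (intro equivI refl_onI symI transI) (auto simp: L2_rel_def)

lemma L2_class_self: "f \<in> L2_functions m \<Longrightarrow> f \<in> L2_class m f"
  by (simp add: L2_class_def L2_rel_def)

lemma L2_class_eq_iff:
  "f \<in> L2_functions m \<Longrightarrow> g \<in> L2_functions m \<Longrightarrow> L2_class m f = L2_class m g \<longleftrightarrow> (AE x in m. f x = g x)"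
  unfolding L2_class_def by (subst eq_equiv_class_iff[OF equiv_L2_rel]) (auto simp: L2_rel_def)

lemma L2_classD: "g \<in> L2_class m f \<Longrightarrow> g \<in> L2_functions m \<and> (AE x in m. f x = g x)"
  by (simp add: L2_class_def L2_rel_def)

lemma L2_vecs: "vecs (L2 m) = L2_class m ` L2_functions m"
  by (auto simp: L2_def quotient_def L2_class_def)

text \<open>The operations of \<open>L2\<close> are unions over all representatives; such a union is
  a single class once that class does not depend on the representative.\<close>

lemma L2_UN:
  assumes f: "f \<in> L2_functions m"
    and F: "\<And>g. g \<in> L2_functions m \<Longrightarrow> AE x in m. f x = g x \<Longrightarrow> L2_class m (F g) = L2_class m (F f)"
  shows "(\<Union>g\<in>L2_class m f. L2_class m (F g)) = L2_class m (F f)"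
proof -
  have "L2_class m (F g) = L2_class m (F f)" if "g \<in> L2_class m f" for g
    using F L2_classD[OF that] by blast
  then show ?thesis using L2_class_self[OF f] by blast
qed

lemma L2_vscale:
  assumes f: "f \<in> L2_functions m"
  shows "vscale (L2 m) c (L2_class m f) = L2_class m (\<lambda>x. c * f x)"
proof -
  have "(\<Union>g\<in>L2_class m f. L2_class m (\<lambda>x. c * g x)) = L2_class m (\<lambda>x. c * f x)"
  proof (rule L2_UN[OF f])
    fix g assume g: "g \<in> L2_functions m" "AE x in m. f x = g x"
    from g(2) have "AE x in m. c * g x = c * f x" by eventually_elim simp
    then show "L2_class m (\<lambda>x. c * g x) = L2_class m (\<lambda>x. c * f x)"
      by (subst L2_class_eq_iff) (simp_all only: f g L2_scale)
  qed
  then show ?thesis by (simp add: L2_def)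
qed

lemma L2_vadd:
  assumes f: "f \<in> L2_functions m" and g: "g \<in> L2_functions m"
  shows "vadd (L2 m) (L2_class m f) (L2_class m g) = L2_class m (\<lambda>x. f x + g x)"
proof -
  have 1: "(\<Union>g'\<in>L2_class m g. L2_class m (\<lambda>x. f' x + g' x)) = L2_class m (\<lambda>x. f' x + g x)"
    if "f' \<in> L2_functions m" for f'
    by (rule L2_UN[OF g]) (auto simp: L2_class_eq_iff g that L2_add elim: eventually_mono)
  have "(\<Union>f'\<in>L2_class m f. \<Union>g'\<in>L2_class m g. L2_class m (\<lambda>x. f' x + g' x)) =
      (\<Union>f'\<in>L2_class m f. L2_class m (\<lambda>x. f' x + g x))"
    using 1 L2_classD by (intro SUP_cong) auto
  also have "\<dots> = L2_class m (\<lambda>x. f x + g x)"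
    by (rule L2_UN[OF f]) (auto simp: L2_class_eq_iff f g L2_add elim: eventually_mono)
  finally show ?thesis by (simp add: L2_def)
qed

lemma L2_inn:
  assumes f: "f \<in> L2_functions m" and g: "g \<in> L2_functions m"
  shows "inn (L2 m) (L2_class m f) (L2_class m g) = (\<integral>x. f x * cnj (g x) \<partial>m)"
proof -
  define f' where "f' = (SOME h. h \<in> L2_class m f)"
  define g' where "g' = (SOME h. h \<in> L2_class m g)"
  have f': "f' \<in> L2_functions m" "AE x in m. f x = f' x"
    using L2_classD someI[of "\<lambda>h. h \<in> L2_class m f", OF L2_class_self[OF f]] unfolding f'_def by blast+
  have g': "g' \<in> L2_functions m" "AE x in m. g x = g' x"
    using L2_classD someI[of "\<lambda>h. h \<in> L2_class m g", OF L2_class_self[OF g]] unfolding g'_def by blast+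
  have "(\<integral>x. f' x * cnj (g' x) \<partial>m) = (\<integral>x. f x * cnj (g x) \<partial>m)"
  proof (rule integral_cong_AE)
    show "AE x in m. f' x * cnj (g' x) = f x * cnj (g x)"
      using f'(2) g'(2) by eventually_elim simp
  qed (use f g f' g' in \<open>auto intro!: borel_measurable_times borel_measurable_integrable[OF L2_mult_integrable]\<close>)
  then show ?thesis by (simp add: L2_def f'_def g'_def)
qed

lemma L2_vdiff:
  assumes f: "f \<in> L2_functions m" and g: "g \<in> L2_functions m"
  shows "vdiff (L2 m) (L2_class m f) (L2_class m g) = L2_class m (\<lambda>x. f x - g x)"
  unfolding vdiff_def using f g by (simp add: L2_vscale L2_vadd[OF f L2_scale[OF g, of "-1", simplified]])

lemma L2_vzero: "vzero (L2 m) = L2_class m (\<lambda>x. 0)"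
  by (simp add: L2_def)

lemma L2_hnorm:
  assumes f: "f \<in> L2_functions m"
  shows "hnorm (L2 m) (L2_class m f) = sqrt (\<integral>x. (cmod (f x))\<^sup>2 \<partial>m)"
proof -
  have "(\<integral>x. f x * cnj (f x) \<partial>m) = (\<integral>x. complex_of_real ((cmod (f x))\<^sup>2) \<partial>m)"
    by (simp only: complex_norm_square)
  also have "\<dots> = complex_of_real (\<integral>x. (cmod (f x))\<^sup>2 \<partial>m)" by (rule integral_complex_of_real)
  finally show ?thesis unfolding hnorm_def L2_inn[OF f f] by simp
qed

lemma L2_hdist:
  assumes f: "f \<in> L2_functions m" and g: "g \<in> L2_functions m"
  shows "hdist (L2 m) (L2_class m f) (L2_class m g) = sqrt (\<integral>x. (cmod (f x - g x))\<^sup>2 \<partial>m)"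
  unfolding hdist_def L2_vdiff[OF f g] by (rule L2_hnorm[OF L2_diff[OF f g]])

lemma complex_vector_space_L2: "complex_vector_space (L2 m)"
  by unfold_locales
     (auto simp: L2_vecs L2_vzero L2_vadd L2_vscale L2_vdiff L2_zero L2_add L2_scale algebra_simps)

lemma hilbert_space_L2: "hilbert_space (L2 m)"
proof -
  interpret complex_vector_space "L2 m" by (rule complex_vector_space_L2)
  show ?thesis
  proof
    fix \<xi> \<eta> \<zeta> c
    show "inn (L2 m) (vadd (L2 m) \<xi> \<eta>) \<zeta> = inn (L2 m) \<xi> \<zeta> + inn (L2 m) \<eta> \<zeta>"
      if "\<xi> \<in> vecs (L2 m)" "\<eta> \<in> vecs (L2 m)" "\<zeta> \<in> vecs (L2 m)"
      using that by (auto simp: L2_vecs L2_vadd L2_inn L2_add distrib_right L2_mult_integrable)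
    show "inn (L2 m) (vscale (L2 m) c \<xi>) \<eta> = c * inn (L2 m) \<xi> \<eta>"
      if "\<xi> \<in> vecs (L2 m)" "\<eta> \<in> vecs (L2 m)"
      using that by (auto simp: L2_vecs L2_vscale L2_inn L2_scale mult.assoc)
    show "inn (L2 m) \<eta> \<xi> = cnj (inn (L2 m) \<xi> \<eta>)" if "\<xi> \<in> vecs (L2 m)" "\<eta> \<in> vecs (L2 m)"
      using that by (auto simp: L2_vecs L2_inn mult.commute simp flip: Bochner_Integration.integral_cnj)
    show "0 \<le> Re (inn (L2 m) \<xi> \<xi>)" if "\<xi> \<in> vecs (L2 m)"
      using that by (auto simp: L2_vecs L2_inn complex_norm_square[symmetric] simp del: of_real_power)
    show "\<xi> = vzero (L2 m)" if a: "\<xi> \<in> vecs (L2 m)" "inn (L2 m) \<xi> \<xi> = 0"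
    proof -
      obtain f where f: "f \<in> L2_functions m" "\<xi> = L2_class m f" using a(1) by (auto simp: L2_vecs)
      have "(\<integral>x. (cmod (f x))\<^sup>2 \<partial>m) = 0"
        using a(2) f by (simp add: L2_inn complex_norm_square[symmetric] del: of_real_power)
      then have "AE x in m. (cmod (f x))\<^sup>2 = 0"
        using integral_nonneg_eq_0_iff_AE[OF L2_integrable_square[OF f(1)]] by simp
      then show ?thesis using f by (simp add: L2_vzero L2_class_eq_iff L2_zero)
    qed
  next
    fix F :: "nat \<Rightarrow> _" assume F: "\<And>n. F n \<in> vecs (L2 m)"
      and cauchy: "\<And>e. e > 0 \<Longrightarrow> \<exists>N. \<forall>i\<ge>N. \<forall>j\<ge>N. hdist (L2 m) (F i) (F j) < e"
    have "\<forall>n. \<exists>h. h \<in> L2_functions m \<and> F n = L2_class m h"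
      using F by (auto simp: L2_vecs)
    from choice[OF this]
    obtain f where f: "\<And>n. f n \<in> L2_functions m" "\<And>n. F n = L2_class m (f n)" by auto
    obtain g where g: "g \<in> L2_functions m" "(\<lambda>n. \<integral>x. (cmod (f n x - g x))\<^sup>2 \<partial>m) \<longlonglongrightarrow> 0"
    proof (rule Riesz_Fischer[OF f(1)])
      fix e :: real assume "e > 0"
      then obtain N where "\<forall>i\<ge>N. \<forall>j\<ge>N. hdist (L2 m) (F i) (F j) < sqrt e"
        using cauchy[of "sqrt e"] by auto
      then show "\<exists>N. \<forall>i\<ge>N. \<forall>j\<ge>N. (\<integral>x. (cmod (f i x - f j x))\<^sup>2 \<partial>m) < e"
        unfolding f(2) L2_hdist[OF f(1) f(1)] real_sqrt_less_iff by blast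
    qed
    have "(\<lambda>n. hdist (L2 m) (F n) (L2_class m g)) \<longlonglongrightarrow> sqrt 0"
      unfolding f(2) L2_hdist[OF f(1) g(1)] by (intro tendsto_real_sqrt g)
    then show "\<exists>\<xi>\<in>vecs (L2 m). (\<lambda>n. hdist (L2 m) (F n) \<xi>) \<longlonglongrightarrow> 0"
      using g(1) by (auto simp: L2_vecs)
  qed
qed

section \<open>Compactly supported functions on locally compact spaces\<close>

lemma sets_borel_of_topology: "sets (borel_of_topology T) = sigma_sets (topspace T) {U. openin T U}"
  unfolding borel_of_topology_def by (rule sets_measure_of) (auto dest: openin_subset)

lemma space_borel_of_topology: "space (borel_of_topology T) = topspace T"
  unfolding borel_of_topology_def by (rule space_measure_of) (auto dest: openin_subset)

lemma openin_in_borel: "openin T U \<Longrightarrow> U \<in> sets (borel_of_topology T)"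
  unfolding sets_borel_of_topology by (rule sigma_sets.Basic) simp

lemma closedin_in_borel:
  assumes C: "closedin T C"
  shows "C \<in> sets (borel_of_topology T)"
proof -
  have "topspace T - C \<in> sets (borel_of_topology T)" using C by (intro openin_in_borel) blast
  from sets.compl_sets[OF this] have "topspace T - (topspace T - C) \<in> sets (borel_of_topology T)"
    by (simp only: space_borel_of_topology)
  then show ?thesis using closedin_subset[OF C] by (simp only: double_diff[OF _ order_refl])
qed

lemma sets_borel_of_topology_euclidean:
  "sets (borel_of_topology (euclidean :: 'a::topological_space topology)) = sets borel"
  by (simp add: sets_borel_of_topology borel_def flip: open_openin)

lemma continuous_map_measurable_borel:
  assumes "continuous_map T euclidean f"
  shows "f \<in> borel_measurable (borel_of_topology T)"
proof (rule borel_measurableI)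
  fix S :: "'b set" assume "open S"
  then have "openin T {x \<in> topspace T. f x \<in> S}"
    using assms by (simp add: continuous_map_def)
  moreover have "{x \<in> topspace T. f x \<in> S} = f -` S \<inter> space (borel_of_topology T)"
    by (auto simp: space_borel_of_topology)
  ultimately show "f -` S \<inter> space (borel_of_topology T) \<in> sets (borel_of_topology T)"
    using openin_in_borel by metis
qed

text \<open>The locale speaks of a \<open>topology\<close> value because it is applied both to the
  types of \<open>G\<close> and \<open>X\<close> and to the set of cosets, which is not a type of
  its own.\<close>

locale lch =
  fixes T :: "'a topology"
  assumes loc_compact: "locally_compact_space T"
    and hausdorff: "Hausdorff_space T"
    and second_countable: "second_countable T"
begin

lemma normal_space: "normal_space T"
proof (rule regular_Lindelof_imp_normal_space)
  show "regular_space T"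
    using loc_compact hausdorff by (rule locally_compact_Hausdorff_imp_regular_space)
  show "Lindelof_space T"
    using second_countable by (rule second_countable_imp_Lindelof_space)
qed

lemma compactin_in_borel: "compactin T K \<Longrightarrow> K \<in> sets (borel_of_topology T)"
  by (rule closedin_in_borel[OF compactin_imp_closedin[OF hausdorff]])

text \<open>Letting the function vanish off \<open>W\<close>, which lies in a compact subset
  \<open>L\<close> of \<open>U\<close>, makes the support compact; \<open>W\<close> and
  \<open>L\<close> exist because \<open>U\<close> is itself locally compact.\<close>

lemma Urysohn_compact:
  assumes K: "compactin T K" and U: "openin T U" and KU: "K \<subseteq> U"
  obtains f K' where "continuous_map T euclideanreal f" "\<And>x. 0 \<le> f x" "\<And>x. f x \<le> 1"
    "\<And>x. x \<in> K \<Longrightarrow> f x = 1" "compactin T K'" "K' \<subseteq> U" "\<And>x. x \<in> topspace T - K' \<Longrightarrow> f x = 0"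
proof -
  have lcU: "locally_compact_space (subtopology T U)"
    using loc_compact hausdorff U by (simp add: locally_compact_space_open_subset)
  have "Hausdorff_space (subtopology T U)" using hausdorff by (rule Hausdorff_space_subtopology)
  moreover have "compactin (subtopology T U) K" using K KU by (simp add: compactin_subtopology)
  ultimately obtain W L where W: "openin (subtopology T U) W" "compactin (subtopology T U) L"
      "K \<subseteq> W" "W \<subseteq> L"
    using lcU locally_compact_space_compact_closed_compact[of "subtopology T U"] by blast
  have W': "openin T W" using W(1) U by (simp add: openin_open_subtopology)
  have L: "compactin T L" "L \<subseteq> U" using W(2) by (simp_all add: compactin_subtopology)
  have "closedin T (topspace T - W)" using W' by blast
  moreover have "closedin T K" using K hausdorff compactin_imp_closedin by blast
  ultimately obtain f where f: "continuous_map T euclideanreal f"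
      "f ` (topspace T - W) \<subseteq> {0}" "f ` K \<subseteq> {1}"
    using Urysohn_lemma_alt[OF normal_space, of "topspace T - W" K 0 1] W(3)
    by (metis Diff_disjoint disjnt_def disjnt_subset2 inf_commute)
  let ?f = "\<lambda>x. max 0 (min 1 (f x))"
  have "continuous_map T euclideanreal ?f"
    using f(1) by (intro continuous_map_real_max continuous_map_real_min) auto
  moreover have "?f x = 1" if "x \<in> K" for x using f(3) that by (auto simp: image_subset_iff)
  moreover have "?f x = 0" if "x \<in> topspace T - L" for x
  proof -
    have "f x = 0" using f(2) that W(4) by (auto simp: image_subset_iff)
    then show ?thesis by simp
  qed
  ultimately show ?thesis using that[of ?f L] L by auto
qed

text \<open>Each point of \<open>U\<close> has an open neighbourhood with a compact hull in
  \<open>U\<close>; the Lindelof property leaves countably many, and finite unions of the hulls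
  increase to \<open>U\<close>.\<close>

lemma open_exhaustion:
  assumes U: "openin T U"
  obtains K :: "nat \<Rightarrow> 'a set" where "\<And>n. compactin T (K n)" "incseq K" "(\<Union>n. K n) = U"
proof -
  let ?S = "subtopology T U"
  have U': "topspace ?S = U" using U openin_subset by fastforce
  have "locally_compact_space ?S"
    using loc_compact hausdorff U by (simp add: locally_compact_space_open_subset)
  then have "\<forall>x\<in>U. \<exists>W L. openin ?S W \<and> compactin ?S L \<and> x \<in> W \<and> W \<subseteq> L"
    unfolding locally_compact_space_def U' by blast
  then obtain W L where WL: "\<And>x. x \<in> U \<Longrightarrow> openin ?S (W x) \<and> compactin ?S (L x) \<and> x \<in> W x \<and> W x \<subseteq> L x"
    by metis
  have "Lindelof_space ?S"
    using second_countable second_countable_subtopology second_countable_imp_Lindelof_space by blast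
  moreover have "\<And>V. V \<in> W ` U \<Longrightarrow> openin ?S V" using WL by blast
  moreover have "\<Union>(W ` U) = topspace ?S"
  proof
    show "\<Union>(W ` U) \<subseteq> topspace ?S" using WL openin_subset by blast
    show "topspace ?S \<subseteq> \<Union>(W ` U)" unfolding U' using WL by blast
  qed
  ultimately have "\<exists>D. countable D \<and> D \<subseteq> W ` U \<and> \<Union>D = topspace ?S"
    by (rule Lindelof_spaceD)
  then obtain D where D: "countable D" "D \<subseteq> W ` U" "\<Union>D = U" unfolding U' by blast
  have "\<exists>C. countable C \<and> C \<subseteq> U \<and> D = W ` C"
    using D(1,2) by (metis countable_image_inj_eq subset_image_inj)
  then obtain C where C: "countable C" "C \<subseteq> U" "D = W ` C" by blast
  show ?thesis
  proof (cases "C = {}")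
    case True
    then have "U = {}" using D C by simp
    then show ?thesis using that[of "\<lambda>n. {}"] by (simp add: incseq_def)
  next
    case False
    define K where "K = (\<lambda>n. \<Union>i\<le>n. L (from_nat_into C i))"
    have in': "from_nat_into C i \<in> C" for i using False by (rule from_nat_into)
    have "compactin T (K n)" for n
      unfolding K_def using in' WL C(2) by (intro compactin_Union) (auto simp: compactin_subtopology)
    moreover have "incseq K" unfolding K_def incseq_def by (intro allI impI UN_mono) auto
    moreover have "(\<Union>n. K n) = U"
    proof
      show "(\<Union>n. K n) \<subseteq> U" unfolding K_def
        using in' WL C(2) by (auto simp: compactin_subtopology)
      show "U \<subseteq> (\<Union>n. K n)"
      proof
        fix x assume "x \<in> U"
        then obtain c where c: "c \<in> C" "x \<in> W c" using D C by auto
        then obtain i where "from_nat_into C i = c" using C(1) False from_nat_into_surj by metis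
        then have "x \<in> K i" unfolding K_def using WL C(2) c by auto
        then show "x \<in> (\<Union>n. K n)" by blast
      qed
    qed
    ultimately show ?thesis using that by blast
  qed
qed

section \<open>Approximation of Borel sets and comparison of measures\<close>

text \<open>The sets that can be approximated include the open ones and are closed under complements
  and countable unions. One function serves all measures of \<open>\<M>\<close> at once, which
  allows two measures to be compared through it. Restriction to \<open>Q\<close>, of finite measure,
  makes complements and tails harmless.\<close>

lemma indicator_approx:
  assumes fin\<M>: "finite \<M>" and sets: "\<And>m. m \<in> \<M> \<Longrightarrow> sets m = sets (borel_of_topology T)"
    and Q: "openin T Q" and Qfin: "\<And>m. m \<in> \<M> \<Longrightarrow> emeasure m Q < \<infinity>"
    and B: "B \<in> sets (borel_of_topology T)"
  shows "\<forall>e>0. \<exists>f K. continuous_map T euclideanreal f \<and> (\<forall>x. 0 \<le> f x \<and> f x \<le> 1) \<and>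
    compactin T K \<and> K \<subseteq> Q \<and> (\<forall>x\<in>topspace T - K. f x = 0) \<and>
    (\<forall>m\<in>\<M>. (\<integral>\<^sup>+x. ennreal \<bar>indicator (B \<inter> Q) x - f x\<bar> \<partial>m) < ennreal e)"
proof -
  define appr where "appr = (\<lambda>B e f K. continuous_map T euclideanreal f \<and> (\<forall>x. 0 \<le> f x \<and> f x \<le> 1) \<and>
    compactin T K \<and> K \<subseteq> Q \<and> (\<forall>x\<in>topspace T - K. f x = 0) \<and>
    (\<forall>m\<in>\<M>. (\<integral>\<^sup>+x. ennreal \<bar>indicator (B \<inter> Q) x - f x\<bar> \<partial>m) < ennreal e))"
  have space: "space m = topspace T" if "m \<in> \<M>" for m
    using sets_eq_imp_space_eq[OF sets[OF that]] by (simp add: space_borel_of_topology)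
  have meas: "f \<in> borel_measurable m" if "m \<in> \<M>" "continuous_map T euclideanreal f" for f m
    using continuous_map_measurable_borel[OF that(2)] sets[OF that(1)] by (metis measurable_cong_sets)
  have in': "A \<inter> Q \<in> sets m" if "m \<in> \<M>" "A \<in> sets (borel_of_topology T)" for A m
    using that sets openin_in_borel[OF Q] by auto
  have meas_diff: "(\<lambda>x. ennreal \<bar>indicator (A \<inter> Q) x - f x\<bar>) \<in> borel_measurable m"
    if "m \<in> \<M>" "A \<in> sets (borel_of_topology T)" "continuous_map T euclideanreal f" for A f m
  proof -
    have [measurable]: "f \<in> borel_measurable m" "A \<inter> Q \<in> sets m" using meas in' that by auto
    show ?thesis by measurable
  qed
  have small: "\<exists>n. \<forall>m\<in>\<M>. emeasure m (U - K n) < ennreal e"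
    if K: "\<And>n. K n \<in> sets (borel_of_topology T)" "incseq K" "(\<Union>n. K n) = U" "U \<subseteq> Q" and e: "e > 0"
    for K :: "nat \<Rightarrow> 'a set" and U e
  proof -
    have "\<forall>\<^sub>F n in sequentially. emeasure m (U - K n) < ennreal e" if m: "m \<in> \<M>" for m
    proof -
      have "U \<in> sets m" using K(1,3) sets[OF m] by auto
      then have U: "emeasure m U < \<infinity>" "U \<in> sets m"
        using emeasure_mono[OF K(4), of m] Qfin[OF m] openin_in_borel[OF Q] sets[OF m] by auto
      have "(\<lambda>n. emeasure m (U - K n)) \<longlonglongrightarrow> emeasure m (\<Inter>n. U - K n)"
      proof (rule Lim_emeasure_decseq)
        show "range (\<lambda>n. U - K n) \<subseteq> sets m" using U K(1) sets[OF m] by auto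
        show "decseq (\<lambda>n. U - K n)" using K(2) by (auto simp: incseq_def decseq_def)
        show "emeasure m (U - K n) \<noteq> \<infinity>" for n
          using emeasure_mono[of "U - K n" U m] U by (auto simp: top_unique)
      qed
      moreover have "(\<Inter>n. U - K n) = {}" using K(3) by auto
      ultimately have "(\<lambda>n. emeasure m (U - K n)) \<longlonglongrightarrow> 0" by (simp only: emeasure_empty)
      then show ?thesis using e by (intro order_tendstoD(2)) auto
    qed
    then have "\<forall>\<^sub>F n in sequentially. \<forall>m\<in>\<M>. emeasure m (U - K n) < ennreal e"
      using fin\<M> by (simp add: eventually_ball_finite_distrib)
    from eventually_happens'[OF sequentially_bot this] show ?thesis .
  qed
  have dist_le: "(\<integral>\<^sup>+x. ennreal \<bar>a x - c x\<bar> \<partial>m) < ennreal (e1 + e2)"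
    if "(\<integral>\<^sup>+x. ennreal (u x) \<partial>m) < ennreal e1" "(\<integral>\<^sup>+x. ennreal (v x) \<partial>m) < ennreal e2"
      and "\<And>x. x \<in> space m \<Longrightarrow> \<bar>a x - c x\<bar> \<le> u x + v x"
      and "\<And>x. u x \<ge> 0" "\<And>x. v x \<ge> 0" "(\<lambda>x. ennreal (u x)) \<in> borel_measurable m"
      and "(\<lambda>x. ennreal (v x)) \<in> borel_measurable m" "e1 > 0" "e2 > 0"
    for a c u v :: "'a \<Rightarrow> real" and m :: "'a measure" and e1 e2
  proof -
    have "(\<integral>\<^sup>+x. ennreal \<bar>a x - c x\<bar> \<partial>m) \<le> (\<integral>\<^sup>+x. ennreal (u x) + ennreal (v x) \<partial>m)"
      using that(3-5) by (intro nn_integral_mono) (simp flip: ennreal_plus)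
    also have "\<dots> = (\<integral>\<^sup>+x. ennreal (u x) \<partial>m) + (\<integral>\<^sup>+x. ennreal (v x) \<partial>m)"
      using that by (intro nn_integral_add) auto
    also have "\<dots> < ennreal e1 + ennreal e2" using that by (intro add_strict_mono) auto
    finally show ?thesis using that by simp
  qed
  have open_case: "\<exists>f K. appr U e f K" if U: "openin T U" and e: "e > 0" for U e
  proof -
    have UQ: "openin T (U \<inter> Q)" using U Q by (rule openin_Int)
    obtain K :: "nat \<Rightarrow> 'a set" where K: "\<And>n. compactin T (K n)" "incseq K" "(\<Union>n. K n) = U \<inter> Q"
      using open_exhaustion[OF UQ] by blast
    have KB: "K n \<in> sets (borel_of_topology T)" for n using K(1) by (rule compactin_in_borel)
    obtain n where n: "\<And>m. m \<in> \<M> \<Longrightarrow> emeasure m (U \<inter> Q - K n) < ennreal e"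
      using small[OF KB K(2,3) _ e] by auto
    have "K n \<subseteq> U \<inter> Q" using K(3) by blast
    from Urysohn_compact[OF K(1) UQ this]
    obtain f K' where f: "continuous_map T euclideanreal f" "\<And>x. 0 \<le> f x" "\<And>x. f x \<le> 1"
      "\<And>x. x \<in> K n \<Longrightarrow> f x = 1" "compactin T K'" "K' \<subseteq> U \<inter> Q" "\<And>x. x \<in> topspace T - K' \<Longrightarrow> f x = 0"
      by metis
    have "(\<integral>\<^sup>+x. ennreal \<bar>indicator (U \<inter> Q) x - f x\<bar> \<partial>m) < ennreal e" if m: "m \<in> \<M>" for m
    proof -
      have "(\<integral>\<^sup>+x. ennreal \<bar>indicator (U \<inter> Q) x - f x\<bar> \<partial>m) \<le> (\<integral>\<^sup>+x. indicator (U \<inter> Q - K n) x \<partial>m)"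
      proof (rule nn_integral_mono)
        fix x assume "x \<in> space m"
        then have "x \<in> topspace T" using space[OF m] by simp
        then show "ennreal \<bar>indicator (U \<inter> Q) x - f x\<bar> \<le> indicator (U \<inter> Q - K n) x"
          using f(2)[of x] f(3)[of x] f(4)[of x] f(6) f(7)[of x]
          by (cases "x \<in> K n"; cases "x \<in> U \<inter> Q") (auto simp: indicator_def ennreal_le_1)
      qed
      also have "\<dots> = emeasure m (U \<inter> Q - K n)"
        using in'[OF m openin_in_borel[OF U]] KB sets[OF m] by (intro nn_integral_indicator) auto
      finally show ?thesis using n[OF m] by simp
    qed
    then have "appr U e f K'" unfolding appr_def using f by auto
    then show ?thesis by blast
  qed
  from B have "B \<in> sigma_sets (topspace T) {U. openin T U}" by (simp add: sets_borel_of_topology)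
  then have "\<forall>e>0. \<exists>f K. appr B e f K"
  proof induction
    case (Basic U) then show ?case using open_case by auto
  next
    case Empty then show ?case using open_case[of "{}"] by auto
  next
    case (Compl A)
    then have A: "A \<in> sets (borel_of_topology T)" by (simp add: sets_borel_of_topology)
    show ?case
    proof (intro allI impI)
      fix e :: real assume e: "e > 0"
      obtain f K where f: "appr A (e/2) f K" using Compl(2) e half_gt_zero by blast
      obtain h L where h: "appr (topspace T) (e/2) h L" using open_case[of "topspace T" "e/2"] e by auto
      \<comment> \<open>The complement within \<open>Q\<close> is approximated by the truncated
        difference of the approximants of \<open>Q\<close> and of A \<inter> Q.\<close>
      let ?g = "\<lambda>x. max 0 (h x - f x)"
      have "continuous_map T euclideanreal ?g"
        using f h unfolding appr_def by (intro continuous_map_real_max continuous_map_diff) auto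
      moreover have "0 \<le> ?g x \<and> ?g x \<le> 1" for x
      proof -
        have "0 \<le> f x" "h x \<le> 1" using f h unfolding appr_def by auto
        then show ?thesis by auto
      qed
      moreover have "compactin T L" "L \<subseteq> Q" "\<forall>x\<in>topspace T - L. ?g x = 0"
        using f h unfolding appr_def by auto
      moreover have "(\<integral>\<^sup>+x. ennreal \<bar>indicator ((topspace T - A) \<inter> Q) x - ?g x\<bar> \<partial>m) < ennreal e"
        if m: "m \<in> \<M>" for m
      proof -
        have "(\<integral>\<^sup>+x. ennreal \<bar>indicator ((topspace T - A) \<inter> Q) x - ?g x\<bar> \<partial>m) < ennreal (e/2 + e/2)"
        proof (rule dist_le)
          show "(\<integral>\<^sup>+x. ennreal \<bar>indicator (topspace T \<inter> Q) x - h x\<bar> \<partial>m) < ennreal (e/2)"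
            using h m unfolding appr_def by blast
          show "(\<integral>\<^sup>+x. ennreal \<bar>indicator (A \<inter> Q) x - f x\<bar> \<partial>m) < ennreal (e/2)"
            using f m unfolding appr_def by blast
          show "\<bar>indicator ((topspace T - A) \<inter> Q) x - ?g x\<bar> \<le>
              \<bar>indicator (topspace T \<inter> Q) x - h x\<bar> + \<bar>indicator (A \<inter> Q) x - f x\<bar>" if "x \<in> space m" for x
            using that space[OF m] by (auto simp: indicator_def)
          show "(\<lambda>x. ennreal \<bar>indicator (topspace T \<inter> Q) x - h x\<bar>) \<in> borel_measurable m"
            using h m unfolding appr_def by (intro meas_diff openin_in_borel) auto
          show "(\<lambda>x. ennreal \<bar>indicator (A \<inter> Q) x - f x\<bar>) \<in> borel_measurable m"
            using f m A unfolding appr_def by (intro meas_diff) auto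
        qed (use e in auto)
        then show ?thesis by simp
      qed
      ultimately have "appr (topspace T - A) e ?g L" unfolding appr_def by blast
      then show "\<exists>f K. appr (topspace T - A) e f K" by blast
    qed
  next
    case (Union A)
    then have A: "A i \<in> sets (borel_of_topology T)" for i by (simp add: sets_borel_of_topology)
    \<comment> \<open>Finite unions are handled by maxima; the countable union then differs from one
      of them by a set that is small for all measures of the finite family.\<close>
    have fin: "\<forall>e>0. \<exists>f K. appr (\<Union>i<n. A i) e f K" for n :: nat
    proof (induction n)
      case 0 then show ?case using open_case[of "{}"] by auto
    next
      case (Suc n)
      let ?S = "\<Union>i<n. A i"
      have S: "?S \<in> sets (borel_of_topology T)" using A by auto
      show ?case
      proof (intro allI impI)
        fix e :: real assume e: "e > 0"
        obtain f K where f: "appr ?S (e/2) f K" using Suc e half_gt_zero by blast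
        obtain h L where h: "appr (A n) (e/2) h L" using Union(2) e half_gt_zero by blast
        let ?g = "\<lambda>x. max (f x) (h x)"
        have un: "(\<Union>i<Suc n. A i) = ?S \<union> A n" by (auto simp: less_Suc_eq)
        have "continuous_map T euclideanreal ?g"
          using f h unfolding appr_def by (intro continuous_map_real_max) auto
        moreover have "0 \<le> ?g x \<and> ?g x \<le> 1" for x
        proof -
          have "0 \<le> f x" "f x \<le> 1" "h x \<le> 1" using f h unfolding appr_def by auto
          then show ?thesis by auto
        qed
        moreover have "compactin T (K \<union> L)" "K \<union> L \<subseteq> Q" "\<forall>x\<in>topspace T - (K \<union> L). ?g x = 0"
          using f h unfolding appr_def by (auto intro: compactin_Un)
        moreover have "(\<integral>\<^sup>+x. ennreal \<bar>indicator ((?S \<union> A n) \<inter> Q) x - ?g x\<bar> \<partial>m) < ennreal e"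
          if m: "m \<in> \<M>" for m
        proof -
          have "(\<integral>\<^sup>+x. ennreal \<bar>indicator ((?S \<union> A n) \<inter> Q) x - ?g x\<bar> \<partial>m) < ennreal (e/2 + e/2)"
          proof (rule dist_le)
            show "(\<integral>\<^sup>+x. ennreal \<bar>indicator (?S \<inter> Q) x - f x\<bar> \<partial>m) < ennreal (e/2)"
              using f m unfolding appr_def by blast
            show "(\<integral>\<^sup>+x. ennreal \<bar>indicator (A n \<inter> Q) x - h x\<bar> \<partial>m) < ennreal (e/2)"
              using h m unfolding appr_def by blast
            show "\<bar>indicator ((?S \<union> A n) \<inter> Q) x - ?g x\<bar> \<le>
                \<bar>indicator (?S \<inter> Q) x - f x\<bar> + \<bar>indicator (A n \<inter> Q) x - h x\<bar>" if "x \<in> space m" for x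
            proof -
              have "0 \<le> f x" "f x \<le> 1" "0 \<le> h x" "h x \<le> 1" using f h unfolding appr_def by auto
              then show ?thesis by (auto simp: indicator_def max_def)
            qed
            show "(\<lambda>x. ennreal \<bar>indicator (?S \<inter> Q) x - f x\<bar>) \<in> borel_measurable m"
              using f m S unfolding appr_def by (intro meas_diff) auto
            show "(\<lambda>x. ennreal \<bar>indicator (A n \<inter> Q) x - h x\<bar>) \<in> borel_measurable m"
              using h m A unfolding appr_def by (intro meas_diff) auto
          qed (use e in auto)
          then show ?thesis by simp
        qed
        ultimately have "appr (\<Union>i<Suc n. A i) e ?g (K \<union> L)" unfolding appr_def un by blast
        then show "\<exists>f K. appr (\<Union>i<Suc n. A i) e f K" by blast
      qed
    qed
    show ?case
    proof (intro allI impI)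
      fix e :: real assume e: "e > 0"
      let ?K = "\<lambda>n. (\<Union>i<n. A i) \<inter> Q" and ?U = "(\<Union>i. A i) \<inter> Q"
      have inc: "incseq ?K" unfolding incseq_def by (auto intro: less_le_trans)
      have KB: "?K n \<in> sets (borel_of_topology T)" for n
        using A openin_in_borel[OF Q] by auto
      have un: "(\<Union>n. ?K n) = ?U" by auto
      obtain n where n: "\<And>m. m \<in> \<M> \<Longrightarrow> emeasure m (?U - ?K n) < ennreal (e/2)"
        using small[OF KB inc un Int_lower2 half_gt_zero[OF e]] by blast
      obtain f K where f: "appr (\<Union>i<n. A i) (e/2) f K" using fin e half_gt_zero by blast
      have "(\<integral>\<^sup>+x. ennreal \<bar>indicator ?U x - f x\<bar> \<partial>m) < ennreal e" if m: "m \<in> \<M>" for m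
      proof -
        have ms: "?U - ?K n \<in> sets m" using KB A openin_in_borel[OF Q] sets[OF m] by auto
        have "(\<integral>\<^sup>+x. ennreal \<bar>indicator ?U x - f x\<bar> \<partial>m) < ennreal (e/2 + e/2)"
        proof (rule dist_le)
          show "(\<integral>\<^sup>+x. ennreal \<bar>indicator (?K n) x - f x\<bar> \<partial>m) < ennreal (e/2)"
            using f m unfolding appr_def by blast
          show "(\<integral>\<^sup>+x. ennreal (indicator (?U - ?K n) x) \<partial>m) < ennreal (e/2)"
            using n[OF m] ms by (simp add: ennreal_indicator)
          show "\<bar>indicator ?U x - f x\<bar> \<le> \<bar>indicator (?K n) x - f x\<bar> + indicator (?U - ?K n) x" for x
            by (auto simp: indicator_def)
          show "(\<lambda>x. ennreal \<bar>indicator (?K n) x - f x\<bar>) \<in> borel_measurable m"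
            using f m A unfolding appr_def by (intro meas_diff) auto
          show "(\<lambda>x. ennreal (indicator (?U - ?K n) x)) \<in> borel_measurable m"
            using ms by simp
        qed (use e in auto)
        then show ?thesis by simp
      qed
      then have "appr (\<Union>i. A i) e f K" using f unfolding appr_def by blast
      then show "\<exists>f K. appr (\<Union>i. A i) e f K" by blast
    qed
  qed
  then show ?thesis unfolding appr_def .
qed

lemma open_rel_compact_exhaustion:
  "\<exists>Q :: nat \<Rightarrow> 'a set. (\<forall>n. openin T (Q n)) \<and> incseq Q \<and> (\<Union>n. Q n) = topspace T \<and>
    (\<forall>n. \<exists>K. compactin T K \<and> Q n \<subseteq> K)"
proof -
  obtain K :: "nat \<Rightarrow> 'a set" where K: "\<And>n. compactin T (K n)" "incseq K" "(\<Union>n. K n) = topspace T"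
    using open_exhaustion[OF openin_topspace] by blast
  have "\<exists>U L. openin T U \<and> compactin T L \<and> K n \<subseteq> U \<and> U \<subseteq> L" for n
    using loc_compact locally_compact_space_compact_closed_compact[of T] hausdorff K(1)[of n] by blast
  then obtain U L where UL: "\<And>n. openin T (U n)" "\<And>n. compactin T (L n)" "\<And>n. K n \<subseteq> U n"
      "\<And>n. U n \<subseteq> L n" by metis
  let ?Q = "\<lambda>n. \<Union>i\<le>n. U i"
  have "openin T (?Q n)" for n using UL(1) by blast
  moreover have "incseq ?Q" unfolding incseq_def by (auto intro: order_trans)
  moreover have "(\<Union>n. ?Q n) = topspace T"
  proof
    show "(\<Union>n. ?Q n) \<subseteq> topspace T" using openin_subset[OF UL(1)] by blast
    show "topspace T \<subseteq> (\<Union>n. ?Q n)"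
    proof
      fix x assume "x \<in> topspace T"
      then obtain n where "x \<in> K n" using K(3) by auto
      then have "x \<in> ?Q n" using UL(3)[of n] by auto
      then show "x \<in> (\<Union>n. ?Q n)" by (rule UN_I[OF UNIV_I])
    qed
  qed
  moreover have "\<exists>K. compactin T K \<and> ?Q n \<subseteq> K" for n
  proof (intro exI conjI)
    show "compactin T (\<Union>i\<le>n. L i)" using UL(2) by (intro compactin_Union) auto
    show "?Q n \<subseteq> (\<Union>i\<le>n. L i)" using UL(4) by fastforce
  qed
  ultimately show ?thesis by (intro exI[of _ ?Q] conjI allI)
qed

text \<open>Approximating the indicator of B \<inter> Q n for both measures by one function
  transfers the inequality to Borel sets of finite measure, and the sets \<open>Q n\<close> exhaust
  the space. Applied in both directions it also yields equality of measures.\<close>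

lemma measure_le_if_integrals_le:
  assumes s1: "sets m1 = sets (borel_of_topology T)" and s2: "sets m2 = sets (borel_of_topology T)"
    and f1: "\<And>K. compactin T K \<Longrightarrow> emeasure m1 K < \<infinity>" and f2: "\<And>K. compactin T K \<Longrightarrow> emeasure m2 K < \<infinity>"
    and le: "\<And>f K. continuous_map T euclideanreal f \<Longrightarrow> (\<And>x. 0 \<le> f x) \<Longrightarrow> compactin T K \<Longrightarrow>
      (\<And>x. x \<in> topspace T - K \<Longrightarrow> f x = 0) \<Longrightarrow>
      (\<integral>\<^sup>+x. ennreal (f x) \<partial>m1) \<le> (\<integral>\<^sup>+x. ennreal (f x) \<partial>m2)"
  shows "m1 \<le> m2"
proof -
  obtain Q :: "nat \<Rightarrow> 'a set" where Q: "\<And>n. openin T (Q n)" "incseq Q" "(\<Union>n. Q n) = topspace T"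
    "\<And>n. \<exists>K. compactin T K \<and> Q n \<subseteq> K" using open_rel_compact_exhaustion by metis
  have Qfin: "emeasure m (Q n) < \<infinity>"
    if "sets m = sets (borel_of_topology T)" "\<And>K. compactin T K \<Longrightarrow> emeasure m K < \<infinity>" for m n
  proof -
    obtain K where K: "compactin T K" "Q n \<subseteq> K" using Q(4) by blast
    then have "emeasure m (Q n) \<le> emeasure m K"
      using compactin_in_borel that(1) by (intro emeasure_mono) auto
    then show ?thesis using that(2)[OF K(1)] by (rule le_less_trans)
  qed
  have leQ: "emeasure m1 (B \<inter> Q n) \<le> emeasure m2 (B \<inter> Q n)" if B: "B \<in> sets m1" for B n
  proof (rule ennreal_le_epsilon)
    fix e :: real assume e: "e > 0"
    have "\<exists>f K. continuous_map T euclideanreal f \<and> (\<forall>x. 0 \<le> f x \<and> f x \<le> 1) \<and>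
      compactin T K \<and> K \<subseteq> Q n \<and> (\<forall>x\<in>topspace T - K. f x = 0) \<and>
      (\<forall>m\<in>{m1, m2}. (\<integral>\<^sup>+x. ennreal \<bar>indicator (B \<inter> Q n) x - f x\<bar> \<partial>m) < ennreal (e/2))"
    proof (rule indicator_approx[rule_format])
      show "sets m = sets (borel_of_topology T)" if "m \<in> {m1, m2}" for m using that s1 s2 by auto
      show "emeasure m (Q n) < \<infinity>" if "m \<in> {m1, m2}" for m
        using that Qfin[OF s1 f1] Qfin[OF s2 f2] by auto
    qed (use Q(1) B s1 e in auto)
    then obtain f K where f: "continuous_map T euclideanreal f" "\<And>x. 0 \<le> f x"
      "compactin T K" "\<And>x. x \<in> topspace T - K \<Longrightarrow> f x = 0"
      "(\<integral>\<^sup>+x. ennreal \<bar>indicator (B \<inter> Q n) x - f x\<bar> \<partial>m1) < ennreal (e/2)"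
      "(\<integral>\<^sup>+x. ennreal \<bar>indicator (B \<inter> Q n) x - f x\<bar> \<partial>m2) < ennreal (e/2)" by blast
    have BQ: "B \<inter> Q n \<in> sets m1" "B \<inter> Q n \<in> sets m2"
      using B openin_in_borel[OF Q(1)] s1 s2 by auto
    have fm: "f \<in> borel_measurable m1" "f \<in> borel_measurable m2"
      using continuous_map_measurable_borel[OF f(1)] s1 s2 by (metis measurable_cong_sets)+
    have dm: "(\<lambda>x. ennreal \<bar>indicator (B \<inter> Q n) x - f x\<bar>) \<in> borel_measurable m1"
        "(\<lambda>x. ennreal \<bar>indicator (B \<inter> Q n) x - f x\<bar>) \<in> borel_measurable m2"
      using fm BQ by measurable
    have tri: "ennreal a \<le> ennreal b + ennreal \<bar>c\<bar>" if "a \<le> b + \<bar>c\<bar>" "b \<ge> 0" for a b c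
      using that by (simp flip: ennreal_plus)
    have "emeasure m1 (B \<inter> Q n) = (\<integral>\<^sup>+x. ennreal (indicator (B \<inter> Q n) x) \<partial>m1)"
      using BQ by (simp add: ennreal_indicator)
    also have "\<dots> \<le> (\<integral>\<^sup>+x. ennreal (f x) + ennreal \<bar>indicator (B \<inter> Q n) x - f x\<bar> \<partial>m1)"
      using f(2) by (intro nn_integral_mono tri) auto
    also have "\<dots> = (\<integral>\<^sup>+x. ennreal (f x) \<partial>m1) + (\<integral>\<^sup>+x. ennreal \<bar>indicator (B \<inter> Q n) x - f x\<bar> \<partial>m1)"
      using fm dm by (intro nn_integral_add) auto
    also have "\<dots> \<le> (\<integral>\<^sup>+x. ennreal (f x) \<partial>m2) + ennreal (e/2)"
      by (rule add_mono[OF le[OF f(1,2,3,4)] less_imp_le[OF f(5)]])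
    also have "(\<integral>\<^sup>+x. ennreal (f x) \<partial>m2) \<le>
        (\<integral>\<^sup>+x. ennreal (indicator (B \<inter> Q n) x) + ennreal \<bar>indicator (B \<inter> Q n) x - f x\<bar> \<partial>m2)"
      by (intro nn_integral_mono tri) (auto simp: indicator_def)
    also have "\<dots> = (\<integral>\<^sup>+x. ennreal (indicator (B \<inter> Q n) x) \<partial>m2) +
        (\<integral>\<^sup>+x. ennreal \<bar>indicator (B \<inter> Q n) x - f x\<bar> \<partial>m2)"
      using BQ dm by (intro nn_integral_add) auto
    also have "(\<integral>\<^sup>+x. ennreal (indicator (B \<inter> Q n) x) \<partial>m2) = emeasure m2 (B \<inter> Q n)"
      using BQ by (simp add: ennreal_indicator)
    finally have "emeasure m1 (B \<inter> Q n) \<le> emeasure m2 (B \<inter> Q n) +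
        (\<integral>\<^sup>+x. ennreal \<bar>indicator (B \<inter> Q n) x - f x\<bar> \<partial>m2) + ennreal (e/2)"
      by simp
    also have "\<dots> \<le> emeasure m2 (B \<inter> Q n) + ennreal (e/2) + ennreal (e/2)"
      by (intro add_mono order_refl less_imp_le[OF f(6)])
    also have "\<dots> = emeasure m2 (B \<inter> Q n) + ennreal e"
      using e by (simp add: add.assoc flip: ennreal_plus)
    finally show "emeasure m1 (B \<inter> Q n) \<le> emeasure m2 (B \<inter> Q n) + ennreal e" .
  qed
  have "emeasure m1 B \<le> emeasure m2 B" if B: "B \<in> sets m1" for B
  proof -
    have inc: "incseq (\<lambda>n. B \<inter> Q n)" using Q(2) by (auto simp: incseq_def)
    have BB: "range (\<lambda>n. B \<inter> Q n) \<subseteq> sets m1" "range (\<lambda>n. B \<inter> Q n) \<subseteq> sets m2"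
      using B openin_in_borel[OF Q(1)] s1 s2 by auto
    have "B \<subseteq> topspace T"
      using sets.sets_into_space[OF B] sets_eq_imp_space_eq[OF s1] by (simp add: space_borel_of_topology)
    then have un: "(\<Union>n. B \<inter> Q n) = B" using Q(3) by blast
    show ?thesis
      using SUP_emeasure_incseq[OF BB(1) inc] SUP_emeasure_incseq[OF BB(2) inc] SUP_mono' leQ[OF B]
      unfolding un by metis
  qed
  then show ?thesis by (intro le_measure[THEN iffD2]) (use s1 s2 in auto)
qed

end

lemma continuous_map_comp_on:
  assumes "continuous_map T euclidean f" "continuous_on UNIV h"
  shows "continuous_map T euclidean (\<lambda>x. h (f x))"
  using continuous_map_compose[OF assms(1), of euclidean h] assms(2) by (simp add: o_def)

section \<open>Density of compactly supported functions in L^2\<close>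

context lch
begin

text \<open>The error is an extended integral, so no integrability has to be carried through sums;
  it is recovered in \<open>L2_dense_Cc\<close>.\<close>

definition L2_appr :: "'a measure \<Rightarrow> real \<Rightarrow> ('a \<Rightarrow> complex) \<Rightarrow> bool" where
  "L2_appr m e F \<longleftrightarrow> (\<exists>g K. continuous_map T euclidean g \<and> compactin T K \<and>
     (\<forall>x\<in>topspace T - K. g x = 0) \<and> (\<integral>\<^sup>+x. ennreal ((cmod (F x - g x))\<^sup>2) \<partial>m) < ennreal e)"

context
  fixes m :: "'a measure"
  assumes sets_m: "sets m = sets (borel_of_topology T)"
    and fin_m: "\<And>K. compactin T K \<Longrightarrow> emeasure m K < \<infinity>"
begin

lemma continuous_measurable: "continuous_map T euclidean f \<Longrightarrow> f \<in> borel_measurable m"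
  using continuous_map_measurable_borel sets_m by (metis measurable_cong_sets)

lemma L2_appr_add:
  assumes F: "\<And>e. e > 0 \<Longrightarrow> L2_appr m e F" "F \<in> borel_measurable m"
    and G: "\<And>e. e > 0 \<Longrightarrow> L2_appr m e G" "G \<in> borel_measurable m" and e: "e > 0"
  shows "L2_appr m e (\<lambda>x. F x + G x)"
proof -
  have e4: "e/4 > 0" using e by simp
  obtain f K where f: "continuous_map T euclidean f" "compactin T K" "\<forall>x\<in>topspace T - K. f x = 0"
      "(\<integral>\<^sup>+x. ennreal ((cmod (F x - f x))\<^sup>2) \<partial>m) < ennreal (e/4)"
    using F(1)[OF e4] unfolding L2_appr_def by auto
  obtain g L where g: "continuous_map T euclidean g" "compactin T L" "\<forall>x\<in>topspace T - L. g x = 0"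
      "(\<integral>\<^sup>+x. ennreal ((cmod (G x - g x))\<^sup>2) \<partial>m) < ennreal (e/4)"
    using G(1)[OF e4] unfolding L2_appr_def by auto
  note [measurable] = F(2) G(2) continuous_measurable[OF f(1)] continuous_measurable[OF g(1)]
  have le: "(cmod (F x + G x - (f x + g x)))\<^sup>2 \<le> 2 * (cmod (F x - f x))\<^sup>2 + 2 * (cmod (G x - g x))\<^sup>2" for x
    using cmod_add_square_le[of "F x - f x" "G x - g x"] by (simp add: algebra_simps)
  have "(\<integral>\<^sup>+x. ennreal ((cmod (F x + G x - (f x + g x)))\<^sup>2) \<partial>m) \<le>
      (\<integral>\<^sup>+x. ennreal (2 * (cmod (F x - f x))\<^sup>2 + 2 * (cmod (G x - g x))\<^sup>2) \<partial>m)"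
    using le by (intro nn_integral_mono ennreal_leI)
  also have "\<dots> = (\<integral>\<^sup>+x. 2 * ennreal ((cmod (F x - f x))\<^sup>2) + 2 * ennreal ((cmod (G x - g x))\<^sup>2) \<partial>m)"
    by (simp add: ennreal_mult)
  also have "\<dots> = 2 * (\<integral>\<^sup>+x. ennreal ((cmod (F x - f x))\<^sup>2) \<partial>m) + 2 * (\<integral>\<^sup>+x. ennreal ((cmod (G x - g x))\<^sup>2) \<partial>m)"
    by (simp add: nn_integral_add nn_integral_cmult)
  also have "\<dots> < 2 * ennreal (e/4) + 2 * ennreal (e/4)"
    using f(4) g(4) by (intro add_strict_mono ennreal_mult_strict_left_mono) auto
  also have "2 * ennreal (e/4) = ennreal (e/2)" using ennreal_mult[of 2 "e/4"] e by simp
  also have "ennreal (e/2) + ennreal (e/2) = ennreal e" using ennreal_plus[of "e/2" "e/2"] e by simp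
  finally have "(\<integral>\<^sup>+x. ennreal ((cmod (F x + G x - (f x + g x)))\<^sup>2) \<partial>m) < ennreal e" .
  moreover have "continuous_map T euclidean (\<lambda>x. f x + g x)" using f g by (intro continuous_map_add)
  moreover have "compactin T (K \<union> L)" using f g by (intro compactin_Un)
  moreover have "\<forall>x\<in>topspace T - (K \<union> L). f x + g x = 0" using f g by auto
  ultimately show ?thesis unfolding L2_appr_def by blast
qed

lemma L2_appr_indicator:
  assumes B: "B \<in> sets m" "emeasure m B < \<infinity>" and e: "e > 0"
  shows "L2_appr m e (\<lambda>x. c * indicator B x)"
proof (cases "c = 0")
  case True
  then show ?thesis using e unfolding L2_appr_def
    by (intro exI[of _ "\<lambda>x. 0"] exI[of _ "{}"]) auto
next
  case False
  \<comment> \<open>Each of the two error terms below stays under 2 |c|^2 d = e / 2.\<close>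
  define d where "d = e / (4 * (cmod c)\<^sup>2)"
  have d: "d > 0" using False e by (simp add: d_def)
  obtain Q :: "nat \<Rightarrow> 'a set" where Q: "\<And>n. openin T (Q n)" "incseq Q" "(\<Union>n. Q n) = topspace T"
    "\<And>n. \<exists>K. compactin T K \<and> Q n \<subseteq> K" using open_rel_compact_exhaustion by metis
  have Qs: "Q n \<in> sets m" for n using openin_in_borel[OF Q(1)] sets_m by simp
  have Qfin: "emeasure m (Q n) < \<infinity>" for n
  proof -
    obtain K where K: "compactin T K" "Q n \<subseteq> K" using Q(4) by blast
    then have "emeasure m (Q n) \<le> emeasure m K"
      using compactin_in_borel sets_m by (intro emeasure_mono) auto
    then show ?thesis using fin_m[OF K(1)] by (rule le_less_trans)
  qed
  have BT: "B \<subseteq> topspace T"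
    using sets.sets_into_space[OF B(1)] sets_eq_imp_space_eq[OF sets_m] by (simp add: space_borel_of_topology)
  have "(\<lambda>n. emeasure m (B - Q n)) \<longlonglongrightarrow> emeasure m (\<Inter>n. B - Q n)"
  proof (rule Lim_emeasure_decseq)
    show "range (\<lambda>n. B - Q n) \<subseteq> sets m" using B(1) Qs by auto
    show "decseq (\<lambda>n. B - Q n)" using Q(2) by (auto simp: incseq_def decseq_def)
    show "emeasure m (B - Q n) \<noteq> \<infinity>" for n
      using emeasure_mono[of "B - Q n" B m] B by (auto simp: top_unique)
  qed
  moreover have "(\<Inter>n. B - Q n) = {}" using Q(3) BT by auto
  ultimately have "(\<lambda>n. emeasure m (B - Q n)) \<longlonglongrightarrow> 0" by (simp only: emeasure_empty)
  then have "\<forall>\<^sub>F n in sequentially. emeasure m (B - Q n) < ennreal d"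
    using d by (intro order_tendstoD(2)) auto
  from eventually_happens'[OF sequentially_bot this]
  obtain n where n: "emeasure m (B - Q n) < ennreal d" by blast
  have "\<exists>f K. continuous_map T euclideanreal f \<and> (\<forall>x. 0 \<le> f x \<and> f x \<le> 1) \<and>
      compactin T K \<and> K \<subseteq> Q n \<and> (\<forall>x\<in>topspace T - K. f x = 0) \<and>
      (\<forall>m\<in>{m}. (\<integral>\<^sup>+x. ennreal \<bar>indicator (B \<inter> Q n) x - f x\<bar> \<partial>m) < ennreal d)"
    by (rule indicator_approx[rule_format]) (use sets_m Qfin Q(1) B d in auto)
  then obtain f K where f: "continuous_map T euclideanreal f" "\<And>x. 0 \<le> f x \<and> f x \<le> 1"
      "compactin T K" "\<forall>x\<in>topspace T - K. f x = 0"
      "(\<integral>\<^sup>+x. ennreal \<bar>indicator (B \<inter> Q n) x - f x\<bar> \<partial>m) < ennreal d" by auto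
  note [measurable] = continuous_measurable[OF f(1)] B(1) Qs
  have cf: "continuous_map T euclidean (\<lambda>x. c * complex_of_real (f x))"
    by (rule continuous_map_comp_on[OF f(1), of "\<lambda>y. c * complex_of_real y"]) (intro continuous_intros)
  have le: "(cmod (c * indicator B x - c * complex_of_real (f x)))\<^sup>2 \<le>
      2 * (cmod c)\<^sup>2 * indicator (B - Q n) x + 2 * (cmod c)\<^sup>2 * \<bar>indicator (B \<inter> Q n) x - f x\<bar>" for x
  proof -
    have eq: "(cmod (c * indicator B x - c * complex_of_real (f x)))\<^sup>2 = (cmod c)\<^sup>2 * (indicator B x - f x)\<^sup>2"
    proof -
      have "c * indicator B x - c * complex_of_real (f x) = c * complex_of_real (indicator B x - f x)"
        by (simp add: indicator_def right_diff_distrib)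
      then show ?thesis by (simp only: norm_mult norm_of_real power_mult_distrib power2_abs)
    qed
    have "(indicator B x - f x)\<^sup>2 \<le> \<bar>indicator B x - f x\<bar>"
      using f(2)[of x] by (auto simp: indicator_def power2_eq_square mult_left_le)
    also have "\<dots> \<le> 2 * indicator (B - Q n) x + 2 * \<bar>indicator (B \<inter> Q n) x - f x\<bar>"
      using f(2)[of x] by (auto simp: indicator_def)
    finally have "(cmod c)\<^sup>2 * (indicator B x - f x)\<^sup>2 \<le>
        (cmod c)\<^sup>2 * (2 * indicator (B - Q n) x + 2 * \<bar>indicator (B \<inter> Q n) x - f x\<bar>)"
      by (rule mult_left_mono) simp
    with eq show ?thesis by (simp add: algebra_simps)
  qed
  have "(\<integral>\<^sup>+x. ennreal ((cmod (c * indicator B x - c * complex_of_real (f x)))\<^sup>2) \<partial>m) \<le>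
      (\<integral>\<^sup>+x. ennreal (2 * (cmod c)\<^sup>2) * indicator (B - Q n) x +
        ennreal (2 * (cmod c)\<^sup>2) * ennreal \<bar>indicator (B \<inter> Q n) x - f x\<bar> \<partial>m)"
    using le by (intro nn_integral_mono)
      (simp add: ennreal_indicator[symmetric] ennreal_leI flip: ennreal_mult ennreal_plus)
  also have "\<dots> = ennreal (2 * (cmod c)\<^sup>2) * emeasure m (B - Q n) +
      ennreal (2 * (cmod c)\<^sup>2) * (\<integral>\<^sup>+x. ennreal \<bar>indicator (B \<inter> Q n) x - f x\<bar> \<partial>m)"
    by (simp add: nn_integral_add nn_integral_cmult nn_integral_cmult_indicator)
  also have "\<dots> < ennreal (2 * (cmod c)\<^sup>2) * ennreal d + ennreal (2 * (cmod c)\<^sup>2) * ennreal d"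
    using n f(5) False by (intro add_strict_mono ennreal_mult_strict_left_mono) auto
  also have "\<dots> = ennreal e"
    using d False ennreal_plus[of "e/2" "e/2"] e by (simp add: d_def flip: ennreal_mult)
  finally have "(\<integral>\<^sup>+x. ennreal ((cmod (c * indicator B x - c * complex_of_real (f x)))\<^sup>2) \<partial>m) < ennreal e" .
  then show ?thesis unfolding L2_appr_def using cf f by (intro exI[of _ "\<lambda>x. c * complex_of_real (f x)"] exI[of _ K]) auto
qed

lemma L2_appr_simple:
  assumes s: "simple_function m s" and fin: "(\<integral>\<^sup>+x. ennreal ((cmod (s x))\<^sup>2) \<partial>m) < \<infinity>" and e: "e > 0"
  shows "L2_appr m e s"
proof -
  have [measurable]: "s \<in> borel_measurable m" using s by (rule borel_measurable_simple_function)
  let ?B = "\<lambda>y. s -` {y} \<inter> space m"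
  have B: "?B y \<in> sets m" for y using s by (rule simple_functionD(2))
  have Bfin: "emeasure m (?B y) < \<infinity>" if "y \<noteq> 0" for y
  proof -
    have "ennreal ((cmod y)\<^sup>2) * emeasure m (?B y) = (\<integral>\<^sup>+x. ennreal ((cmod y)\<^sup>2) * indicator (?B y) x \<partial>m)"
      using B by (simp add: nn_integral_cmult_indicator)
    also have "\<dots> \<le> (\<integral>\<^sup>+x. ennreal ((cmod (s x))\<^sup>2) \<partial>m)"
      by (intro nn_integral_mono) (auto simp: indicator_def)
    finally have "ennreal ((cmod y)\<^sup>2) * emeasure m (?B y) < \<infinity>" using fin by (rule le_less_trans)
    then show ?thesis using that by (auto simp: ennreal_mult_less_top)
  qed
  have "L2_appr m e (\<lambda>x. \<Sum>y\<in>Y. y * indicator (?B y) x)" if "finite Y" "e > 0" for Y e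
    using that
  proof (induction Y arbitrary: e rule: finite_induct)
    case empty
    then show ?case unfolding L2_appr_def by (intro exI[of _ "\<lambda>x. 0"] exI[of _ "{}"]) auto
  next
    case (insert y Y)
    have "L2_appr m e' (\<lambda>x. y * indicator (?B y) x)" if "e' > 0" for e'
    proof (cases "y = 0")
      case True
      then show ?thesis using that unfolding L2_appr_def by (intro exI[of _ "\<lambda>x. 0"] exI[of _ "{}"]) auto
    next
      case False then show ?thesis using L2_appr_indicator[OF B Bfin[OF False] that] by blast
    qed
    moreover have "(\<lambda>x. y * indicator (?B y) x) \<in> borel_measurable m"
        "(\<lambda>x. \<Sum>y\<in>Y. y * indicator (?B y) x) \<in> borel_measurable m"
      using B by (auto intro!: borel_measurable_sum borel_measurable_times borel_measurable_indicator)
    ultimately have "L2_appr m e (\<lambda>x. y * indicator (?B y) x + (\<Sum>y\<in>Y. y * indicator (?B y) x))"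
      using insert by (intro L2_appr_add) auto
    then show ?case unfolding sum.insert[OF insert(1,2)] .
  qed
  from this[OF simple_functionD(1)[OF s] e]
  obtain g K where g: "continuous_map T euclidean g" "compactin T K" "\<forall>x\<in>topspace T - K. g x = 0"
      "(\<integral>\<^sup>+x. ennreal ((cmod ((\<Sum>y\<in>s ` space m. y * indicator (?B y) x) - g x))\<^sup>2) \<partial>m) < ennreal e"
    unfolding L2_appr_def by auto
  have "(\<Sum>y\<in>s ` space m. y * indicator (?B y) x) = s x" if x: "x \<in> space m" for x
  proof -
    have "(\<Sum>y\<in>s ` space m. y * indicator (?B y) x) = (\<Sum>y\<in>s ` space m. if y = s x then y else 0)"
      using x by (intro sum.cong) (auto simp: indicator_def)
    then show ?thesis using simple_functionD(1)[OF s] x by simp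
  qed
  then have "(\<integral>\<^sup>+x. ennreal ((cmod (s x - g x))\<^sup>2) \<partial>m) < ennreal e"
    using g(4) by (simp cong: nn_integral_cong_simp)
  then show ?thesis using g unfolding L2_appr_def by blast
qed

text \<open>Simple functions bounded by 2 |F| converge to \<open>F\<close> in L^2 by dominated
  convergence, and their nonzero values are taken on sets of finite measure.\<close>

lemma L2_dense_Cc:
  assumes F: "F \<in> L2_functions m" and e: "e > 0"
  obtains g K where "continuous_map T euclidean g" "compactin T K" "\<And>x. x \<in> topspace T - K \<Longrightarrow> g x = 0"
    "g \<in> L2_functions m" "(\<integral>x. (cmod (F x - g x))\<^sup>2 \<partial>m) < e"
proof -
  note [measurable] = L2_measurable[OF F]
  obtain s where s: "\<And>i. simple_function m (s i)" "\<And>x. x \<in> space m \<Longrightarrow> (\<lambda>i. s i x) \<longlonglongrightarrow> F x"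
      "\<And>i x. x \<in> space m \<Longrightarrow> cmod (s i x) \<le> 2 * cmod (F x)"
    using borel_measurable_implies_sequence_metric[OF L2_measurable[OF F], of 0] by simp metis
  have [measurable]: "s i \<in> borel_measurable m" for i using s(1) by (rule borel_measurable_simple_function)
  have sL2: "s i \<in> L2_functions m" for i
  proof -
    have "integrable m (\<lambda>x. (cmod (s i x))\<^sup>2)"
    proof (rule Bochner_Integration.integrable_bound)
      show "integrable m (\<lambda>x. 4 * (cmod (F x))\<^sup>2)" using F by (intro integrable_mult_right L2_integrable_square)
      show "AE x in m. norm ((cmod (s i x))\<^sup>2) \<le> norm (4 * (cmod (F x))\<^sup>2)"
      proof (rule AE_I2)
        fix x assume "x \<in> space m"
        from power_mono[OF s(3)[OF this] norm_ge_zero, of i 2]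
        show "norm ((cmod (s i x))\<^sup>2) \<le> norm (4 * (cmod (F x))\<^sup>2)" by (simp add: power_mult_distrib)
      qed
    qed measurable
    then show ?thesis by (simp add: L2_functions_def)
  qed
  have "(\<lambda>i. \<integral>x. (cmod (F x - s i x))\<^sup>2 \<partial>m) \<longlonglongrightarrow> (\<integral>x. 0 \<partial>m)"
  proof (rule integral_dominated_convergence)
    show "integrable m (\<lambda>x. 9 * (cmod (F x))\<^sup>2)" using F by (intro integrable_mult_right L2_integrable_square)
    show "AE x in m. (\<lambda>i. (cmod (F x - s i x))\<^sup>2) \<longlonglongrightarrow> 0"
    proof (rule AE_I2)
      fix x assume "x \<in> space m"
      then have "(\<lambda>i. (cmod (F x - s i x))\<^sup>2) \<longlonglongrightarrow> (cmod (F x - F x))\<^sup>2" by (intro tendsto_intros s)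
      then show "(\<lambda>i. (cmod (F x - s i x))\<^sup>2) \<longlonglongrightarrow> 0" by simp
    qed
    show "AE x in m. norm ((cmod (F x - s i x))\<^sup>2) \<le> 9 * (cmod (F x))\<^sup>2" for i
    proof (rule AE_I2)
      fix x assume x: "x \<in> space m"
      have "cmod (F x - s i x) \<le> 3 * cmod (F x)"
        using norm_triangle_ineq4[of "F x" "s i x"] s(3)[OF x, of i] by simp
      from power_mono[OF this norm_ge_zero, of 2]
      show "norm ((cmod (F x - s i x))\<^sup>2) \<le> 9 * (cmod (F x))\<^sup>2" by (simp add: power_mult_distrib)
    qed
  qed measurable
  then have "(\<lambda>i. \<integral>x. (cmod (F x - s i x))\<^sup>2 \<partial>m) \<longlonglongrightarrow> 0" by simp
  then have "\<forall>\<^sub>F i in sequentially. (\<integral>x. (cmod (F x - s i x))\<^sup>2 \<partial>m) < e / 4"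
    using e by (intro order_tendstoD(2)) auto
  from eventually_happens'[OF sequentially_bot this]
  obtain i where i: "(\<integral>x. (cmod (F x - s i x))\<^sup>2 \<partial>m) < e / 4" by blast
  have e4: "e / 4 > 0" using e by simp
  have "(\<integral>\<^sup>+x. ennreal ((cmod (s i x))\<^sup>2) \<partial>m) < \<infinity>" using sL2[of i] by (simp add: L2_functions_iff)
  from L2_appr_simple[OF s(1) this e4]
  obtain g K where g: "continuous_map T euclidean g" "compactin T K" "\<forall>x\<in>topspace T - K. g x = 0"
      "(\<integral>\<^sup>+x. ennreal ((cmod (s i x - g x))\<^sup>2) \<partial>m) < ennreal (e/4)"
    unfolding L2_appr_def by auto
  note [measurable] = continuous_measurable[OF g(1)]
  have d: "(\<lambda>x. s i x - g x) \<in> L2_functions m"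
    using g(4) by (auto simp: L2_functions_iff intro: less_trans)
  have gL2: "g \<in> L2_functions m" using L2_diff[OF sL2[of i] d] by simp
  have "ennreal (\<integral>x. (cmod (s i x - g x))\<^sup>2 \<partial>m) < ennreal (e/4)"
    using g(4) L2_nn_integral[OF d] by simp
  then have d4: "(\<integral>x. (cmod (s i x - g x))\<^sup>2 \<partial>m) < e/4" by (simp add: ennreal_less_iff)
  have le: "(cmod (F x - g x))\<^sup>2 \<le> 2 * (cmod (F x - s i x))\<^sup>2 + 2 * (cmod (s i x - g x))\<^sup>2" for x
    using cmod_add_square_le[of "F x - s i x" "s i x - g x"] by simp
  have "(\<integral>x. (cmod (F x - g x))\<^sup>2 \<partial>m) \<le> (\<integral>x. 2 * (cmod (F x - s i x))\<^sup>2 + 2 * (cmod (s i x - g x))\<^sup>2 \<partial>m)"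
    using le F gL2 sL2 d by (intro integral_mono Bochner_Integration.integrable_add integrable_mult_right
        L2_integrable_square L2_diff)
  also have "\<dots> = 2 * (\<integral>x. (cmod (F x - s i x))\<^sup>2 \<partial>m) + 2 * (\<integral>x. (cmod (s i x - g x))\<^sup>2 \<partial>m)"
    using L2_integrable_square[OF L2_diff[OF F sL2[of i]]] L2_integrable_square[OF d] by simp
  also have "\<dots> < e" using i d4 by simp
  finally have "(\<integral>x. (cmod (F x - g x))\<^sup>2 \<partial>m) < e" .
  with g gL2 show ?thesis by (intro that[of g K]) auto
qed

end

end

section \<open>Cosets and invariant measures\<close>

lemma continuous_map_measurable:
  assumes f: "continuous_map T T' f"
    and m: "sets m = sets (borel_of_topology T)" and m': "sets m' = sets (borel_of_topology T')"
  shows "f \<in> measurable m m'"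
proof -
  have sp: "space m = topspace T" "space m' = topspace T'"
    using sets_eq_imp_space_eq[OF m] sets_eq_imp_space_eq[OF m'] by (simp_all add: space_borel_of_topology)
  show ?thesis
  proof (rule measurable_sigma_sets)
    show "sets m' = sigma_sets (topspace T') {U. openin T' U}" by (simp add: m' sets_borel_of_topology)
    show "{U. openin T' U} \<subseteq> Pow (topspace T')" by (auto dest: openin_subset)
    show "f \<in> space m \<rightarrow> topspace T'" using f by (auto simp: sp continuous_map_def)
    fix U assume "U \<in> {U. openin T' U}"
    then have "openin T {x \<in> topspace T. f x \<in> U}" using f by (simp add: continuous_map_def)
    moreover have "f -` U \<inter> space m = {x \<in> topspace T. f x \<in> U}" by (auto simp: sp)
    ultimately show "f -` U \<inter> space m \<in> sets m" using openin_in_borel m by metis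
  qed
qed

text \<open>With countable bases an open set of the product is a countable union of open rectangles.
  Jointly continuous maps thereby become measurable for the product sigma-algebra, as Fubini
  requires.\<close>

lemma openin_prod_in_sets:
  assumes T1: "second_countable T1" and T2: "second_countable T2"
    and m1: "sets m1 = sets (borel_of_topology T1)" and m2: "sets m2 = sets (borel_of_topology T2)"
    and W: "openin (prod_topology T1 T2) W"
  shows "W \<in> sets (m1 \<Otimes>\<^sub>M m2)"
proof -
  obtain B1 where B1: "countable B1" "\<And>V. V \<in> B1 \<Longrightarrow> openin T1 V"
      "\<And>U x. openin T1 U \<Longrightarrow> x \<in> U \<Longrightarrow> \<exists>V\<in>B1. x \<in> V \<and> V \<subseteq> U"
    using T1 unfolding second_countable_def by auto
  obtain B2 where B2: "countable B2" "\<And>V. V \<in> B2 \<Longrightarrow> openin T2 V"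
      "\<And>U x. openin T2 U \<Longrightarrow> x \<in> U \<Longrightarrow> \<exists>V\<in>B2. x \<in> V \<and> V \<subseteq> U"
    using T2 unfolding second_countable_def by auto
  let ?R = "{(A, B). A \<in> B1 \<and> B \<in> B2 \<and> A \<times> B \<subseteq> W}"
  have "?R \<subseteq> B1 \<times> B2" by auto
  then have cR: "countable ?R" using B1(1) B2(1) by (meson countable_SIGMA countable_subset)
  have "W = (\<Union>(A, B)\<in>?R. A \<times> B)"
  proof
    show "W \<subseteq> (\<Union>(A, B)\<in>?R. A \<times> B)"
    proof
      fix p assume p: "p \<in> W"
      obtain x y where xy: "p = (x, y)" by fastforce
      have "\<exists>U V. openin T1 U \<and> openin T2 V \<and> x \<in> U \<and> y \<in> V \<and> U \<times> V \<subseteq> W"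
        using W p xy unfolding openin_prod_topology_alt by blast
      then obtain U V where UV: "openin T1 U" "openin T2 V" "x \<in> U" "y \<in> V" "U \<times> V \<subseteq> W" by blast
      obtain A where A: "A \<in> B1" "x \<in> A" "A \<subseteq> U" using B1(3)[OF UV(1,3)] by blast
      obtain B where B: "B \<in> B2" "y \<in> B" "B \<subseteq> V" using B2(3)[OF UV(2,4)] by blast
      have "A \<times> B \<subseteq> W" using A(3) B(3) UV(5) by auto
      then have "(A, B) \<in> ?R" using A B by simp
      then show "p \<in> (\<Union>(A, B)\<in>?R. A \<times> B)" using xy A B by blast
    qed
  qed auto
  moreover have "A \<times> B \<in> sets (m1 \<Otimes>\<^sub>M m2)" if "(A, B) \<in> ?R" for A B
    using that openin_in_borel[OF B1(2)[of A]] openin_in_borel[OF B2(2)[of B]] m1 m2 by (intro pair_measureI) auto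
  then have "(\<Union>(A, B)\<in>?R. A \<times> B) \<in> sets (m1 \<Otimes>\<^sub>M m2)"
    by (intro sets.countable_UN'[OF cR]) auto
  ultimately show ?thesis by simp
qed

lemma prod_continuous_measurable:
  assumes T1: "second_countable T1" and T2: "second_countable T2"
    and m1: "sets m1 = sets (borel_of_topology T1)" and m2: "sets m2 = sets (borel_of_topology T2)"
    and m': "sets m' = sets (borel_of_topology T')"
    and f: "continuous_map (prod_topology T1 T2) T' f"
  shows "f \<in> measurable (m1 \<Otimes>\<^sub>M m2) m'"
proof -
  have sp: "space m1 = topspace T1" "space m2 = topspace T2"
    using sets_eq_imp_space_eq[OF m1] sets_eq_imp_space_eq[OF m2] by (simp_all add: space_borel_of_topology)
  show ?thesis
  proof (rule measurable_sigma_sets)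
    show "sets m' = sigma_sets (topspace T') {U. openin T' U}" by (simp add: m' sets_borel_of_topology)
    show "{U. openin T' U} \<subseteq> Pow (topspace T')" by (auto dest: openin_subset)
    show "f \<in> space (m1 \<Otimes>\<^sub>M m2) \<rightarrow> topspace T'"
      using f by (auto simp: space_pair_measure sp continuous_map_def)
    fix U assume "U \<in> {U. openin T' U}"
    then have "openin (prod_topology T1 T2) {x \<in> topspace (prod_topology T1 T2). f x \<in> U}"
      using f by (simp add: continuous_map_def)
    moreover have "f -` U \<inter> space (m1 \<Otimes>\<^sub>M m2) = {x \<in> topspace (prod_topology T1 T2). f x \<in> U}"
      by (auto simp: space_pair_measure sp)
    ultimately show "f -` U \<inter> space (m1 \<Otimes>\<^sub>M m2) \<in> sets (m1 \<Otimes>\<^sub>M m2)"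
      using openin_prod_in_sets[OF T1 T2 m1 m2] by metis
  qed
qed

lemma second_countable_euclidean: "second_countable (euclidean :: 'a::second_countable_topology topology)"
proof -
  obtain B :: "'a set set" where B: "countable B" "topological_basis B"
    using ex_countable_basis by blast
  show ?thesis unfolding second_countable_def
    using B(1) topological_basis_open[OF B(2)] topological_basisE[OF B(2)]
    by (intro exI[of _ B]) (metis open_openin)
qed

lemma lch_euclidean:
  assumes "locally_compact_space (euclidean :: 'a::{t2_space, second_countable_topology} topology)"
  shows "lch (euclidean :: 'a topology)"
proof
  show "Hausdorff_space (euclidean :: 'a topology)"
    unfolding Hausdorff_space_def using hausdorff by (auto simp: disjnt_def)
qed (use assms second_countable_euclidean in auto)

context lch
begin

lemma sigma_finite_measure_if_finite_on_compact:
  assumes m: "sets m = sets (borel_of_topology T)"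
    and fin: "\<And>K. compactin T K \<Longrightarrow> emeasure m K < \<infinity>"
  shows "sigma_finite_measure m"
proof -
  obtain K :: "nat \<Rightarrow> 'a set" where K: "\<And>n. compactin T (K n)" "incseq K" "(\<Union>n. K n) = topspace T"
    using open_exhaustion[OF openin_topspace] by metis
  have sp: "space m = topspace T"
    using sets_eq_imp_space_eq[OF m] by (simp add: space_borel_of_topology)
  show ?thesis
  proof
    show "\<exists>A. countable A \<and> A \<subseteq> sets m \<and> \<Union> A = space m \<and> (\<forall>a\<in>A. emeasure m a \<noteq> \<infinity>)"
      using K(1,3) compactin_in_borel fin m sp
      by (intro exI[of _ "range K"]) (auto simp: less_top[symmetric])
  qed
qed

end

text \<open>Invariance is given for images of sets; the image under \<open>tr (- s)\<close> is the
  preimage under \<open>tr s\<close>, which turns it into a statement on push-forward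
  measures.\<close>

lemma invariant_measure_distr:
  assumes inv: "invariant_measure T S tr m" and s: "s \<in> S" "- s \<in> S"
    and cont: "continuous_map T T (tr s)" "continuous_map T T (tr (- s))"
    and inverse: "\<And>x. x \<in> topspace T \<Longrightarrow> tr s (tr (- s) x) = x" "\<And>x. x \<in> topspace T \<Longrightarrow> tr (- s) (tr s x) = x"
  shows "distr m m (tr s) = m"
proof (rule measure_eqI)
  have m: "sets m = sets (borel_of_topology T)"
    and tr: "\<And>s B. s \<in> S \<Longrightarrow> B \<in> sets m \<Longrightarrow> emeasure m (tr s ` B) = emeasure m B"
    using inv by (auto simp: invariant_measure_def)
  have sp: "space m = topspace T"
    using sets_eq_imp_space_eq[OF m] by (simp add: space_borel_of_topology)
  have meas: "tr s \<in> measurable m m" by (rule continuous_map_measurable[OF cont(1) m m])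
  fix A assume "A \<in> sets (distr m m (tr s))"
  then have A: "A \<in> sets m" by simp
  have AT: "A \<subseteq> topspace T" using sets.sets_into_space[OF A] sp by simp
  have img: "tr (- s) x \<in> topspace T" if "x \<in> topspace T" for x
    using cont(2) that by (auto simp: continuous_map_def)
  have "tr s -` A \<inter> space m = tr (- s) ` A"
  proof
    show "tr s -` A \<inter> space m \<subseteq> tr (- s) ` A"
    proof
      fix x assume "x \<in> tr s -` A \<inter> space m"
      then have "x = tr (- s) (tr s x)" "tr s x \<in> A" using inverse(2) sp by auto
      then show "x \<in> tr (- s) ` A" by blast
    qed
    show "tr (- s) ` A \<subseteq> tr s -` A \<inter> space m" using AT inverse(1) img sp by auto
  qed
  then show "emeasure (distr m m (tr s)) A = emeasure m A"
    using A tr[OF s(2) A] meas by (simp add: emeasure_distr)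
qed simp

lemma uminus_zero_subgroup:
  assumes "H \<in> closed_subgroups"
  shows "closed H" "0 \<in> H" "\<And>s t. s \<in> H \<Longrightarrow> t \<in> H \<Longrightarrow> s + t \<in> H" "\<And>s. s \<in> H \<Longrightarrow> - s \<in> H"
  using assms by (auto simp: closed_subgroups_def)

section \<open>Locally compact abelian groups and their coset spaces\<close>

locale lc_group =
  fixes type_dummy :: "'g::{topological_ab_group_add, t2_space, second_countable_topology} itself"
  assumes lc_group: "locally_compact_space (euclidean :: 'g topology)"
begin

sublocale G: lch "euclidean :: 'g topology"
  by (rule lch_euclidean[OF lc_group])

lemma compact_neighbourhood:
  fixes K :: "'g set"
  assumes "compact K"
  shows "\<exists>U C. open U \<and> compact C \<and> K \<subseteq> U \<and> U \<subseteq> C"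
proof -
  have "\<exists>U L. openin euclidean U \<and> compactin euclidean L \<and> closedin euclidean L \<and> K \<subseteq> U \<and> U \<subseteq> L"
    using locally_compact_space_compact_closed_compact[THEN iffD1, OF disjI1, OF G.hausdorff G.loc_compact,
        rule_format, of K] assms by simp
  then show ?thesis by auto
qed

lemma compact_sum_set:
  fixes A B :: "'g set"
  assumes "compact A" "compact B"
  shows "compact ((\<lambda>(a, b). a + b) ` (A \<times> B))" "compact ((\<lambda>(a, b). a - b) ` (A \<times> B))"
  unfolding case_prod_unfold
  by (intro compact_continuous_image compact_Times continuous_intros assms)+

end

lemma coset_eq_iff:
  fixes H :: "'g::{topological_space, ab_group_add} set"
  assumes H: "H \<in> closed_subgroups"
  shows "coset H s = coset H t \<longleftrightarrow> t - s \<in> H"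
proof
  note sg = uminus_zero_subgroup[OF H]
  assume "coset H s = coset H t"
  moreover have "t \<in> coset H t" using imageI[OF sg(2), of "(+) t"] by (simp add: coset_def)
  ultimately obtain h where "h \<in> H" "t = s + h" by (auto simp: coset_def)
  then show "t - s \<in> H" by simp
next
  note sg = uminus_zero_subgroup[OF H]
  assume ts: "t - s \<in> H"
  have "s + h = t + (h + - (t - s))" "t + h = s + (h + (t - s))" for h by (simp_all add: algebra_simps)
  then have "s + h \<in> (+) t ` H" "t + h \<in> (+) s ` H" if "h \<in> H" for h
    using sg(3)[OF that sg(4)[OF ts]] sg(3)[OF that ts] by blast+
  then show "coset H s = coset H t" unfolding coset_def by blast
qed

lemma mem_coset_self: "H \<in> closed_subgroups \<Longrightarrow> s \<in> coset H s" for s :: "'g::{topological_space, ab_group_add}"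
  using imageI[OF uminus_zero_subgroup(2), of H "(+) s"] by (simp add: coset_def)

lemma coset_coset_rep:
  fixes H :: "'g::{topological_space, ab_group_add} set"
  assumes H: "H \<in> closed_subgroups" and c: "c \<in> range (coset H)"
  shows "coset H (coset_rep c) = c"
proof -
  obtain s where s: "c = coset H s" using c by blast
  have "coset_rep c \<in> c" unfolding coset_rep_def s by (rule someI[of "\<lambda>u. u \<in> coset H s", OF mem_coset_self[OF H]])
  then obtain h where "h \<in> H" "coset_rep c = s + h" using s by (auto simp: coset_def)
  then have "coset H s = coset H (coset_rep c)" using coset_eq_iff[OF H] by simp
  then show ?thesis using s by simp
qed

lemma coset_rep_coset:
  fixes H :: "'g::{topological_space, ab_group_add} set"
  assumes H: "H \<in> closed_subgroups"
  shows "\<exists>h\<in>H. coset_rep (coset H s) = s + h"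
proof -
  have "coset H s = coset H (coset_rep (coset H s))" using coset_coset_rep[OF H, of "coset H s"] by simp
  then have "coset_rep (coset H s) - s \<in> H" using coset_eq_iff[OF H] by simp
  then show ?thesis by (intro bexI[of _ "coset_rep (coset H s) - s"]) auto
qed

lemma translate_coset: "(+) t ` coset H s = coset H (t + s)" for t :: "'g::ab_group_add"
  by (simp add: coset_def image_image add.assoc)

lemma translate_translate: "(+) s ` (+) t ` c = (+) (s + t) ` c" for t :: "'g::ab_group_add"
  by (simp add: image_image add.assoc)

lemma topspace_coset_topology: "topspace (coset_topology H) = range (coset H)"
proof
  show "topspace (coset_topology H) \<subseteq> range (coset H)"
    using openin_topspace[of "coset_topology H"] unfolding openin_coset_topology by (rule conjunct1)
  have "coset H -` range (coset H) = UNIV" by auto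
  then have "openin (coset_topology H) (range (coset H))" by (simp add: openin_coset_topology)
  then show "range (coset H) \<subseteq> topspace (coset_topology H)" by (rule openin_subset)
qed

locale coset_space = lc_group type_dummy
  for type_dummy :: "'g::{topological_ab_group_add, t2_space, second_countable_topology} itself" +
  fixes H :: "'g set"
  assumes H: "H \<in> closed_subgroups"
begin

abbreviation "q \<equiv> coset H"
abbreviation "Q \<equiv> coset_topology H"

lemma continuous_q: "continuous_map euclidean Q q"
proof -
  have "open {s. q s \<in> U}" if "openin Q U" for U
  proof -
    have "open (q -` U)" using that unfolding openin_coset_topology by (rule conjunct2)
    then show ?thesis unfolding vimage_def .
  qed
  then show ?thesis by (simp add: continuous_map_def topspace_coset_topology)
qed

text \<open>The saturation of \<open>A\<close> is the union of its translates by elements of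
  \<open>H\<close>.\<close>

lemma open_q_image:
  assumes "open A"
  shows "openin Q (q ` A)"
proof -
  have "q -` q ` A = (\<Union>h\<in>H. (\<lambda>s. s + h) -` A)"
  proof
    show "q -` q ` A \<subseteq> (\<Union>h\<in>H. (\<lambda>s. s + h) -` A)"
    proof
      fix s assume "s \<in> q -` q ` A"
      then obtain a where a: "a \<in> A" "coset H s = coset H a" by auto
      then have "a - s \<in> H" using coset_eq_iff[OF H] by simp
      moreover have "s + (a - s) \<in> A" using a by simp
      ultimately show "s \<in> (\<Union>h\<in>H. (\<lambda>s. s + h) -` A)" by blast
    qed
    show "(\<Union>h\<in>H. (\<lambda>s. s + h) -` A) \<subseteq> q -` q ` A"
    proof
      fix s assume "s \<in> (\<Union>h\<in>H. (\<lambda>s. s + h) -` A)"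
      then obtain h where h: "h \<in> H" "s + h \<in> A" by blast
      then have "coset H s = coset H (s + h)" using coset_eq_iff[OF H] by simp
      then show "s \<in> q -` q ` A" using h(2) by blast
    qed
  qed
  moreover have "open (\<Union>h\<in>H. (\<lambda>s. s + h) -` A)"
    using assms by (intro open_UN ballI open_vimage continuous_intros)
  ultimately show ?thesis unfolding openin_coset_topology by auto
qed

lemma open_map_q: "open_map euclidean Q q"
  unfolding open_map_def using open_q_image by (simp flip: open_openin)

text \<open>Since \<open>H\<close> is closed, b - a stays outside \<open>H\<close> for all (a, b) in
  a box around (s, t), and then the images of the two sides of the box are disjoint.\<close>

lemma hausdorff_Q: "Hausdorff_space Q"
  unfolding Hausdorff_space_def
proof (intro allI impI)
  fix c d assume cd: "c \<in> topspace Q \<and> d \<in> topspace Q \<and> c \<noteq> d"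
  then obtain s t where s: "c = q s" "d = q t" unfolding topspace_coset_topology by blast
  with cd have st: "c = q s" "d = q t" "t - s \<notin> H" using coset_eq_iff[OF H, of s t] by simp_all
  have "open (- H)" using uminus_zero_subgroup(1)[OF H] by auto
  then have "open ((\<lambda>(a, b). b - a) -` (- H))"
    by (rule open_vimage) (unfold case_prod_unfold, intro continuous_intros)
  moreover have "(s, t) \<in> (\<lambda>(a, b). b - a) -` (- H)" using st by simp
  ultimately obtain A B where AB: "open A" "open B" "s \<in> A" "t \<in> B" "A \<times> B \<subseteq> (\<lambda>(a, b). b - a) -` (- H)"
    by (metis open_prod_elim mem_Sigma_iff)
  have "disjnt (q ` A) (q ` B)"
  proof -
    have False if "a \<in> A" "b \<in> B" "coset H a = coset H b" for a b
    proof -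
      have "b - a \<in> H" using that coset_eq_iff[OF H] by simp
      moreover have "(a, b) \<in> (\<lambda>(a, b). b - a) -` (- H)" using AB(5) that by blast
      ultimately show False by simp
    qed
    then show ?thesis by (auto simp: disjnt_def)
  qed
  then show "\<exists>U V. openin Q U \<and> openin Q V \<and> c \<in> U \<and> d \<in> V \<and> disjnt U V"
    using open_q_image[OF AB(1)] open_q_image[OF AB(2)] AB(3,4) st(1,2) by blast
qed

sublocale Q: lch "coset_topology H"
proof
  have im: "q ` topspace euclidean = topspace Q" by (simp add: topspace_coset_topology)
  show "locally_compact_space Q"
    using locally_compact_space_continuous_open_map_image[OF continuous_q open_map_q im lc_group] .
  show "Hausdorff_space Q" by (rule hausdorff_Q)
  show "second_countable Q"
    using second_countable_open_map_image[OF continuous_q open_map_q im second_countable_euclidean] .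
qed

text \<open>The images of relatively compact open subsets of \<open>G\<close> form an open cover of
  the coset space, of which finitely many suffice for \<open>K\<close>.\<close>

lemma compactin_lift:
  assumes K: "compactin Q K"
  obtains C where "compact C" "K \<subseteq> q ` C"
proof -
  have "\<exists>U C. open U \<and> compact C \<and> s \<in> U \<and> U \<subseteq> C" for s :: 'g
    using compact_neighbourhood[of "{s}"] by auto
  then obtain U C where UC: "\<And>s :: 'g. open (U s)" "\<And>s. compact (C s)" "\<And>s. s \<in> U s" "\<And>s. U s \<subseteq> C s"
    by metis
  have "\<forall>V\<in>range (\<lambda>s. q ` U s). openin Q V" using open_q_image UC(1) by blast
  moreover have "K \<subseteq> \<Union>(range (\<lambda>s. q ` U s))"
    using compactin_subset_topspace[OF K] UC(3) by (fastforce simp: topspace_coset_topology)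
  ultimately obtain F where F: "finite F" "F \<subseteq> range (\<lambda>s. q ` U s)" "K \<subseteq> \<Union>F"
    using K unfolding compactin_def by metis
  obtain S where S: "finite S" "F = (\<lambda>s. q ` U s) ` S"
    using finite_subset_image[OF F(1,2)] by auto
  have "compact (\<Union>s\<in>S. C s)" using S(1) UC(2) by (intro compact_UN) auto
  moreover have "(\<Union>s\<in>S. q ` U s) \<subseteq> q ` (\<Union>s\<in>S. C s)"
    unfolding image_UN by (intro UN_mono image_mono UC(4) order_refl)
  then have "K \<subseteq> q ` (\<Union>s\<in>S. C s)" using F(3) unfolding S(2) by (rule order_trans[rotated])
  ultimately show ?thesis using that by blast
qed

lemma compactin_q_image: "compact C \<Longrightarrow> compactin Q (q ` C)"
  using image_compactin[OF _ continuous_q] by simp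

text \<open>A box A x B found in \<open>G\<close> is mapped to the box A x q(B), which is open
  because \<open>q\<close> is an open map.\<close>

lemma translate_continuous: "continuous_map (prod_topology euclidean Q) Q (\<lambda>(t, c). (+) t ` c)"
  unfolding continuous_map_def
proof (intro conjI allI impI)
  show "(\<lambda>(t, c). (+) t ` c) \<in> topspace (prod_topology euclidean Q) \<rightarrow> topspace Q"
    by (auto simp: topspace_coset_topology translate_coset)
  fix O' assume O: "openin Q O'"
  have qO: "open (q -` O')" using O by (simp add: openin_coset_topology)
  show "openin (prod_topology euclidean Q)
      {p \<in> topspace (prod_topology euclidean Q). (case p of (t, c) \<Rightarrow> (+) t ` c) \<in> O'}"
    unfolding openin_prod_topology_alt
  proof (intro allI impI)
    fix t c assume "(t, c) \<in> {p \<in> topspace (prod_topology euclidean Q). (case p of (t, c) \<Rightarrow> (+) t ` c) \<in> O'}"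
    then obtain s where s: "c = q s" "q (t + s) \<in> O'"
      by (auto simp: topspace_coset_topology translate_coset)
    have "open ((\<lambda>(a, b). a + b) -` (q -` O'))"
      by (rule open_vimage[OF qO]) (unfold case_prod_unfold, intro continuous_intros)
    moreover have "(t, s) \<in> (\<lambda>(a, b). a + b) -` (q -` O')" using s by simp
    ultimately obtain A B where AB: "open A" "open B" "t \<in> A" "s \<in> B" "A \<times> B \<subseteq> (\<lambda>(a, b). a + b) -` (q -` O')"
      by (metis open_prod_elim mem_Sigma_iff)
    have "A \<times> q ` B \<subseteq> {p \<in> topspace (prod_topology euclidean Q). (case p of (t, c) \<Rightarrow> (+) t ` c) \<in> O'}"
      using AB(5) by (auto simp: topspace_coset_topology translate_coset)
    moreover have "openin euclidean A" using AB(1) by simp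
    moreover have "c \<in> q ` B" using AB(4) s(1) by blast
    ultimately show "\<exists>U V. openin euclidean U \<and> openin Q V \<and> t \<in> U \<and> c \<in> V \<and>
        U \<times> V \<subseteq> {p \<in> topspace (prod_topology euclidean Q). (case p of (t, c) \<Rightarrow> (+) t ` c) \<in> O'}"
      using open_q_image[OF AB(2)] AB(3) by (intro exI[of _ A] exI[of _ "q ` B"] conjI)
  qed
qed

lemma translate_continuous': "continuous_map Q Q ((`) ((+) t))"
proof -
  have "continuous_map Q (prod_topology euclidean Q) (\<lambda>c. (t, c))"
    by (simp add: continuous_map_pairwise o_def)
  from continuous_map_compose[OF this translate_continuous] show ?thesis by (simp add: o_def)
qed

lemma translate_in: "c \<in> topspace Q \<Longrightarrow> (+) t ` c \<in> topspace Q"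
  by (auto simp: topspace_coset_topology translate_coset)

end

section \<open>Haar measure on the group\<close>

locale haar_group = lc_group type_dummy
  for type_dummy :: "'g::{topological_ab_group_add, t2_space, second_countable_topology} itself" +
  fixes \<mu> :: "'g measure"
  assumes haar: "haar_measure \<mu>"
begin

lemma sets_\<mu> [measurable_cong]: "sets \<mu> = sets borel"
  using haar by (simp add: haar_measure_def invariant_measure_def sets_borel_of_topology_euclidean)

lemma space_\<mu>: "space \<mu> = UNIV"
  using sets_eq_imp_space_eq[OF sets_\<mu>] by simp

lemma finite_\<mu>: "compact K \<Longrightarrow> emeasure \<mu> K < \<infinity>"
  using haar compact_imp_closed[of K]
  by (simp add: haar_measure_def invariant_measure_def sets_borel_of_topology_euclidean)

lemma sigma_finite_\<mu>: "sigma_finite_measure \<mu>"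
  using finite_\<mu> sets_\<mu>
  by (intro G.sigma_finite_measure_if_finite_on_compact) (simp_all add: sets_borel_of_topology_euclidean)

lemma distr_\<mu>: "distr \<mu> \<mu> ((+) s) = \<mu>"
proof (rule invariant_measure_distr)
  show "invariant_measure euclidean UNIV (+) \<mu>" using haar by (simp add: haar_measure_def)
  show "continuous_map euclidean euclidean ((+) s)" "continuous_map euclidean euclidean ((+) (- s))"
    unfolding continuous_map_iff_continuous2 by (intro continuous_intros)+
qed simp_all

lemma measurable_\<mu> [measurable (raw)]:
  "f \<in> borel_measurable borel \<Longrightarrow> f \<in> borel_measurable \<mu>"
  by (simp cong: measurable_cong_sets add: sets_\<mu>)

lemma measurable_\<mu>_comp:
  "f \<in> borel_measurable borel \<Longrightarrow> continuous_on UNIV h \<Longrightarrow> (\<lambda>t :: 'g. f (h t)) \<in> borel_measurable \<mu>"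
  by (rule measurable_\<mu>, rule measurable_compose[OF borel_measurable_continuous_onI])

lemma plus_measurable_\<mu> [measurable]: "(+) s \<in> measurable \<mu> \<mu>"
  unfolding measurable_cong_sets[OF sets_\<mu> sets_\<mu>]
  by (intro borel_measurable_continuous_onI continuous_intros)

lemma nn_integral_\<mu>_translate:
  assumes [measurable]: "f \<in> borel_measurable \<mu>"
  shows "(\<integral>\<^sup>+t. f (s + t) \<partial>\<mu>) = (\<integral>\<^sup>+t. f t \<partial>\<mu>)"
proof -
  have "(\<integral>\<^sup>+t. f t \<partial>\<mu>) = (\<integral>\<^sup>+t. f t \<partial>distr \<mu> \<mu> ((+) s))" by (simp add: distr_\<mu>)
  also have "\<dots> = (\<integral>\<^sup>+t. f (s + t) \<partial>\<mu>)" by (rule nn_integral_distr) measurable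
  finally show ?thesis by simp
qed

text \<open>If \<open>U\<close> were null, countably many of its translates would cover
  \<open>G\<close> by the Lindelof property, and \<mu> would vanish.\<close>

lemma emeasure_\<mu>_open:
  assumes U: "open U" "U \<noteq> {}"
  shows "emeasure \<mu> U \<noteq> 0"
proof
  assume 0: "emeasure \<mu> U = 0"
  obtain u where u: "u \<in> U" using U by blast
  have tr: "emeasure \<mu> ((+) s ` U) = 0" for s
    using haar 0 U(1) by (simp add: haar_measure_def invariant_measure_def sets_borel_of_topology_euclidean)
  have open_tr: "open ((+) s ` U)" for s
  proof -
    have "(+) s ` U = (\<lambda>t. - s + t) -` U"
    proof
      show "(\<lambda>t. - s + t) -` U \<subseteq> (+) s ` U"
      proof
        fix t assume "t \<in> (\<lambda>t. - s + t) -` U"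
        then have "- s + t \<in> U" "t = s + (- s + t)" by simp_all
        then show "t \<in> (+) s ` U" by blast
      qed
    qed auto
    moreover have "open ((\<lambda>t. - s + t) -` U)" using U(1) by (intro open_vimage continuous_intros)
    ultimately show ?thesis by simp
  qed
  have un: "\<Union>(range (\<lambda>s. (+) s ` U)) = UNIV"
  proof -
    have "t \<in> (+) (t - u) ` U" for t using u by (intro image_eqI[of _ _ u]) simp_all
    then show ?thesis by blast
  qed
  have op: "open S" if "S \<in> range (\<lambda>s. (+) s ` U)" for S using that open_tr by auto
  obtain \<V> where V: "\<V> \<subseteq> range (\<lambda>s. (+) s ` U)" "countable \<V>" "\<Union>\<V> = \<Union>(range (\<lambda>s. (+) s ` U))"
    by (rule Lindelof[OF op])
  have "(\<Union>A\<in>\<V>. A) \<in> null_sets \<mu>"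
  proof (rule null_sets_UN'[OF V(2)])
    fix A assume "A \<in> \<V>"
    then obtain s where "A = (+) s ` U" using V(1) by blast
    then show "A \<in> null_sets \<mu>" using tr[of s] open_tr[of s] sets_\<mu> by (simp add: null_sets_def)
  qed
  then have "emeasure \<mu> (\<Union>\<V>) = 0" by (simp add: null_sets_def)
  then have "emeasure \<mu> (topspace euclidean) = 0" using V(3) un by simp
  then show False using haar by (simp add: haar_measure_def invariant_measure_def)
qed

lemma pair_sigma_finite_\<mu>: "pair_sigma_finite \<mu> \<mu>"
  using sigma_finite_\<mu> by (simp add: pair_sigma_finite_def)

lemma pair_measurable_\<mu>:
  assumes "f \<in> borel_measurable borel"
  shows "(\<lambda>(x, y). f (x + y)) \<in> borel_measurable (\<mu> \<Otimes>\<^sub>M \<mu>)" "(\<lambda>(x, y). f (x - y)) \<in> borel_measurable (\<mu> \<Otimes>\<^sub>M \<mu>)"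
proof -
  have "sets (\<mu> \<Otimes>\<^sub>M \<mu>) = sets ((borel :: 'g measure) \<Otimes>\<^sub>M (borel :: 'g measure))"
    by (rule sets_pair_measure_cong[OF sets_\<mu> sets_\<mu>])
  then have s: "sets (\<mu> \<Otimes>\<^sub>M \<mu>) = sets (borel :: ('g \<times> 'g) measure)"
    unfolding borel_prod .
  have "(\<lambda>p. fst p + snd p :: 'g) \<in> borel_measurable borel" "(\<lambda>p. fst p - snd p :: 'g) \<in> borel_measurable borel"
    by (intro borel_measurable_continuous_onI continuous_intros)+
  from this[THEN measurable_compose, OF assms]
  show "(\<lambda>(x, y). f (x + y)) \<in> borel_measurable (\<mu> \<Otimes>\<^sub>M \<mu>)" "(\<lambda>(x, y). f (x - y)) \<in> borel_measurable (\<mu> \<Otimes>\<^sub>M \<mu>)"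
    by (simp_all add: case_prod_unfold measurable_cong_sets[OF s refl])
qed

text \<open>Both sides times \<open>\<mu> N\<close> equal the integral of \<open>1\<^sub>N (x + y) f x\<close> over \<open>\<mu> \<times> \<mu>\<close>, for a
  relatively compact open set \<open>N\<close>.\<close>

lemma nn_integral_\<mu>_uminus:
  assumes f: "f \<in> borel_measurable borel"
  shows "(\<integral>\<^sup>+t. f (- t) \<partial>\<mu>) = (\<integral>\<^sup>+t. f t \<partial>\<mu>)"
proof -
 obtain N C :: "'g set" where N: "open N" "compact C" "{0} \<subseteq> N" "N \<subseteq> C"
    using compact_neighbourhood[OF compact_sing[of 0]] by blast
  have Nb: "N \<in> sets borel" using N(1) by simp
  have N0: "emeasure \<mu> N \<noteq> 0" using N(1,3) by (intro emeasure_\<mu>_open) auto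
  have "emeasure \<mu> N \<le> emeasure \<mu> C" using N compact_imp_closed[OF N(2)] by (intro emeasure_mono) (auto simp: sets_\<mu> borel_closed)
  then have Nfin: "emeasure \<mu> N \<noteq> \<infinity>" using finite_\<mu>[OF N(2)] by (auto simp: top_unique)
  interpret pair_sigma_finite \<mu> \<mu> by (rule pair_sigma_finite_\<mu>)
  have Nm: "(indicator N :: 'g \<Rightarrow> ennreal) \<in> borel_measurable borel" using Nb by simp
  have fm: "f \<in> borel_measurable \<mu>" using f by (rule measurable_\<mu>)
  have f_minus: "(\<lambda>t. f (- t)) \<in> borel_measurable \<mu>" "(\<lambda>t. f (x - t)) \<in> borel_measurable \<mu>" for x
    by (intro measurable_\<mu>_comp[OF f] continuous_intros)+
  have shift_minus: "(\<integral>\<^sup>+y. f (x - y) \<partial>\<mu>) = (\<integral>\<^sup>+y. f (- y) \<partial>\<mu>)" for x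
    using nn_integral_\<mu>_translate[OF f_minus(2)[of x], of x] by simp
  have shift_N: "(\<integral>\<^sup>+y. indicator N (x + y) * c \<partial>\<mu>) = emeasure \<mu> N * c" for x and c :: ennreal
    using nn_integral_\<mu>_translate[OF measurable_\<mu>[OF Nm], of x] Nb
      nn_integral_multc[OF measurable_\<mu>_comp[OF Nm, of "(+) x"], of c]
    by (simp add: sets_\<mu> continuous_intros)
  have "(\<integral>\<^sup>+x. \<integral>\<^sup>+y. indicator N (x + y) * f x \<partial>\<mu> \<partial>\<mu>) = (\<integral>\<^sup>+x. emeasure \<mu> N * f x \<partial>\<mu>)"
    by (simp only: shift_N)
  also have "\<dots> = emeasure \<mu> N * (\<integral>\<^sup>+x. f x \<partial>\<mu>)" by (rule nn_integral_cmult[OF fm])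
  finally have 1: "(\<integral>\<^sup>+x. \<integral>\<^sup>+y. indicator N (x + y) * f x \<partial>\<mu> \<partial>\<mu>) = emeasure \<mu> N * (\<integral>\<^sup>+x. f x \<partial>\<mu>)" .
  have "(\<integral>\<^sup>+x. \<integral>\<^sup>+y. indicator N (x + y) * f x \<partial>\<mu> \<partial>\<mu>) = (\<integral>\<^sup>+y. \<integral>\<^sup>+x. indicator N (x + y) * f x \<partial>\<mu> \<partial>\<mu>)"
  proof (rule Fubini'[symmetric])
    show "(\<lambda>(x, y). indicator N (x + y) * f x) \<in> borel_measurable (\<mu> \<Otimes>\<^sub>M \<mu>)"
      using measurable_compose[OF measurable_fst fm] pair_measurable_\<mu>(1)[OF Nm]
      unfolding case_prod_unfold by (intro borel_measurable_times_ennreal)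
  qed
  also have "(\<integral>\<^sup>+y. \<integral>\<^sup>+x. indicator N (x + y) * f x \<partial>\<mu> \<partial>\<mu>) = (\<integral>\<^sup>+y. \<integral>\<^sup>+x. indicator N x * f (x - y) \<partial>\<mu> \<partial>\<mu>)"
  proof (rule nn_integral_cong)
    fix y
    have "(\<lambda>x. indicator N (x + y) * f x) \<in> borel_measurable \<mu>"
      by (intro borel_measurable_times_ennreal fm measurable_\<mu>_comp[OF Nm] continuous_intros)
    from nn_integral_\<mu>_translate[OF this, of "- y"]
    show "(\<integral>\<^sup>+x. indicator N (x + y) * f x \<partial>\<mu>) = (\<integral>\<^sup>+x. indicator N x * f (x - y) \<partial>\<mu>)" by simp
  qed
  also have "\<dots> = (\<integral>\<^sup>+x. \<integral>\<^sup>+y. indicator N x * f (x - y) \<partial>\<mu> \<partial>\<mu>)"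
  proof (rule Fubini')
    show "(\<lambda>(x, y). indicator N x * f (x - y)) \<in> borel_measurable (\<mu> \<Otimes>\<^sub>M \<mu>)"
      using measurable_compose[OF measurable_fst measurable_\<mu>[OF Nm]] pair_measurable_\<mu>(2)[OF f]
      unfolding case_prod_unfold by (intro borel_measurable_times_ennreal)
  qed
  also have "\<dots> = (\<integral>\<^sup>+x. indicator N x * (\<integral>\<^sup>+y. f (- y) \<partial>\<mu>) \<partial>\<mu>)"
  proof (rule nn_integral_cong)
    fix x
    show "(\<integral>\<^sup>+y. indicator N x * f (x - y) \<partial>\<mu>) = indicator N x * (\<integral>\<^sup>+y. f (- y) \<partial>\<mu>)"
      using nn_integral_cmult[OF f_minus(2)[of x], of "indicator N x"] by (simp only: shift_minus)
  qed
  also have "\<dots> = emeasure \<mu> N * (\<integral>\<^sup>+y. f (- y) \<partial>\<mu>)"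
    using Nb nn_integral_multc[OF measurable_\<mu>[OF Nm]] by (simp add: sets_\<mu>)
  finally have "emeasure \<mu> N * (\<integral>\<^sup>+x. f x \<partial>\<mu>) = emeasure \<mu> N * (\<integral>\<^sup>+y. f (- y) \<partial>\<mu>)"
    using 1 by simp
  then show ?thesis using N0 Nfin by (simp add: ennreal_mult_cancel_left)
qed

end

section \<open>The invariant measure on the coset space\<close>

locale coset_measure = coset_space type_dummy H
  for type_dummy :: "'g::{topological_ab_group_add, t2_space, second_countable_topology} itself" and H +
  fixes m :: "'g set measure"
  assumes haar_quotient: "haar_measure_quotient H m"
begin

lemma sets_m: "sets m = sets (borel_of_topology Q)"
  using haar_quotient by (simp add: haar_measure_quotient_def invariant_measure_def)

lemma space_m: "space m = range q"
  using sets_eq_imp_space_eq[OF sets_m] by (simp add: space_borel_of_topology topspace_coset_topology)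

lemma finite_m: "compactin Q K \<Longrightarrow> emeasure m K < \<infinity>"
  using haar_quotient Q.compactin_in_borel[of K] by (simp add: haar_measure_quotient_def invariant_measure_def)

lemma sigma_finite_m: "sigma_finite_measure m"
  using Q.sigma_finite_measure_if_finite_on_compact[OF sets_m finite_m] .

lemma continuous_measurable_m: "continuous_map Q euclidean f \<Longrightarrow> f \<in> borel_measurable m"
  using continuous_map_measurable_borel[of Q f] by (simp add: measurable_cong_sets[OF sets_m refl])

lemma translate_measurable [measurable]: "(`) ((+) s) \<in> measurable m m"
  by (rule continuous_map_measurable[OF translate_continuous' sets_m sets_m])

lemma distr_m: "distr m m ((`) ((+) s)) = m"
proof (rule invariant_measure_distr)
  show "invariant_measure Q UNIV (\<lambda>s. (`) ((+) s)) m"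
    using haar_quotient by (simp add: haar_measure_quotient_def)
  show "continuous_map Q Q ((`) ((+) s))" "continuous_map Q Q ((`) ((+) (- s)))"
    by (rule translate_continuous')+
qed (auto simp: image_image)

lemma nn_integral_m_translate:
  assumes [measurable]: "f \<in> borel_measurable m"
  shows "(\<integral>\<^sup>+c. f ((+) s ` c) \<partial>m) = (\<integral>\<^sup>+c. f c \<partial>m)"
proof -
  have "(\<integral>\<^sup>+c. f c \<partial>m) = (\<integral>\<^sup>+c. f c \<partial>distr m m ((`) ((+) s)))" by (simp add: distr_m)
  also have "\<dots> = (\<integral>\<^sup>+c. f ((+) s ` c) \<partial>m)" by (rule nn_integral_distr) measurable
  finally show ?thesis by simp
qed

lemma integral_m_translate:
  fixes f :: "'g set \<Rightarrow> complex"
  assumes [measurable]: "f \<in> borel_measurable m"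
  shows "(\<integral>c. f ((+) s ` c) \<partial>m) = (\<integral>c. f c \<partial>m)"
proof -
  have "(\<integral>c. f c \<partial>m) = (\<integral>c. f c \<partial>distr m m ((`) ((+) s)))" by (simp add: distr_m)
  also have "\<dots> = (\<integral>c. f ((+) s ` c) \<partial>m)" by (rule integral_distr) measurable
  finally show ?thesis by simp
qed

lemma AE_translate: "AE c in m. P c \<Longrightarrow> AE c in m. P ((+) s ` c)"
  by (rule AE_distrD[OF translate_measurable]) (simp only: distr_m)

lemma L2_translate:
  assumes f: "f \<in> L2_functions m"
  shows "(\<lambda>c. f ((+) s ` c)) \<in> L2_functions m"
proof -
  note [measurable] = L2_measurable[OF f]
  have "(\<integral>\<^sup>+c. ennreal ((cmod (f ((+) s ` c)))\<^sup>2) \<partial>m) = (\<integral>\<^sup>+c. ennreal ((cmod (f c))\<^sup>2) \<partial>m)"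
    by (rule nn_integral_m_translate) measurable
  then show ?thesis using f by (simp add: L2_functions_iff)
qed

lemma translate_joint_measurable:
  assumes "sets M = sets borel"
  shows "(\<lambda>(t, c). (+) t ` c) \<in> measurable (M \<Otimes>\<^sub>M m) m"
proof (rule prod_continuous_measurable[OF second_countable_euclidean Q.second_countable _ sets_m sets_m translate_continuous])
  show "sets M = sets (borel_of_topology euclidean)" using assms by (simp only: sets_borel_of_topology_euclidean)
qed

end

section \<open>The representations induced from a stabilizer\<close>

context transformation_group
begin

lemma continuous_on_act:
  "continuous_on S f \<Longrightarrow> continuous_on S g \<Longrightarrow> continuous_on S (\<lambda>w. act (f w) (g w))"
  using continuous_on_compose2[OF act_continuous continuous_on_Pair[of S f g]] by simp

lemma stabilizer_closed_subgroup: "stabilizer act x \<in> closed_subgroups"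
proof -
  have "closed {s. act s x = x}"
    by (rule closed_Collect_eq) (intro continuous_on_act continuous_intros)+
  moreover have "act (- s) x = x" if "act s x = x" for s
    using act_add[of "- s" s x] that by (simp add: act_zero)
  ultimately show ?thesis
    by (simp add: closed_subgroups_def stabilizer_def act_zero act_add)
qed

end

lemma character_zero:
  fixes \<tau> :: "'g::{topological_space, group_add} \<Rightarrow> complex"
  assumes "\<tau> \<in> characters"
  shows "\<tau> 0 = 1"
proof -
  have "\<tau> (0 + 0) = \<tau> 0 * \<tau> 0" "cmod (\<tau> 0) = 1" using assms unfolding characters_def by blast+
  then have "\<tau> 0 * 1 = \<tau> 0 * \<tau> 0" "\<tau> 0 \<noteq> 0" by auto
  then show ?thesis unfolding mult_cancel_left by auto
qed

locale orbit_rep = transformation_group act + coset_measure "TYPE('g)" "stabilizer act x" m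
  for act :: "'g::{topological_ab_group_add, t2_space, second_countable_topology} \<Rightarrow>
      'x::{t2_space, second_countable_topology} \<Rightarrow> 'x"
    and x :: 'x and m :: "'g set measure" +
  fixes \<tau> :: "'g \<Rightarrow> complex"
  assumes \<tau>: "\<tau> \<in> characters"
begin

text \<open>The injection of the coset space into \<open>X\<close> induced by the orbit map;
  \<open>p_q\<close> removes the choice of a representative.\<close>

definition p :: "'g set \<Rightarrow> 'x" where "p c = act (coset_rep c) x"

lemma \<tau>_continuous: "continuous_on UNIV \<tau>" and \<tau>_norm: "cmod (\<tau> s) = 1"
  and \<tau>_add: "\<tau> (s + t) = \<tau> s * \<tau> t" and \<tau>_zero: "\<tau> 0 = 1"
  using \<tau> character_zero[OF \<tau>] unfolding characters_def by blast+

lemma \<tau>_cnj: "\<tau> s * cnj (\<tau> s) = 1"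
  unfolding complex_norm_square[symmetric] \<tau>_norm by simp

lemma p_q: "p (q s) = act s x"
proof -
  obtain h where "h \<in> stabilizer act x" "coset_rep (q s) = s + h" using coset_rep_coset[OF H] by blast
  then show ?thesis by (simp add: p_def act_add stabilizer_def)
qed

lemma p_translate: "c \<in> range q \<Longrightarrow> p ((+) t ` c) = act t (p c)"
  by (auto simp: translate_coset p_q act_add)

lemma continuous_p: "continuous_map Q euclidean p"
proof -
  have "openin Q {c \<in> topspace Q. p c \<in> U}" if "open U" for U
    unfolding openin_coset_topology
  proof
    have "q -` {c \<in> topspace Q. p c \<in> U} = (\<lambda>s. act s x) -` U"
      by (auto simp: topspace_coset_topology p_q)
    moreover have "open ((\<lambda>s. act s x) -` U)"
      using that by (intro open_vimage continuous_on_act continuous_intros)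
    ultimately show "open (q -` {c \<in> topspace Q. p c \<in> U})" by simp
  qed (auto simp: topspace_coset_topology)
  then show ?thesis by (simp add: continuous_map_def)
qed

lemma comp_p_measurable: "continuous_on UNIV f \<Longrightarrow> (\<lambda>c. f (p c)) \<in> borel_measurable m"
  by (rule continuous_measurable_m[OF continuous_map_comp_on[OF continuous_p]])

lemma C0_comp_p_L2:
  assumes f: "f \<in> C0" and \<xi>: "\<xi> \<in> L2_functions m"
  shows "(\<lambda>c. f (p c) * \<xi> c) \<in> L2_functions m"
proof -
  obtain B where B: "B \<ge> 0" "\<And>y. cmod (f y) \<le> B" using C0_bounded[OF f] by blast
  have [measurable]: "(\<lambda>c. f (p c)) \<in> borel_measurable m" using f by (intro comp_p_measurable) (simp add: C0_def)
  note [measurable] = L2_measurable[OF \<xi>]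
  show ?thesis
  proof (rule L2_bound)
    show "integrable m (\<lambda>c. B\<^sup>2 * (cmod (\<xi> c))\<^sup>2)" using \<xi> by (intro integrable_mult_right L2_integrable_square)
    show "(cmod (f (p c) * \<xi> c))\<^sup>2 \<le> B\<^sup>2 * (cmod (\<xi> c))\<^sup>2" for c
      using B(2)[of "p c"] by (simp add: norm_mult power_mult_distrib mult_right_mono power_mono)
  qed measurable
qed

lemma translation_L2: "\<xi> \<in> L2_functions m \<Longrightarrow> (\<lambda>c. \<tau> t * \<xi> ((+) (- t) ` c)) \<in> L2_functions m"
  by (intro L2_scale L2_translate)

lemma mult_op_class:
  assumes f: "f \<in> C0" and \<xi>: "\<xi> \<in> L2_functions m"
  shows "mult_op act m x f (L2_class m \<xi>) = L2_class m (\<lambda>c. f (p c) * \<xi> c)"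
  unfolding mult_op_def p_def[symmetric]
proof (rule L2_UN[OF \<xi>])
  fix g assume g: "g \<in> L2_functions m" "AE c in m. \<xi> c = g c"
  from g(2) have "AE c in m. f (p c) * g c = f (p c) * \<xi> c" by eventually_elim simp
  then show "L2_class m (\<lambda>c. f (p c) * g c) = L2_class m (\<lambda>c. f (p c) * \<xi> c)"
    by (simp only: L2_class_eq_iff[OF C0_comp_p_L2[OF f g(1)] C0_comp_p_L2[OF f \<xi>]])
qed

lemma translation_op_class:
  assumes \<xi>: "\<xi> \<in> L2_functions m"
  shows "translation_op m \<tau> t (L2_class m \<xi>) = L2_class m (\<lambda>c. \<tau> t * \<xi> ((+) (- t) ` c))"
  unfolding translation_op_def
proof (rule L2_UN[OF \<xi>])
  fix g assume g: "g \<in> L2_functions m" "AE c in m. \<xi> c = g c"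
  from AE_translate[OF g(2), of "- t"]
  have "AE c in m. \<tau> t * g ((+) (- t) ` c) = \<tau> t * \<xi> ((+) (- t) ` c)" by eventually_elim simp
  then show "L2_class m (\<lambda>c. \<tau> t * g ((+) (- t) ` c)) = L2_class m (\<lambda>c. \<tau> t * \<xi> ((+) (- t) ` c))"
    by (simp only: L2_class_eq_iff[OF translation_L2[OF g(1)] translation_L2[OF \<xi>]])
qed

text \<open>For \<open>\<xi>\<close> continuous with compact support the translates converge uniformly, with supports in
  a common compact set.\<close>

lemma translation_continuous_Cc:
  assumes g: "continuous_map Q euclidean g" and K: "compactin Q K"
    and gK: "\<And>c. c \<in> topspace Q - K \<Longrightarrow> g c = 0" and e: "e > 0"
  shows "\<forall>\<^sub>F t in at s. (\<integral>c. (cmod (\<tau> t * g ((+) (- t) ` c) - \<tau> s * g ((+) (- s) ` c)))\<^sup>2 \<partial>m) < e"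
proof -
  obtain C0 where C0: "compact C0" "K \<subseteq> q ` C0" using compactin_lift[OF K] by blast
  obtain W W' :: "'g set" where W: "open W" "compact W'" "{s} \<subseteq> W" "W \<subseteq> W'"
    using compact_neighbourhood[OF compact_sing[of s]] by blast
  \<comment> \<open>For \<open>t\<close> in \<open>W\<close> the translate of \<open>g\<close> by
    \<open>t\<close> is supported in the image of this one compact set.\<close>
  define C where "C = (\<lambda>(a, b). a + b) ` (W' \<times> C0)"
  have C: "compact C" unfolding C_def by (rule compact_sum_set(1)[OF W(2) C0(1)])
  have KC: "compactin Q (q ` C)" by (rule compactin_q_image[OF C])
  have fin: "emeasure m (q ` C) < \<infinity>" by (rule finite_m[OF KC])
  have Cm: "q ` C \<in> sets m" using Q.compactin_in_borel[OF KC] sets_m by simp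
  \<comment> \<open>Chosen so that the measure of the common support times d^2 stays below
    \<open>e\<close>; the summand 1 covers the case that this measure is 0.\<close>
  define d where "d = sqrt (e / (measure m (q ` C) + 1))"
  have mpos: "measure m (q ` C) + 1 > 0" by (intro add_nonneg_pos) auto
  have d: "d > 0" unfolding d_def using e mpos by simp
  have d2: "d\<^sup>2 = e / (measure m (q ` C) + 1)" unfolding d_def using e mpos by (intro real_sqrt_pow2) simp
  have "continuous_map euclidean euclidean (g \<circ> q)" by (rule continuous_map_compose[OF continuous_q g])
  then have gq: "continuous_on UNIV (\<lambda>r. g (q r))" by (simp add: o_def)
  have cont: "continuous_on (UNIV \<times> C) (\<lambda>(t, r). \<tau> t * g (q (- t + r)))"
    unfolding case_prod_unfold
    by (intro continuous_intros continuous_on_compose2[OF \<tau>_continuous] continuous_on_compose2[OF gq]) auto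
  obtain X0 where X0: "s \<in> X0" "open X0"
      "\<forall>t\<in>X0 \<inter> UNIV. \<forall>r\<in>C. dist (case (t, r) of (t, r) \<Rightarrow> \<tau> t * g (q (- t + r)))
        (case (s, r) of (t, r) \<Rightarrow> \<tau> t * g (q (- t + r))) \<le> d"
    by (rule continuous_on_prod_compactE[OF cont C UNIV_I d])
  have zero: "g ((+) (- t) ` c) = 0" if t: "t \<in> W" and c: "c \<in> topspace Q" "c \<notin> q ` C" for t c
  proof (rule gK)
    obtain r where r: "c = q r" using c(1) by (auto simp: topspace_coset_topology)
    have "(+) (- t) ` c \<notin> q ` C0"
    proof
      assume "(+) (- t) ` c \<in> q ` C0"
      then obtain b where b: "b \<in> C0" "(+) (- t) ` c = q b" by blast
      have "c = (+) t ` ((+) (- t) ` c)" by (simp add: image_image)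
      also have "\<dots> = q (t + b)" by (simp only: b(2) translate_coset)
      finally have "c = q (t + b)" .
      moreover have "t + b \<in> C" unfolding C_def using t W(4) b(1) by force
      ultimately show False using c(2) by blast
    qed
    then show "(+) (- t) ` c \<in> topspace Q - K" using translate_in[OF c(1)] C0(2) by blast
  qed
  have bound: "(cmod (\<tau> t * g ((+) (- t) ` c) - \<tau> s * g ((+) (- s) ` c)))\<^sup>2 \<le> indicator (q ` C) c * d\<^sup>2"
    if t: "t \<in> X0 \<inter> W" and c: "c \<in> space m" for t c
  proof (cases "c \<in> q ` C")
    case True
    then obtain r where r: "r \<in> C" "c = q r" by blast
    have "cmod (\<tau> t * g ((+) (- t) ` c) - \<tau> s * g ((+) (- s) ` c)) \<le> d"
    proof -
      have "cmod (\<tau> t * g (q (- t + r)) - \<tau> s * g (q (- s + r))) \<le> d"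
        using bspec[OF bspec[OF X0(3), of t] r(1)] t by (simp add: dist_norm)
      then show ?thesis by (simp only: r(2) translate_coset)
    qed
    from power_mono[OF this norm_ge_zero, of 2] show ?thesis using True by simp
  next
    case False
    have "c \<in> topspace Q" using c by (simp add: space_m topspace_coset_topology)
    then show ?thesis using zero[of t c] zero[of s c] t False W(3) by simp
  qed
  have "\<forall>\<^sub>F t in at s. t \<in> X0 \<inter> W"
    using X0(1,2) W(1,3) by (intro eventually_at_in_open') auto
  then show ?thesis
  proof eventually_elim
    case (elim t)
    have "(\<integral>c. (cmod (\<tau> t * g ((+) (- t) ` c) - \<tau> s * g ((+) (- s) ` c)))\<^sup>2 \<partial>m) \<le>
        (\<integral>c. indicator (q ` C) c * d\<^sup>2 \<partial>m)"
    proof (rule integral_mono_AE')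
      show "integrable m (\<lambda>c. indicator (q ` C) c * d\<^sup>2)"
        using Cm fin by (intro integrable_mult_left integrable_real_indicator) auto
    qed (use bound[OF elim] in auto)
    also have "\<dots> = measure m (q ` C) * d\<^sup>2" using Cm fin by simp
    also have "\<dots> < e" unfolding d2 using e mpos by (simp add: field_simps)
    finally show ?case .
  qed
qed

text \<open>Translations multiplied by a character are isometric, so approximating \<xi> by a
  compactly supported function costs e / 3 twice and reduces the claim to
  \<open>translation_continuous_Cc\<close>.\<close>

lemma translation_continuous:
  assumes \<xi>: "\<xi> \<in> L2_functions m"
  shows "((\<lambda>t. hdist (L2 m) (translation_op m \<tau> t (L2_class m \<xi>)) (translation_op m \<tau> s (L2_class m \<xi>))) \<longlongrightarrow> 0) (at s)"
proof (rule tendstoI)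
  fix e :: real assume e: "e > 0"
  interpret L: hilbert_space "L2 m" by (rule hilbert_space_L2)
  let ?U = "\<lambda>\<xi> t c. \<tau> t * \<xi> ((+) (- t) ` c)"
  have e2: "(e/3)\<^sup>2 > 0" using e by simp
  have "\<exists>g K. continuous_map Q euclidean g \<and> compactin Q K \<and> (\<forall>c\<in>topspace Q - K. g c = 0) \<and>
      g \<in> L2_functions m \<and> (\<integral>c. (cmod (\<xi> c - g c))\<^sup>2 \<partial>m) < (e/3)\<^sup>2"
  proof (rule Q.L2_dense_Cc[OF sets_m finite_m \<xi> e2])
    fix g K assume "continuous_map Q euclidean g" "compactin Q K" "\<And>c. c \<in> topspace Q - K \<Longrightarrow> g c = 0"
      "g \<in> L2_functions m" "(\<integral>c. (cmod (\<xi> c - g c))\<^sup>2 \<partial>m) < (e/3)\<^sup>2"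
    then show ?thesis by (intro exI[of _ g] exI[of _ K]) simp
  qed
  then obtain g :: "'g set \<Rightarrow> complex" and K where g: "continuous_map Q euclidean g" "compactin Q K"
      "\<And>c. c \<in> topspace Q - K \<Longrightarrow> g c = 0"
      "g \<in> L2_functions m" "(\<integral>c. (cmod (\<xi> c - g c))\<^sup>2 \<partial>m) < (e/3)\<^sup>2" by blast
  have isometry: "hdist (L2 m) (L2_class m (?U \<xi> t)) (L2_class m (?U g t)) < e/3" for t
  proof -
    note [measurable] = L2_measurable[OF \<xi>] L2_measurable[OF g(4)]
    have "(\<integral>c. (cmod (?U \<xi> t c - ?U g t c))\<^sup>2 \<partial>m) = (\<integral>c. (cmod (\<xi> ((+) (- t) ` c) - g ((+) (- t) ` c)))\<^sup>2 \<partial>m)"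
      by (simp add: norm_mult \<tau>_norm flip: right_diff_distrib)
    also have "\<dots> = (\<integral>c. (cmod (\<xi> c - g c))\<^sup>2 \<partial>m)"
    proof -
      have "(\<integral>\<^sup>+c. ennreal ((cmod (\<xi> ((+) (- t) ` c) - g ((+) (- t) ` c)))\<^sup>2) \<partial>m) =
          (\<integral>\<^sup>+c. ennreal ((cmod (\<xi> c - g c))\<^sup>2) \<partial>m)"
        by (rule nn_integral_m_translate) measurable
      then have "ennreal (\<integral>c. (cmod (\<xi> ((+) (- t) ` c) - g ((+) (- t) ` c)))\<^sup>2 \<partial>m) =
          ennreal (\<integral>c. (cmod (\<xi> c - g c))\<^sup>2 \<partial>m)"
        by (simp only: L2_nn_integral[OF L2_diff[OF \<xi> g(4)]]
            L2_nn_integral[OF L2_diff[OF L2_translate[OF \<xi>, of "- t"] L2_translate[OF g(4), of "- t"]]])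
      then show ?thesis by simp
    qed
    finally have "(\<integral>c. (cmod (?U \<xi> t c - ?U g t c))\<^sup>2 \<partial>m) < (e/3)\<^sup>2" using g(5) by simp
    then have "sqrt (\<integral>c. (cmod (?U \<xi> t c - ?U g t c))\<^sup>2 \<partial>m) < sqrt ((e/3)\<^sup>2)" by (rule real_sqrt_less_mono)
    then show ?thesis using e unfolding L2_hdist[OF translation_L2[OF \<xi>] translation_L2[OF g(4)]] by simp
  qed
  have in': "L2_class m (?U \<xi> t) \<in> vecs (L2 m)" "L2_class m (?U g t) \<in> vecs (L2 m)" for t
    using translation_L2[OF \<xi>] translation_L2[OF g(4)] by (auto simp: L2_vecs)
  have ev: "\<forall>\<^sub>F t in at s. (\<integral>c. (cmod (?U g t c - ?U g s c))\<^sup>2 \<partial>m) < (e/3)\<^sup>2"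
    by (rule translation_continuous_Cc[OF g(1,2) _ e2]) (rule g(3))
  show "\<forall>\<^sub>F t in at s. dist (hdist (L2 m) (translation_op m \<tau> t (L2_class m \<xi>)) (translation_op m \<tau> s (L2_class m \<xi>))) 0 < e"
    using ev
  proof eventually_elim
    case (elim t)
    from real_sqrt_less_mono[OF elim]
    have d: "hdist (L2 m) (L2_class m (?U g t)) (L2_class m (?U g s)) < e/3"
      using e unfolding L2_hdist[OF translation_L2[OF g(4)] translation_L2[OF g(4)]] by simp
    have "hdist (L2 m) (L2_class m (?U \<xi> t)) (L2_class m (?U \<xi> s)) \<le>
        hdist (L2 m) (L2_class m (?U \<xi> t)) (L2_class m (?U g t)) +
        hdist (L2 m) (L2_class m (?U g t)) (L2_class m (?U \<xi> s))"
      by (rule L.hdist_triangle[OF in'(1) in'(2) in'(1)])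
    also have "hdist (L2 m) (L2_class m (?U g t)) (L2_class m (?U \<xi> s)) \<le>
        hdist (L2 m) (L2_class m (?U g t)) (L2_class m (?U g s)) +
        hdist (L2 m) (L2_class m (?U g s)) (L2_class m (?U \<xi> s))"
      by (rule L.hdist_triangle[OF in'(2) in'(2) in'(1)])
    also have "hdist (L2 m) (L2_class m (?U g s)) (L2_class m (?U \<xi> s)) =
        hdist (L2 m) (L2_class m (?U \<xi> s)) (L2_class m (?U g s))"
      by (rule L.hdist_commute[OF in'(2) in'(1)])
    finally have "hdist (L2 m) (L2_class m (?U \<xi> t)) (L2_class m (?U \<xi> s)) < e"
      using isometry[of t] isometry[of s] d by simp
    then show ?case
      using L.hdist_ge0[OF in'(1) in'(1), of t s] by (simp add: translation_op_class[OF \<xi>])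
  qed
qed

text \<open>Through this the results on abstract covariant pairs apply to \<open>Ind\<close>: its
  weak integrals exist and are bounded by the universal norm.\<close>

lemma covariant_pair_L2: "covariant_pair act (L2 m) (mult_op act m x) (translation_op m \<tau>)"
proof -
  interpret L: hilbert_space "L2 m" by (rule hilbert_space_L2)
  note fL = C0_comp_p_L2 and tL = translation_L2 and mc = mult_op_class and tc = translation_op_class
  have bdd1: "bounded_operator (L2 m) (mult_op act m x f)" if f: "f \<in> C0" for f
    unfolding bounded_operator_def
  proof (intro conjI ballI allI)
    obtain B where B: "B \<ge> 0" "\<And>y. cmod (f y) \<le> B" using C0_bounded[OF f] by blast
    show "\<exists>C. \<forall>\<xi>\<in>vecs (L2 m). hnorm (L2 m) (mult_op act m x f \<xi>) \<le> C * hnorm (L2 m) \<xi>"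
    proof (intro exI ballI)
      fix \<xi> assume "\<xi> \<in> vecs (L2 m)"
      then obtain h where h: "h \<in> L2_functions m" "\<xi> = L2_class m h" by (auto simp: L2_vecs)
      have "(\<integral>c. (cmod (f (p c) * h c))\<^sup>2 \<partial>m) \<le> (\<integral>c. B\<^sup>2 * (cmod (h c))\<^sup>2 \<partial>m)"
      proof (rule integral_mono)
        show "(cmod (f (p c) * h c))\<^sup>2 \<le> B\<^sup>2 * (cmod (h c))\<^sup>2" for c
          using B(2)[of "p c"] by (simp add: norm_mult power_mult_distrib mult_right_mono power_mono)
      qed (intro L2_integrable_square fL f h(1) integrable_mult_right)+
      then have "sqrt (\<integral>c. (cmod (f (p c) * h c))\<^sup>2 \<partial>m) \<le> sqrt (B\<^sup>2 * (\<integral>c. (cmod (h c))\<^sup>2 \<partial>m))"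
        by simp
      then show "hnorm (L2 m) (mult_op act m x f \<xi>) \<le> B * hnorm (L2 m) \<xi>"
        using B(1) by (simp add: h mc[OF f] L2_hnorm fL[OF f] real_sqrt_mult)
    qed
  qed (use f in \<open>auto simp: L2_vecs mc L2_vadd L2_vscale fL L2_add L2_scale distrib_left mult.left_commute\<close>)
  have bdd2: "bounded_operator (L2 m) (translation_op m \<tau> s)" for s
    unfolding bounded_operator_def
  proof (intro conjI ballI allI)
    show "\<exists>C. \<forall>\<xi>\<in>vecs (L2 m). hnorm (L2 m) (translation_op m \<tau> s \<xi>) \<le> C * hnorm (L2 m) \<xi>"
    proof (intro exI ballI)
      fix \<xi> assume "\<xi> \<in> vecs (L2 m)"
      then obtain h where h: "h \<in> L2_functions m" "\<xi> = L2_class m h" by (auto simp: L2_vecs)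
      note [measurable] = L2_measurable[OF h(1)]
      have "(\<integral>\<^sup>+c. ennreal ((cmod (h ((+) (- s) ` c)))\<^sup>2) \<partial>m) = (\<integral>\<^sup>+c. ennreal ((cmod (h c))\<^sup>2) \<partial>m)"
        by (rule nn_integral_m_translate) measurable
      then have "ennreal (\<integral>c. (cmod (h ((+) (- s) ` c)))\<^sup>2 \<partial>m) = ennreal (\<integral>c. (cmod (h c))\<^sup>2 \<partial>m)"
        by (simp only: L2_nn_integral[OF h(1)] L2_nn_integral[OF L2_translate[OF h(1), of "- s"]])
      then show "hnorm (L2 m) (translation_op m \<tau> s \<xi>) \<le> 1 * hnorm (L2 m) \<xi>"
        unfolding h(2) tc[OF h(1)] L2_hnorm[OF tL[OF h(1)]] L2_hnorm[OF h(1)]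
        by (simp add: norm_mult \<tau>_norm)
    qed
  qed (auto simp: L2_vecs tc L2_vadd L2_vscale tL L2_add L2_scale distrib_left mult.left_commute
      simp del: uminus_add_conv_diff)
  have unit: "inn (L2 m) (translation_op m \<tau> s \<xi>) (translation_op m \<tau> s \<eta>) = inn (L2 m) \<xi> \<eta>"
    if xy: "\<xi> \<in> vecs (L2 m)" "\<eta> \<in> vecs (L2 m)" for s \<xi> \<eta>
  proof -
    obtain f g where fg: "f \<in> L2_functions m" "\<xi> = L2_class m f" "g \<in> L2_functions m" "\<eta> = L2_class m g"
      using xy by (auto simp: L2_vecs)
    have "inn (L2 m) (translation_op m \<tau> s \<xi>) (translation_op m \<tau> s \<eta>) =
        (\<integral>c. (\<tau> s * f ((+) (- s) ` c)) * cnj (\<tau> s * g ((+) (- s) ` c)) \<partial>m)"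
      unfolding fg(2,4) tc[OF fg(1)] tc[OF fg(3)] by (rule L2_inn[OF tL[OF fg(1)] tL[OF fg(3)]])
    also have "\<dots> = (\<integral>c. (\<tau> s * cnj (\<tau> s)) * (f ((+) (- s) ` c) * cnj (g ((+) (- s) ` c))) \<partial>m)"
      by (simp add: mult_ac)
    also have "\<dots> = (\<integral>c. f ((+) (- s) ` c) * cnj (g ((+) (- s) ` c)) \<partial>m)" by (simp only: \<tau>_cnj mult_1)
    also have "\<dots> = (\<integral>c. f c * cnj (g c) \<partial>m)"
      by (rule integral_m_translate[OF borel_measurable_integrable[OF L2_mult_integrable[OF fg(1,3)]]])
    finally show ?thesis unfolding fg(2,4) by (simp only: L2_inn[OF fg(1,3)])
  qed
  have covariance: "translation_op m \<tau> s (mult_op act m x f \<xi>) =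
      mult_op act m x (\<lambda>y. f (act (- s) y)) (translation_op m \<tau> s \<xi>)"
    if f: "f \<in> C0" and x: "\<xi> \<in> vecs (L2 m)" for f s \<xi>
  proof -
    obtain h where h: "h \<in> L2_functions m" "\<xi> = L2_class m h" using x by (auto simp: L2_vecs)
    have f': "(\<lambda>y. f (act (- s) y)) \<in> C0" unfolding C0_def
    proof (intro CollectI conjI allI impI)
      have cf: "continuous_on UNIV f" using f by (simp add: C0_def)
      show "continuous_on UNIV (\<lambda>y. f (act (- s) y))"
        by (intro continuous_on_compose2[OF cf] continuous_on_act continuous_intros) auto
      fix e :: real assume e: "e > 0"
      have "compact {y. e \<le> cmod (f y)}" using f e by (simp add: C0_def)
      then have "compact (act s ` {y. e \<le> cmod (f y)})"
        by (intro compact_continuous_image continuous_on_act continuous_intros)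
      moreover have "act s ` {y. e \<le> cmod (f y)} = {y. e \<le> cmod (f (act (- s) y))}"
      proof
        show "{y. e \<le> cmod (f (act (- s) y))} \<subseteq> act s ` {y. e \<le> cmod (f y)}"
        proof
          fix y assume "y \<in> {y. e \<le> cmod (f (act (- s) y))}"
          moreover have "y = act s (act (- s) y)" using act_add[of s "- s" y] by (simp add: act_zero)
          ultimately show "y \<in> act s ` {y. e \<le> cmod (f y)}" by blast
        qed
      qed (auto simp: act_zero simp flip: act_add)
      ultimately show "compact {y. e \<le> cmod (f (act (- s) y))}" by simp
    qed
    show ?thesis unfolding h(2) mc[OF f h(1)] tc[OF h(1)] tc[OF fL[OF f h(1)]] mc[OF f' tL[OF h(1)]]
    proof (subst L2_class_eq_iff[OF tL[OF fL[OF f h(1)]] fL[OF f' tL[OF h(1)]]], rule AE_I2)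
      fix c assume "c \<in> space m"
      then have "p ((+) (- s) ` c) = act (- s) (p c)" by (intro p_translate) (simp add: space_m)
      then show "\<tau> s * (f (p ((+) (- s) ` c)) * h ((+) (- s) ` c)) =
          f (act (- s) (p c)) * (\<tau> s * h ((+) (- s) ` c))" by simp
    qed
  qed
  have cont: "((\<lambda>t. hdist (L2 m) (translation_op m \<tau> t \<xi>) (translation_op m \<tau> s \<xi>)) \<longlongrightarrow> 0) (at s)"
    if "\<xi> \<in> vecs (L2 m)" for \<xi> s
    using that translation_continuous by (auto simp: L2_vecs)
  show ?thesis unfolding covariant_pair_def
  proof (intro conjI ballI allI)
    fix \<xi> \<eta> s t f g c
    show "mult_op act m x (\<lambda>y. f y + g y) \<xi> = vadd (L2 m) (mult_op act m x f \<xi>) (mult_op act m x g \<xi>)"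
      if "f \<in> C0" "g \<in> C0" "\<xi> \<in> vecs (L2 m)"
      using that by (auto simp: L2_vecs mc C0_add L2_vadd fL distrib_right)
    show "mult_op act m x (\<lambda>y. c * f y) \<xi> = vscale (L2 m) c (mult_op act m x f \<xi>)"
      if "f \<in> C0" "\<xi> \<in> vecs (L2 m)"
      using that by (auto simp: L2_vecs mc C0_scale L2_vscale fL mult.assoc)
    show "mult_op act m x (\<lambda>y. f y * g y) \<xi> = mult_op act m x f (mult_op act m x g \<xi>)"
      if fg: "f \<in> C0" "g \<in> C0" and x: "\<xi> \<in> vecs (L2 m)"
    proof -
      have prod: "(\<lambda>y. f y * g y) \<in> C0"
      proof -
        obtain B where B: "B \<ge> 0" "\<And>y. cmod (f y) \<le> B" using C0_bounded[OF fg(1)] by blast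
        have cfg: "continuous_on UNIV (\<lambda>y. f y * g y)"
          using fg by (intro continuous_intros) (simp_all add: C0_def)
        have "compact {y. e \<le> cmod (f y * g y)}" if e: "e > 0" for e
        proof (rule compact_closed_subset)
          have "e / (B + 1) > 0" using e B by simp
          then show "compact {y. e / (B + 1) \<le> cmod (g y)}" using fg(2) unfolding C0_def by blast
          show "closed {y. e \<le> cmod (f y * g y)}"
            by (intro closed_Collect_le continuous_on_const continuous_on_norm cfg)
          have "e / (B + 1) \<le> cmod (g y)" if "e \<le> cmod (f y * g y)" for y
          proof -
            have "e \<le> B * cmod (g y)"
              using that mult_right_mono[OF B(2)[of y] norm_ge_zero[of "g y"]] by (simp add: norm_mult)
            also have "\<dots> \<le> (B + 1) * cmod (g y)" by (simp add: mult_right_mono)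
            finally show ?thesis using B(1) by (simp add: divide_le_eq mult.commute)
          qed
          then show "{y. e \<le> cmod (f y * g y)} \<subseteq> {y. e / (B + 1) \<le> cmod (g y)}" by blast
        qed
        then show ?thesis using cfg by (simp add: C0_def)
      qed
      show ?thesis using x by (auto simp: L2_vecs mc fg prod fL mult.assoc)
    qed
    show "inn (L2 m) (mult_op act m x (\<lambda>y. cnj (f y)) \<xi>) \<eta> = inn (L2 m) \<xi> (mult_op act m x f \<eta>)"
      if f: "f \<in> C0" and xy: "\<xi> \<in> vecs (L2 m)" "\<eta> \<in> vecs (L2 m)"
    proof -
      obtain h k where hk: "h \<in> L2_functions m" "\<xi> = L2_class m h" "k \<in> L2_functions m" "\<eta> = L2_class m k"
        using xy by (auto simp: L2_vecs)
      show ?thesis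
        unfolding hk(2,4) mc[OF C0_cnj[OF f] hk(1)] mc[OF f hk(3)]
          L2_inn[OF fL[OF C0_cnj[OF f] hk(1)] hk(3)] L2_inn[OF hk(1) fL[OF f hk(3)]]
        by (simp add: mult_ac)
    qed
    show "translation_op m \<tau> 0 \<xi> = \<xi>" if "\<xi> \<in> vecs (L2 m)"
      using that by (auto simp: L2_vecs tc \<tau>_zero image_image)
    show "translation_op m \<tau> (s + t) \<xi> = translation_op m \<tau> s (translation_op m \<tau> t \<xi>)"
      if x: "\<xi> \<in> vecs (L2 m)"
    proof -
      obtain h where h: "h \<in> L2_functions m" "\<xi> = L2_class m h" using x by (auto simp: L2_vecs)
      show ?thesis unfolding h(2) tc[OF h(1)] tc[OF tL[OF h(1)]]
        by (simp only: translate_translate \<tau>_add minus_add mult.assoc)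
    qed
  qed (fact bdd1 bdd2 unit cont covariance)+
qed

end

context transformation_group
begin

text \<open>The function vanishes unless \<open>y\<close> lies in \<open>K\<close> and
  \<open>t\<close> in \<open>L\<close>; joint continuity and compactness of \<open>K\<close> make
  the convergence in \<open>t\<close> uniform in \<open>y\<close>.\<close>

lemma test_function_CcC0:
  assumes E: "continuous_on UNIV E" "compact K" "\<And>y. y \<notin> K \<Longrightarrow> E y = 0"
    and k: "continuous_on UNIV k" "compact L" "\<And>t. t \<notin> L \<Longrightarrow> k t = 0"
  shows "(\<lambda>t y. E y * cnj (E (act (- t) y)) * (k t :: complex)) \<in> CcC0"
proof -
  let ?D = "\<lambda>t y. E y * cnj (E (act (- t) y)) * k t"
  have cD: "continuous_on UNIV (\<lambda>(t, y). ?D t y)"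
    unfolding case_prod_unfold
    by (intro continuous_intros continuous_on_compose2[OF E(1)] continuous_on_compose2[OF k(1)] continuous_on_act) auto
  have c: "continuous_on UNIV (?D t)" for t
    using continuous_on_compose2[OF cD, of UNIV "\<lambda>y. (t, y)"] by (simp add: continuous_intros)
  have C0: "?D t \<in> C0" for t
  proof -
    have "compact {y. e \<le> cmod (?D t y)}" if e: "e > 0" for e
    proof (rule compact_closed_subset[OF E(2)])
      show "closed {y. e \<le> cmod (?D t y)}"
        by (intro closed_Collect_le continuous_on_const continuous_on_norm c)
      have "y \<in> K" if "e \<le> cmod (?D t y)" for y
      proof (rule ccontr)
        assume "y \<notin> K"
        then have "?D t y = 0" by (simp add: E(3))
        then show False using that e by (simp only: norm_zero)
      qed
      then show "{y. e \<le> cmod (?D t y)} \<subseteq> K" by blast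
    qed
    then show ?thesis using c by (simp add: C0_def)
  qed
  have lim: "uniform_limit UNIV ?D (?D s) (at s)" for s
    unfolding uniform_limit_iff
  proof (intro allI impI)
    fix e :: real assume e: "e > 0"
    have cD': "continuous_on (UNIV \<times> K) (\<lambda>(t, y). ?D t y)" by (rule continuous_on_subset[OF cD]) auto
    obtain X0 where X0: "s \<in> X0" "open X0"
        "\<forall>t\<in>X0 \<inter> UNIV. \<forall>y\<in>K. dist (case (t, y) of (t, y) \<Rightarrow> ?D t y) (case (s, y) of (t, y) \<Rightarrow> ?D t y) \<le> e/2"
      by (rule continuous_on_prod_compactE[OF cD' E(2) UNIV_I half_gt_zero[OF e]])
    have "\<forall>\<^sub>F t in at s. t \<in> X0" using X0(1,2) by (intro eventually_at_in_open') auto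
    then show "\<forall>\<^sub>F t in at s. \<forall>y\<in>UNIV. dist (?D t y) (?D s y) < e"
    proof eventually_elim
      case (elim t)
      show ?case
      proof
        fix y
        show "dist (?D t y) (?D s y) < e"
        proof (cases "y \<in> K")
          case True
          have "dist (?D t y) (?D s y) \<le> e/2" using bspec[OF bspec[OF X0(3), of t] True] elim by simp
          then show ?thesis using e by simp
        qed (use e in \<open>simp add: E(3)\<close>)
      qed
    qed
  qed
  have "{t. ?D t \<noteq> (\<lambda>y. 0)} \<subseteq> L"
  proof
    fix t assume "t \<in> {t. ?D t \<noteq> (\<lambda>y. 0)}"
    then obtain y where "?D t y \<noteq> 0" by (auto simp: fun_eq_iff)
    then have "k t \<noteq> 0" by simp
    then show "t \<in> L" using k(3) by blast
  qed
  then have "closure {t. ?D t \<noteq> (\<lambda>y. 0)} \<subseteq> L"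
    by (rule closure_minimal) (rule compact_imp_closed[OF k(2)])
  then have "compact (closure {t. ?D t \<noteq> (\<lambda>y. 0)})" by (rule compact_closed_subset[OF k(2) closed_closure])
  then show ?thesis unfolding CcC0_def using C0 lim by simp
qed

end

section \<open>Vector functionals as double integrals\<close>

locale orbit_haar = orbit_rep act x m \<tau> + haar_group "TYPE('g)" \<mu>
  for act :: "'g::{topological_ab_group_add, t2_space, second_countable_topology} \<Rightarrow>
      'x::{t2_space, second_countable_topology} \<Rightarrow> 'x"
    and x m \<tau> and \<mu> :: "'g measure"
begin

lemma covariant_rep_L2: "covariant_rep (L2 m) act (mult_op act m x) (translation_op m \<tau>) \<mu>"
  using hilbert_space_L2 covariant_pair_L2 sets_\<mu> finite_\<mu>
  by (simp add: covariant_rep_def covariant_rep_axioms_def)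

lemma inn_integrand:
  assumes D: "D \<in> CcC0" and f: "f \<in> L2_functions m"
  shows "inn (L2 m) (mult_op act m x (D t) (translation_op m \<tau> t (L2_class m f))) (L2_class m f) =
    (\<integral>c. D t (p c) * (\<tau> t * f ((+) (- t) ` c)) * cnj (f c) \<partial>m)"
proof -
  have Dt: "D t \<in> C0" using D by (simp add: CcC0_def)
  show ?thesis
    unfolding translation_op_class[OF f] mult_op_class[OF Dt translation_L2[OF f]]
    by (rule L2_inn[OF C0_comp_p_L2[OF Dt translation_L2[OF f]] f])
qed

text \<open>The completion, the weak integral and the classes of functions are unfolded together
  here; afterwards the vector functionals at \<open>D\<close> enter only as this double
  integral.\<close>

lemma Ind_value:
  assumes D: "D \<in> CcC0" and f: "f \<in> L2_functions m" and m: "m = \<nu> (stabilizer act x)"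
  shows "vector_functional (Ind act \<mu> \<nu> x \<tau>) (L2_class m f) (null_rel (convolution_algebra act \<mu>) `` {\<lambda>n. D}) =
    (\<integral>t. \<integral>c. D t (p c) * (\<tau> t * f ((+) (- t) ` c)) * cnj (f c) \<partial>m \<partial>\<mu>)"
    and "integrable \<mu> (\<lambda>t. \<integral>c. D t (p c) * (\<tau> t * f ((+) (- t) ` c)) * cnj (f c) \<partial>m)"
proof -
  interpret C: covariant_rep "L2 m" act "mult_op act m x" "translation_op m \<tau>" \<mu> by (rule covariant_rep_L2)
  have fv: "L2_class m f \<in> vecs (L2 m)" using f by (auto simp: L2_vecs)
  have "rop (Ind act \<mu> \<nu> x \<tau>) = extend_to_completion (L2 m)
      (integrated_form \<mu> (L2 m) (mult_op act m x) (translation_op m \<tau>))"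
    and sp: "rspace (Ind act \<mu> \<nu> x \<tau>) = L2 m"
    by (simp_all add: Ind_def Let_def m)
  then have "vector_functional (Ind act \<mu> \<nu> x \<tau>) (L2_class m f) (null_rel (convolution_algebra act \<mu>) `` {\<lambda>n. D}) =
      inn (L2 m) (integrated_form \<mu> (L2 m) (mult_op act m x) (translation_op m \<tau>) D (L2_class m f)) (L2_class m f)"
    unfolding vector_functional_def by (simp only: extend_to_completion_const[OF covariant_rep_L2 D fv])
  also have "\<dots> = (\<integral>t. inn (L2 m) (mult_op act m x (D t) (translation_op m \<tau> t (L2_class m f))) (L2_class m f) \<partial>\<mu>)"
    by (rule C.inn_integrated_form[OF D fv fv])
  finally show "vector_functional (Ind act \<mu> \<nu> x \<tau>) (L2_class m f) (null_rel (convolution_algebra act \<mu>) `` {\<lambda>n. D}) =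
    (\<integral>t. \<integral>c. D t (p c) * (\<tau> t * f ((+) (- t) ` c)) * cnj (f c) \<partial>m \<partial>\<mu>)"
    by (simp only: inn_integrand[OF D f])
  obtain B where "B \<ge> 0" "\<And>s x. cmod (D s x) \<le> B" using CcC0_bounded[OF D] by metis
  from C.integrable_integrand(1)[OF D this(2) fv fv]
  show "integrable \<mu> (\<lambda>t. \<integral>c. D t (p c) * (\<tau> t * f ((+) (- t) ` c)) * cnj (f c) \<partial>m)"
    by (simp only: inn_integrand[OF D f])
qed

lemma translate_pair_measurable [measurable]:
  "(\<lambda>(t, c). (+) t ` c) \<in> measurable (\<mu> \<Otimes>\<^sub>M m) m" "(\<lambda>(t, c). (+) (- t) ` c) \<in> measurable (\<mu> \<Otimes>\<^sub>M m) m"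
proof -
  show 1: "(\<lambda>(t, c). (+) t ` c) \<in> measurable (\<mu> \<Otimes>\<^sub>M m) m"
    by (rule translate_joint_measurable[OF sets_\<mu>])
  have "(uminus :: 'g \<Rightarrow> 'g) \<in> measurable \<mu> \<mu>"
    unfolding measurable_cong_sets[OF sets_\<mu> sets_\<mu>]
    by (intro borel_measurable_continuous_onI continuous_intros)
  then have "(\<lambda>(t, c). (- t, c)) \<in> measurable (\<mu> \<Otimes>\<^sub>M m) (\<mu> \<Otimes>\<^sub>M m)"
    unfolding case_prod_unfold by (intro measurable_Pair measurable_compose[OF measurable_fst] measurable_snd)
  from measurable_compose[OF this 1]
  show "(\<lambda>(t, c). (+) (- t) ` c) \<in> measurable (\<mu> \<Otimes>\<^sub>M m) m" by (simp add: case_prod_unfold)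
qed

lemma pair_sigma_finite_\<mu>_m: "pair_sigma_finite \<mu> m"
  using sigma_finite_\<mu> sigma_finite_m by (simp add: pair_sigma_finite_def)

text \<open>Tonelli, combined in the first formula with a translation of \<open>c\<close> by
  \<open>t\<close>. The equality of the two right-hand sides moves an average over \<open>k\<close>
  from one function to the other.\<close>

lemma convolution_form_swap:
  assumes k: "k \<in> borel_measurable \<mu>" and u: "u \<in> borel_measurable m" and v: "v \<in> borel_measurable m"
  shows "(\<integral>\<^sup>+t. k t * (\<integral>\<^sup>+c. u c * v ((+) (- t) ` c) \<partial>m) \<partial>\<mu>) = (\<integral>\<^sup>+c. v c * (\<integral>\<^sup>+t. k t * u ((+) t ` c) \<partial>\<mu>) \<partial>m)"
    and "(\<integral>\<^sup>+t. k t * (\<integral>\<^sup>+c. u c * v ((+) (- t) ` c) \<partial>m) \<partial>\<mu>) = (\<integral>\<^sup>+c. u c * (\<integral>\<^sup>+t. k t * v ((+) (- t) ` c) \<partial>\<mu>) \<partial>m)"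
proof -
  interpret pair_sigma_finite \<mu> m by (rule pair_sigma_finite_\<mu>_m)
  note [measurable] = k u v
  have shift: "(\<integral>\<^sup>+c. u c * v ((+) (- t) ` c) \<partial>m) = (\<integral>\<^sup>+c. u ((+) t ` c) * v c \<partial>m)" for t
  proof -
    have "(\<lambda>c. v ((+) (- t) ` c)) \<in> borel_measurable m" by (rule measurable_compose[OF translate_measurable v])
    then have "(\<lambda>c. u c * v ((+) (- t) ` c)) \<in> borel_measurable m" by measurable
    from nn_integral_m_translate[OF this, of t]
    have "(\<integral>\<^sup>+c. u c * v ((+) (- t) ` c) \<partial>m) = (\<integral>\<^sup>+c. u ((+) t ` c) * v ((+) (- t + t) ` c) \<partial>m)"
      by (simp only: translate_translate)
    then show ?thesis by (simp add: image_image)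
  qed
  have ju: "(\<lambda>(t, c). u ((+) t ` c)) \<in> borel_measurable (\<mu> \<Otimes>\<^sub>M m)"
    using measurable_compose[OF translate_pair_measurable(1) u] by (simp add: case_prod_unfold)
  have jv: "(\<lambda>(t, c). v ((+) (- t) ` c)) \<in> borel_measurable (\<mu> \<Otimes>\<^sub>M m)"
    using measurable_compose[OF translate_pair_measurable(2) v] by (simp add: case_prod_unfold)
  have tu: "(\<lambda>t. u ((+) t ` c)) \<in> borel_measurable \<mu>" if "c \<in> space m" for c
    using measurable_compose[OF measurable_Pair2'[OF that] ju] by simp
  have tv: "(\<lambda>t. v ((+) (- t) ` c)) \<in> borel_measurable \<mu>" if "c \<in> space m" for c
    using measurable_compose[OF measurable_Pair2'[OF that] jv] by simp
  have "(\<integral>\<^sup>+t. k t * (\<integral>\<^sup>+c. u c * v ((+) (- t) ` c) \<partial>m) \<partial>\<mu>) = (\<integral>\<^sup>+t. \<integral>\<^sup>+c. k t * (u ((+) t ` c) * v c) \<partial>m \<partial>\<mu>)"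
    unfolding shift by (intro nn_integral_cong nn_integral_cmult[symmetric]) measurable
  also have "\<dots> = (\<integral>\<^sup>+c. \<integral>\<^sup>+t. k t * (u ((+) t ` c) * v c) \<partial>\<mu> \<partial>m)"
  proof (rule Fubini'[symmetric])
    show "(\<lambda>(t, c). k t * (u ((+) t ` c) * v c)) \<in> borel_measurable (\<mu> \<Otimes>\<^sub>M m)"
      using ju unfolding case_prod_unfold by measurable
  qed
  also have "\<dots> = (\<integral>\<^sup>+c. v c * (\<integral>\<^sup>+t. k t * u ((+) t ` c) \<partial>\<mu>) \<partial>m)"
  proof (rule nn_integral_cong)
    fix c assume c: "c \<in> space m"
    have "(\<lambda>t. k t * u ((+) t ` c)) \<in> borel_measurable \<mu>" using tu[OF c] by measurable
    from nn_integral_cmult[OF this, of "v c"]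
    show "(\<integral>\<^sup>+t. k t * (u ((+) t ` c) * v c) \<partial>\<mu>) = v c * (\<integral>\<^sup>+t. k t * u ((+) t ` c) \<partial>\<mu>)"
      by (simp add: mult_ac)
  qed
  finally show "(\<integral>\<^sup>+t. k t * (\<integral>\<^sup>+c. u c * v ((+) (- t) ` c) \<partial>m) \<partial>\<mu>) =
      (\<integral>\<^sup>+c. v c * (\<integral>\<^sup>+t. k t * u ((+) t ` c) \<partial>\<mu>) \<partial>m)" .
  have "(\<integral>\<^sup>+t. k t * (\<integral>\<^sup>+c. u c * v ((+) (- t) ` c) \<partial>m) \<partial>\<mu>) = (\<integral>\<^sup>+t. \<integral>\<^sup>+c. k t * (u c * v ((+) (- t) ` c)) \<partial>m \<partial>\<mu>)"
    by (intro nn_integral_cong nn_integral_cmult[symmetric]) measurable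
  also have "\<dots> = (\<integral>\<^sup>+c. \<integral>\<^sup>+t. k t * (u c * v ((+) (- t) ` c)) \<partial>\<mu> \<partial>m)"
  proof (rule Fubini'[symmetric])
    show "(\<lambda>(t, c). k t * (u c * v ((+) (- t) ` c))) \<in> borel_measurable (\<mu> \<Otimes>\<^sub>M m)"
      using jv unfolding case_prod_unfold by measurable
  qed
  also have "\<dots> = (\<integral>\<^sup>+c. u c * (\<integral>\<^sup>+t. k t * v ((+) (- t) ` c) \<partial>\<mu>) \<partial>m)"
  proof (rule nn_integral_cong)
    fix c assume c: "c \<in> space m"
    have "(\<lambda>t. k t * v ((+) (- t) ` c)) \<in> borel_measurable \<mu>" using tv[OF c] by measurable
    from nn_integral_cmult[OF this, of "u c"]
    show "(\<integral>\<^sup>+t. k t * (u c * v ((+) (- t) ` c)) \<partial>\<mu>) = u c * (\<integral>\<^sup>+t. k t * v ((+) (- t) ` c) \<partial>\<mu>)"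
      by (simp add: mult_ac)
  qed
  finally show "(\<integral>\<^sup>+t. k t * (\<integral>\<^sup>+c. u c * v ((+) (- t) ` c) \<partial>m) \<partial>\<mu>) =
      (\<integral>\<^sup>+c. u c * (\<integral>\<^sup>+t. k t * v ((+) (- t) ` c) \<partial>\<mu>) \<partial>m)" .
qed

end

text \<open>Representatives are used instead of classes because the kernel formed from them is
  evaluated pointwise.\<close>

definition L2_orthonormal :: "'a measure \<Rightarrow> ('i \<Rightarrow> 'a \<Rightarrow> complex) \<Rightarrow> 'i set \<Rightarrow> bool" where
  "L2_orthonormal m f I \<longleftrightarrow> (\<forall>i\<in>I. f i \<in> L2_functions m) \<and>
     (\<forall>i\<in>I. \<forall>j\<in>I. (\<integral>c. f i c * cnj (f j c) \<partial>m) = (if i = j then 1 else 0))"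

text \<open>Pythagoras. With b i = f i c it integrates, over one of the two variables, the square
  modulus of the kernel \<Psi> of the estimate that follows.\<close>

lemma nn_integral_orthonormal_sum:
  assumes I: "finite I" and f: "L2_orthonormal m f I"
  shows "(\<integral>\<^sup>+d. ennreal ((cmod (\<Sum>i\<in>I. b i * cnj (f i d)))\<^sup>2) \<partial>m) = ennreal (\<Sum>i\<in>I. (cmod (b i))\<^sup>2)"
proof -
  let ?s = "\<lambda>d. \<Sum>i\<in>I. cnj (b i) * f i d"
  have fL: "f i \<in> L2_functions m" if "i \<in> I" for i using f that by (simp add: L2_orthonormal_def)
  have orth: "(\<integral>c. f i c * cnj (f j c) \<partial>m) = (if i = j then 1 else 0)" if "i \<in> I" "j \<in> I" for i j
    using f that by (simp add: L2_orthonormal_def)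
  have sL: "?s \<in> L2_functions m" using I fL
  proof (induction I rule: finite_induct)
    case empty then show ?case by (simp add: L2_zero)
  next
    case (insert i I)
    have "(\<lambda>d. cnj (b i) * f i d + (\<Sum>i\<in>I. cnj (b i) * f i d)) \<in> L2_functions m"
      using insert by (intro L2_add L2_scale) auto
    then show ?case unfolding sum.insert[OF insert(1,2)] .
  qed
  have "complex_of_real (\<integral>d. (cmod (?s d))\<^sup>2 \<partial>m) = (\<integral>d. ?s d * cnj (?s d) \<partial>m)"
    by (simp only: complex_norm_square[symmetric] integral_complex_of_real)
  also have "\<dots> = (\<integral>d. (\<Sum>i\<in>I. \<Sum>j\<in>I. cnj (b i) * b j * (f i d * cnj (f j d))) \<partial>m)"
    unfolding cnj_sum sum_product complex_cnj_mult complex_cnj_cnj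
    by (intro Bochner_Integration.integral_cong refl sum.cong) (simp add: mult_ac)
  also have "\<dots> = (\<Sum>i\<in>I. \<Sum>j\<in>I. cnj (b i) * b j * (\<integral>d. f i d * cnj (f j d) \<partial>m))"
    using fL by (simp add: Bochner_Integration.integral_sum Bochner_Integration.integrable_sum L2_mult_integrable)
  also have "\<dots> = (\<Sum>i\<in>I. \<Sum>j\<in>I. if i = j then cnj (b i) * b j else 0)"
    by (intro sum.cong) (auto simp: orth)
  also have "\<dots> = (\<Sum>i\<in>I. cnj (b i) * b i)" using I by (simp add: sum.delta)
  also have "\<dots> = (\<Sum>i\<in>I. complex_of_real ((cmod (b i))\<^sup>2))"
    by (simp only: complex_norm_square mult.commute)
  also have "\<dots> = complex_of_real (\<Sum>i\<in>I. (cmod (b i))\<^sup>2)" by (rule of_real_sum[symmetric])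
  finally have eq: "(\<integral>d. (cmod (?s d))\<^sup>2 \<partial>m) = (\<Sum>i\<in>I. (cmod (b i))\<^sup>2)" unfolding of_real_eq_iff .
  have "cmod (\<Sum>i\<in>I. b i * cnj (f i d)) = cmod (?s d)" for d
  proof -
    have "(\<Sum>i\<in>I. b i * cnj (f i d)) = cnj (?s d)" by simp
    then show ?thesis by (simp only: complex_mod_cnj)
  qed
  then have "(\<integral>\<^sup>+d. ennreal ((cmod (\<Sum>i\<in>I. b i * cnj (f i d)))\<^sup>2) \<partial>m) = (\<integral>\<^sup>+d. ennreal ((cmod (?s d))\<^sup>2) \<partial>m)"
    by (simp only:)
  also have "\<dots> = ennreal (\<Sum>i\<in>I. (cmod (b i))\<^sup>2)" unfolding L2_nn_integral[OF sL] eq ..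
  finally show ?thesis .
qed

context orbit_haar
begin

text \<open>A Hilbert--Schmidt estimate: \<open>\<Sum> \<langle>T f\<^sub>i, f\<^sub>i\<rangle>\<close> is the pairing of the kernel of \<open>T\<close> with
  \<open>\<Psi>(c, d) = \<Sum> f\<^sub>i(d) cnj (f\<^sub>i(c))\<close>, and \<open>\<bar>x y\<bar> \<le> (\<bar>x\<bar>\<^sup>2 + \<bar>y\<bar>\<^sup>2) / 2\<close>.\<close>

lemma quadratic_form_sum_bound:
  assumes E: "continuous_on UNIV E" and D: "(\<lambda>t y. E y * cnj (E (act (- t) y)) * \<kappa> t) \<in> CcC0"
    and \<kappa>: "\<kappa> \<in> borel_measurable \<mu>"
    and A: "\<And>y. E y \<noteq> 0 \<Longrightarrow> (\<integral>\<^sup>+t. ennreal (cmod (\<kappa> t)) * ennreal ((cmod (E (act t y)))\<^sup>2) \<partial>\<mu>) \<le> A"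
    and b: "\<And>g c. g \<in> borel_measurable m \<Longrightarrow> c \<in> space m \<Longrightarrow>
      (\<integral>\<^sup>+t. ennreal (cmod (\<kappa> t)) * g ((+) t ` c) \<partial>\<mu>) \<le> b * (\<integral>\<^sup>+d. g d \<partial>m)"
    and N: "(\<integral>\<^sup>+c. ennreal ((cmod (E (p c)))\<^sup>2) \<partial>m) \<le> N"
    and I: "finite I" and f: "L2_orthonormal m f I"
  shows "ennreal (cmod (\<Sum>i\<in>I. \<integral>t. \<integral>c. E (p c) * cnj (E (act (- t) (p c))) * \<kappa> t *
      (\<tau> t * f i ((+) (- t) ` c)) * cnj (f i c) \<partial>m \<partial>\<mu>)) \<le> (A * N + b * of_nat (card I)) / 2"
proof -
  interpret pair_sigma_finite \<mu> m by (rule pair_sigma_finite_\<mu>_m)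
  define D where "D = (\<lambda>t y. E y * cnj (E (act (- t) y)) * \<kappa> t)"
  define G where "G = (\<lambda>i t c. D t (p c) * (\<tau> t * f i ((+) (- t) ` c)) * cnj (f i c))"
  define u where "u = (\<lambda>c. ennreal ((cmod (E (p c)))\<^sup>2))"
  \<comment> \<open>The square modulus of \<open>\<Psi>\<close> at (d, c); it is symmetric in its
    two arguments.\<close>
  define w where "w = (\<lambda>d c. ennreal ((cmod (\<Sum>i\<in>I. f i c * cnj (f i d)))\<^sup>2))"
  define k where "k = (\<lambda>t. ennreal (cmod (\<kappa> t)))"
  have fL: "f i \<in> L2_functions m" if "i \<in> I" for i using f that by (simp add: L2_orthonormal_def)
  have fm [measurable]: "f i \<in> borel_measurable m" if "i \<in> I" for i using fL[OF that] by (rule L2_measurable)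
  have [measurable]: "k \<in> borel_measurable \<mu>" unfolding k_def using \<kappa> by measurable
  have u_meas [measurable]: "u \<in> borel_measurable m" unfolding u_def using comp_p_measurable[OF E] by measurable
  have cnj_meas [measurable]: "cnj \<in> borel_measurable borel"
    by (intro borel_measurable_continuous_onI continuous_intros)
  have DC: "D \<in> CcC0" using D unfolding D_def .
  have Dt: "D t \<in> C0" for t using DC by (simp add: CcC0_def)
  have Gi: "integrable m (G i t)" if "i \<in> I" for i t
    unfolding G_def
    by (rule L2_mult_integrable[OF C0_comp_p_L2[OF Dt translation_L2[OF fL[OF that]]] fL[OF that]])
  have Gt: "integrable \<mu> (\<lambda>t. \<integral>c. G i t c \<partial>m)" if "i \<in> I" for i
    using Ind_value(2)[OF DC fL[OF that], of "\<lambda>_. m"] unfolding G_def by simp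
  have jointm: "(\<lambda>(t, c). w ((+) t ` c) c) \<in> borel_measurable (\<mu> \<Otimes>\<^sub>M m)"
  proof -
    have "(\<lambda>p. f i (snd p) * cnj (f i (case p of (t, c) \<Rightarrow> (+) t ` c))) \<in> borel_measurable (\<mu> \<Otimes>\<^sub>M m)" if "i \<in> I" for i
      using measurable_compose[OF measurable_compose[OF translate_pair_measurable(1) fm[OF that]] cnj_meas]
        measurable_compose[OF measurable_snd fm[OF that]] by (rule borel_measurable_times[rotated])
    then have "(\<lambda>p. \<Sum>i\<in>I. f i (snd p) * cnj (f i (case p of (t, c) \<Rightarrow> (+) t ` c))) \<in> borel_measurable (\<mu> \<Otimes>\<^sub>M m)"
      by (rule borel_measurable_sum)
    then show ?thesis unfolding w_def case_prod_unfold by measurable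
  qed
  have pt: "ennreal (cmod (\<Sum>i\<in>I. G i t c)) \<le> k t * ((u c * u ((+) (- t) ` c) + w c ((+) (- t) ` c)) / 2)"
    if c: "c \<in> space m" for t c
  proof -
    let ?x = "cmod (E (p c)) * cmod (E (p ((+) (- t) ` c)))"
    let ?y = "cmod (\<Sum>i\<in>I. f i ((+) (- t) ` c) * cnj (f i c))"
    have "p ((+) (- t) ` c) = act (- t) (p c)" using c by (intro p_translate) (simp add: space_m)
    then have "(\<Sum>i\<in>I. G i t c) = \<kappa> t * \<tau> t * (E (p c) * cnj (E (p ((+) (- t) ` c)))) *
        (\<Sum>i\<in>I. f i ((+) (- t) ` c) * cnj (f i c))"
      unfolding sum_distrib_left G_def D_def by (intro sum.cong) (simp_all add: mult_ac)
    \<comment> \<open>Only the modulus of \<open>\<tau>\<close> is left here, so the character of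
      this representation need not match one that is built into \<open>\<kappa>\<close>.\<close>
    then have "cmod (\<Sum>i\<in>I. G i t c) = cmod (\<kappa> t) * (?x * ?y)" by (simp add: norm_mult \<tau>_norm)
    also have "\<dots> \<le> cmod (\<kappa> t) * ((?x\<^sup>2 + ?y\<^sup>2) / 2)"
    proof (rule mult_left_mono)
      show "?x * ?y \<le> (?x\<^sup>2 + ?y\<^sup>2) / 2"
        using zero_le_power2[of "?x - ?y"] unfolding power2_diff by simp
    qed simp
    finally have "ennreal (cmod (\<Sum>i\<in>I. G i t c)) \<le> ennreal (cmod (\<kappa> t) * ((?x\<^sup>2 + ?y\<^sup>2) / 2))"
      by (rule ennreal_leI)
    also have "\<dots> = k t * ((u c * u ((+) (- t) ` c) + w c ((+) (- t) ` c)) / 2)"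
    proof -
      have half: "ennreal ((X + Y) / 2) = (ennreal X + ennreal Y) / 2" if "0 \<le> X" "0 \<le> Y" for X Y :: real
        using divide_ennreal[of "X + Y" 2] that by simp
      have "ennreal (?x\<^sup>2) = u c * u ((+) (- t) ` c)" unfolding u_def power_mult_distrib by (rule ennreal_mult) auto
      moreover have "ennreal (?y\<^sup>2) = w c ((+) (- t) ` c)" by (simp only: w_def)
      moreover have "ennreal (cmod (\<kappa> t) * ((?x\<^sup>2 + ?y\<^sup>2) / 2)) = k t * ennreal ((?x\<^sup>2 + ?y\<^sup>2) / 2)"
        unfolding k_def by (rule ennreal_mult) auto
      ultimately show ?thesis using half[of "?x\<^sup>2" "?y\<^sup>2"] by (simp only: zero_le_power2)
    qed
    finally show ?thesis .
  qed
  have "ennreal (cmod (\<Sum>i\<in>I. \<integral>t. \<integral>c. G i t c \<partial>m \<partial>\<mu>)) = ennreal (cmod (\<integral>t. (\<Sum>i\<in>I. \<integral>c. G i t c \<partial>m) \<partial>\<mu>))"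
    using Gt by (simp add: Bochner_Integration.integral_sum)
  also have "\<dots> \<le> (\<integral>\<^sup>+t. ennreal (cmod (\<Sum>i\<in>I. \<integral>c. G i t c \<partial>m)) \<partial>\<mu>)"
    using Gt by (intro integral_norm_bound_ennreal Bochner_Integration.integrable_sum)
  also have "\<dots> \<le> (\<integral>\<^sup>+t. \<integral>\<^sup>+c. k t * ((u c * u ((+) (- t) ` c) + w c ((+) (- t) ` c)) / 2) \<partial>m \<partial>\<mu>)"
  proof (rule nn_integral_mono)
    fix t
    have "(\<Sum>i\<in>I. \<integral>c. G i t c \<partial>m) = (\<integral>c. (\<Sum>i\<in>I. G i t c) \<partial>m)"
      using Gi by (simp add: Bochner_Integration.integral_sum)
    then have "ennreal (cmod (\<Sum>i\<in>I. \<integral>c. G i t c \<partial>m)) = ennreal (cmod (\<integral>c. (\<Sum>i\<in>I. G i t c) \<partial>m))"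
      by (simp only:)
    also have "\<dots> \<le> (\<integral>\<^sup>+c. ennreal (cmod (\<Sum>i\<in>I. G i t c)) \<partial>m)"
      by (intro integral_norm_bound_ennreal Bochner_Integration.integrable_sum Gi)
    also have "\<dots> \<le> (\<integral>\<^sup>+c. k t * ((u c * u ((+) (- t) ` c) + w c ((+) (- t) ` c)) / 2) \<partial>m)"
      by (intro nn_integral_mono pt)
    finally show "ennreal (cmod (\<Sum>i\<in>I. \<integral>c. G i t c \<partial>m)) \<le>
        (\<integral>\<^sup>+c. k t * ((u c * u ((+) (- t) ` c) + w c ((+) (- t) ` c)) / 2) \<partial>m)" .
  qed
  also have "\<dots> = (\<integral>\<^sup>+t. (k t * (\<integral>\<^sup>+c. u c * u ((+) (- t) ` c) \<partial>m) + k t * (\<integral>\<^sup>+c. w ((+) t ` c) c \<partial>m)) / 2 \<partial>\<mu>)"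
  proof (rule nn_integral_cong)
    fix t
    have m1: "(\<lambda>c. u c * u ((+) (- t) ` c)) \<in> borel_measurable m"
      using measurable_compose[OF translate_measurable u_meas, of "- t"] by measurable
    have m2: "(\<lambda>c. w c ((+) (- t) ` c)) \<in> borel_measurable m"
    proof -
      have "(\<lambda>c. \<Sum>i\<in>I. f i ((+) (- t) ` c) * cnj (f i c)) \<in> borel_measurable m"
        using measurable_compose[OF translate_measurable fm, of _ "- t"] by measurable
      then show ?thesis unfolding w_def by measurable
    qed
    have "(\<integral>\<^sup>+c. w c ((+) (- t) ` c) \<partial>m) = (\<integral>\<^sup>+c. w ((+) t ` c) ((+) (- t + t) ` c) \<partial>m)"
      using nn_integral_m_translate[OF m2, of t] by (simp only: translate_translate)
    \<comment> \<open>After this translation it is the first argument that moves with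
      \<open>t\<close>, as the hypothesis \<open>b\<close> expects.\<close>
    then have shift: "(\<integral>\<^sup>+c. w c ((+) (- t) ` c) \<partial>m) = (\<integral>\<^sup>+c. w ((+) t ` c) c \<partial>m)" by (simp add: image_image)
    have m12: "(\<lambda>c. u c * u ((+) (- t) ` c) + w c ((+) (- t) ` c)) \<in> borel_measurable m"
      using m1 m2 by measurable
    have "(\<integral>\<^sup>+c. k t * ((u c * u ((+) (- t) ` c) + w c ((+) (- t) ` c)) / 2) \<partial>m) =
        k t * ((\<integral>\<^sup>+c. u c * u ((+) (- t) ` c) + w c ((+) (- t) ` c) \<partial>m) / 2)"
      using m12 by (simp add: nn_integral_cmult nn_integral_divide)
    also have "(\<integral>\<^sup>+c. u c * u ((+) (- t) ` c) + w c ((+) (- t) ` c) \<partial>m) =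
        (\<integral>\<^sup>+c. u c * u ((+) (- t) ` c) \<partial>m) + (\<integral>\<^sup>+c. w ((+) t ` c) c \<partial>m)"
      unfolding shift[symmetric] by (rule nn_integral_add[OF m1 m2])
    also have "k t * (((\<integral>\<^sup>+c. u c * u ((+) (- t) ` c) \<partial>m) + (\<integral>\<^sup>+c. w ((+) t ` c) c \<partial>m)) / 2) =
        (k t * (\<integral>\<^sup>+c. u c * u ((+) (- t) ` c) \<partial>m) + k t * (\<integral>\<^sup>+c. w ((+) t ` c) c \<partial>m)) / 2"
      by (simp add: ennreal_times_divide distrib_left)
    finally show "(\<integral>\<^sup>+c. k t * ((u c * u ((+) (- t) ` c) + w c ((+) (- t) ` c)) / 2) \<partial>m) =
        (k t * (\<integral>\<^sup>+c. u c * u ((+) (- t) ` c) \<partial>m) + k t * (\<integral>\<^sup>+c. w ((+) t ` c) c \<partial>m)) / 2" .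
  qed
  also have "\<dots> = ((\<integral>\<^sup>+t. k t * (\<integral>\<^sup>+c. u c * u ((+) (- t) ` c) \<partial>m) \<partial>\<mu>) +
      (\<integral>\<^sup>+t. k t * (\<integral>\<^sup>+c. w ((+) t ` c) c \<partial>m) \<partial>\<mu>)) / 2"
  proof -
    have "(\<lambda>(t, c). u c * u ((+) (- t) ` c)) \<in> borel_measurable (\<mu> \<Otimes>\<^sub>M m)"
      using measurable_compose[OF translate_pair_measurable(2) u_meas] unfolding case_prod_unfold by measurable
    then have m1: "(\<lambda>t. k t * (\<integral>\<^sup>+c. u c * u ((+) (- t) ` c) \<partial>m)) \<in> borel_measurable \<mu>" by measurable
    have m2: "(\<lambda>t. k t * (\<integral>\<^sup>+c. w ((+) t ` c) c \<partial>m)) \<in> borel_measurable \<mu>" using jointm by measurable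
    show ?thesis using m1 m2 by (simp add: nn_integral_add nn_integral_divide)
  qed
  also have "\<dots> \<le> (A * N + b * of_nat (card I)) / 2"
  proof (intro divide_right_mono_ennreal add_mono)
    have "(\<integral>\<^sup>+t. k t * (\<integral>\<^sup>+c. u c * u ((+) (- t) ` c) \<partial>m) \<partial>\<mu>) = (\<integral>\<^sup>+c. u c * (\<integral>\<^sup>+t. k t * u ((+) t ` c) \<partial>\<mu>) \<partial>m)"
      by (rule convolution_form_swap(1)) measurable
    also have "\<dots> \<le> (\<integral>\<^sup>+c. A * u c \<partial>m)"
    proof (rule nn_integral_mono)
      fix c assume c: "c \<in> space m"
      show "u c * (\<integral>\<^sup>+t. k t * u ((+) t ` c) \<partial>\<mu>) \<le> A * u c"
      proof (cases "E (p c) = 0")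
        case True then show ?thesis by (simp add: u_def)
      next
        case False
        have "p ((+) t ` c) = act t (p c)" for t using c by (intro p_translate) (simp add: space_m)
        then have "(\<integral>\<^sup>+t. k t * u ((+) t ` c) \<partial>\<mu>) \<le> A"
          using A[OF False] by (simp only: k_def u_def)
        then show ?thesis unfolding mult.commute[of A] by (rule mult_left_mono) simp
      qed
    qed
    also have "\<dots> = A * (\<integral>\<^sup>+c. u c \<partial>m)" by (rule nn_integral_cmult) measurable
    also have "\<dots> \<le> A * N" using N by (intro mult_left_mono) (simp_all add: u_def)
    finally show "(\<integral>\<^sup>+t. k t * (\<integral>\<^sup>+c. u c * u ((+) (- t) ` c) \<partial>m) \<partial>\<mu>) \<le> A * N" .
    have "(\<integral>\<^sup>+t. k t * (\<integral>\<^sup>+c. w ((+) t ` c) c \<partial>m) \<partial>\<mu>) = (\<integral>\<^sup>+t. \<integral>\<^sup>+c. k t * w ((+) t ` c) c \<partial>m \<partial>\<mu>)"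
    proof (intro nn_integral_cong nn_integral_cmult[symmetric])
      fix t show "(\<lambda>c. w ((+) t ` c) c) \<in> borel_measurable m"
        using measurable_compose[OF measurable_Pair1' jointm, of t] by (simp add: space_\<mu>)
    qed
    also have "\<dots> = (\<integral>\<^sup>+c. \<integral>\<^sup>+t. k t * w ((+) t ` c) c \<partial>\<mu> \<partial>m)"
    proof (rule Fubini'[symmetric])
      show "(\<lambda>(t, c). k t * w ((+) t ` c) c) \<in> borel_measurable (\<mu> \<Otimes>\<^sub>M m)"
        using jointm unfolding case_prod_unfold by measurable
    qed
    also have "\<dots> \<le> (\<integral>\<^sup>+c. b * ennreal (\<Sum>i\<in>I. (cmod (f i c))\<^sup>2) \<partial>m)"
    proof (rule nn_integral_mono)
      fix c assume c: "c \<in> space m"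
      have "(\<lambda>d. \<Sum>i\<in>I. f i c * cnj (f i d)) \<in> borel_measurable m" by measurable
      then have "(\<lambda>d. w d c) \<in> borel_measurable m" unfolding w_def by measurable
      \<comment> \<open>For fixed \<open>c\<close> the weighted integral over the translates of
        \<open>c\<close> is replaced by an integral over the whole coset space, where orthonormality
        applies.\<close>
      from b[OF this c] have "(\<integral>\<^sup>+t. k t * w ((+) t ` c) c \<partial>\<mu>) \<le> b * (\<integral>\<^sup>+d. w d c \<partial>m)"
        by (simp only: k_def)
      also have "(\<integral>\<^sup>+d. w d c \<partial>m) = ennreal (\<Sum>i\<in>I. (cmod (f i c))\<^sup>2)"
        unfolding w_def by (rule nn_integral_orthonormal_sum[OF I f])
      finally show "(\<integral>\<^sup>+t. k t * w ((+) t ` c) c \<partial>\<mu>) \<le> b * ennreal (\<Sum>i\<in>I. (cmod (f i c))\<^sup>2)" .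
    qed
    also have "\<dots> = b * (\<Sum>i\<in>I. \<integral>\<^sup>+c. ennreal ((cmod (f i c))\<^sup>2) \<partial>m)"
    proof -
      have e: "ennreal (\<Sum>i\<in>I. (cmod (f i c))\<^sup>2) = (\<Sum>i\<in>I. ennreal ((cmod (f i c))\<^sup>2))" for c
        by (rule sum_ennreal[symmetric]) simp
      have "(\<integral>\<^sup>+c. b * (\<Sum>i\<in>I. ennreal ((cmod (f i c))\<^sup>2)) \<partial>m) = b * (\<integral>\<^sup>+c. (\<Sum>i\<in>I. ennreal ((cmod (f i c))\<^sup>2)) \<partial>m)"
        by (rule nn_integral_cmult) measurable
      also have "(\<integral>\<^sup>+c. (\<Sum>i\<in>I. ennreal ((cmod (f i c))\<^sup>2)) \<partial>m) = (\<Sum>i\<in>I. \<integral>\<^sup>+c. ennreal ((cmod (f i c))\<^sup>2) \<partial>m)"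
        by (rule nn_integral_sum) measurable
      finally show ?thesis unfolding e .
    qed
    also have "(\<Sum>i\<in>I. \<integral>\<^sup>+c. ennreal ((cmod (f i c))\<^sup>2) \<partial>m) = (\<Sum>i\<in>I. 1)"
    proof (rule sum.cong)
      fix i assume i: "i \<in> I"
      have "complex_of_real (\<integral>c. (cmod (f i c))\<^sup>2 \<partial>m) = (\<integral>c. f i c * cnj (f i c) \<partial>m)"
        by (simp only: complex_norm_square[symmetric] integral_complex_of_real)
      also have "\<dots> = complex_of_real 1" using f i by (simp add: L2_orthonormal_def)
      finally have "(\<integral>c. (cmod (f i c))\<^sup>2 \<partial>m) = 1" unfolding of_real_eq_iff .
      then show "(\<integral>\<^sup>+c. ennreal ((cmod (f i c))\<^sup>2) \<partial>m) = 1" unfolding L2_nn_integral[OF fL[OF i]] by simp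
    qed simp
    finally show "(\<integral>\<^sup>+t. k t * (\<integral>\<^sup>+c. w ((+) t ` c) c \<partial>m) \<partial>\<mu>) \<le> b * of_nat (card I)" by simp
  qed
  finally show ?thesis by (simp add: G_def D_def)
qed

end

section \<open>Haar measures on closed subgroups\<close>

text \<open>Near \<open>y0\<close> the integrand is uniformly close to its value at
  \<open>y0\<close> on the compact set \<open>C\<close>. The intersection with
  \<open>space m\<close> is there because \<open>m\<close> may live on a subset of the type, as
  \<open>\<alpha> H\<close> does on \<open>H\<close>.\<close>

lemma continuous_on_parameter_integral:
  fixes \<phi> :: "'y::topological_space \<times> 'a::topological_space \<Rightarrow> real"
  assumes \<phi>: "continuous_on UNIV \<phi>" and C: "compact C"
    and meas: "\<And>y. (\<lambda>t. \<phi> (y, t)) \<in> borel_measurable m"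
    and Cm: "C \<inter> space m \<in> sets m" "emeasure m (C \<inter> space m) < \<infinity>"
    and zero: "\<And>y t. t \<in> space m \<Longrightarrow> t \<notin> C \<Longrightarrow> \<phi> (y, t) = 0"
  shows "continuous_on UNIV (\<lambda>y. \<integral>t. \<phi> (y, t) \<partial>m)" and "integrable m (\<lambda>t. \<phi> (y, t))"
proof -
  let ?c = "measure m (C \<inter> space m)"
  have int: "integrable m (\<lambda>t. \<phi> (y, t))" for y
  proof -
    have "continuous_on C (\<lambda>t. \<phi> (y, t))"
      by (rule continuous_on_compose2[OF \<phi>]) (auto intro!: continuous_intros)
    then have "bounded ((\<lambda>t. \<phi> (y, t)) ` C)" by (intro compact_imp_bounded compact_continuous_image C)
    then obtain B where B: "\<And>t. t \<in> C \<Longrightarrow> norm (\<phi> (y, t)) \<le> B" by (auto simp: bounded_iff)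
    show ?thesis
      using Cm meas B zero by (intro integrableI_bounded_set[of "C \<inter> space m" _ _ B]) auto
  qed
  then show "integrable m (\<lambda>t. \<phi> (y, t))" .
  have "((\<lambda>y. \<integral>t. \<phi> (y, t) \<partial>m) \<longlongrightarrow> (\<integral>t. \<phi> (y0, t) \<partial>m)) (at y0)" for y0
  proof (rule tendstoI)
    fix e :: real assume e: "e > 0"
    define d where "d = e / (?c + 1)"
    have cpos: "?c + 1 > 0" by (intro add_nonneg_pos) auto
    have d: "d > 0" using e cpos by (simp add: d_def)
    have c\<phi>: "continuous_on (UNIV \<times> C) \<phi>" by (rule continuous_on_subset[OF \<phi>]) auto
    obtain X0 where X0: "y0 \<in> X0" "open X0" "\<forall>y\<in>X0 \<inter> UNIV. \<forall>t\<in>C. dist (\<phi> (y, t)) (\<phi> (y0, t)) \<le> d"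
      by (rule continuous_on_prod_compactE[OF c\<phi> C UNIV_I d])
    have "\<forall>\<^sub>F y in at y0. y \<in> X0" using X0(1,2) by (intro eventually_at_in_open') auto
    then show "\<forall>\<^sub>F y in at y0. dist (\<integral>t. \<phi> (y, t) \<partial>m) (\<integral>t. \<phi> (y0, t) \<partial>m) < e"
    proof eventually_elim
      case (elim y)
      have "norm ((\<integral>t. \<phi> (y, t) \<partial>m) - (\<integral>t. \<phi> (y0, t) \<partial>m)) = norm (\<integral>t. \<phi> (y, t) - \<phi> (y0, t) \<partial>m)"
        using int by simp
      also have "\<dots> \<le> (\<integral>t. norm (\<phi> (y, t) - \<phi> (y0, t)) \<partial>m)" by (rule integral_norm_bound)
      also have "\<dots> \<le> (\<integral>t. indicator (C \<inter> space m) t * d \<partial>m)"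
      proof (rule integral_mono)
        show "integrable m (\<lambda>t. norm (\<phi> (y, t) - \<phi> (y0, t)))" using int by simp
        show "integrable m (\<lambda>t. indicator (C \<inter> space m) t * d)"
          using Cm by (intro integrable_mult_left integrable_real_indicator) auto
        show "norm (\<phi> (y, t) - \<phi> (y0, t)) \<le> indicator (C \<inter> space m) t * d" if t: "t \<in> space m" for t
        proof (cases "t \<in> C")
          case True
          then show ?thesis using bspec[OF bspec[OF X0(3), of y] True] elim t by (simp add: dist_norm)
        qed (use zero[OF t] in simp)
      qed
      also have "\<dots> = ?c * d" using Cm by simp
      also have "\<dots> < e" unfolding d_def using e cpos by (simp add: field_simps)
      finally show ?case by (simp add: dist_norm)
    qed
  qed
  then show "continuous_on UNIV (\<lambda>y. \<integral>t. \<phi> (y, t) \<partial>m)" by (simp add: continuous_on_def)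
qed

locale haar_family = haar_group type_dummy \<mu>
  for type_dummy :: "'g::{topological_ab_group_add, t2_space, second_countable_topology} itself" and \<mu> +
  fixes f0 :: "'g \<Rightarrow> real" and \<alpha> :: "'g set \<Rightarrow> 'g measure" and \<nu> :: "'g set \<Rightarrow> 'g set measure"
  assumes f0: "f0 \<in> Cc" "f0 0 = 1" "\<And>s. 0 \<le> f0 s \<and> f0 s \<le> 1"
    and families: "haar_families f0 \<mu> \<alpha> \<nu>"
begin

lemma f0_continuous: "continuous_on UNIV f0"
  using f0(1) by (simp add: Cc_def)

lemma f0_measurable: "f0 \<in> borel_measurable borel"
  using f0_continuous by (rule borel_measurable_continuous_onI)

context
  fixes H :: "'g set"
  assumes H: "H \<in> closed_subgroups"
begin

lemma haar_\<alpha>: "invariant_measure (top_of_set H) H (+) (\<alpha> H)" "(\<integral>t. f0 t \<partial>\<alpha> H) = 1"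
  using families H by (auto simp: haar_families_def haar_measure_on_def)

lemma Weil: "f \<in> Cc \<Longrightarrow> (\<integral>s. f s \<partial>\<mu>) = (\<integral>c. (\<integral>t. f (coset_rep c + t) \<partial>\<alpha> H) \<partial>\<nu> H)" for f :: "'g \<Rightarrow> complex"
  using families H unfolding haar_families_def by blast

lemma sets_\<alpha>: "sets (\<alpha> H) = sets (borel_of_topology (top_of_set H))"
  using haar_\<alpha>(1) by (simp add: invariant_measure_def)

lemma space_\<alpha>: "space (\<alpha> H) = H"
  using sets_eq_imp_space_eq[OF sets_\<alpha>] by (simp add: space_borel_of_topology)

lemma ident_measurable_\<alpha>: "(\<lambda>t. t) \<in> measurable (\<alpha> H) borel"
  by (rule continuous_map_measurable[of "top_of_set H" euclidean]) (simp_all add: sets_\<alpha> sets_borel_of_topology_euclidean)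

lemma borel_measurable_\<alpha>: "f \<in> borel_measurable borel \<Longrightarrow> f \<in> borel_measurable (\<alpha> H)"
  by (rule measurable_compose[OF ident_measurable_\<alpha>])

lemma Int_sets_\<alpha>: "B \<in> sets borel \<Longrightarrow> B \<inter> H \<in> sets (\<alpha> H)"
  using measurable_sets[OF ident_measurable_\<alpha>, of B] by (simp add: space_\<alpha>)

lemma finite_\<alpha>:
  assumes K: "compact K"
  shows "emeasure (\<alpha> H) (K \<inter> H) < \<infinity>"
proof -
  have "compact (K \<inter> H)" using K uminus_zero_subgroup(1)[OF H] by (rule compact_Int_closed)
  then have "compactin (top_of_set H) (K \<inter> H)" by (simp add: compactin_subtopology)
  moreover have "K \<inter> H \<in> sets (\<alpha> H)" using compact_imp_closed[OF K] by (intro Int_sets_\<alpha>) simp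
  ultimately show ?thesis using haar_\<alpha>(1) by (auto simp: invariant_measure_def)
qed

lemma nn_integral_\<alpha>_translate:
  assumes h: "h \<in> H" and f: "f \<in> borel_measurable borel"
  shows "(\<integral>\<^sup>+t. f (h + t) \<partial>\<alpha> H) = (\<integral>\<^sup>+t. f t \<partial>\<alpha> H)"
proof -
  note sg = uminus_zero_subgroup[OF H]
  have cont: "continuous_map (top_of_set H) (top_of_set H) ((+) s)" if "s \<in> H" for s
    using sg(3)[OF that] by (auto simp: continuous_map_in_subtopology intro!: continuous_intros)
  have d: "distr (\<alpha> H) (\<alpha> H) ((+) h) = \<alpha> H"
    using h sg(4)[OF h] by (intro invariant_measure_distr[OF haar_\<alpha>(1)] cont) auto
  have meas: "(+) h \<in> measurable (\<alpha> H) (\<alpha> H)"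
    by (rule continuous_map_measurable[OF cont[OF h] sets_\<alpha> sets_\<alpha>])
  have "(\<integral>\<^sup>+t. f t \<partial>\<alpha> H) = (\<integral>\<^sup>+t. f t \<partial>distr (\<alpha> H) (\<alpha> H) ((+) h))" by (simp only: d)
  also have "\<dots> = (\<integral>\<^sup>+t. f (h + t) \<partial>\<alpha> H)" by (rule nn_integral_distr[OF meas]) (simp only: d borel_measurable_\<alpha>[OF f])
  finally show ?thesis by simp
qed

lemma nn_integral_f0: "(\<integral>\<^sup>+t. ennreal (f0 t) \<partial>\<alpha> H) = 1"
proof -
  \<comment> \<open>The Bochner integral of a non-integrable function is 0, so the normalisation to
    1 forces integrability.\<close>
  have "integrable (\<alpha> H) f0" using haar_\<alpha>(2) not_integrable_integral_eq by fastforce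
  then have "(\<integral>\<^sup>+t. ennreal (f0 t) \<partial>\<alpha> H) = ennreal (\<integral>t. f0 t \<partial>\<alpha> H)"
    using f0(3) by (intro nn_integral_eq_integral) auto
  then show ?thesis by (simp add: haar_\<alpha>(2))
qed

lemma sigma_finite_\<alpha>: "sigma_finite_measure (\<alpha> H)"
proof -
  obtain K :: "nat \<Rightarrow> 'g set" where K: "\<And>n. compactin euclidean (K n)" "incseq K" "(\<Union>n. K n) = topspace euclidean"
    using G.open_exhaustion[OF openin_topspace] by metis
  show ?thesis
  proof
    have "K n \<inter> H \<in> sets (\<alpha> H)" "emeasure (\<alpha> H) (K n \<inter> H) \<noteq> \<infinity>" for n
      using K(1)[of n] finite_\<alpha>[of "K n"] Int_sets_\<alpha>[of "K n"] compact_imp_closed[of "K n"] by auto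
    moreover have "(\<Union>n. K n \<inter> H) = H" using K(3) by auto
    ultimately show "\<exists>A. countable A \<and> A \<subseteq> sets (\<alpha> H) \<and> \<Union> A = space (\<alpha> H) \<and> (\<forall>a\<in>A. emeasure (\<alpha> H) a \<noteq> \<infinity>)"
      by (intro exI[of _ "range (\<lambda>n. K n \<inter> H)"]) (auto simp: space_\<alpha>)
  qed
qed

end

lemma pair_\<alpha>_measurable:
  assumes H: "H \<in> closed_subgroups" and L: "L \<in> closed_subgroups" and f: "f \<in> borel_measurable borel"
  shows "(\<lambda>(s, h). f (s + h)) \<in> borel_measurable (\<alpha> H \<Otimes>\<^sub>M \<alpha> L)"
proof -
  have "(\<lambda>p. (fst p, snd p)) \<in> measurable (\<alpha> H \<Otimes>\<^sub>M \<alpha> L) (borel \<Otimes>\<^sub>M borel)"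
    by (intro measurable_Pair measurable_compose[OF measurable_fst ident_measurable_\<alpha>[OF H]]
        measurable_compose[OF measurable_snd ident_measurable_\<alpha>[OF L]])
  then have 1: "(\<lambda>p. (fst p, snd p)) \<in> measurable (\<alpha> H \<Otimes>\<^sub>M \<alpha> L) (borel :: ('g \<times> 'g) measure)"
    unfolding borel_prod .
  have "(\<lambda>p. fst p + snd p :: 'g) \<in> borel_measurable (borel :: ('g \<times> 'g) measure)"
    by (intro borel_measurable_continuous_onI continuous_intros)
  from measurable_compose[OF measurable_compose[OF 1 this] f]
  show ?thesis by (simp add: case_prod_unfold)
qed

text \<open>Convergence of subgroups is used in this form: a compact set is avoided and finitely
  many open sets are met. The sets of \<open>F\<close> meet \<open>H\<close>, hence are non-empty as
  the basis demands.\<close>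

lemma fell_nhd:
  fixes H :: "'g set"
  assumes lim: "limitin fell_topology Hn H sequentially"
    and C: "compact C" "C \<inter> H = {}" and F: "finite F" "\<And>A. A \<in> F \<Longrightarrow> open A \<and> H \<inter> A \<noteq> {}"
  shows "\<forall>\<^sub>F n in sequentially. Hn n \<in> closed_subgroups \<and> C \<inter> Hn n = {} \<and> (\<forall>A\<in>F. Hn n \<inter> A \<noteq> {})"
    and "H \<in> closed_subgroups"
proof -
  have op: "openin fell_topology {H \<in> closed_subgroups. C \<inter> H = {} \<and> (\<forall>A\<in>F. H \<inter> A \<noteq> {})}"
    if "compact C" "finite F" "\<And>A. A \<in> F \<Longrightarrow> open A \<and> A \<noteq> {}" for C :: "'g set" and F
    unfolding fell_topology_def by (rule topology_generated_by_Basis) (use that in blast)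
  have "openin fell_topology {H \<in> closed_subgroups :: 'g set set. {} \<inter> H = {} \<and> (\<forall>A\<in>{}. H \<inter> A \<noteq> {})}"
    by (rule op) auto
  have top: "topspace (fell_topology :: 'g set topology) \<subseteq> closed_subgroups"
    unfolding fell_topology_def topology_generated_by_topspace by blast
  then show H: "H \<in> closed_subgroups" using lim subsetD[OF top, of H] by (simp add: limitin_def)
  have "openin fell_topology {H \<in> closed_subgroups. C \<inter> H = {} \<and> (\<forall>A\<in>F. H \<inter> A \<noteq> {})}"
    using C F by (intro op) fast+
  moreover have "H \<in> {H \<in> closed_subgroups. C \<inter> H = {} \<and> (\<forall>A\<in>F. H \<inter> A \<noteq> {})}" using H C F by blast
  ultimately have "\<forall>\<^sub>F n in sequentially. Hn n \<in> {H \<in> closed_subgroups. C \<inter> H = {} \<and> (\<forall>A\<in>F. H \<inter> A \<noteq> {})}"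
    using lim unfolding limitin_def by blast
  then show "\<forall>\<^sub>F n in sequentially. Hn n \<in> closed_subgroups \<and> C \<inter> Hn n = {} \<and> (\<forall>A\<in>F. Hn n \<inter> A \<noteq> {})"
    by simp
qed

text \<open>Averaging \<open>f\<^sub>0\<close> over the compact group \<open>H\<close> gives a continuous function equal to \<open>1\<close> on \<open>H\<close>,
  hence close to \<open>1\<close> on \<open>C \<inter> H\<^sub>n\<close> for large \<open>n\<close>; its integral over \<open>C \<inter> H\<^sub>n\<close> is computed by
  Tonelli, replacing the translation by \<open>h \<in> H\<close> by one by a nearby element of \<open>H\<^sub>n\<close>.\<close>

lemma haar_upper_semicontinuous:
  assumes lim: "limitin fell_topology Hn H sequentially" and cH: "compact H" and C: "compact C" and e: "e > 0"
  shows "\<forall>\<^sub>F n in sequentially. Hn n \<in> closed_subgroups \<and>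
    emeasure (\<alpha> (Hn n)) (C \<inter> Hn n) \<le> ennreal (1 + e) * emeasure (\<alpha> H) H"
proof -
  have H: "H \<in> closed_subgroups" by (rule fell_nhd(2)[OF lim, of "{}" "{}"]) auto
  define \<beta> where "\<beta> = measure (\<alpha> H) H"
  have \<beta>fin: "emeasure (\<alpha> H) H < \<infinity>" using finite_\<alpha>[OF H cH] by simp
  then have \<beta>: "emeasure (\<alpha> H) H = ennreal \<beta>" unfolding \<beta>_def by (simp add: emeasure_eq_ennreal_measure less_top[symmetric])
  have \<beta>1: "1 \<le> \<beta>"
  proof -
    have "1 = (\<integral>\<^sup>+t. ennreal (f0 t) \<partial>\<alpha> H)" by (rule nn_integral_f0[OF H, symmetric])
    also have "\<dots> \<le> (\<integral>\<^sup>+t. 1 \<partial>\<alpha> H)" using f0(3) by (intro nn_integral_mono) (simp add: ennreal_le_1)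
    also have "\<dots> = ennreal \<beta>" using \<beta> by (simp add: space_\<alpha>[OF H])
    finally show ?thesis by simp
  qed
  \<comment> \<open>Chosen for \<open>key\<close>: with d (1 + \<beta>) = e / (1 + e) the inequality
    (1 - d) a <= \<beta> (1 + d a) becomes a <= (1 + e) \<beta>.\<close>
  define d where "d = e / ((1 + e) * (1 + \<beta>))"
  have d: "d > 0" using e \<beta>1 by (simp add: d_def)
  have key: "a \<le> (1 + e) * \<beta>" if "(1 - d) * a \<le> \<beta> * (1 + d * a)" for a
  proof -
    have "a * (1 - d * (1 + \<beta>)) \<le> \<beta>" using that by (simp add: algebra_simps)
    moreover have "d * (1 + \<beta>) = e / (1 + e)" using \<beta>1 by (simp add: d_def)
    moreover have "1 - e / (1 + e) = 1 / (1 + e)" using e by (simp add: field_simps)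
    ultimately have "a * (1 / (1 + e)) \<le> \<beta>" by simp
    then show ?thesis using e by (simp add: field_simps)
  qed
  define g where "g = (\<lambda>s. \<integral>h. f0 (s + h) \<partial>\<alpha> H)"
  have meas: "(\<lambda>h. f0 (s + h)) \<in> borel_measurable borel" for s
    by (intro borel_measurable_continuous_onI continuous_on_compose2[OF f0_continuous] continuous_intros) auto
  have g: "continuous_on UNIV g" "integrable (\<alpha> H) (\<lambda>h. f0 (s + h))" for s
  proof -
    have c: "continuous_on UNIV (\<lambda>(s, h). f0 (s + h))"
      unfolding case_prod_unfold by (intro continuous_on_compose2[OF f0_continuous] continuous_intros) auto
    have m: "(\<lambda>h. case (s, h) of (s, h) \<Rightarrow> f0 (s + h)) \<in> borel_measurable (\<alpha> H)" for s
      using borel_measurable_\<alpha>[OF H meas[of s]] by simp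
    have Hs: "H \<inter> space (\<alpha> H) \<in> sets (\<alpha> H)" "emeasure (\<alpha> H) (H \<inter> space (\<alpha> H)) < \<infinity>"
      using \<beta>fin sets.top[of "\<alpha> H"] by (simp_all add: space_\<alpha>[OF H])
    have "continuous_on UNIV (\<lambda>s. \<integral>h. (case (s, h) of (s, h) \<Rightarrow> f0 (s + h)) \<partial>\<alpha> H)"
      by (rule continuous_on_parameter_integral(1)[OF c cH m Hs]) (simp add: space_\<alpha>[OF H])
    then show "continuous_on UNIV g" by (simp add: g_def)
    have "integrable (\<alpha> H) (\<lambda>h. case (s, h) of (s, h) \<Rightarrow> f0 (s + h))"
      by (rule continuous_on_parameter_integral(2)[OF c cH m Hs]) (simp add: space_\<alpha>[OF H])
    then show "integrable (\<alpha> H) (\<lambda>h. f0 (s + h))" by simp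
  qed
  have gnn: "ennreal (g s) = (\<integral>\<^sup>+h. ennreal (f0 (s + h)) \<partial>\<alpha> H)" for s
    unfolding g_def using f0(3) by (intro nn_integral_eq_integral[symmetric] g) auto
  have g1: "g s = 1" if "s \<in> H" for s
  proof -
    have "ennreal (g s) = 1" unfolding gnn
      using nn_integral_\<alpha>_translate[OF H that, of "\<lambda>t. ennreal (f0 t)"] nn_integral_f0[OF H] f0_measurable by simp
    then show ?thesis by (simp add: ennreal_eq_1)
  qed
  \<comment> \<open>On this neighbourhood of \<open>H\<close> the average \<open>g\<close> exceeds 1
    - d; the compact remainder of \<open>C\<close> misses \<open>H\<close>, hence also
    \<open>Hn n\<close> for large \<open>n\<close>.\<close>
  define O' where "O' = {s. 1 - d < g s}"
  have O: "open O'" unfolding O'_def by (intro open_Collect_less continuous_on_const g(1))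
  have HO: "H \<subseteq> O'" unfolding O'_def using g1 d by auto
  have CO: "compact (C - O')" using C O by (rule compact_diff)
  \<comment> \<open>Two elements of one set \<open>X h\<close> shift \<open>f0\<close> to functions
    differing by at most \<open>d\<close> on \<open>C\<close>. Finitely many of these sets cover
    \<open>H\<close>, and \<open>Hn n\<close> meets each of them for large \<open>n\<close>.\<close>
  have "\<exists>X. h \<in> X \<and> open X \<and> (\<forall>h'\<in>X. \<forall>s\<in>C. \<bar>f0 (s + h') - f0 (s + h)\<bar> \<le> d / 2)" for h
  proof -
    have c: "continuous_on (UNIV \<times> C) (\<lambda>(h, s). f0 (s + h))"
      unfolding case_prod_unfold by (intro continuous_on_compose2[OF f0_continuous] continuous_intros) auto
    obtain X0 where X0: "h \<in> X0" "open X0"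
        "\<forall>h'\<in>X0 \<inter> UNIV. \<forall>s\<in>C. dist (case (h', s) of (h, s) \<Rightarrow> f0 (s + h)) (case (h, s) of (h, s) \<Rightarrow> f0 (s + h)) \<le> d / 2"
      by (rule continuous_on_prod_compactE[OF c C UNIV_I half_gt_zero[OF d]])
    then show ?thesis by (intro exI[of _ X0]) (simp add: dist_real_def)
  qed
  then obtain X where X: "\<And>h. h \<in> X h" "\<And>h. open (X h)"
      "\<And>h h' s. h' \<in> X h \<Longrightarrow> s \<in> C \<Longrightarrow> \<bar>f0 (s + h') - f0 (s + h)\<bar> \<le> d / 2" by metis
  obtain D where D: "D \<subseteq> H" "finite D" "H \<subseteq> (\<Union>h\<in>D. X h)"
    by (rule compactE_image[OF cH, of H X]) (use X(1,2) in blast)+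
  have "\<forall>\<^sub>F n in sequentially. Hn n \<in> closed_subgroups \<and> (C - O') \<inter> Hn n = {} \<and> (\<forall>A\<in>X ` D. Hn n \<inter> A \<noteq> {})"
  proof (rule fell_nhd(1)[OF lim CO])
    show "(C - O') \<inter> H = {}" using HO by blast
    show "open A \<and> H \<inter> A \<noteq> {}" if "A \<in> X ` D" for A using that X(1,2) D(1) by blast
  qed (use D in simp)
  then show ?thesis
  proof eventually_elim
    case (elim n)
    let ?A = "\<alpha> (Hn n)" and ?L = "C \<inter> Hn n"
    have Hn: "Hn n \<in> closed_subgroups" using elim by blast
    define a where "a = measure ?A ?L"
    have Ls: "?L \<in> sets ?A" using compact_imp_closed[OF C] by (intro Int_sets_\<alpha>[OF Hn]) simp
    have a: "emeasure ?A ?L = ennreal a"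
      unfolding a_def using finite_\<alpha>[OF Hn C] by (simp add: emeasure_eq_ennreal_measure less_top[symmetric])
    have a0: "a \<ge> 0" by (simp add: a_def)
    interpret P: pair_sigma_finite ?A "\<alpha> H"
      using sigma_finite_\<alpha>[OF Hn] sigma_finite_\<alpha>[OF H] by (simp add: pair_sigma_finite_def)
    have f0m: "(\<lambda>t. ennreal (f0 t)) \<in> borel_measurable borel" using f0_measurable by measurable
    have f0t: "(\<lambda>t. ennreal (f0 (t + h))) \<in> borel_measurable ?A" for h
      using borel_measurable_\<alpha>[OF Hn meas[of h]] by (simp add: add.commute)
    \<comment> \<open>Replacing \<open>h\<close> by a nearby element of \<open>Hn n\<close> costs
      \<open>d\<close> on \<open>?L\<close>; the integral over all of \<open>Hn n\<close> is then
      the translated normalisation, which is 1.\<close>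
    have inner: "(\<integral>\<^sup>+s. indicator ?L s * ennreal (f0 (s + h)) \<partial>?A) \<le> ennreal (1 + d * a)" if h: "h \<in> H" for h
    proof -
      obtain h0 where h0: "h0 \<in> D" "h \<in> X h0" using D(3) h by blast
      obtain h' where h': "h' \<in> Hn n" "h' \<in> X h0" using elim h0(1) by blast
      have "(\<integral>\<^sup>+s. indicator ?L s * ennreal (f0 (s + h)) \<partial>?A) \<le>
          (\<integral>\<^sup>+s. ennreal (f0 (s + h')) + ennreal d * indicator ?L s \<partial>?A)"
      proof (rule nn_integral_mono)
        fix s assume "s \<in> space ?A"
        show "indicator ?L s * ennreal (f0 (s + h)) \<le> ennreal (f0 (s + h')) + ennreal d * indicator ?L s"
        proof (cases "s \<in> ?L")
          case True
          then have sC: "s \<in> C" by blast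
          have "f0 (s + h) \<le> f0 (s + h') + d"
            using X(3)[OF h0(2) sC] X(3)[OF h'(2) sC] by linarith
          then show ?thesis using True d f0(3)[of "s + h'"] by (simp add: ennreal_leI flip: ennreal_plus)
        qed simp
      qed
      also have "\<dots> = (\<integral>\<^sup>+s. ennreal (f0 (s + h')) \<partial>?A) + (\<integral>\<^sup>+s. ennreal d * indicator ?L s \<partial>?A)"
        using f0t Ls by (intro nn_integral_add) auto
      also have "(\<integral>\<^sup>+s. ennreal (f0 (s + h')) \<partial>?A) = 1"
        using nn_integral_\<alpha>_translate[OF Hn h'(1) f0m] nn_integral_f0[OF Hn] by (simp add: add.commute)
      also have "(\<integral>\<^sup>+s. ennreal d * indicator ?L s \<partial>?A) = ennreal d * ennreal a"
        using Ls by (simp add: nn_integral_cmult_indicator a)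
      also have "1 + ennreal d * ennreal a = ennreal (1 + d * a)"
        using d a0 by (simp add: ennreal_mult)
      finally show ?thesis .
    qed
    have joint: "(\<lambda>(s, h). indicator ?L s * ennreal (f0 (s + h))) \<in> borel_measurable (?A \<Otimes>\<^sub>M \<alpha> H)"
      using pair_\<alpha>_measurable[OF Hn H f0m] Ls unfolding case_prod_unfold
      by (intro borel_measurable_times_ennreal measurable_compose[OF measurable_fst borel_measurable_indicator])
    have "ennreal ((1 - d) * a) \<le> (\<integral>\<^sup>+s. ennreal (1 - d) * indicator ?L s \<partial>?A)"
    proof (cases "1 - d \<ge> 0")
      case True then show ?thesis using Ls a0 by (simp add: nn_integral_cmult_indicator a ennreal_mult)
    next
      case False
      then have "(1 - d) * a \<le> 0" using a0 by (intro mult_nonpos_nonneg) auto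
      then show ?thesis by (simp add: ennreal_neg)
    qed
    also have "\<dots> \<le> (\<integral>\<^sup>+s. indicator ?L s * ennreal (g s) \<partial>?A)"
    proof (rule nn_integral_mono)
      fix s assume "s \<in> space ?A"
      show "ennreal (1 - d) * indicator ?L s \<le> indicator ?L s * ennreal (g s)"
      proof (cases "s \<in> ?L")
        case True
        then have "s \<in> O'" using elim by blast
        then show ?thesis using True by (simp add: O'_def ennreal_leI)
      qed simp
    qed
    also have "\<dots> = (\<integral>\<^sup>+s. \<integral>\<^sup>+h. indicator ?L s * ennreal (f0 (s + h)) \<partial>\<alpha> H \<partial>?A)"
      unfolding gnn using borel_measurable_\<alpha>[OF H meas]
      by (intro nn_integral_cong nn_integral_cmult[symmetric]) measurable
    also have "\<dots> = (\<integral>\<^sup>+h. \<integral>\<^sup>+s. indicator ?L s * ennreal (f0 (s + h)) \<partial>?A \<partial>\<alpha> H)"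
      by (rule P.Fubini'[symmetric, OF joint])
    also have "\<dots> \<le> (\<integral>\<^sup>+h. ennreal (1 + d * a) \<partial>\<alpha> H)"
      using inner by (intro nn_integral_mono) (simp add: space_\<alpha>[OF H])
    also have "\<dots> = ennreal (\<beta> * (1 + d * a))"
      using \<beta> \<beta>1 a0 d by (simp add: space_\<alpha>[OF H] ennreal_mult mult.commute)
    finally have "(1 - d) * a \<le> \<beta> * (1 + d * a)"
      using \<beta>1 a0 d by (subst (asm) ennreal_le_iff) auto
    from key[OF this] have "ennreal a \<le> ennreal ((1 + e) * \<beta>)" by (rule ennreal_leI)
    also have "\<dots> = ennreal (1 + e) * emeasure (\<alpha> H) H" using e \<beta>1 by (simp add: \<beta> ennreal_mult)
    finally show ?case using Hn by (simp add: a)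
  qed
qed

end

section \<open>Weil's formula and integration along cosets\<close>

lemma CcI:
  fixes f :: "'a::t2_space \<Rightarrow> 'b::real_normed_vector"
  assumes f: "continuous_on UNIV f" and C: "compact C" and zero: "\<And>x. x \<notin> C \<Longrightarrow> f x = 0"
  shows "f \<in> Cc"
proof -
  have "closure {x. f x \<noteq> 0} \<subseteq> C"
    using zero by (intro closure_minimal compact_imp_closed[OF C]) blast
  then have "compact (closure {x. f x \<noteq> 0})" by (rule compact_closed_subset[OF C closed_closure])
  then show ?thesis using f by (simp add: Cc_def)
qed

lemma CcD:
  assumes "f \<in> Cc"
  shows "continuous_on UNIV f" "compact (closure {x. f x \<noteq> 0})" "x \<notin> closure {x. f x \<noteq> 0} \<Longrightarrow> f x = 0"
  using assms closure_subset[of "{x. f x \<noteq> 0}"] by (auto simp: Cc_def)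

text \<open>For a non-integrable function the left side is 0 by convention.\<close>

lemma ennreal_integral_le_nn_integral:
  fixes f :: "'a \<Rightarrow> real"
  assumes "AE x in m. 0 \<le> f x"
  shows "ennreal (\<integral>x. f x \<partial>m) \<le> (\<integral>\<^sup>+x. ennreal (f x) \<partial>m)"
  using nn_integral_eq_integral[OF _ assms] by (cases "integrable m f") (simp_all add: not_integrable_integral_eq)

text \<open>The preimage is closed and lies in the sum of \<open>H\<close> and a compact lift of
  \<open>K\<close>.\<close>

lemma (in coset_space) compact_vimage_q:
  assumes H': "compact H" and K: "compactin Q K"
  shows "compact (q -` K)"
proof -
  obtain C where C: "compact C" "K \<subseteq> q ` C" by (rule compactin_lift[OF K])
  have "closed (q -` K)"
    using compactin_imp_closedin[OF Q.hausdorff K] closedin_continuous_map_preimage[OF continuous_q]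
    by (simp add: vimage_def)
  moreover have "q -` K \<subseteq> (\<lambda>(a, b). a + b) ` (C \<times> H)"
  proof
    fix s assume "s \<in> q -` K"
    then obtain a where a: "a \<in> C" "q a = q s" using C(2) by force
    then have "s - a \<in> H" by (simp add: coset_eq_iff[OF H])
    then have "(a, s - a) \<in> C \<times> H" using a by simp
    then show "s \<in> (\<lambda>(a, b). a + b) ` (C \<times> H)" by (rule rev_image_eqI) simp
  qed
  ultimately show ?thesis by (rule compact_closed_subset[OF compact_sum_set(1)[OF C(1) H']])
qed

locale haar_subgroup = haar_family type_dummy \<mu> f0 \<alpha> \<nu> + coset_measure type_dummy H "\<nu> H"
  for type_dummy :: "'g::{topological_ab_group_add, t2_space, second_countable_topology} itself"
    and \<mu> f0 \<alpha> \<nu> and H :: "'g set"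
begin

lemma q_measurable: "q \<in> measurable \<mu> (\<nu> H)"
  using sets_\<mu> sets_m by (intro continuous_map_measurable[OF continuous_q]) (simp_all add: sets_borel_of_topology_euclidean)

lemma q_rep_add:
  assumes c: "c \<in> range q" and t: "t \<in> H"
  shows "q (coset_rep c + t) = c"
proof -
  have "q (coset_rep c + t) = q (coset_rep c)" using t by (simp add: coset_eq_iff[OF H] uminus_zero_subgroup(4)[OF H])
  then show ?thesis by (simp add: coset_coset_rep[OF H c])
qed

text \<open>The factor \<open>f (q s)\<close> is constant along the fibres and leaves the inner
  integral.\<close>

lemma Weil_real:
  fixes k :: "'g \<Rightarrow> real"
  assumes f: "continuous_map Q euclideanreal f" and kf: "(\<lambda>s. k s * f (q s)) \<in> Cc"
  shows "(\<integral>s. k s * f (q s) \<partial>\<mu>) = (\<integral>c. f c * (\<integral>t. k (coset_rep c + t) \<partial>\<alpha> H) \<partial>\<nu> H)"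
proof -
  have cl: "closure {s. complex_of_real (k s * f (q s)) \<noteq> 0} = closure {s. k s * f (q s) \<noteq> 0}"
    by (simp only: of_real_eq_0_iff)
  have cr: "continuous_on UNIV (\<lambda>s. complex_of_real (k s * f (q s)))" by (rule continuous_on_of_real[OF CcD(1)[OF kf]])
  have c: "(\<lambda>s. complex_of_real (k s * f (q s))) \<in> Cc"
    using kf cr cl unfolding Cc_def mem_Collect_eq by (simp only:)
  have "complex_of_real (\<integral>s. k s * f (q s) \<partial>\<mu>) = (\<integral>s. complex_of_real (k s * f (q s)) \<partial>\<mu>)"
    by (rule integral_complex_of_real[symmetric])
  also have "\<dots> = (\<integral>c. (\<integral>t. complex_of_real (k (coset_rep c + t) * f (q (coset_rep c + t))) \<partial>\<alpha> H) \<partial>\<nu> H)"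
    by (rule Weil[OF H c])
  also have "\<dots> = (\<integral>c. complex_of_real (f c * (\<integral>t. k (coset_rep c + t) \<partial>\<alpha> H)) \<partial>\<nu> H)"
  proof (rule Bochner_Integration.integral_cong[OF refl])
    fix c assume "c \<in> space (\<nu> H)"
    then have c: "c \<in> range q" by (simp add: space_m)
    have "(\<integral>t. complex_of_real (k (coset_rep c + t) * f (q (coset_rep c + t))) \<partial>\<alpha> H) =
        (\<integral>t. complex_of_real (f c * k (coset_rep c + t)) \<partial>\<alpha> H)"
      by (intro Bochner_Integration.integral_cong refl) (simp add: q_rep_add[OF c] space_\<alpha>[OF H] mult.commute)
    then show "(\<integral>t. complex_of_real (k (coset_rep c + t) * f (q (coset_rep c + t))) \<partial>\<alpha> H) =
        complex_of_real (f c * (\<integral>t. k (coset_rep c + t) \<partial>\<alpha> H))"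
      by (simp only: integral_complex_of_real integral_mult_right_zero)
  qed
  also have "\<dots> = complex_of_real (\<integral>c. f c * (\<integral>t. k (coset_rep c + t) \<partial>\<alpha> H) \<partial>\<nu> H)"
    by (rule integral_complex_of_real)
  finally show ?thesis by (simp only: of_real_eq_iff)
qed

lemma nn_integral_Cc_finite:
  assumes k: "k \<in> Cc" "\<And>s. 0 \<le> k s"
  shows "integrable \<mu> k" "(\<integral>\<^sup>+s. ennreal (k s) \<partial>\<mu>) < \<infinity>"
proof -
  note kD = CcD[OF k(1)]
  have "bounded (k ` closure {x. k x \<noteq> 0})"
    by (intro compact_imp_bounded compact_continuous_image kD continuous_on_subset[OF kD(1)]) auto
  then obtain B where B: "\<And>t. t \<in> closure {x. k x \<noteq> 0} \<Longrightarrow> norm (k t) \<le> B" by (auto simp: bounded_iff)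
  show i: "integrable \<mu> k"
  proof (rule integrableI_bounded_set[of "closure {x. k x \<noteq> 0}" _ _ B])
    show "closure {x. k x \<noteq> 0} \<in> sets \<mu>" by (simp add: sets_\<mu>)
    show "k \<in> borel_measurable \<mu>" by (intro measurable_\<mu> borel_measurable_continuous_onI kD)
    show "emeasure \<mu> (closure {x. k x \<noteq> 0}) < \<infinity>" by (rule finite_\<mu>[OF kD(2)])
    show "AE x in \<mu>. x \<in> closure {x. k x \<noteq> 0} \<longrightarrow> norm (k x) \<le> B" using B by simp
    show "AE x in \<mu>. x \<notin> closure {x. k x \<noteq> 0} \<longrightarrow> k x = 0" by (intro AE_I2 impI kD(3))
  qed
  then show "(\<integral>\<^sup>+s. ennreal (k s) \<partial>\<mu>) < \<infinity>"
    using k(2) by (simp add: nn_integral_eq_integral)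
qed

text \<open>By Weil's formula the fibre integrals of \<open>k\<close> act as the density of the
  image of k \<mu>. The bound is stated for measures so that it applies to all non-negative
  measurable functions and not only to continuous ones.\<close>

lemma Weil_measure_le:
  assumes k: "k \<in> Cc" "\<And>s. 0 \<le> k s" and b: "b \<ge> 0" "\<And>s. (\<integral>\<^sup>+t. ennreal (k (s + t)) \<partial>\<alpha> H) \<le> ennreal b"
  shows "distr (density \<mu> (\<lambda>s. ennreal (k s))) (\<nu> H) q \<le> scale_measure (ennreal b) (\<nu> H)"
proof (rule Q.measure_le_if_integrals_le)
  note kD = CcD[OF k(1)]
  have kb [measurable]: "k \<in> borel_measurable borel" by (rule borel_measurable_continuous_onI[OF kD(1)])
  have km: "(\<lambda>s. ennreal (k s)) \<in> borel_measurable \<mu>" by (intro measurable_\<mu>) measurable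
  have qd: "q \<in> measurable (density \<mu> (\<lambda>s. ennreal (k s))) (\<nu> H)" using q_measurable by simp
  show "sets (distr (density \<mu> (\<lambda>s. ennreal (k s))) (\<nu> H) q) = sets (borel_of_topology Q)" by (simp add: sets_m)
  show "sets (scale_measure (ennreal b) (\<nu> H)) = sets (borel_of_topology Q)" by (simp add: sets_m)
  fix K assume K: "compactin Q K"
  have Ks: "K \<in> sets (\<nu> H)" using Q.compactin_in_borel[OF K] by (simp add: sets_m)
  have pre: "q -` K \<inter> space \<mu> \<in> sets \<mu>" by (rule measurable_sets[OF q_measurable Ks])
  have "emeasure (distr (density \<mu> (\<lambda>s. ennreal (k s))) (\<nu> H) q) K = (\<integral>\<^sup>+s. ennreal (k s) * indicator (q -` K \<inter> space \<mu>) s \<partial>\<mu>)"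
    using emeasure_distr[OF qd Ks] emeasure_density[OF km pre] by simp
  also have "\<dots> \<le> (\<integral>\<^sup>+s. ennreal (k s) \<partial>\<mu>)" by (intro nn_integral_mono) (simp add: indicator_def)
  also have "\<dots> < \<infinity>" by (rule nn_integral_Cc_finite(2)[OF k])
  finally show "emeasure (distr (density \<mu> (\<lambda>s. ennreal (k s))) (\<nu> H) q) K < \<infinity>" .
  show "emeasure (scale_measure (ennreal b) (\<nu> H)) K < \<infinity>" using finite_m[OF K] by (simp add: ennreal_mult_less_top)
next
  note kD = CcD[OF k(1)]
  have kb [measurable]: "k \<in> borel_measurable borel" by (rule borel_measurable_continuous_onI[OF kD(1)])
  have km: "(\<lambda>s. ennreal (k s)) \<in> borel_measurable \<mu>" by (intro measurable_\<mu>) measurable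
  have qd: "q \<in> measurable (density \<mu> (\<lambda>s. ennreal (k s))) (\<nu> H)" using q_measurable by simp
  fix f K assume f: "continuous_map Q euclideanreal f" "\<And>c. 0 \<le> f c"
  have fm: "(\<lambda>c. ennreal (f c)) \<in> borel_measurable (\<nu> H)" using continuous_measurable_m[OF f(1)] by measurable
  have cq: "continuous_on UNIV (\<lambda>s. f (q s))"
    using continuous_map_compose[OF continuous_q f(1)] by (simp add: o_def)
  have Cc: "(\<lambda>s. k s * f (q s)) \<in> Cc"
  proof (rule CcI[OF _ kD(2)])
    show "continuous_on UNIV (\<lambda>s. k s * f (q s))" by (intro continuous_intros kD(1) cq)
    show "k s * f (q s) = 0" if "s \<notin> closure {x. k x \<noteq> 0}" for s using kD(3)[OF that] by simp
  qed
  have kint: "0 \<le> (\<integral>t. k (s + t) \<partial>\<alpha> H)" "(\<integral>t. k (s + t) \<partial>\<alpha> H) \<le> b" for s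
  proof -
    show "0 \<le> (\<integral>t. k (s + t) \<partial>\<alpha> H)" using k(2) by (intro Bochner_Integration.integral_nonneg) simp
    have "ennreal (\<integral>t. k (s + t) \<partial>\<alpha> H) \<le> ennreal b"
      using ennreal_integral_le_nn_integral[of "\<lambda>t. k (s + t)" "\<alpha> H"] b(2)[of s] k(2) by simp
    then show "(\<integral>t. k (s + t) \<partial>\<alpha> H) \<le> b" using b(1) by simp
  qed
  have "(\<integral>\<^sup>+c. ennreal (f c) \<partial>distr (density \<mu> (\<lambda>s. ennreal (k s))) (\<nu> H) q) = (\<integral>\<^sup>+s. ennreal (k s) * ennreal (f (q s)) \<partial>\<mu>)"
    using nn_integral_distr[OF qd, of "\<lambda>c. ennreal (f c)"] fm
      nn_integral_density[OF km measurable_compose[OF q_measurable fm]] by simp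
  also have "\<dots> = ennreal (\<integral>s. k s * f (q s) \<partial>\<mu>)"
    using k(2) f(2) nn_integral_eq_integral[OF nn_integral_Cc_finite(1)[OF Cc]] by (simp add: ennreal_mult)
  also have "\<dots> = ennreal (\<integral>c. f c * (\<integral>t. k (coset_rep c + t) \<partial>\<alpha> H) \<partial>\<nu> H)" by (simp only: Weil_real[OF f(1) Cc])
  also have "\<dots> \<le> (\<integral>\<^sup>+c. ennreal (f c * (\<integral>t. k (coset_rep c + t) \<partial>\<alpha> H)) \<partial>\<nu> H)"
    using f(2) kint by (intro ennreal_integral_le_nn_integral) simp
  also have "\<dots> \<le> (\<integral>\<^sup>+c. ennreal b * ennreal (f c) \<partial>\<nu> H)"
  proof (rule nn_integral_mono)
    fix c
    have "f c * (\<integral>t. k (coset_rep c + t) \<partial>\<alpha> H) \<le> f c * b" by (rule mult_left_mono[OF kint(2) f(2)])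
    then show "ennreal (f c * (\<integral>t. k (coset_rep c + t) \<partial>\<alpha> H)) \<le> ennreal b * ennreal (f c)"
      using b(1) f(2) by (simp add: ennreal_mult[symmetric] ennreal_leI mult.commute)
  qed
  also have "\<dots> = (\<integral>\<^sup>+c. ennreal (f c) \<partial>scale_measure (ennreal b) (\<nu> H))"
    using fm by (simp add: nn_integral_cmult nn_integral_scale_measure)
  finally show "(\<integral>\<^sup>+c. ennreal (f c) \<partial>distr (density \<mu> (\<lambda>s. ennreal (k s))) (\<nu> H) q) \<le>
      (\<integral>\<^sup>+c. ennreal (f c) \<partial>scale_measure (ennreal b) (\<nu> H))" .
qed

text \<open>If s + h lies in \<open>C\<close>, then every t in \<open>H\<close> with s + t in
  \<open>C\<close> lies in the translate by \<open>h\<close> of (C - C) \<inter> H. The bound is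
  thus the same for all cosets and concerns one compact set, to which upper semicontinuity
  applies.\<close>

lemma nn_integral_fibre_le:
  assumes C: "compact C" and k: "\<And>s. k s \<le> 1" "\<And>s. s \<notin> C \<Longrightarrow> k s = 0"
  shows "(\<integral>\<^sup>+t. ennreal (k (s + t)) \<partial>\<alpha> H) \<le> emeasure (\<alpha> H) ((\<lambda>(a, b). a - b) ` (C \<times> C) \<inter> H)"
proof -
  let ?D = "(\<lambda>(a, b). a - b) ` (C \<times> C)"
  have D: "?D \<inter> H \<in> sets (\<alpha> H)" using compact_imp_closed[OF compact_sum_set(2)[OF C C]] by (intro Int_sets_\<alpha>[OF H]) simp
  show ?thesis
  proof (cases "\<exists>h\<in>H. s + h \<in> C")
    case False
    have "(\<integral>\<^sup>+t. ennreal (k (s + t)) \<partial>\<alpha> H) = (\<integral>\<^sup>+t. 0 \<partial>\<alpha> H)"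
      using False k(2) by (intro nn_integral_cong) (simp add: space_\<alpha>[OF H])
    then show ?thesis by simp
  next
    case True
    then obtain h where h: "h \<in> H" "s + h \<in> C" by blast
    have "(\<integral>\<^sup>+t. ennreal (k (s + t)) \<partial>\<alpha> H) \<le> (\<integral>\<^sup>+t. indicator ?D (- h + t) \<partial>\<alpha> H)"
    proof (rule nn_integral_mono)
      fix t assume "t \<in> space (\<alpha> H)"
      show "ennreal (k (s + t)) \<le> indicator ?D (- h + t)"
      proof (cases "s + t \<in> C")
        case True
        then have "(s + t, s + h) \<in> C \<times> C" using h by simp
        then have "- h + t \<in> ?D" by (rule rev_image_eqI) simp
        then show ?thesis using k(1)[of "s + t"] by (simp add: ennreal_le_1)
      qed (simp add: k(2))
    qed
    also have "\<dots> = (\<integral>\<^sup>+t. indicator ?D t \<partial>\<alpha> H)"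
      using compact_imp_closed[OF compact_sum_set(2)[OF C C]]
      by (intro nn_integral_\<alpha>_translate[OF H uminus_zero_subgroup(4)[OF H h(1)]] borel_measurable_indicator) simp
    also have "\<dots> = (\<integral>\<^sup>+t. indicator (?D \<inter> H) t \<partial>\<alpha> H)"
      by (intro nn_integral_cong) (simp add: space_\<alpha>[OF H] indicator_def)
    also have "\<dots> = emeasure (\<alpha> H) (?D \<inter> H)" using D by simp
    finally show ?thesis .
  qed
qed

text \<open>With c = q s, substituting t - s for \<open>t\<close> translates \<open>k\<close> and
  leaves its fibre bound unchanged. This supplies the hypothesis \<open>b\<close> of
  \<open>quadratic_form_sum_bound\<close>.\<close>

lemma nn_integral_translate_le:
  assumes k: "k \<in> Cc" "\<And>s. 0 \<le> k s \<and> k s \<le> 1" and C: "compact C" "\<And>s. s \<notin> C \<Longrightarrow> k s = 0"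
    and b: "b \<ge> 0" "emeasure (\<alpha> H) ((\<lambda>(a, b). a - b) ` (C \<times> C) \<inter> H) \<le> ennreal b"
    and g: "g \<in> borel_measurable (\<nu> H)" and c: "c \<in> range q"
  shows "(\<integral>\<^sup>+t. ennreal (k t) * g ((+) t ` c) \<partial>\<mu>) \<le> ennreal b * (\<integral>\<^sup>+d. g d \<partial>\<nu> H)"
proof -
  obtain s where s: "c = q s" using c by blast
  define k' where "k' = (\<lambda>t. k (- s + t))"
  define C' where "C' = (+) s ` C"
  have bound: "(\<integral>\<^sup>+t. ennreal (k' (r + t)) \<partial>\<alpha> H) \<le> ennreal b" for r
  proof -
    have "(\<integral>\<^sup>+t. ennreal (k' (r + t)) \<partial>\<alpha> H) = (\<integral>\<^sup>+t. ennreal (k ((- s + r) + t)) \<partial>\<alpha> H)"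
      by (simp only: k'_def add.assoc)
    also have "\<dots> \<le> ennreal b"
      by (rule order_trans[OF nn_integral_fibre_le[OF C(1)] b(2)]) (use k(2) C(2) in auto)
    finally show ?thesis .
  qed
  have k'C: "k' \<in> Cc"
  proof (rule CcI)
    show "continuous_on UNIV k'" unfolding k'_def
      by (intro continuous_on_compose2[OF CcD(1)[OF k(1)]] continuous_intros) auto
    show "compact C'" unfolding C'_def by (intro compact_continuous_image C(1) continuous_intros)
    fix t assume t: "t \<notin> C'"
    have "- s + t \<notin> C"
    proof
      assume "- s + t \<in> C"
      then have "t \<in> C'" unfolding C'_def by (rule rev_image_eqI) simp
      then show False using t by blast
    qed
    then show "k' t = 0" unfolding k'_def by (rule C(2))
  qed
  have k'b: "k' \<in> borel_measurable borel" by (rule borel_measurable_continuous_onI[OF CcD(1)[OF k'C]])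
  have k'm: "(\<lambda>t. ennreal (k' t)) \<in> borel_measurable \<mu>" using k'b by (intro measurable_\<mu>) measurable
  note gq = measurable_compose[OF q_measurable g]
  have qd: "q \<in> measurable (density \<mu> (\<lambda>s. ennreal (k' s))) (\<nu> H)" using q_measurable by simp
  have "(\<integral>\<^sup>+t. ennreal (k t) * g ((+) t ` c) \<partial>\<mu>) = (\<integral>\<^sup>+t. ennreal (k' (s + t)) * g (q (s + t)) \<partial>\<mu>)"
    by (simp add: s translate_coset k'_def add.commute)
  also have "\<dots> = (\<integral>\<^sup>+t. ennreal (k' t) * g (q t) \<partial>\<mu>)"
    by (rule nn_integral_\<mu>_translate) (intro borel_measurable_times_ennreal k'm gq)
  also have "\<dots> = (\<integral>\<^sup>+d. g d \<partial>distr (density \<mu> (\<lambda>s. ennreal (k' s))) (\<nu> H) q)"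
    using nn_integral_distr[OF qd, of g] g nn_integral_density[OF k'm gq] by simp
  also have "\<dots> \<le> (\<integral>\<^sup>+d. g d \<partial>scale_measure (ennreal b) (\<nu> H))"
    using k(2) by (intro nn_integral_mono_measure Weil_measure_le k'C b(1) bound) (simp_all add: k'_def)
  also have "\<dots> = ennreal b * (\<integral>\<^sup>+d. g d \<partial>\<nu> H)" by (rule nn_integral_scale_measure[OF g])
  finally show ?thesis .
qed

text \<open>The fibre integral of the constant 1 is the total mass of \<open>\<alpha> H\<close>, and
  compactness of \<open>H\<close> gives \<open>f (q s)\<close> compact support in \<open>s\<close>,
  so Weil's formula applies with k = 1.\<close>

lemma distr_q_compact:
  assumes H': "compact H"
  shows "distr \<mu> (\<nu> H) q = scale_measure (emeasure (\<alpha> H) H) (\<nu> H)"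
proof -
  define a where "a = measure (\<alpha> H) H"
  have a: "emeasure (\<alpha> H) H = ennreal a" "a \<ge> 0"
    unfolding a_def using finite_\<alpha>[OF H H'] by (simp_all add: emeasure_eq_ennreal_measure less_top[symmetric])
  have eq: "(\<integral>\<^sup>+c. ennreal (f c) \<partial>distr \<mu> (\<nu> H) q) = (\<integral>\<^sup>+c. ennreal (f c) \<partial>scale_measure (ennreal a) (\<nu> H))"
    if f: "continuous_map Q euclideanreal f" "\<And>c. 0 \<le> f c" and K: "compactin Q K" "\<And>c. c \<in> topspace Q - K \<Longrightarrow> f c = 0" for f K
  proof -
    have fm: "f \<in> borel_measurable (\<nu> H)" by (rule continuous_measurable_m[OF f(1)])
    then have fm': "(\<lambda>c. ennreal (f c)) \<in> borel_measurable (\<nu> H)" by measurable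
    have cq: "continuous_on UNIV (\<lambda>s. f (q s))"
      using continuous_map_compose[OF continuous_q f(1)] by (simp add: o_def)
    have Cc: "(\<lambda>s. 1 * f (q s)) \<in> Cc"
    proof (rule CcI[OF _ compact_vimage_q[OF H' K(1)]])
      show "continuous_on UNIV (\<lambda>s. 1 * f (q s))" using cq by simp
      show "1 * f (q s) = 0" if "s \<notin> q -` K" for s using K(2)[of "q s"] that by (simp add: topspace_coset_topology)
    qed
    have Ks: "K \<in> sets (\<nu> H)" using Q.compactin_in_borel[OF K(1)] by (simp add: sets_m)
    have "bounded (f ` K)"
    proof -
      have "compactin euclideanreal (f ` K)" by (rule image_compactin[OF K(1) f(1)])
      then show ?thesis by (simp add: compact_imp_bounded)
    qed
    then obtain B where B: "\<And>c. c \<in> K \<Longrightarrow> norm (f c) \<le> B" by (auto simp: bounded_iff)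
    have int: "integrable (\<nu> H) f"
      by (rule integrableI_bounded_set[of K _ _ B])
        (use Ks fm finite_m[OF K(1)] B K(2) in \<open>auto simp: space_m topspace_coset_topology intro!: AE_I2\<close>)
    have "(\<integral>\<^sup>+c. ennreal (f c) \<partial>distr \<mu> (\<nu> H) q) = (\<integral>\<^sup>+s. ennreal (1 * f (q s)) \<partial>\<mu>)"
      using nn_integral_distr[OF q_measurable, of "\<lambda>c. ennreal (f c)"] fm' by simp
    also have "\<dots> = ennreal (\<integral>s. 1 * f (q s) \<partial>\<mu>)"
      using f(2) by (intro nn_integral_eq_integral nn_integral_Cc_finite(1)[OF Cc]) auto
    also have "\<dots> = ennreal (\<integral>c. f c * (\<integral>t. 1 \<partial>\<alpha> H) \<partial>\<nu> H)" by (simp only: Weil_real[OF f(1) Cc])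
    also have "(\<integral>t. 1 \<partial>\<alpha> H) = a" by (simp add: a_def space_\<alpha>[OF H])
    also have "ennreal (\<integral>c. f c * a \<partial>\<nu> H) = ennreal a * ennreal (\<integral>c. f c \<partial>\<nu> H)"
      using f(2) a(2) by (simp add: ennreal_mult' mult.commute)
    also have "ennreal (\<integral>c. f c \<partial>\<nu> H) = (\<integral>\<^sup>+c. ennreal (f c) \<partial>\<nu> H)"
      using f(2) by (intro nn_integral_eq_integral[symmetric] int) auto
    also have "ennreal a * \<dots> = (\<integral>\<^sup>+c. ennreal (f c) \<partial>scale_measure (ennreal a) (\<nu> H))"
      using fm' by (simp add: nn_integral_scale_measure)
    finally show ?thesis .
  qed
  have fin: "emeasure (distr \<mu> (\<nu> H) q) K < \<infinity>" "emeasure (scale_measure (ennreal a) (\<nu> H)) K < \<infinity>" if K: "compactin Q K" for K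
  proof -
    have "K \<in> sets (\<nu> H)" using Q.compactin_in_borel[OF K] by (simp add: sets_m)
    then show "emeasure (distr \<mu> (\<nu> H) q) K < \<infinity>"
      using emeasure_distr[OF q_measurable, of K] finite_\<mu>[OF compact_vimage_q[OF H' K]] by (simp add: space_\<mu>)
    show "emeasure (scale_measure (ennreal a) (\<nu> H)) K < \<infinity>" using finite_m[OF K] by (simp add: ennreal_mult_less_top)
  qed
  have "distr \<mu> (\<nu> H) q \<le> scale_measure (ennreal a) (\<nu> H)"
    by (rule Q.measure_le_if_integrals_le[OF _ _ fin eq[THEN eq_refl]]) (simp_all only: sets_distr sets_scale_measure sets_m)
  moreover have "scale_measure (ennreal a) (\<nu> H) \<le> distr \<mu> (\<nu> H) q"
    by (rule Q.measure_le_if_integrals_le[OF _ _ fin(2,1) eq[symmetric, THEN eq_refl]]) (simp_all only: sets_distr sets_scale_measure sets_m)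
  ultimately show ?thesis unfolding a(1) by (rule antisym)
qed

end

section \<open>Vector functionals at the test function\<close>

locale orbit_family = orbit_rep act x "\<nu> (stabilizer act x)" \<tau> + haar_subgroup "TYPE('g)" \<mu> f0 \<alpha> \<nu> "stabilizer act x"
  for act :: "'g::{topological_ab_group_add, t2_space, second_countable_topology} \<Rightarrow>
      'x::{t2_space, second_countable_topology} \<Rightarrow> 'x"
    and x \<tau> and \<mu> :: "'g measure" and f0 \<alpha> \<nu>
begin

abbreviation "m \<equiv> \<nu> (stabilizer act x)"

sublocale orbit_haar act x m \<tau> \<mu> ..

text \<open>\<open>F\<close> converts the measure of \<open>V\<close> into a bound on the square
  norm N of \<open>E\<close>: the averages over \<open>k\<close> are at least \<open>B\<close> for
  \<open>F\<close> where \<open>E\<close> is nonzero, and at most \<open>A\<close> for |E|^2 where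
  \<open>F\<close> is nonzero, so B N <= A w. The rest is \<open>quadratic_form_sum_bound\<close>
  with the weight divided by \<open>a\<close>.\<close>

lemma vector_functional_sum_bound:
  assumes E: "continuous_on UNIV E" "compact L" "\<And>y. y \<notin> L \<Longrightarrow> E y = 0"
    and k: "k \<in> Cc" "\<And>s. 0 \<le> k s \<and> k s \<le> 1" and C: "compact C" "\<And>s. s \<notin> C \<Longrightarrow> k s = 0"
    and \<sigma>: "\<sigma> \<in> characters" and a: "a > 0"
    and b: "b \<ge> 0" "emeasure (\<alpha> (stabilizer act x)) ((\<lambda>(a, b). a - b) ` (C \<times> C) \<inter> stabilizer act x) \<le> ennreal b"
    and V: "open V" "emeasure m (q ` {s. act s x \<in> V}) \<le> ennreal w" "w \<ge> 0"
    and F: "continuous_on UNIV F" "\<And>y. 0 \<le> F y \<and> F y \<le> 1" "\<And>y. F y \<noteq> 0 \<Longrightarrow> y \<in> V"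
    and A: "A \<ge> 0" "\<And>y. E y \<noteq> 0 \<Longrightarrow> (\<integral>\<^sup>+t. ennreal (k t) * ennreal ((cmod (E (act t y)))\<^sup>2) \<partial>\<mu>) \<le> ennreal A"
      "\<And>y. F y \<noteq> 0 \<Longrightarrow> (\<integral>\<^sup>+t. ennreal (k t) * ennreal ((cmod (E (act (- t) y)))\<^sup>2) \<partial>\<mu>) \<le> ennreal A"
    and B: "B > 0" "\<And>y. E y \<noteq> 0 \<Longrightarrow> ennreal B \<le> (\<integral>\<^sup>+t. ennreal (k t) * ennreal (F (act t y)) \<partial>\<mu>)"
    and D: "D = (\<lambda>t y. E y * cnj (E (act (- t) y)) * (of_real (k t) * cnj (\<sigma> t) / of_real a))"
    and I: "finite I" and f: "L2_orthonormal m f I"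
  shows "cmod (\<Sum>i\<in>I. vector_functional (Ind act \<mu> \<nu> x \<tau>) (L2_class m (f i))
      (null_rel (convolution_algebra act \<mu>) `` {\<lambda>n. D})) \<le> (A / a * (A * w / B) + b / a * card I) / 2"
proof -
  define \<kappa> where "\<kappa> = (\<lambda>t. of_real (k t) * cnj (\<sigma> t) / complex_of_real a)"
  have \<sigma>c: "continuous_on UNIV \<sigma>" and \<sigma>n: "cmod (\<sigma> t) = 1" for t using \<sigma> by (simp_all add: characters_def)
  have kc: "continuous_on UNIV k" by (rule CcD(1)[OF k(1)])
  have \<kappa>c: "continuous_on UNIV \<kappa>" unfolding \<kappa>_def using a by (intro continuous_intros kc \<sigma>c) simp
  have \<kappa>n: "ennreal (cmod (\<kappa> t)) = ennreal (1 / a) * ennreal (k t)" for t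
    using k(2)[of t] a by (simp add: \<kappa>_def norm_mult norm_divide \<sigma>n divide_ennreal ennreal_mult' flip: ennreal_mult)
  have D': "(\<lambda>t y. E y * cnj (E (act (- t) y)) * \<kappa> t) \<in> CcC0"
  proof (rule test_function_CcC0[OF E \<kappa>c C(1)])
    show "\<kappa> t = 0" if "t \<notin> C" for t unfolding \<kappa>_def C(2)[OF that] by simp
  qed
  have D\<kappa>: "D = (\<lambda>t y. E y * cnj (E (act (- t) y)) * \<kappa> t)" by (simp add: D \<kappa>_def)
  have DC: "D \<in> CcC0" using D' by (simp only: D\<kappa>)
  have kb [measurable]: "k \<in> borel_measurable borel" by (rule borel_measurable_continuous_onI[OF kc])
  have km: "(\<lambda>t. ennreal (k t)) \<in> borel_measurable \<mu>" by (intro measurable_\<mu>) measurable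
  have scale: "(\<integral>\<^sup>+t. ennreal (cmod (\<kappa> t)) * g t \<partial>\<mu>) = ennreal (1 / a) * (\<integral>\<^sup>+t. ennreal (k t) * g t \<partial>\<mu>)"
    if "g \<in> borel_measurable \<mu>" for g
    unfolding \<kappa>n mult.assoc by (rule nn_integral_cmult[OF borel_measurable_times_ennreal[OF km that]])
  have cEt: "continuous_on UNIV (\<lambda>t. E (act (r t) y))" if "continuous_on UNIV r" for r y
    by (intro continuous_on_compose2[OF E(1)] continuous_on_act continuous_on_const that) auto
  have mEt: "(\<lambda>t. ennreal ((cmod (E (act t y)))\<^sup>2)) \<in> borel_measurable \<mu>" for y
  proof -
    have "(\<lambda>t. (cmod (E (act t y)))\<^sup>2) \<in> borel_measurable borel"
      by (intro borel_measurable_continuous_onI continuous_intros cEt)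
    from measurable_compose[OF this measurable_ennreal] show ?thesis by (rule measurable_\<mu>)
  qed
  define u where "u = (\<lambda>c. ennreal ((cmod (E (p c)))\<^sup>2))"
  define v where "v = (\<lambda>c. ennreal (F (p c)))"
  have u: "u \<in> borel_measurable m" unfolding u_def using comp_p_measurable[OF E(1)] by measurable
  have v: "v \<in> borel_measurable m" unfolding v_def using comp_p_measurable[OF F(1)] by measurable
  have N: "(\<integral>\<^sup>+c. u c \<partial>m) \<le> ennreal (A * w / B)"
  proof -
    have Wset: "q ` {s. act s x \<in> V} = p -` V \<inter> space m"
    proof -
      have "q ` {s. act s x \<in> V} \<subseteq> p -` V \<inter> range q" using p_q by auto
      moreover have "p -` V \<inter> range q \<subseteq> q ` {s. act s x \<in> V}" by (auto simp: p_q)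
      ultimately show ?thesis unfolding space_m by blast
    qed
    have pm: "p \<in> measurable m borel"
      by (rule continuous_map_measurable[OF continuous_p sets_m sets_borel_of_topology_euclidean[symmetric]])
    have Ws: "q ` {s. act s x \<in> V} \<in> sets m" unfolding Wset by (rule measurable_sets[OF pm]) (simp add: V(1))
    have "ennreal B * (\<integral>\<^sup>+c. u c \<partial>m) = (\<integral>\<^sup>+c. u c * ennreal B \<partial>m)"
      unfolding nn_integral_multc[OF u] by (rule mult.commute)
    also have "\<dots> \<le> (\<integral>\<^sup>+c. u c * (\<integral>\<^sup>+t. ennreal (k t) * v ((+) t ` c) \<partial>\<mu>) \<partial>m)"
    proof (rule nn_integral_mono)
      fix c assume "c \<in> space m"
      then have c: "c \<in> range q" by (simp add: space_m)
      show "u c * ennreal B \<le> u c * (\<integral>\<^sup>+t. ennreal (k t) * v ((+) t ` c) \<partial>\<mu>)"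
      proof (cases "E (p c) = 0")
        case False
        from B(2)[OF this] show ?thesis by (intro mult_left_mono) (simp_all add: v_def p_translate[OF c])
      qed (simp add: u_def)
    qed
    \<comment> \<open>Here the average moves from \<open>F\<close> to |E|^2.\<close>
    also have "\<dots> = (\<integral>\<^sup>+c. v c * (\<integral>\<^sup>+t. ennreal (k t) * u ((+) (- t) ` c) \<partial>\<mu>) \<partial>m)"
      using convolution_form_swap[OF km v u] by simp
    also have "\<dots> \<le> (\<integral>\<^sup>+c. ennreal A * indicator (q ` {s. act s x \<in> V}) c \<partial>m)"
    proof (rule nn_integral_mono)
      fix c assume c': "c \<in> space m"
      then have c: "c \<in> range q" by (simp add: space_m)
      show "v c * (\<integral>\<^sup>+t. ennreal (k t) * u ((+) (- t) ` c) \<partial>\<mu>) \<le> ennreal A * indicator (q ` {s. act s x \<in> V}) c"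
      proof (cases "F (p c) = 0")
        case False
        have "c \<in> q ` {s. act s x \<in> V}" unfolding Wset using F(3)[OF False] c' by blast
        moreover have "v c \<le> 1" using F(2) by (simp add: v_def ennreal_le_1)
        moreover have "(\<integral>\<^sup>+t. ennreal (k t) * u ((+) (- t) ` c) \<partial>\<mu>) \<le> ennreal A"
          using A(3)[OF False] by (simp add: u_def p_translate[OF c] del: uminus_add_conv_diff)
        ultimately show ?thesis using mult_mono[of "v c" 1] by fastforce
      qed (simp add: v_def)
    qed
    also have "\<dots> = ennreal A * emeasure m (q ` {s. act s x \<in> V})" by (rule nn_integral_cmult_indicator[OF Ws])
    also have "\<dots> \<le> ennreal A * ennreal w" by (rule mult_left_mono[OF V(2)]) simp
    finally have "ennreal B * (\<integral>\<^sup>+c. u c \<partial>m) \<le> ennreal (A * w)" using A(1) V(3) by (simp add: ennreal_mult)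
    then have "ennreal (1 / B) * (ennreal B * (\<integral>\<^sup>+c. u c \<partial>m)) \<le> ennreal (1 / B) * ennreal (A * w)"
      by (rule mult_left_mono) simp
    then show ?thesis using B(1) A(1) V(3) by (simp add: mult.assoc[symmetric] flip: ennreal_mult)
  qed
  have "ennreal (cmod (\<Sum>i\<in>I. \<integral>t. \<integral>c. E (p c) * cnj (E (act (- t) (p c))) * \<kappa> t *
      (\<tau> t * f i ((+) (- t) ` c)) * cnj (f i c) \<partial>m \<partial>\<mu>)) \<le>
      (ennreal (A / a) * ennreal (A * w / B) + ennreal (b / a) * of_nat (card I)) / 2"
  proof (rule quadratic_form_sum_bound[OF E(1) D' _ _ _ N[unfolded u_def] I f])
    show "\<kappa> \<in> borel_measurable \<mu>" by (intro measurable_\<mu> borel_measurable_continuous_onI \<kappa>c)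
    show "(\<integral>\<^sup>+t. ennreal (cmod (\<kappa> t)) * ennreal ((cmod (E (act t y)))\<^sup>2) \<partial>\<mu>) \<le> ennreal (A / a)" if "E y \<noteq> 0" for y
    proof -
      have "(\<integral>\<^sup>+t. ennreal (cmod (\<kappa> t)) * ennreal ((cmod (E (act t y)))\<^sup>2) \<partial>\<mu>) \<le> ennreal (1 / a) * ennreal A"
        unfolding scale[OF mEt] by (rule mult_left_mono[OF A(2)[OF that]]) simp
      then show ?thesis using a A(1) by (simp flip: ennreal_mult)
    qed
    show "(\<integral>\<^sup>+t. ennreal (cmod (\<kappa> t)) * g ((+) t ` c) \<partial>\<mu>) \<le> ennreal (b / a) * (\<integral>\<^sup>+d. g d \<partial>m)"
      if g: "g \<in> borel_measurable m" and c: "c \<in> space m" for g c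
    proof -
      have c': "c \<in> range q" using c by (simp add: space_m)
      have tm: "(\<lambda>t. g ((+) t ` c)) \<in> borel_measurable \<mu>"
        using measurable_compose[OF measurable_compose[OF measurable_Pair2'[OF c] translate_pair_measurable(1)] g] by simp
      have "(\<integral>\<^sup>+t. ennreal (cmod (\<kappa> t)) * g ((+) t ` c) \<partial>\<mu>) \<le> ennreal (1 / a) * (ennreal b * (\<integral>\<^sup>+d. g d \<partial>m))"
        unfolding scale[OF tm] by (intro mult_left_mono nn_integral_translate_le[OF k C b g c'] zero_le)
      also have "\<dots> = ennreal (b / a) * (\<integral>\<^sup>+d. g d \<partial>m)" using a b(1) by (simp add: mult.assoc[symmetric] flip: ennreal_mult)
      finally show ?thesis .
    qed
  qed
  also have "\<dots> = ennreal ((A / a * (A * w / B) + b / a * card I) / 2)"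
  proof -
    have nn: "0 \<le> A / a" "0 \<le> A * w / B" "0 \<le> b / a" using A(1) V(3) B(1) b(1) a by simp_all
    have "ennreal (A / a) * ennreal (A * w / B) + ennreal (b / a) * of_nat (card I) = ennreal (A / a * (A * w / B) + b / a * card I)"
      using nn by (simp only: ennreal_of_nat_eq_real_of_nat ennreal_mult[symmetric] of_nat_0_le_iff ennreal_plus[symmetric] mult_nonneg_nonneg)
    moreover have "0 \<le> A / a * (A * w / B) + b / a * card I" using nn by (intro add_nonneg_nonneg mult_nonneg_nonneg) auto
    ultimately show ?thesis using divide_ennreal[of _ 2] by simp
  qed
  finally have "cmod (\<Sum>i\<in>I. \<integral>t. \<integral>c. E (p c) * cnj (E (act (- t) (p c))) * \<kappa> t *
      (\<tau> t * f i ((+) (- t) ` c)) * cnj (f i c) \<partial>m \<partial>\<mu>) \<le> (A / a * (A * w / B) + b / a * card I) / 2"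
    using A(1) V(3) B(1) b(1) a by (subst (asm) ennreal_le_iff) auto
  moreover have "(\<Sum>i\<in>I. vector_functional (Ind act \<mu> \<nu> x \<tau>) (L2_class m (f i)) (null_rel (convolution_algebra act \<mu>) `` {\<lambda>n. D})) =
      (\<Sum>i\<in>I. \<integral>t. \<integral>c. E (p c) * cnj (E (act (- t) (p c))) * \<kappa> t * (\<tau> t * f i ((+) (- t) ` c)) * cnj (f i c) \<partial>m \<partial>\<mu>)"
  proof (rule sum.cong[OF refl])
    fix i assume "i \<in> I"
    then have "f i \<in> L2_functions m" using f by (simp add: L2_orthonormal_def)
    from Ind_value(1)[where \<nu> = \<nu>, OF DC this refl]
    show "vector_functional (Ind act \<mu> \<nu> x \<tau>) (L2_class m (f i)) (null_rel (convolution_algebra act \<mu>) `` {\<lambda>n. D}) =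
      (\<integral>t. \<integral>c. E (p c) * cnj (E (act (- t) (p c))) * \<kappa> t * (\<tau> t * f i ((+) (- t) ` c)) * cnj (f i c) \<partial>m \<partial>\<mu>)"
      by (simp only: D\<kappa>)
  qed
  ultimately show ?thesis by simp
qed

end

locale compact_orbit_family = orbit_family act x \<tau> \<mu> f0 \<alpha> \<nu>
  for act :: "'g::{topological_ab_group_add, t2_space, second_countable_topology} \<Rightarrow>
      'x::{t2_space, second_countable_topology} \<Rightarrow> 'x"
    and x \<tau> and \<mu> :: "'g measure" and f0 \<alpha> \<nu> +
  assumes compact_stabilizer: "compact (stabilizer act x)"
begin

definition a :: real where "a = measure (\<alpha> (stabilizer act x)) (stabilizer act x)"

lemma emeasure_a: "emeasure (\<alpha> (stabilizer act x)) (stabilizer act x) = ennreal a" and a_pos: "a > 0"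
proof -
  show e: "emeasure (\<alpha> (stabilizer act x)) (stabilizer act x) = ennreal a"
    unfolding a_def using finite_\<alpha>[OF H compact_stabilizer] by (simp add: emeasure_eq_ennreal_measure less_top[symmetric])
  have "emeasure (\<alpha> (stabilizer act x)) (stabilizer act x) \<noteq> 0"
    using haar_\<alpha>(1)[OF H] by (simp add: invariant_measure_def)
  then show "a > 0" by (simp add: e ennreal_eq_0_iff not_le)
qed

text \<open>The push-forward of \<mu> under \<open>q\<close> is \<open>a\<close> times the measure
  on the cosets; translation and inversion invariance of \<mu> give the shifted forms.\<close>

lemma nn_integral_q:
  assumes u: "u \<in> borel_measurable m"
  shows "(\<integral>\<^sup>+t. u (q t) \<partial>\<mu>) = ennreal a * (\<integral>\<^sup>+c. u c \<partial>m)"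
    "(\<integral>\<^sup>+t. u (q (t + s)) \<partial>\<mu>) = ennreal a * (\<integral>\<^sup>+c. u c \<partial>m)"
    "(\<integral>\<^sup>+t. u (q (- t + s)) \<partial>\<mu>) = ennreal a * (\<integral>\<^sup>+c. u c \<partial>m)"
proof -
  have uq: "(\<lambda>t. u (q t)) \<in> borel_measurable \<mu>" by (rule measurable_compose[OF q_measurable u])
  have "(\<integral>\<^sup>+t. u (q t) \<partial>\<mu>) = (\<integral>\<^sup>+c. u c \<partial>distr \<mu> m q)"
    using nn_integral_distr[OF q_measurable, of u] u by simp
  then show 1: "(\<integral>\<^sup>+t. u (q t) \<partial>\<mu>) = ennreal a * (\<integral>\<^sup>+c. u c \<partial>m)"
    by (simp add: distr_q_compact[OF compact_stabilizer] emeasure_a nn_integral_scale_measure[OF u])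
  show 2: "(\<integral>\<^sup>+t. u (q (t + s)) \<partial>\<mu>) = ennreal a * (\<integral>\<^sup>+c. u c \<partial>m)"
    using nn_integral_\<mu>_translate[OF uq, of s] 1 by (simp add: add.commute)
  have "(\<lambda>t. u (q (t + s))) \<in> borel_measurable \<mu>"
    using measurable_compose[OF plus_measurable_\<mu> uq, of s] by (simp add: add.commute)
  then have "(\<lambda>t. u (q (t + s))) \<in> borel_measurable borel" by (simp only: measurable_cong_sets[OF sets_\<mu> refl])
  from nn_integral_\<mu>_uminus[OF this] show "(\<integral>\<^sup>+t. u (q (- t + s)) \<partial>\<mu>) = ennreal a * (\<integral>\<^sup>+c. u c \<partial>m)"
    using 2 by simp
qed

text \<open>Derived from an identity of measures, so that the complex function need not be split
  into parts.\<close>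

lemma integral_q:
  fixes u :: "'g set \<Rightarrow> complex"
  assumes u: "u \<in> borel_measurable m"
  shows "(\<integral>t. u (q (- t + s)) \<partial>\<mu>) = of_real a * (\<integral>c. u c \<partial>m)"
proof -
  have "(\<lambda>t. - t + s) \<in> measurable \<mu> \<mu>"
    unfolding measurable_cong_sets[OF sets_\<mu> sets_\<mu>] by (intro borel_measurable_continuous_onI continuous_intros)
  from measurable_compose[OF this q_measurable] have qm: "(\<lambda>t. q (- t + s)) \<in> measurable \<mu> m" .
  have "distr \<mu> m (\<lambda>t. q (- t + s)) = density m (\<lambda>c. ennreal a)"
  proof (rule measure_eqI)
    fix B assume "B \<in> sets (distr \<mu> m (\<lambda>t. q (- t + s)))"
    then have B: "B \<in> sets m" by simp
    have "emeasure (distr \<mu> m (\<lambda>t. q (- t + s))) B = (\<integral>\<^sup>+c. indicator B c \<partial>distr \<mu> m (\<lambda>t. q (- t + s)))" using B by simp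
    also have "\<dots> = (\<integral>\<^sup>+t. indicator B (q (- t + s)) \<partial>\<mu>)" by (rule nn_integral_distr[OF qm]) (use B in simp)
    also have "\<dots> = ennreal a * emeasure m B" using nn_integral_q(3)[of "indicator B" s] B by simp
    finally show "emeasure (distr \<mu> m (\<lambda>t. q (- t + s))) B = emeasure (density m (\<lambda>c. ennreal a)) B"
      using B by (simp add: emeasure_density_const)
  qed simp
  moreover have "(\<integral>c. u c \<partial>distr \<mu> m (\<lambda>t. q (- t + s))) = (\<integral>t. u (q (- t + s)) \<partial>\<mu>)"
    by (rule integral_distr[OF qm u])
  moreover have "(\<integral>c. u c \<partial>density m (\<lambda>c. ennreal a)) = of_real a * (\<integral>c. u c \<partial>m)"
    using integral_density[OF u, of "\<lambda>c. a"] a_pos by (simp add: scaleR_conv_of_real)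
  ultimately show ?thesis by simp
qed

text \<open>On the orbit \<open>k\<close> equals 1 wherever both values of \<open>E\<close> are
  nonzero, and \<tau> cancels against its conjugate. By Fubini the integral over \<open>t\<close> of
  what remains is \<open>a\<close> times the inner product of \<open>f\<close> and \<open>g\<close>,
  independently of the coset; the integral over \<open>c\<close> contributes the conjugate of that
  inner product.\<close>

lemma vector_functional_value:
  assumes E: "continuous_on UNIV E" "\<And>s. E (act s x) = g (q s)"
    and D: "D = (\<lambda>t y. E y * cnj (E (act (- t) y)) * (of_real (k t) * cnj (\<tau> t) / of_real a))" "D \<in> CcC0"
    and k: "\<And>s s'. g (q s) \<noteq> 0 \<Longrightarrow> g (q s') \<noteq> 0 \<Longrightarrow> k (s - s') = 1"
    and f: "f \<in> L2_functions m" and g: "g \<in> L2_functions m"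
  shows "vector_functional (Ind act \<mu> \<nu> x \<tau>) (L2_class m f) (null_rel (convolution_algebra act \<mu>) `` {\<lambda>n. D}) =
    of_real ((cmod (\<integral>c. f c * cnj (g c) \<partial>m))\<^sup>2)"
proof -
  interpret P: pair_sigma_finite \<mu> m by (rule pair_sigma_finite_\<mu>_m)
  define u where "u = (\<lambda>c. f c * cnj (g c))"
  define v where "v = (\<lambda>c. g c * cnj (f c))"
  have u: "integrable m u" and v: "integrable m v" unfolding u_def v_def by (intro L2_mult_integrable f g)+
  have um: "u \<in> borel_measurable m" and vm: "v \<in> borel_measurable m" using u v by auto
  have "(\<lambda>c. ennreal (norm (u c))) \<in> borel_measurable m" using um by measurable
  note nnq = nn_integral_q(3)[OF this]
  define w where "w = (\<lambda>t c. v c * u ((+) (- t) ` c))"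
  have wm: "case_prod w \<in> borel_measurable (\<mu> \<Otimes>\<^sub>M m)"
    unfolding w_def case_prod_unfold
    using measurable_compose[OF translate_pair_measurable(2) um] measurable_compose[OF measurable_snd vm]
    by (intro borel_measurable_times) (simp_all add: case_prod_unfold)
  have inner: "(\<integral>t. w t c \<partial>\<mu>) = v c * (of_real a * (\<integral>c. u c \<partial>m))" if "c \<in> space m" for c
  proof -
    obtain s where s: "c = q s" using \<open>c \<in> space m\<close> space_m by blast
    have "(\<integral>t. u ((+) (- t) ` c) \<partial>\<mu>) = of_real a * (\<integral>c. u c \<partial>m)"
      using integral_q[OF um, of s] unfolding s translate_coset .
    then show ?thesis by (simp add: w_def)
  qed
  have wint: "integrable (\<mu> \<Otimes>\<^sub>M m) (case_prod w)"
  proof (rule integrableI_bounded[OF wm])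
    have "(\<integral>\<^sup>+p. ennreal (norm (case_prod w p)) \<partial>(\<mu> \<Otimes>\<^sub>M m)) = (\<integral>\<^sup>+c. \<integral>\<^sup>+t. ennreal (norm (w t c)) \<partial>\<mu> \<partial>m)"
      using P.nn_integral_snd[of "\<lambda>p. ennreal (norm (case_prod w p))"] wm by simp
    also have "\<dots> = (\<integral>\<^sup>+c. ennreal (norm (v c)) * (ennreal a * (\<integral>\<^sup>+c. ennreal (norm (u c)) \<partial>m)) \<partial>m)"
    proof (rule nn_integral_cong)
      fix c assume c: "c \<in> space m"
      then obtain s where s: "c = q s" using space_m by blast
      have tm: "(\<lambda>t. ennreal (norm (u ((+) (- t) ` c)))) \<in> borel_measurable \<mu>"
        using measurable_compose[OF measurable_compose[OF measurable_Pair2'[OF c] translate_pair_measurable(2)] um]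
        by (simp del: uminus_add_conv_diff)
      have "(\<integral>\<^sup>+t. ennreal (norm (w t c)) \<partial>\<mu>) = (\<integral>\<^sup>+t. ennreal (norm (v c)) * ennreal (norm (u ((+) (- t) ` c))) \<partial>\<mu>)"
        by (simp add: w_def norm_mult ennreal_mult)
      also have "\<dots> = ennreal (norm (v c)) * (\<integral>\<^sup>+t. ennreal (norm (u ((+) (- t) ` c))) \<partial>\<mu>)"
        by (rule nn_integral_cmult[OF tm])
      also have "(\<integral>\<^sup>+t. ennreal (norm (u ((+) (- t) ` c))) \<partial>\<mu>) = ennreal a * (\<integral>\<^sup>+c. ennreal (norm (u c)) \<partial>m)"
        unfolding s translate_coset by (rule nnq)
      finally show "(\<integral>\<^sup>+t. ennreal (norm (w t c)) \<partial>\<mu>) = ennreal (norm (v c)) * (ennreal a * (\<integral>\<^sup>+c. ennreal (norm (u c)) \<partial>m))" .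
    qed
    also have "\<dots> = (\<integral>\<^sup>+c. ennreal (norm (v c)) \<partial>m) * (ennreal a * (\<integral>\<^sup>+c. ennreal (norm (u c)) \<partial>m))"
      using vm by (intro nn_integral_multc) measurable
    also have "\<dots> < \<infinity>" using u v by (simp add: integrable_iff_bounded ennreal_mult_less_top)
    finally show "(\<integral>\<^sup>+p. ennreal (norm (case_prod w p)) \<partial>(\<mu> \<Otimes>\<^sub>M m)) < \<infinity>" .
  qed
  have "vector_functional (Ind act \<mu> \<nu> x \<tau>) (L2_class m f) (null_rel (convolution_algebra act \<mu>) `` {\<lambda>n. D}) =
      (\<integral>t. \<integral>c. D t (p c) * (\<tau> t * f ((+) (- t) ` c)) * cnj (f c) \<partial>m \<partial>\<mu>)"
    by (rule Ind_value(1)[where \<nu> = \<nu>, OF D(2) f refl])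
  also have "\<dots> = (\<integral>t. \<integral>c. w t c / of_real a \<partial>m \<partial>\<mu>)"
  proof (intro Bochner_Integration.integral_cong refl)
    fix t c assume "c \<in> space m"
    then obtain s where s: "c = q s" using space_m by blast
    have 1: "E (p c) = g c" by (simp only: s p_q E(2))
    have 2: "E (act (- t) (p c)) = g ((+) (- t) ` c)" by (simp only: s p_q translate_coset act_add[symmetric] E(2))
    show "D t (p c) * (\<tau> t * f ((+) (- t) ` c)) * cnj (f c) = w t c / of_real a"
    proof (cases "g c \<noteq> 0 \<and> g ((+) (- t) ` c) \<noteq> 0")
      case True
      then have "k (s - (- t + s)) = 1" unfolding s translate_coset by (intro k) auto
      then have k1: "k t = 1" by simp
      have "D t (p c) * (\<tau> t * f ((+) (- t) ` c)) * cnj (f c) =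
          g c * cnj (g ((+) (- t) ` c)) * f ((+) (- t) ` c) * cnj (f c) * (\<tau> t * cnj (\<tau> t)) / of_real a"
        unfolding D(1) 1 2 k1 by (simp only: of_real_1 mult_1 times_divide_eq_right times_divide_eq_left mult_ac)
      then show ?thesis unfolding \<tau>_cnj w_def u_def v_def by (simp only: mult_1_left mult_1_right mult_ac)
    next
      case False
      then have "g c = 0 \<or> g ((+) (- t) ` c) = 0" by blast
      then show ?thesis unfolding D(1) 1 2 w_def u_def v_def by (elim disjE) (simp_all only: complex_cnj_zero mult_zero_left mult_zero_right div_0)
    qed
  qed
  also have "\<dots> = (\<integral>t. \<integral>c. w t c \<partial>m \<partial>\<mu>) / of_real a" by (simp only: integral_divide_zero)
  also have "(\<integral>t. \<integral>c. w t c \<partial>m \<partial>\<mu>) = (\<integral>c. \<integral>t. w t c \<partial>\<mu> \<partial>m)" by (rule P.Fubini_integral[OF wint, symmetric])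
  also have "\<dots> = (\<integral>c. v c * (of_real a * (\<integral>c. u c \<partial>m)) \<partial>m)"
    by (rule Bochner_Integration.integral_cong[OF refl inner])
  also have "\<dots> = (\<integral>c. v c \<partial>m) * (of_real a * (\<integral>c. u c \<partial>m))" by (rule integral_mult_left_zero)
  also have "(\<integral>c. v c \<partial>m) = cnj (\<integral>c. u c \<partial>m)" 
    unfolding u_def v_def Bochner_Integration.integral_cnj[symmetric] by (simp only: complex_cnj_mult complex_cnj_cnj mult.commute)
  also have "cnj (\<integral>c. u c \<partial>m) * (of_real a * (\<integral>c. u c \<partial>m)) / of_real a = (\<integral>c. u c \<partial>m) * cnj (\<integral>c. u c \<partial>m)"
    using a_pos by simp
  finally show ?thesis by (simp only: u_def complex_norm_square)
qed

end

section \<open>Construction of the test functions\<close>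

lemma compact_cutoff:
  fixes K U :: "'a::{t2_space, second_countable_topology} set"
  assumes lc: "locally_compact_space (euclidean :: 'a topology)" and K: "compact K" and U: "open U" "K \<subseteq> U"
  obtains h :: "'a \<Rightarrow> real" and L where "continuous_on UNIV h" "compact L" "L \<subseteq> U" "\<And>y. 0 \<le> h y \<and> h y \<le> 1"
    "\<And>y. y \<in> K \<Longrightarrow> h y = 1" "\<And>y. y \<notin> L \<Longrightarrow> h y = 0"
proof -
  interpret lch "euclidean :: 'a topology" by (rule lch_euclidean[OF lc])
  have K': "compactin euclidean K" and U': "openin euclidean U" using K U by simp_all
  show thesis
  proof (rule Urysohn_compact[OF K' U' U(2)])
    fix h :: "'a \<Rightarrow> real" and L
    assume h: "continuous_map euclidean euclideanreal h" "\<And>y. 0 \<le> h y" "\<And>y. h y \<le> 1" "\<And>y. y \<in> K \<Longrightarrow> h y = 1"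
      "compactin euclidean L" "L \<subseteq> U" "\<And>y. y \<in> topspace euclidean - L \<Longrightarrow> h y = 0"
    show thesis
    proof (rule that)
      show "continuous_on UNIV h" "compact L" using h by simp_all
      show "0 \<le> h y \<and> h y \<le> 1" for y using h(2,3) by blast
      show "h y = 0" if "y \<notin> L" for y using h(7)[of y] that by simp
    qed (fact h)+
  qed
qed

context orbit_haar
begin

text \<open>Continuity in \<open>y\<close> is the point: strict bounds on averages become open
  conditions on a point of \<open>X\<close>.\<close>

lemma average:
  fixes \<Phi> :: "'x \<Rightarrow> real"
  assumes k: "k \<in> Cc" "\<And>t. 0 \<le> k t" and \<Phi>: "continuous_on UNIV \<Phi>" "\<And>y. 0 \<le> \<Phi> y" and r: "continuous_on UNIV r"
  shows "continuous_on UNIV (\<lambda>y. \<integral>t. k t * \<Phi> (act (r t) y) \<partial>\<mu>)"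
    and "(\<integral>\<^sup>+t. ennreal (k t) * ennreal (\<Phi> (act (r t) y)) \<partial>\<mu>) = ennreal (\<integral>t. k t * \<Phi> (act (r t) y) \<partial>\<mu>)"
proof -
  let ?C = "closure {t. k t \<noteq> 0}"
  let ?f = "\<lambda>p. k (snd p) * \<Phi> (act (r (snd p)) (fst p))"
  have c: "continuous_on UNIV ?f"
    by (intro continuous_intros continuous_on_compose2[OF CcD(1)[OF k(1)]] continuous_on_compose2[OF \<Phi>(1)]
        continuous_on_act continuous_on_compose2[OF r]) auto
  have m: "(\<lambda>t. ?f (y, t)) \<in> borel_measurable \<mu>" for y
    by (intro measurable_\<mu> borel_measurable_continuous_onI continuous_on_compose2[OF c]) (auto intro!: continuous_intros)
  have C: "?C \<inter> space \<mu> \<in> sets \<mu>" "emeasure \<mu> (?C \<inter> space \<mu>) < \<infinity>"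
    using finite_\<mu>[OF CcD(2)[OF k(1)]] by (simp_all add: space_\<mu> sets_\<mu>)
  have z: "?f (y, t) = 0" if "t \<notin> ?C" for y t using CcD(3)[OF k(1) that] by simp
  show "continuous_on UNIV (\<lambda>y. \<integral>t. k t * \<Phi> (act (r t) y) \<partial>\<mu>)"
    using continuous_on_parameter_integral(1)[OF c CcD(2)[OF k(1)] m C z] by simp
  have "integrable \<mu> (\<lambda>t. k t * \<Phi> (act (r t) y))"
    using continuous_on_parameter_integral(2)[OF c CcD(2)[OF k(1)] m C z, of y] by simp
  then show "(\<integral>\<^sup>+t. ennreal (k t) * ennreal (\<Phi> (act (r t) y)) \<partial>\<mu>) = ennreal (\<integral>t. k t * \<Phi> (act (r t) y) \<partial>\<mu>)"
    using k(2) \<Phi>(2) by (simp add: nn_integral_eq_integral flip: ennreal_mult)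
qed

end

context compact_orbit_family
begin

text \<open>Finitely many translates of \<open>V\<close> cover the piece of the orbit over
  \<open>L\<close>, and each of them is visited only at times in a translate of the relatively
  compact set of all \<open>s\<close> with \<open>act s x \<in> V\<close>. Thus the orbit is in
  \<open>U\<close> only at times in the compact set \<open>C\<close>.\<close>

lemma orbit_neighbourhood:
  assumes V: "open V" "x \<in> V" "relatively_compact {s. act s x \<in> V}" and L: "compact L"
  obtains U C where "open U" "compact C" "\<And>s. s \<in> L \<Longrightarrow> act s x \<in> U" "\<And>s. act s x \<in> U \<Longrightarrow> s \<in> C"
proof -
  let ?W = "{s. act s x \<in> V}"
  have op: "open {s. act (- r + s) x \<in> V}" for r
    using open_vimage[OF V(1), of "\<lambda>s. act (- r + s) x"] continuous_on_act[OF _ continuous_on_const, of UNIV "\<lambda>s. - r + s" x]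
    by (simp add: vimage_def continuous_on_add del: uminus_add_conv_diff)
  obtain D where D: "D \<subseteq> L" "finite D" "L \<subseteq> (\<Union>r\<in>D. {s. act (- r + s) x \<in> V})"
  proof (rule compactE_image[OF L, of L "\<lambda>r. {s. act (- r + s) x \<in> V}"])
    show "L \<subseteq> (\<Union>r\<in>L. {s. act (- r + s) x \<in> V})" using V(2) act_zero by auto
  qed (rule op)
  define U where "U = (\<Union>r\<in>D. act (- r) -` V)"
  define C where "C = (\<Union>r\<in>D. (+) r ` closure ?W)"
  show thesis
  proof (rule that)
    show "open U" unfolding U_def
      by (intro open_UN ballI open_vimage V(1) continuous_on_act continuous_intros)
    show "compact C" unfolding C_def using V(3)
      by (intro compact_UN D(2) compact_continuous_image continuous_intros) (simp add: relatively_compact_def)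
    show "act s x \<in> U" if s: "s \<in> L" for s
    proof -
      obtain r where "r \<in> D" "act (- r + s) x \<in> V" using D(3) s by blast
      then show ?thesis unfolding U_def act_add by blast
    qed
    show "s \<in> C" if s: "act s x \<in> U" for s
    proof -
      obtain r where r: "r \<in> D" "act (- r) (act s x) \<in> V" using s unfolding U_def by blast
      then have "- r + s \<in> ?W" by (simp only: mem_Collect_eq act_add)
      then have "- r + s \<in> closure ?W" by (rule subsetD[OF closure_subset])
      then have "r + (- r + s) \<in> (+) r ` closure ?W" by (rule imageI)
      then show ?thesis unfolding C_def using r(1) by auto
    qed
  qed
qed

lemma act_eq_iff: "act s x = act t x \<longleftrightarrow> q s = q t"
proof
  assume "act s x = act t x"
  then have "act (- s + t) x = act (- s + s) x" by (simp only: act_add)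
  then have "t - s \<in> stabilizer act x" by (simp add: stabilizer_def act_zero)
  then show "q s = q t" by (simp only: coset_eq_iff[OF H])
next
  assume "q s = q t"
  then have "p (q s) = p (q t)" by simp
  then show "act s x = act t x" by (simp only: p_q)
qed

text \<open>Near the support of \<open>g\<close> the orbit map is a quotient map from a compact set, so \<open>g\<close> descends to a
  continuous function on a compact subset of \<open>X\<close>, which Tietze's theorem extends.\<close>

lemma orbit_extension:
  assumes V: "open V" "x \<in> V" "relatively_compact {s. act s x \<in> V}"
    and g: "continuous_map Q euclidean g" "compactin Q K" "\<And>c. c \<in> topspace Q - K \<Longrightarrow> g c = (0 :: complex)"
  obtains E L where "continuous_on UNIV E" "compact L" "\<And>y. y \<notin> L \<Longrightarrow> E y = 0" "\<And>s. E (act s x) = g (q s)"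
proof -
  interpret X: lch "euclidean :: 'x topology" by (rule lch_euclidean[OF locally_compact_space])
  have K: "compact (q -` K)" by (rule compact_vimage_q[OF compact_stabilizer g(2)])
  have gz: "g (q s) = 0" if "s \<notin> q -` K" for s using g(3)[of "q s"] that by (simp add: topspace_coset_topology)
  obtain U C where U: "open U" "compact C" "\<And>s. s \<in> q -` K \<Longrightarrow> act s x \<in> U" "\<And>s. act s x \<in> U \<Longrightarrow> s \<in> C"
    using orbit_neighbourhood[OF V K] by blast
  define \<psi> where "\<psi> = (\<lambda>s. act s x)"
  have c\<psi>: "continuous_on S \<psi>" for S unfolding \<psi>_def by (intro continuous_on_act continuous_intros)
  define e where "e = (\<lambda>y. g (q (SOME s. act s x = y)))"
  have e: "e (\<psi> s) = g (q s)" for s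
  proof -
    have "act (SOME r. act r x = act s x) x = act s x" by (rule someI) simp
    then show ?thesis by (simp only: e_def \<psi>_def act_eq_iff)
  qed
  have \<psi>C: "compact (\<psi> ` C)" by (intro compact_continuous_image c\<psi> U(2))
  have "quotient_map (top_of_set C) (top_of_set (\<psi> ` C)) \<psi>"
  proof (rule T1_Spaces.continuous_imp_quotient_map)
    show "continuous_map (top_of_set C) (top_of_set (\<psi> ` C)) \<psi>" using c\<psi> by (auto simp: continuous_map_in_subtopology)
    show "compact_space (top_of_set C)" using U(2) by (simp add: compact_space_subtopology)
    show "Hausdorff_space (top_of_set (\<psi> ` C))" using X.hausdorff by (rule Hausdorff_space_subtopology)
  qed simp
  moreover have "continuous_map (top_of_set C) euclidean (e \<circ> \<psi>)"
  proof -
    have "continuous_map euclidean euclidean (g \<circ> q)" by (rule continuous_map_compose[OF continuous_q g(1)])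
    moreover have "e \<circ> \<psi> = g \<circ> q" using e by (simp add: fun_eq_iff)
    ultimately show ?thesis by (simp only: continuous_map_from_subtopology)
  qed
  ultimately have "continuous_map (top_of_set (\<psi> ` C)) euclidean e" by (rule continuous_compose_quotient_map)
  then have "continuous_on (\<psi> ` C) e" by simp
  then have cRe: "continuous_map (subtopology euclidean (\<psi> ` C)) euclideanreal (\<lambda>y. Re (e y))"
    and cIm: "continuous_map (subtopology euclidean (\<psi> ` C)) euclideanreal (\<lambda>y. Im (e y))"
    by (simp_all add: continuous_on_Re continuous_on_Im)
  have cl: "closedin euclidean (\<psi> ` C)" using compact_imp_closed[OF \<psi>C] by simp
  obtain e1 where e1: "continuous_map euclidean euclideanreal e1" "\<And>y. y \<in> \<psi> ` C \<Longrightarrow> e1 y = Re (e y)"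
    using Tietze_extension_realinterval[OF X.normal_space cl is_interval_univ UNIV_not_empty cRe subset_UNIV] by metis
  obtain e2 where e2: "continuous_map euclidean euclideanreal e2" "\<And>y. y \<in> \<psi> ` C \<Longrightarrow> e2 y = Im (e y)"
    using Tietze_extension_realinterval[OF X.normal_space cl is_interval_univ UNIV_not_empty cIm subset_UNIV] by metis
  have K\<psi>: "compact (\<psi> ` (q -` K))" "\<psi> ` (q -` K) \<subseteq> U" 
    using compact_continuous_image[OF c\<psi> K] U(3) by (auto simp: \<psi>_def)
  \<comment> \<open>The Tietze extensions are uncontrolled away from the image of \<open>C\<close>.
    As the orbit is in \<open>U\<close> only at times in \<open>C\<close>, a cutoff supported in
    \<open>U\<close> makes the product vanish at all other points of the orbit.\<close>
  obtain h :: "'x \<Rightarrow> real" and L where h: "continuous_on UNIV h" "compact L" "L \<subseteq> U" "\<And>y. 0 \<le> h y \<and> h y \<le> 1"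
      "\<And>y. y \<in> \<psi> ` (q -` K) \<Longrightarrow> h y = 1" "\<And>y. y \<notin> L \<Longrightarrow> h y = 0"
    using compact_cutoff[OF locally_compact_space K\<psi>(1) U(1) K\<psi>(2)] by metis
  define E where "E = (\<lambda>y. of_real (h y) * Complex (e1 y) (e2 y))"
  show thesis
  proof (rule that)
    show "continuous_on UNIV E"
      unfolding E_def Complex_eq using e1(1) e2(1) h(1) by (intro continuous_intros) simp_all
    show "compact L" by (fact h)
    show "E y = 0" if "y \<notin> L" for y unfolding E_def h(6)[OF that] by simp
    show "E (act s x) = g (q s)" for s
    proof (cases "act s x \<in> U")
      case True
      then have "\<psi> s \<in> \<psi> ` C" using U(4) by blast
      then have 1: "Complex (e1 (\<psi> s)) (e2 (\<psi> s)) = g (q s)" by (simp add: e1(2) e2(2) e)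
      show ?thesis
      proof (cases "s \<in> q -` K")
        case True
        then have "h (\<psi> s) = 1" by (intro h(5) imageI)
        then show ?thesis using 1 by (simp add: E_def \<psi>_def)
      next
        case False
        then show ?thesis using 1 by (simp add: E_def \<psi>_def gz)
      qed
    next
      case False
      then have "act s x \<notin> L" "s \<notin> q -` K" using h(3) U(3) by blast+
      then show ?thesis by (simp add: E_def h(6) gz)
    qed
  qed
qed

end

context compact_orbit_family
begin

text \<open>The set of \<open>s\<close> with \<open>act s x \<in> V\<close> is a union of cosets, so
  its \<mu>-measure is \<open>a\<close> times the measure of its image; it is open and non-empty,
  hence not null.\<close>

lemma orbit_measure:
  assumes V: "open V" "x \<in> V" "relatively_compact {s. act s x \<in> V}"
  obtains w where "w > 0" "emeasure m (q ` {s. act s x \<in> V}) = ennreal w" "emeasure \<mu> {s. act s x \<in> V} = ennreal (a * w)"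
proof -
  let ?W = "{s. act s x \<in> V}"
  have oW: "open ?W"
    using open_vimage[OF V(1), of "\<lambda>s. act s x"] continuous_on_act[OF continuous_on_id continuous_on_const, of UNIV x]
    by (simp add: vimage_def)
  have Ws: "q ` ?W \<in> sets m"
    unfolding sets_m by (rule openin_in_borel[OF open_q_image[OF oW]])
  have "compactin Q (q ` closure ?W)" using V(3) by (intro compactin_q_image) (simp add: relatively_compact_def)
  moreover from this have "q ` closure ?W \<in> sets m" unfolding sets_m by (rule Q.compactin_in_borel)
  moreover have "q ` ?W \<subseteq> q ` closure ?W" by (intro image_mono closure_subset)
  ultimately have fin: "emeasure m (q ` ?W) < \<infinity>" using finite_m emeasure_mono[of "q ` ?W" "q ` closure ?W" m] by (meson le_less_trans)
  define w where "w = measure m (q ` ?W)"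
  have w: "emeasure m (q ` ?W) = ennreal w" "w \<ge> 0"
    using fin by (simp_all add: w_def emeasure_eq_ennreal_measure less_top[symmetric])
  have mem: "q t \<in> q ` ?W \<longleftrightarrow> t \<in> ?W" for t
  proof
    assume "q t \<in> q ` ?W"
    then obtain s where "s \<in> ?W" "q t = q s" by blast
    then show "t \<in> ?W" by (simp only: act_eq_iff[symmetric] mem_Collect_eq)
  qed simp
  have "emeasure \<mu> ?W = (\<integral>\<^sup>+t. indicator ?W t \<partial>\<mu>)" using oW by (simp add: sets_\<mu>)
  also have "\<dots> = (\<integral>\<^sup>+t. indicator (q ` ?W) (q t) \<partial>\<mu>)" by (intro nn_integral_cong) (simp only: indicator_def mem)
  also have "\<dots> = ennreal (a * w)"
    using nn_integral_q(1)[of "indicator (q ` ?W)"] Ws a_pos w by (simp add: ennreal_mult)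
  finally have \<mu>: "emeasure \<mu> ?W = ennreal (a * w)" .
  have "0 \<in> ?W" using V(2) by (simp add: act_zero)
  then have "emeasure \<mu> ?W \<noteq> 0" using emeasure_\<mu>_open[OF oW] by blast
  then have "w \<noteq> 0" unfolding \<mu> by auto
  then show thesis using w \<mu> by (intro that[of w]) auto
qed

text \<open>Compact sets exhaust \<open>V\<close>, so the preimage of one of them takes up nearly
  all of the finite measure of the preimage of \<open>V\<close>; a cutoff equal to 1 on that set
  keeps this share.\<close>

lemma bump_function:
  assumes V: "open V" "x \<in> V" "relatively_compact {s. act s x \<in> V}"
    and w: "emeasure \<mu> {s. act s x \<in> V} = ennreal (a * w)" "w > 0" and e: "0 < e" "e < 1"
  obtains F :: "'x \<Rightarrow> real" and L B where "continuous_on UNIV F" "\<And>y. 0 \<le> F y \<and> F y \<le> 1" "compact L"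
    "L \<subseteq> V" "\<And>y. y \<notin> L \<Longrightarrow> F y = 0" "(\<integral>\<^sup>+t. ennreal (F (act t x)) \<partial>\<mu>) = ennreal B" "(1 - e) * (a * w) \<le> B"
proof -
  interpret X: lch "euclidean :: 'x topology" by (rule lch_euclidean[OF locally_compact_space])
  have oV: "openin euclidean V" using V(1) by simp
  obtain K :: "nat \<Rightarrow> 'x set" where K: "\<And>n. compactin euclidean (K n)" "incseq K" "(\<Union>n. K n) = V"
    using X.open_exhaustion[OF oV] by metis
  have c: "continuous_on UNIV (\<lambda>s. act s x)" by (intro continuous_on_act continuous_intros)
  have pre: "closed {s. act s x \<in> S}" if "compact S" for S
    using closed_vimage[OF compact_imp_closed[OF that] c] by (simp add: vimage_def)
  have Kc: "compact (K n)" for n using K(1) by simp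
  have "(SUP n. emeasure \<mu> {s. act s x \<in> K n}) = emeasure \<mu> (\<Union>n. {s. act s x \<in> K n})"
  proof (rule SUP_emeasure_incseq)
    show "range (\<lambda>n. {s. act s x \<in> K n}) \<subseteq> sets \<mu>" using pre[OF Kc] by (auto simp: sets_\<mu>)
    show "incseq (\<lambda>n. {s. act s x \<in> K n})" using K(2) by (fastforce simp: incseq_def)
  qed
  also have "(\<Union>n. {s. act s x \<in> K n}) = {s. act s x \<in> V}" using K(3) by blast
  finally have sup: "(SUP n. emeasure \<mu> {s. act s x \<in> K n}) = ennreal (a * w)" by (simp only: w(1))
  have "(1 - e) * (a * w) < 1 * (a * w)" using e w(2) a_pos by (intro mult_strict_right_mono) auto
  then have "ennreal ((1 - e) * (a * w)) < (SUP n. emeasure \<mu> {s. act s x \<in> K n})"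
    unfolding sup using e w(2) a_pos by (simp add: ennreal_less_iff)
  then obtain n where n: "ennreal ((1 - e) * (a * w)) < emeasure \<mu> {s. act s x \<in> K n}" unfolding less_SUP_iff by blast
  have KV: "K n \<subseteq> V" using K(3) by blast
  obtain F :: "'x \<Rightarrow> real" and L where F: "continuous_on UNIV F" "compact L" "L \<subseteq> V" "\<And>y. 0 \<le> F y \<and> F y \<le> 1"
      "\<And>y. y \<in> K n \<Longrightarrow> F y = 1" "\<And>y. y \<notin> L \<Longrightarrow> F y = 0"
    using compact_cutoff[OF locally_compact_space Kc V(1) KV] by metis
  have "(\<integral>\<^sup>+t. ennreal (F (act t x)) \<partial>\<mu>) \<le> (\<integral>\<^sup>+t. indicator {s. act s x \<in> L} t \<partial>\<mu>)"
    using F(4,6) by (intro nn_integral_mono) (simp add: indicator_def ennreal_le_1)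
  also have "\<dots> = emeasure \<mu> {s. act s x \<in> L}" using pre[OF F(2)] by (simp add: sets_\<mu>)
  also have "\<dots> \<le> emeasure \<mu> {s. act s x \<in> V}"
  proof (rule emeasure_mono)
    show "{s. act s x \<in> L} \<subseteq> {s. act s x \<in> V}" using F(3) by blast
    show "{s. act s x \<in> V} \<in> sets \<mu>" using open_vimage[OF V(1) c] by (simp add: sets_\<mu> vimage_def)
  qed
  finally have "(\<integral>\<^sup>+t. ennreal (F (act t x)) \<partial>\<mu>) < top" unfolding w(1) by (simp add: le_less_trans)
  then obtain B where B: "(\<integral>\<^sup>+t. ennreal (F (act t x)) \<partial>\<mu>) = ennreal B" "B \<ge> 0" by (auto simp: less_top_ennreal)
  have "ennreal ((1 - e) * (a * w)) \<le> (\<integral>\<^sup>+t. indicator {s. act s x \<in> K n} t \<partial>\<mu>)"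
    using n pre[OF Kc] by (simp add: sets_\<mu>)
  also have "\<dots> \<le> ennreal B" unfolding B(1)[symmetric] using F(5) by (intro nn_integral_mono) (simp add: indicator_def)
  finally have "(1 - e) * (a * w) \<le> B" using B(2) by (simp add: ennreal_le_iff)
  then show thesis using that[of F L B] F B(1) by blast
qed

text \<open>Multiplying by cutoff functions, the integrals along the orbit of \<open>x\<close> become bounds that hold
  at every point of the supports of \<open>E\<close> and \<open>F\<close>: these are open conditions on the point.\<close>

lemma test_functions:
  assumes V: "open V" "x \<in> V" "relatively_compact {s. act s x \<in> V}"
    and w: "emeasure \<mu> {s. act s x \<in> V} = ennreal (a * w)" "w > 0" and e: "0 < e" "e < 1"
    and g: "continuous_map Q euclidean g" "compactin Q K" "\<And>c. c \<in> topspace Q - K \<Longrightarrow> g c = (0 :: complex)"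
      "g \<in> L2_functions m"
  obtains E L k C F B where "continuous_on UNIV E" "compact L" "\<And>y. y \<notin> L \<Longrightarrow> E y = 0" "\<And>s. E (act s x) = g (q s)"
    "k \<in> Cc" "\<And>s. 0 \<le> k s \<and> k s \<le> 1" "compact C" "\<And>s. s \<notin> C \<Longrightarrow> k s = 0"
    "\<And>s s'. g (q s) \<noteq> 0 \<Longrightarrow> g (q s') \<noteq> 0 \<Longrightarrow> k (s - s') = 1"
    "continuous_on UNIV F" "\<And>y. 0 \<le> F y \<and> F y \<le> 1" "\<And>y. F y \<noteq> 0 \<Longrightarrow> y \<in> V"
    "\<And>y. E y \<noteq> 0 \<Longrightarrow> (\<integral>\<^sup>+t. ennreal (k t) * ennreal ((cmod (E (act t y)))\<^sup>2) \<partial>\<mu>) \<le>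
        ennreal (a * ((\<integral>c. (cmod (g c))\<^sup>2 \<partial>m) + e))"
    "\<And>y. F y \<noteq> 0 \<Longrightarrow> (\<integral>\<^sup>+t. ennreal (k t) * ennreal ((cmod (E (act (- t) y)))\<^sup>2) \<partial>\<mu>) \<le>
        ennreal (a * ((\<integral>c. (cmod (g c))\<^sup>2 \<partial>m) + e))"
    "(1 - e)\<^sup>2 * (a * w) \<le> B"
    "\<And>y. E y \<noteq> 0 \<Longrightarrow> ennreal B \<le> (\<integral>\<^sup>+t. ennreal (k t) * ennreal (F (act t y)) \<partial>\<mu>)"
proof -
  obtain E0 L0 where E0: "continuous_on UNIV E0" "compact L0" "\<And>y. y \<notin> L0 \<Longrightarrow> E0 y = 0" "\<And>s. E0 (act s x) = g (q s)"
    using orbit_extension[OF V g(1-3)] by metis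
  obtain F0 :: "'x \<Rightarrow> real" and LF B0 where F0: "continuous_on UNIV F0" "\<And>y. 0 \<le> F0 y \<and> F0 y \<le> 1" "compact LF" "LF \<subseteq> V"
      "\<And>y. y \<notin> LF \<Longrightarrow> F0 y = 0" "(\<integral>\<^sup>+t. ennreal (F0 (act t x)) \<partial>\<mu>) = ennreal B0" "(1 - e) * (a * w) \<le> B0"
    using bump_function[OF V w e] by metis
  have B0: "B0 > 0" using F0(7) e w(2) a_pos by (intro less_le_trans[OF _ F0(7)] mult_pos_pos) auto
  define G where "G = (\<integral>c. (cmod (g c))\<^sup>2 \<partial>m)"
  \<comment> \<open>On the orbit of \<open>x\<close> the averages are at most a G; the summand
    \<open>e\<close> leaves room for a strict, hence open, condition.\<close>
  define A where "A = a * (G + e)"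
  have G0: "G \<ge> 0" by (simp add: G_def)
  have GA: "a * G < A" unfolding A_def using a_pos e(1) by (intro mult_strict_left_mono) auto
  define KG where "KG = q -` K"
  define KF where "KF = {s. act s x \<in> LF}"
  have KG: "compact KG" unfolding KG_def by (rule compact_vimage_q[OF compact_stabilizer g(2)])
  have gz: "s \<in> KG" if "g (q s) \<noteq> 0" for s using g(3)[of "q s"] that by (auto simp: topspace_coset_topology KG_def)
  have c\<psi>: "continuous_on S (\<lambda>s. act s x)" for S by (intro continuous_on_act continuous_intros)
  have KF: "compact KF"
  proof (rule compact_closed_subset)
    show "compact (closure {s. act s x \<in> V})" using V(3) by (simp add: relatively_compact_def)
    show "closed KF" using closed_vimage[OF compact_imp_closed[OF F0(3)] c\<psi>] by (simp add: KF_def vimage_def)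
    show "KF \<subseteq> closure {s. act s x \<in> V}"
      using F0(4) unfolding KF_def by (intro order_trans[OF _ closure_subset]) blast
  qed
  have Fz: "s \<in> KF" if "F0 (act s x) \<noteq> 0" for s using F0(5) that by (auto simp: KF_def)
  \<comment> \<open>Differences within \<open>KG\<close> make \<open>k\<close> invisible to the rank
    one operator; differences of \<open>KF\<close> and \<open>KG\<close> let the window
    \<open>k\<close>, placed at any point of \<open>KG\<close>, see all of \<open>F0\<close> along
    the orbit.\<close>
  define P where "P = (\<lambda>(s, t). s - t) ` (KG \<times> KG) \<union> (\<lambda>(s, t). s - t) ` (KF \<times> KG)"
  have P: "compact P" unfolding P_def by (intro compact_Un compact_sum_set(2) KG KF)
  obtain k :: "'g \<Rightarrow> real" and C where k: "continuous_on UNIV k" "compact C" "\<And>s. 0 \<le> k s \<and> k s \<le> 1"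
      "\<And>s. s \<in> P \<Longrightarrow> k s = 1" "\<And>s. s \<notin> C \<Longrightarrow> k s = 0"
    using compact_cutoff[OF lc_group P open_UNIV subset_UNIV] by metis
  have kCc: "k \<in> Cc" by (rule CcI[OF k(1,2,5)])
  have k0: "0 \<le> k s" for s using k(3) by blast
  have kG: "k (s - s') = 1" if "s \<in> KG \<or> s \<in> KF" "s' \<in> KG" for s s'
    by (rule k(4)) (use that in \<open>auto simp: P_def\<close>)
  have cE2: "continuous_on UNIV (\<lambda>y. (cmod (E0 y))\<^sup>2)" by (intro continuous_intros E0(1))
  have cid: "continuous_on UNIV (\<lambda>t :: 'g. t)" and cneg: "continuous_on UNIV (\<lambda>t :: 'g. - t)" by (intro continuous_intros)+
  define S1 where "S1 = (\<lambda>y. \<integral>t. k t * (cmod (E0 (act t y)))\<^sup>2 \<partial>\<mu>)"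
  define S2 where "S2 = (\<lambda>y. \<integral>t. k t * (cmod (E0 (act (- t) y)))\<^sup>2 \<partial>\<mu>)"
  have S1: "continuous_on UNIV S1" "\<And>y. (\<integral>\<^sup>+t. ennreal (k t) * ennreal ((cmod (E0 (act t y)))\<^sup>2) \<partial>\<mu>) = ennreal (S1 y)"
    unfolding S1_def by (rule average[OF kCc k0 cE2 zero_le_power2 cid])+
  have S2: "continuous_on UNIV S2" "\<And>y. (\<integral>\<^sup>+t. ennreal (k t) * ennreal ((cmod (E0 (act (- t) y)))\<^sup>2) \<partial>\<mu>) = ennreal (S2 y)"
    unfolding S2_def by (rule average[OF kCc k0 cE2 zero_le_power2 cneg])+
  define U0 where "U0 = {y. S1 y < A} \<inter> {y. S2 y < A}"
  have oU0: "open U0" unfolding U0_def by (intro open_Int open_Collect_less S1 S2 continuous_on_const)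
  have gm: "(\<lambda>c. ennreal ((cmod (g c))\<^sup>2)) \<in> borel_measurable m" using L2_measurable[OF g(4)] by measurable
  have gG: "(\<integral>\<^sup>+c. ennreal ((cmod (g c))\<^sup>2) \<partial>m) = ennreal G" unfolding G_def by (rule L2_nn_integral[OF g(4)])
  have orbU0: "act s x \<in> U0" for s
  proof -
    have "ennreal (S1 (act s x)) \<le> (\<integral>\<^sup>+t. ennreal ((cmod (g (q (t + s))))\<^sup>2) \<partial>\<mu>)"
      unfolding S1(2)[symmetric]
    proof (rule nn_integral_mono)
      fix t
      have "ennreal (k t) * ennreal ((cmod (g (q (t + s))))\<^sup>2) \<le> 1 * ennreal ((cmod (g (q (t + s))))\<^sup>2)"
        using k(3)[of t] by (intro mult_right_mono) (simp_all add: ennreal_le_1)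
      then show "ennreal (k t) * ennreal ((cmod (E0 (act t (act s x))))\<^sup>2) \<le> ennreal ((cmod (g (q (t + s))))\<^sup>2)"
        by (simp only: act_add[symmetric] E0(4) mult_1)
    qed
    also have "\<dots> = ennreal (a * G)" using nn_integral_q(2)[OF gm] a_pos G0 by (simp add: gG ennreal_mult)
    finally have 1: "S1 (act s x) \<le> a * G" using a_pos G0 by (simp add: ennreal_le_iff)
    have "ennreal (S2 (act s x)) \<le> (\<integral>\<^sup>+t. ennreal ((cmod (g (q (- t + s))))\<^sup>2) \<partial>\<mu>)"
      unfolding S2(2)[symmetric]
    proof (rule nn_integral_mono)
      fix t
      have "ennreal (k t) * ennreal ((cmod (g (q (- t + s))))\<^sup>2) \<le> 1 * ennreal ((cmod (g (q (- t + s))))\<^sup>2)"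
        using k(3)[of t] by (intro mult_right_mono) (simp_all add: ennreal_le_1)
      then show "ennreal (k t) * ennreal ((cmod (E0 (act (- t) (act s x))))\<^sup>2) \<le> ennreal ((cmod (g (q (- t + s))))\<^sup>2)"
        by (simp only: act_add[symmetric] E0(4) mult_1)
    qed
    also have "\<dots> = ennreal (a * G)"
      using nn_integral_q(3)[OF gm] a_pos G0 by (simp only: gG ennreal_mult less_imp_le)
    finally have 2: "S2 (act s x) \<le> a * G" using a_pos G0 by (simp add: ennreal_le_iff)
    show ?thesis using 1 2 GA by (simp add: U0_def)
  qed
  have KF\<psi>: "compact ((\<lambda>s. act s x) ` KF)" "(\<lambda>s. act s x) ` KF \<subseteq> U0"
    using compact_continuous_image[OF c\<psi> KF] orbU0 by auto
  obtain hF :: "'x \<Rightarrow> real" and LhF where hF: "continuous_on UNIV hF" "compact LhF" "LhF \<subseteq> U0" "\<And>y. 0 \<le> hF y \<and> hF y \<le> 1"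
      "\<And>y. y \<in> (\<lambda>s. act s x) ` KF \<Longrightarrow> hF y = 1" "\<And>y. y \<notin> LhF \<Longrightarrow> hF y = 0"
    using compact_cutoff[OF locally_compact_space KF\<psi>(1) oU0 KF\<psi>(2)] by metis
  \<comment> \<open>\<open>F0\<close> is cut down before \<open>E0\<close> because the average
    \<open>S3\<close> is formed with \<open>F\<close> itself, whereas cutting \<open>E0\<close> down
    later only lowers the averages bounded by \<open>S1\<close> and \<open>S2\<close>.\<close>
  define F where "F = (\<lambda>y. F0 y * hF y)"
  have cF: "continuous_on UNIV F" unfolding F_def by (intro continuous_intros F0(1) hF(1))
  have F1: "0 \<le> F y \<and> F y \<le> 1" for y unfolding F_def using F0(2)[of y] hF(4)[of y] by (auto intro: mult_le_one)
  have FU0: "y \<in> U0" "y \<in> V" if "F y \<noteq> 0" for y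
  proof -
    have "F0 y \<noteq> 0" "hF y \<noteq> 0" using that by (auto simp: F_def)
    then have "y \<in> LF" "y \<in> LhF" using F0(5)[of y] hF(6)[of y] by blast+
    then show "y \<in> U0" "y \<in> V" using F0(4) hF(3) by blast+
  qed
  have Forb: "F (act s x) = F0 (act s x)" for s
  proof (cases "F0 (act s x) = 0")
    case False
    then have "hF (act s x) = 1" using Fz by (intro hF(5) imageI) blast
    then show ?thesis by (simp add: F_def)
  qed (simp add: F_def)
  \<comment> \<open>\<open>B0\<close> already carries one factor 1 - e. The second one, again for
    the sake of a strict inequality, accounts for the square in the final bound.\<close>
  define B where "B = (1 - e) * B0"
  have BB0: "B < B0" unfolding B_def using e B0 by (simp add: mult_less_cancel_right1)
  have B1: "(1 - e)\<^sup>2 * (a * w) \<le> B"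
    unfolding B_def power2_eq_square mult.assoc using e by (intro mult_left_mono F0(7)) simp
  define S3 where "S3 = (\<lambda>y. \<integral>t. k t * F (act t y) \<partial>\<mu>)"
  have F0': "0 \<le> F y" for y using F1 by blast
  have S3: "continuous_on UNIV S3" "\<And>y. (\<integral>\<^sup>+t. ennreal (k t) * ennreal (F (act t y)) \<partial>\<mu>) = ennreal (S3 y)"
    unfolding S3_def by (rule average[OF kCc k0 cF F0' cid])+
  define U1 where "U1 = U0 \<inter> {y. B < S3 y}"
  have oU1: "open U1" unfolding U1_def by (intro open_Int oU0 open_Collect_less S3 continuous_on_const)
  \<comment> \<open>Only the part of the orbit over \<open>KG\<close> is claimed: from there
    \<open>k\<close> equals 1 at every difference leading to a point where \<open>F0\<close> is
    nonzero, so the average is the full integral \<open>B0\<close>.\<close>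
  have orbU1: "act s x \<in> U1" if s: "s \<in> KG" for s
  proof -
    have fm: "(\<lambda>t. ennreal (F0 (act t x))) \<in> borel_measurable \<mu>"
    proof -
      have "(\<lambda>t. F0 (act t x)) \<in> borel_measurable borel"
        by (intro borel_measurable_continuous_onI continuous_on_compose2[OF F0(1) c\<psi>]) simp
      from measurable_compose[OF this measurable_ennreal] show ?thesis by (rule measurable_\<mu>)
    qed
    have "ennreal (S3 (act s x)) = (\<integral>\<^sup>+t. ennreal (F0 (act (s + t) x)) \<partial>\<mu>)"
      unfolding S3(2)[symmetric]
    proof (rule nn_integral_cong)
      fix t
      have F: "F (act t (act s x)) = F0 (act (s + t) x)" by (simp only: act_add[symmetric] Forb add.commute)
      show "ennreal (k t) * ennreal (F (act t (act s x))) = ennreal (F0 (act (s + t) x))"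
      proof (cases "F0 (act (s + t) x) = 0")
        case False
        then have "k (s + t - s) = 1" using Fz s by (intro kG) blast+
        then show ?thesis by (simp add: F)
      qed (simp add: F)
    qed
    also have "\<dots> = ennreal B0" using nn_integral_\<mu>_translate[OF fm, of s] F0(6) by simp
    finally have "S3 (act s x) = B0" using B0 by (cases "S3 (act s x) \<ge> 0") (auto simp: ennreal_neg)
    then show ?thesis using orbU0 BB0 by (simp add: U1_def)
  qed
  have KG\<psi>: "compact ((\<lambda>s. act s x) ` KG)" "(\<lambda>s. act s x) ` KG \<subseteq> U1"
    using compact_continuous_image[OF c\<psi> KG] orbU1 by auto
  obtain h :: "'x \<Rightarrow> real" and L where h: "continuous_on UNIV h" "compact L" "L \<subseteq> U1" "\<And>y. 0 \<le> h y \<and> h y \<le> 1"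
      "\<And>y. y \<in> (\<lambda>s. act s x) ` KG \<Longrightarrow> h y = 1" "\<And>y. y \<notin> L \<Longrightarrow> h y = 0"
    using compact_cutoff[OF locally_compact_space KG\<psi>(1) oU1 KG\<psi>(2)] by metis
  define E where "E = (\<lambda>y. of_real (h y) * E0 y)"
  have EL: "E y = 0" if "y \<notin> L" for y unfolding E_def h(6)[OF that] by simp
  have EU1: "y \<in> U1" if "E y \<noteq> 0" for y using EL[of y] that h(3) by blast
  have Ele: "ennreal (k t) * ennreal ((cmod (E y))\<^sup>2) \<le> ennreal (k t) * ennreal ((cmod (E0 y))\<^sup>2)" for t y
  proof (intro mult_left_mono ennreal_leI power_mono)
    have "\<bar>h y\<bar> * cmod (E0 y) \<le> 1 * cmod (E0 y)" using h(4)[of y] by (intro mult_right_mono) auto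
    then show "cmod (E y) \<le> cmod (E0 y)" by (simp add: E_def norm_mult)
  qed simp_all
  show thesis
  proof (rule that)
    show "continuous_on UNIV E" unfolding E_def by (intro continuous_intros h(1) E0(1))
    show "E (act s x) = g (q s)" for s
    proof (cases "s \<in> KG")
      case True
      then have "h (act s x) = 1" by (intro h(5) imageI)
      then show ?thesis by (simp add: E_def E0(4))
    next
      case False
      then have "g (q s) = 0" using gz by blast
      then show ?thesis by (simp add: E_def E0(4))
    qed
    show "k (s - s') = 1" if "g (q s) \<noteq> 0" "g (q s') \<noteq> 0" for s s' using kG gz that by blast
    show "(\<integral>\<^sup>+t. ennreal (k t) * ennreal ((cmod (E (act t y)))\<^sup>2) \<partial>\<mu>) \<le> ennreal (a * ((\<integral>c. (cmod (g c))\<^sup>2 \<partial>m) + e))"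
      if y: "E y \<noteq> 0" for y
    proof -
      have "(\<integral>\<^sup>+t. ennreal (k t) * ennreal ((cmod (E (act t y)))\<^sup>2) \<partial>\<mu>) \<le> ennreal (S1 y)"
        unfolding S1(2)[symmetric] by (intro nn_integral_mono Ele)
      also have "\<dots> \<le> ennreal A" using EU1[OF y] by (intro ennreal_leI) (simp add: U1_def U0_def)
      finally show ?thesis by (simp only: A_def G_def)
    qed
    show "(\<integral>\<^sup>+t. ennreal (k t) * ennreal ((cmod (E (act (- t) y)))\<^sup>2) \<partial>\<mu>) \<le> ennreal (a * ((\<integral>c. (cmod (g c))\<^sup>2 \<partial>m) + e))"
      if y: "F y \<noteq> 0" for y
    proof -
      have "(\<integral>\<^sup>+t. ennreal (k t) * ennreal ((cmod (E (act (- t) y)))\<^sup>2) \<partial>\<mu>) \<le> ennreal (S2 y)"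
        unfolding S2(2)[symmetric] by (intro nn_integral_mono Ele)
      also have "\<dots> \<le> ennreal A" using FU0(1)[OF y] by (intro ennreal_leI) (simp add: U0_def)
      finally show ?thesis by (simp only: A_def G_def)
    qed
    show "ennreal B \<le> (\<integral>\<^sup>+t. ennreal (k t) * ennreal (F (act t y)) \<partial>\<mu>)" if y: "E y \<noteq> 0" for y
      unfolding S3(2) using EU1[OF y] by (intro ennreal_leI) (simp add: U1_def)
  qed (fact h kCc k cF F1 FU0 B1 EL)+
qed

end

section \<open>Choice of the constants and conclusion\<close>

text \<open>\<open>g\<close> is not normalised: its norm is at most 1 + e, and the inner product of
  \<open>f\<close> with \<open>g\<close> is 1 minus that of \<open>f\<close> with f - g, which
  Cauchy-Schwarz bounds by \<open>e\<close>.\<close>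

lemma L2_approximation:
  assumes f: "f \<in> L2_functions m" and g: "g \<in> L2_functions m" and e: "e > 0"
    and f1: "(\<integral>c. (cmod (f c))\<^sup>2 \<partial>m) = 1" and fg: "(\<integral>c. (cmod (f c - g c))\<^sup>2 \<partial>m) < e\<^sup>2"
  shows "(\<integral>c. (cmod (g c))\<^sup>2 \<partial>m) \<le> (1 + e)\<^sup>2" and "1 - e \<le> cmod (\<integral>c. f c * cnj (g c) \<partial>m)"
proof -
  interpret hilbert_space "L2 m" by (rule hilbert_space_L2)
  have fv: "L2_class m f \<in> vecs (L2 m)" and gv: "L2_class m g \<in> vecs (L2 m)"
    and dv: "L2_class m (\<lambda>c. f c - g c) \<in> vecs (L2 m)"
    using f g L2_diff[OF f g] by (simp_all add: L2_vecs)
  have d: "sqrt (\<integral>c. (cmod (f c - g c))\<^sup>2 \<partial>m) \<le> e"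
    using real_sqrt_le_mono[OF less_imp_le[OF fg]] e by simp
  have "sqrt (\<integral>c. (cmod (g c))\<^sup>2 \<partial>m) \<le> 1 + e"
    using abs_hnorm_diff[OF fv gv] d by (simp add: L2_hnorm[OF f] L2_hnorm[OF g] L2_hdist[OF f g] f1)
  then have "(sqrt (\<integral>c. (cmod (g c))\<^sup>2 \<partial>m))\<^sup>2 \<le> (1 + e)\<^sup>2" by (rule power_mono) simp
  then show "(\<integral>c. (cmod (g c))\<^sup>2 \<partial>m) \<le> (1 + e)\<^sup>2" by simp
  have "cmod (\<integral>c. f c * cnj (f c - g c) \<partial>m) \<le> e"
    using Cauchy_Schwarz[OF fv dv] d by (simp add: L2_inn[OF f L2_diff[OF f g]] L2_hnorm[OF f] L2_hnorm[OF L2_diff[OF f g]] f1)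
  moreover have "(\<integral>c. f c * cnj (f c - g c) \<partial>m) = 1 - (\<integral>c. f c * cnj (g c) \<partial>m)"
  proof -
    have "(\<integral>c. f c * cnj (f c - g c) \<partial>m) = (\<integral>c. f c * cnj (f c) - f c * cnj (g c) \<partial>m)"
      by (simp add: algebra_simps)
    also have "\<dots> = (\<integral>c. f c * cnj (f c) \<partial>m) - (\<integral>c. f c * cnj (g c) \<partial>m)"
      by (intro Bochner_Integration.integral_diff L2_mult_integrable f g)
    also have "(\<integral>c. f c * cnj (f c) \<partial>m) = of_real (\<integral>c. (cmod (f c))\<^sup>2 \<partial>m)"
      by (simp only: complex_norm_square[symmetric] integral_complex_of_real)
    finally show ?thesis by (simp add: f1)
  qed
  moreover have "1 - cmod (\<integral>c. f c * cnj (g c) \<partial>m) \<le> cmod (1 - (\<integral>c. f c * cnj (g c) \<partial>m))"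
    using norm_triangle_ineq2[of 1 "\<integral>c. f c * cnj (g c) \<partial>m"] by simp
  ultimately show "1 - e \<le> cmod (\<integral>c. f c * cnj (g c) \<partial>m)" by simp
qed

text \<open>At e = 0 the inequality is (M + K) / 2 < K, that is M < K, and both sides are continuous
  there. The factors anticipate the final estimates: (1 + e)^2 + e for A / a, (1 - e)^2 for B / (a
  w), 1 + e for the subgroup measures, and (1 - e)^2 - e for the value of the state less the
  tolerance.\<close>

lemma epsilon_choice:
  fixes K M :: real
  assumes "M < K"
  obtains e where "0 < e" "e < 1" "(((1 + e)\<^sup>2 + e)\<^sup>2 * M / (1 - e)\<^sup>2 + (1 + e) * K) / 2 < K * ((1 - e)\<^sup>2 - e)"
proof -
  have "((\<lambda>e. K * ((1 - e)\<^sup>2 - e) - (((1 + e)\<^sup>2 + e)\<^sup>2 * M / (1 - e)\<^sup>2 + (1 + e) * K) / 2) \<longlongrightarrow>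
      K * ((1 - 0)\<^sup>2 - 0) - (((1 + 0)\<^sup>2 + 0)\<^sup>2 * M / (1 - 0)\<^sup>2 + (1 + 0) * K) / 2) (at_right 0)"
    by (intro tendsto_intros) auto
  then have "\<forall>\<^sub>F e in at_right 0. 0 < K * ((1 - e)\<^sup>2 - e) - (((1 + e)\<^sup>2 + e)\<^sup>2 * M / (1 - e)\<^sup>2 + (1 + e) * K) / 2"
    by (rule order_tendstoD(1)) (use assms in simp)
  moreover have "\<forall>\<^sub>F e in at_right 0. e \<in> {0<..<1::real}" by (rule eventually_at_right_real) simp
  ultimately have "\<forall>\<^sub>F e in at_right 0. e \<in> {0<..<1} \<and>
      0 < K * ((1 - e)\<^sup>2 - e) - (((1 + e)\<^sup>2 + e)\<^sup>2 * M / (1 - e)\<^sup>2 + (1 + e) * K) / 2" by (rule eventually_elim2) blast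
  from eventually_happens'[OF trivial_limit_at_right_real this]
  obtain e :: real where "e \<in> {0<..<1}" "0 < K * ((1 - e)\<^sup>2 - e) - (((1 + e)\<^sup>2 + e)\<^sup>2 * M / (1 - e)\<^sup>2 + (1 + e) * K) / 2" by blast
  then show thesis by (intro that[of e]) auto
qed

text \<open>Every eventual property holds at some index of the frequent set, so each infimum in the
  lower limit is at most \<open>c\<close>.\<close>

lemma lower_multiplicity_le:
  assumes "N \<in> weak_star_base A" and "\<exists>\<^sub>F l in \<F>. orthonormal_count (\<sigma> l) \<phi> N \<le> c"
  shows "lower_multiplicity A \<phi> \<sigma> \<F> \<le> c"
proof -
  have "lower_multiplicity A \<phi> \<sigma> \<F> \<le> Liminf \<F> (\<lambda>l. orthonormal_count (\<sigma> l) \<phi> N)"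
    unfolding lower_multiplicity_def by (rule INF_lower[OF assms(1)])
  also have "\<dots> \<le> c"
  proof (rule Liminf_least)
    fix P assume "eventually P \<F>"
    from frequently_ex[OF frequently_eventually_conj[OF assms(2) this]]
    obtain l where "orthonormal_count (\<sigma> l) \<phi> N \<le> c" "P l" by blast
    then show "(INF l\<in>Collect P. orthonormal_count (\<sigma> l) \<phi> N) \<le> c" by (intro INF_lower2[of l]) auto
  qed
  finally show ?thesis .
qed

text \<open>For n + 1 vectors the sum of the values at \<open>b\<close> would be within (n + 1) e of
  (n + 1) r, which \<open>bound\<close> and \<open>strict\<close> exclude.\<close>

lemma (in orbit_family) orthonormal_count_le:
  fixes r e Y Z :: real
  assumes bound: "\<And>I f. finite I \<Longrightarrow> L2_orthonormal m f I \<Longrightarrow>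
      cmod (\<Sum>i\<in>I. vector_functional (Ind act \<mu> \<nu> x \<tau>) (L2_class m (f i)) b) \<le> (Z + Y * card (I :: ('g set \<Rightarrow> complex) set set)) / 2"
    and strict: "(Z + Y * Suc n) / 2 < Suc n * (r - e)" and \<phi>: "\<phi> b = of_real r"
    and N: "\<And>\<psi>. \<psi> \<in> N \<Longrightarrow> cmod (\<psi> b) < e"
  shows "orthonormal_count (Ind act \<mu> \<nu> x \<tau>) \<phi> N \<le> enat n"
  unfolding orthonormal_count_def
proof (rule SUP_least)
  let ?\<sigma> = "Ind act \<mu> \<nu> x \<tau>"
  have sp: "rspace ?\<sigma> = L2 m" by (simp add: Ind_def Let_def)
  fix S assume "S \<in> {S. finite S \<and> orthonormal (rspace ?\<sigma>) S \<and>
    S \<subseteq> {\<eta> \<in> vecs (rspace ?\<sigma>). hnorm (rspace ?\<sigma>) \<eta> = 1 \<and> (\<lambda>a. vector_functional ?\<sigma> \<eta> a - \<phi> a) \<in> N}}"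
  then have S: "finite S" "orthonormal (L2 m) S" "\<And>\<eta>. \<eta> \<in> S \<Longrightarrow> (\<lambda>a. vector_functional ?\<sigma> \<eta> a - \<phi> a) \<in> N"
    by (auto simp: sp)
  show "enat (card S) \<le> enat n"
  proof (rule ccontr)
    assume "\<not> enat (card S) \<le> enat n"
    then have "Suc n \<le> card S" by simp
    \<comment> \<open>\<open>strict\<close> concerns exactly \<open>Suc n\<close> vectors, so a
      larger family is first reduced to that size.\<close>
    then obtain T where T: "T \<subseteq> S" "card T = Suc n" "finite T" using obtain_subset_with_card_n by metis
    have TL: "T \<subseteq> L2_class m ` L2_functions m"
      using S(2) T(1) unfolding orthonormal_def L2_vecs by (meson order_trans)
    \<comment> \<open>Representatives are indexed by the classes themselves, so distinct vectors
      keep distinct indices.\<close>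
    define f where "f = (\<lambda>\<eta>. SOME f. f \<in> L2_functions m \<and> \<eta> = L2_class m f)"
    have f: "f \<eta> \<in> L2_functions m \<and> \<eta> = L2_class m (f \<eta>)" if \<eta>: "\<eta> \<in> T" for \<eta>
    proof -
      have "\<exists>f. f \<in> L2_functions m \<and> \<eta> = L2_class m f" using subsetD[OF TL \<eta>] by (simp add: image_iff Bex_def)
      then show ?thesis unfolding f_def by (rule someI_ex)
    qed
    have orth: "L2_orthonormal m f T"
      unfolding L2_orthonormal_def
    proof (intro conjI ballI)
      show "f \<eta> \<in> L2_functions m" if "\<eta> \<in> T" for \<eta> using f[OF that] by blast
      fix \<eta> \<zeta> assume T': "\<eta> \<in> T" "\<zeta> \<in> T"
      have f1: "f \<eta> \<in> L2_functions m" and f2: "f \<zeta> \<in> L2_functions m" using f T' by blast+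
      have "inn (L2 m) \<eta> \<zeta> = (if \<eta> = \<zeta> then 1 else 0)" using S(2) T(1) T' unfolding orthonormal_def by blast
      moreover have "inn (L2 m) \<eta> \<zeta> = inn (L2 m) (L2_class m (f \<eta>)) (L2_class m (f \<zeta>))"
        by (simp only: conjunct2[OF f[OF T'(1)], symmetric] conjunct2[OF f[OF T'(2)], symmetric])
      ultimately show "(\<integral>c. f \<eta> c * cnj (f \<zeta> c) \<partial>m) = (if \<eta> = \<zeta> then 1 else 0)"
        by (simp only: L2_inn[OF f1 f2])
    qed
    let ?v = "\<lambda>\<eta>. vector_functional ?\<sigma> (L2_class m (f \<eta>)) b"
    have v: "cmod (?v \<eta> - of_real r) \<le> e" if "\<eta> \<in> T" for \<eta>
    proof -
      have "cmod (vector_functional ?\<sigma> \<eta> b - \<phi> b) < e" using N[OF S(3), of \<eta>] that T(1) by blast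
      then show ?thesis by (simp add: conjunct2[OF f[OF that], symmetric] \<phi>)
    qed
    have "(\<Sum>\<eta>\<in>T. ?v \<eta>) - of_nat (Suc n) * of_real r = (\<Sum>\<eta>\<in>T. ?v \<eta> - of_real r)" by (simp add: sum_subtractf T(2))
    also have "cmod \<dots> \<le> Suc n * e" using norm_sum[of "\<lambda>\<eta>. ?v \<eta> - of_real r" T] sum_bounded_above[of T "\<lambda>\<eta>. cmod (?v \<eta> - of_real r)" e] v
      by (simp add: T(2))
    finally have "cmod ((\<Sum>\<eta>\<in>T. ?v \<eta>) - of_nat (Suc n) * of_real r) \<le> Suc n * e" .
    moreover have "cmod (of_nat (Suc n) * of_real r) - cmod (\<Sum>\<eta>\<in>T. ?v \<eta>) \<le> cmod ((\<Sum>\<eta>\<in>T. ?v \<eta>) - of_nat (Suc n) * of_real r)"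
      using norm_triangle_ineq2[of "of_nat (Suc n) * complex_of_real r" "\<Sum>\<eta>\<in>T. ?v \<eta>"] by (simp only: norm_minus_commute)
    moreover have "cmod (of_nat (Suc n) * of_real r) \<ge> Suc n * r"
      by (simp only: norm_mult norm_of_nat norm_of_real) (intro mult_left_mono, simp_all)
    moreover have "cmod (\<Sum>\<eta>\<in>T. ?v \<eta>) \<le> (Z + Y * Suc n) / 2" using bound[OF T(3) orth] by (simp add: T(2))
    ultimately have "Suc n * r - Suc n * e \<le> (Z + Y * Suc n) / 2" by linarith
    then show False using strict by (simp only: right_diff_distrib)
  qed
qed

lemma orbit_familyI:
  fixes act :: "'g::{topological_ab_group_add, t2_space, second_countable_topology} \<Rightarrow>
      'x::{t2_space, second_countable_topology} \<Rightarrow> 'x"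
  assumes act: "transformation_group act" and \<mu>: "haar_measure \<mu>"
    and f0: "f0 \<in> Cc" "f0 0 = 1" "\<And>s. 0 \<le> f0 s \<and> f0 s \<le> 1" and families: "haar_families f0 \<mu> \<alpha> \<nu>"
    and \<tau>: "\<tau> \<in> characters"
  shows "orbit_family act x \<tau> \<mu> f0 \<alpha> \<nu>"
proof -
  interpret transformation_group act by (rule act)
  have H: "stabilizer act x \<in> closed_subgroups" by (rule stabilizer_closed_subgroup)
  then have q: "haar_measure_quotient (stabilizer act x) (\<nu> (stabilizer act x))"
    using families by (simp add: haar_families_def)
  interpret lc_group "TYPE('g)" by unfold_locales (rule locally_compact_group)
  interpret haar_group "TYPE('g)" \<mu> by unfold_locales (rule \<mu>)
  interpret haar_family "TYPE('g)" \<mu> f0 \<alpha> \<nu> by unfold_locales (fact f0 families)+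
  interpret coset_measure "TYPE('g)" "stabilizer act x" "\<nu> (stabilizer act x)" by unfold_locales (fact H q)+
  show ?thesis by unfold_locales (rule \<tau>)
qed

theorem theorem5p2:
  fixes act :: "'g::{topological_ab_group_add, t2_space, second_countable_topology} \<Rightarrow>
      'x::{t2_space, second_countable_topology} \<Rightarrow> 'x"
    and \<mu> :: "'g measure"
    and f0 :: "'g \<Rightarrow> real"
    and \<alpha> :: "'g set \<Rightarrow> 'g measure"
    and \<nu> :: "'g set \<Rightarrow> 'g set measure"
    and z :: 'x
    and x :: "nat \<Rightarrow> 'x"
    and M :: real
    and V :: "'x set"
    and \<tau> :: "'g \<Rightarrow> complex"
    and \<tau>s :: "nat \<Rightarrow> 'g \<Rightarrow> complex"
    and \<phi> :: "(nat \<Rightarrow> 'g \<Rightarrow> 'x \<Rightarrow> complex) set \<Rightarrow> complex"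
  assumes "transformation_group act"
    and "haar_measure \<mu>"
    and "f0 \<in> Cc" and "f0 0 = 1" and "\<And>s. 0 \<le> f0 s \<and> f0 s \<le> 1"
    and "haar_families f0 \<mu> \<alpha> \<nu>"
    and "limitin fell_topology (\<lambda>n. stabilizer act (x n)) (stabilizer act z) sequentially"
    and "locally_closed (orbit act z)"
    and "compact (stabilizer act z)"
    and "M \<ge> 1"
    and "open V" and "z \<in> V"
    and "relatively_compact {s. act s z \<in> V}"
    and "\<exists>\<^sub>F n in sequentially.
           emeasure (\<nu> (stabilizer act (x n)))
             (coset (stabilizer act (x n)) ` {s. act s (x n) \<in> V})
           \<le> ennreal M * emeasure (\<nu> (stabilizer act z)) (coset (stabilizer act z) ` {s. act s z \<in> V})"
    and "\<tau> \<in> characters" and "\<And>n. \<tau>s n \<in> characters"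
    and "pure_state_of (crossed_product act \<mu>) (Ind act \<mu> \<nu> z \<tau>) \<phi>"
  shows "lower_multiplicity (crossed_product act \<mu>) \<phi>
           (\<lambda>n. Ind act \<mu> \<nu> (x n) (\<tau>s n)) sequentially \<le> enat (nat \<lfloor>M\<rfloor>)"
proof -
  note families = assms(1-6) and compact = assms(9) and V = assms(11-13)
  interpret Z: orbit_family act z \<tau> \<mu> f0 \<alpha> \<nu> by (rule orbit_familyI[OF families assms(15)])
  interpret Z: compact_orbit_family act z \<tau> \<mu> f0 \<alpha> \<nu> by unfold_locales (rule compact)
  let ?A = "crossed_product act \<mu>" and ?m = "\<nu> (stabilizer act z)"
  define n where "n = nat \<lfloor>M\<rfloor>"
  \<comment> \<open>\<open>Suc n\<close> is the first integer above \<open>M\<close>; it remains to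
    exclude that many vectors.\<close>
  have "M < real (Suc n)" using assms(10) unfolding n_def by linarith
  then obtain e :: real where e: "0 < e" "e < 1"
      "(((1 + e)\<^sup>2 + e)\<^sup>2 * M / (1 - e)\<^sup>2 + (1 + e) * Suc n) / 2 < Suc n * ((1 - e)\<^sup>2 - e)"
    by (rule epsilon_choice)
  obtain w where w: "w > 0" "emeasure ?m (Z.q ` {s. act s z \<in> V}) = ennreal w" "emeasure \<mu> {s. act s z \<in> V} = ennreal (Z.a * w)"
    using Z.orbit_measure[OF V] by metis
  obtain \<xi> where \<xi>: "\<xi> \<in> vecs (L2 ?m)" "hnorm (L2 ?m) \<xi> = 1"
      "\<And>b. b \<in> vecs ?A \<Longrightarrow> \<phi> b = vector_functional (Ind act \<mu> \<nu> z \<tau>) \<xi> b"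
    using assms(17) by (auto simp: pure_state_of_def Ind_def Let_def)
  obtain f where f: "f \<in> L2_functions ?m" "\<xi> = L2_class ?m f" using \<xi>(1) unfolding L2_vecs by blast
  have f1: "(\<integral>c. (cmod (f c))\<^sup>2 \<partial>?m) = 1" using \<xi>(2) by (simp add: f(2) L2_hnorm[OF f(1)])
  \<comment> \<open>The unit vector behind \<phi> is only square integrable, whereas the extension
    to \<open>E\<close> needs a continuous function with compact support.\<close>
  obtain g K where g: "continuous_map Z.Q euclidean g" "compactin Z.Q K" "\<And>c. c \<in> topspace Z.Q - K \<Longrightarrow> g c = 0"
      "g \<in> L2_functions ?m" and fg: "(\<integral>c. (cmod (f c - g c))\<^sup>2 \<partial>?m) < e\<^sup>2"
    using Z.Q.L2_dense_Cc[OF Z.sets_m Z.finite_m f(1), of "e\<^sup>2"] e(1) by auto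
  note approx = L2_approximation[OF f(1) g(4) e(1) f1 fg]
  show ?thesis
  proof (rule Z.test_functions[OF V w(3,1) e(1,2) g])
    fix E L k C and F :: "'x \<Rightarrow> real" and B
    assume E: "continuous_on UNIV E" "compact L" "\<And>y. y \<notin> L \<Longrightarrow> E y = 0" and Eg: "\<And>s. E (act s z) = g (Z.q s)"
      and k: "k \<in> Cc" "\<And>s. 0 \<le> k s \<and> k s \<le> 1" and C: "compact C" "\<And>s. s \<notin> C \<Longrightarrow> k s = 0"
      and kg: "\<And>s s'. g (Z.q s) \<noteq> 0 \<Longrightarrow> g (Z.q s') \<noteq> 0 \<Longrightarrow> k (s - s') = 1"
      and F: "continuous_on UNIV F" "\<And>y. 0 \<le> F y \<and> F y \<le> 1" "\<And>y. F y \<noteq> 0 \<Longrightarrow> y \<in> V"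
      and A: "\<And>y. E y \<noteq> 0 \<Longrightarrow> (\<integral>\<^sup>+t. ennreal (k t) * ennreal ((cmod (E (act t y)))\<^sup>2) \<partial>\<mu>) \<le>
          ennreal (Z.a * ((\<integral>c. (cmod (g c))\<^sup>2 \<partial>?m) + e))"
        "\<And>y. F y \<noteq> 0 \<Longrightarrow> (\<integral>\<^sup>+t. ennreal (k t) * ennreal ((cmod (E (act (- t) y)))\<^sup>2) \<partial>\<mu>) \<le>
          ennreal (Z.a * ((\<integral>c. (cmod (g c))\<^sup>2 \<partial>?m) + e))"
      and B: "(1 - e)\<^sup>2 * (Z.a * w) \<le> B"
        "\<And>y. E y \<noteq> 0 \<Longrightarrow> ennreal B \<le> (\<integral>\<^sup>+t. ennreal (k t) * ennreal (F (act t y)) \<partial>\<mu>)"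
    define G where "G = (\<integral>c. (cmod (g c))\<^sup>2 \<partial>?m)"
    define A where "A = Z.a * (G + e)"
    define D where "D = (\<lambda>t y. E y * cnj (E (act (- t) y)) * (of_real (k t) * cnj (\<tau> t) / of_real Z.a))"
    \<comment> \<open>The crossed product is a completion, so \<open>D\<close> is represented by the
      class of its constant sequence.\<close>
    define b where "b = null_rel (convolution_algebra act \<mu>) `` {\<lambda>n :: nat. D}"
    define r where "r = (cmod (\<integral>c. f c * cnj (g c) \<partial>?m))\<^sup>2"
    have G: "0 \<le> G" "G \<le> (1 + e)\<^sup>2" using approx(1) by (simp_all add: G_def)
    have A0: "A \<ge> 0" using Z.a_pos G(1) e(1) by (simp add: A_def)
    have Bpos: "B > 0" using Z.a_pos w(1) e(2) by (intro less_le_trans[OF _ B(1)] mult_pos_pos) auto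
    have c\<kappa>: "continuous_on UNIV (\<lambda>t. of_real (k t) * cnj (\<tau> t) / complex_of_real Z.a)"
      using Z.a_pos by (intro continuous_intros CcD(1)[OF k(1)] Z.\<tau>_continuous) simp
    have DC: "D \<in> CcC0"
      unfolding D_def
    proof (rule Z.test_function_CcC0[OF E c\<kappa> C(1)])
      show "of_real (k t) * cnj (\<tau> t) / complex_of_real Z.a = 0" if "t \<notin> C" for t by (simp add: C(2)[OF that])
    qed
    have bA: "b \<in> vecs ?A" unfolding b_def by (rule const_in_crossed_product[OF Z.covariant_rep_L2 DC])
    have \<phi>b: "\<phi> b = of_real r"
      using \<xi>(3)[OF bA] unfolding f(2) b_def r_def by (rule trans) (rule Z.vector_functional_value[OF E(1) Eg D_def DC kg f(1) g(4)])
    define N where "N = {\<psi> \<in> dual ?A. \<forall>b'\<in>{b}. cmod (\<psi> b') < e}"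
    have N: "N \<in> weak_star_base ?A"
      unfolding weak_star_base_def N_def using bA e(1) by (intro CollectI exI[of _ "{b}"] exI[of _ e]) simp
    have r: "(1 - e)\<^sup>2 \<le> r" unfolding r_def using approx(2) e(2) by (intro power_mono) auto
    have strict: "(A / Z.a * (A * (M * w) / B) + (1 + e) * Z.a / Z.a * Suc n) / 2 < Suc n * (r - e)"
    proof -
      let ?c = "(1 + e)\<^sup>2 + e"
      have A: "A / Z.a \<le> ?c" "A \<le> ?c * Z.a" using Z.a_pos G(2) by (simp_all add: A_def mult.commute)
      \<comment> \<open>The measure \<open>w\<close> and the mass \<open>Z.a\<close> cancel, so that
        only \<open>M\<close> and \<open>e\<close> remain.\<close>
      have "A * (M * w) / B \<le> (?c * Z.a) * (M * w) / ((1 - e)\<^sup>2 * (Z.a * w))"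
        using A(2) B(1) A0 w(1) Z.a_pos e assms(10) by (intro frac_le mult_right_mono) auto
      also have "\<dots> = ?c * M / (1 - e)\<^sup>2" using Z.a_pos w(1) by simp
      finally have "A / Z.a * (A * (M * w) / B) \<le> ?c * (?c * M / (1 - e)\<^sup>2)"
        using A(1) A0 w(1) Z.a_pos Bpos assms(10) e by (intro mult_mono) auto
      also have "\<dots> = ?c\<^sup>2 * M / (1 - e)\<^sup>2" by (simp add: power2_eq_square)
      finally have "(A / Z.a * (A * (M * w) / B) + (1 + e) * Z.a / Z.a * Suc n) / 2 < Suc n * ((1 - e)\<^sup>2 - e)"
        using e(3) Z.a_pos by simp
      also have "\<dots> \<le> Suc n * (r - e)" using r by (intro mult_left_mono) auto
      finally show ?thesis .
    qed
    show ?thesis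
      unfolding n_def[symmetric]
    proof (rule lower_multiplicity_le[OF N])
      \<comment> \<open>Semicontinuity is applied to C - C, the set that controls the fibre
        integrals of \<open>k\<close> for every stabilizer.\<close>
      have "compact ((\<lambda>(a, b). a - b) ` (C \<times> C))" by (rule Z.compact_sum_set(2)[OF C(1) C(1)])
      \<comment> \<open>The measure hypothesis holds for infinitely many indices and semicontinuity
        for all large ones, so both hold together infinitely often.\<close>
      from frequently_eventually_conj[OF assms(14) Z.haar_upper_semicontinuous[OF assms(7) compact this e(1)]]
      show "\<exists>\<^sub>F l in sequentially. orthonormal_count (Ind act \<mu> \<nu> (x l) (\<tau>s l)) \<phi> N \<le> enat n"
      proof (rule frequently_elim1)
        fix l
        let ?H = "stabilizer act (x l)"
        assume l: "(?H \<in> closed_subgroups \<and> emeasure (\<alpha> ?H) ((\<lambda>(a, b). a - b) ` (C \<times> C) \<inter> ?H)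
              \<le> ennreal (1 + e) * emeasure (\<alpha> (stabilizer act z)) (stabilizer act z)) \<and>
            emeasure (\<nu> ?H) (coset ?H ` {s. act s (x l) \<in> V}) \<le> ennreal M * emeasure ?m (Z.q ` {s. act s z \<in> V})"
        have \<alpha>l: "emeasure (\<alpha> ?H) ((\<lambda>(a, b). a - b) ` (C \<times> C) \<inter> ?H) \<le> ennreal ((1 + e) * Z.a)"
          using l Z.a_pos e(1) by (simp add: Z.emeasure_a ennreal_mult)
        have \<nu>l: "emeasure (\<nu> ?H) (coset ?H ` {s. act s (x l) \<in> V}) \<le> ennreal (M * w)"
          using l w assms(10) by (simp add: ennreal_mult)
        interpret X: orbit_family act "x l" "\<tau>s l" \<mu> f0 \<alpha> \<nu> by (rule orbit_familyI[OF families assms(16)])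
        have nn: "0 \<le> (1 + e) * Z.a" "0 \<le> M * w" using Z.a_pos e(1) assms(10) w(1) by simp_all
        show "orthonormal_count (Ind act \<mu> \<nu> (x l) (\<tau>s l)) \<phi> N \<le> enat n"
        proof (rule X.orthonormal_count_le[where Z = "A / Z.a * (A * (M * w) / B)" and Y = "(1 + e) * Z.a / Z.a" and r = r and e = e and b = b])
          show "(A / Z.a * (A * (M * w) / B) + (1 + e) * Z.a / Z.a * Suc n) / 2 < Suc n * (r - e)" by (rule strict)
          show "\<phi> b = of_real r" by (rule \<phi>b)
          show "cmod (\<psi> b) < e" if "\<psi> \<in> N" for \<psi> using that by (simp add: N_def)
          show "cmod (\<Sum>i\<in>I. vector_functional (Ind act \<mu> \<nu> (x l) (\<tau>s l)) (L2_class (\<nu> ?H) (h i)) b)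
              \<le> (A / Z.a * (A * (M * w) / B) + (1 + e) * Z.a / Z.a * real (card I)) / 2"
            if I: "finite I" and h: "L2_orthonormal (\<nu> ?H) h I" for I :: "('g set \<Rightarrow> complex) set set" and h
            unfolding b_def
            by (rule X.vector_functional_sum_bound[OF E k C assms(15) Z.a_pos nn(1) \<alpha>l V(1) \<nu>l nn(2) F
                  A0 A[folded G_def, folded A_def] Bpos B(2) D_def I h])
        qed
      qed
    qed
  qed
qed

end
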